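(* Let $k\ge 0$ and denote by $L^{\pm}(z)_{k+M|N}$ the generator matrix of $\mathrm{U}_q(\widehat{\mathfrak{gl}}_{k+M|N})$. Then $$\psi_k\bigl(B_q(L^{\pm}(z))\bigr)={\det}_q\bigl(L^{\pm}(zq^{-2k})^{1\ldots k}_{1\ldots k}\bigr)^{-1}\,B_q\bigl(L^{\pm}(zq^{-2k})_{k+M|N}\bigr).$$ Here $B_q(L^\pm(z))$ on the left is the quantum Berezinian of $\mathrm{U}_q(\widehat{\mathfrak{gl}}_{M|N})$, and $L^{\pm}(z)^{1\ldots k}_{1\ldots k}$ is the submatrix of $L^{\pm}(z)_{k+M|N}$ with rows and columns $1,\ldots,k$.
   Context: The base field is $\mathbb{C}(q)$ ($q$ is not a root of unity). Let $m,n\ge 0$ be integers with $m\neq n$; the definitions below are used for $(m,n)=(M,N)$ and $(m,n)=(k+M,N)$. For $1\le i\le m+n$ put $\bar i=0$ if $i\le m$ and $\bar i=1$ if $i>m$, and $q_i=q^{1-2\bar i}$. $E_{ij}\in\mathrm{End}\,\mathbb{C}^{m|n}$ are the matrix units (of parity $\bar i+\bar j$). Tensor products of superalgebras are graded: $(a\otimes b)(a'\otimes b')=(-1)^{|b||a'|}aa'\otimes bb'$. Put $R(z,w)=\sum_i (zq_i-wq_i^{-1})E_{ii}\otimes E_{ii}+(z-w)\sum_{i\ne j}E_{ii}\otimes E_{jj}+z\sum_{i<j}(q_j-q_j^{-1})E_{ij}\otimes E_{ji}+w\sum_{i>j}(q_j-q_j^{-1})E_{ij}\otimes E_{ji}$,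 $\overline R(z/w)=R(z,w)/(zq-wq^{-1})$ and $R(x)=f(x)\overline R(x)$, where $f(x)=1+\sum_{k\ge1}f_kx^{k}$ is the formal power series in $x$ uniquely determined by $f(xq^{2n-2m})=f(x)\frac{(1-xq^{-2})(1-xq^{2n-2m+2})}{(1-x)(1-xq^{2n-2m})}$. $\mathrm{U}_q(\widehat{\mathfrak{gl}}_{m|n})$ is the superalgebra over $\mathbb{C}(q)$ generated by $l_{ij}^{\pm(r)}$ ($1\le i,j\le m+n$, $r\ge 0$, parity $\bar i+\bar j$) and an invertible central element $q^c$. Put $l_{ij}^{\pm}(z)=\sum_{r\ge0}l_{ij}^{\pm(r)}z^{\mp r}$ and let $L^{\pm}(z)=\sum_{i,j}l^{\pm}_{ij}(z)\otimes E_{ij}$ be the generator matrix; $L_a^\pm(z)$ denotes $L^\pm(z)$ acting in the $a$-th copy of $\mathrm{End}\,\mathbb{C}^{m|n}$. The defining relations are: $l_{ji}^{+(0)}=l_{ij}^{-(0)}=0$ for $i<j$; $l_{ii}^{-(0)}l_{ii}^{+(0)}=l_{ii}^{+(0)}l_{ii}^{-(0)}=1$; $R(z/w)L_1^{\pm}(z)L_2^{\pm}(w)=L_2^{\pm}(w)L_1^{\pm}(z)R(z/w)$; $R(zq^{c}/w)L_1^{+}(z)L_2^{-}(w)=L_2^{-}(w)L_1^{+}(z)R(zq^{-c}/w)$. Inverses of $L^\pm(z)$ are taken in the tensor product with $\mathrm{End}\,\mathbb{C}^{m|n}$, and $A_{ij}$ is the coefficient of $E_{ij}$ in $A$. $\omega_{m|n}$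 is the anti-automorphism of $\mathrm{U}_q(\widehat{\mathfrak{gl}}_{m|n})$ given by $\omega_{m|n}(L^{\pm}(z))=L^{\pm}(z)^{-1}$, that is, $l_{ij}^{\pm}(z)\mapsto (L^{\pm}(z)^{-1})_{ij}$. For $k\ge0$, $\phi_k:\mathrm{U}_q(\widehat{\mathfrak{gl}}_{M|N})\to\mathrm{U}_q(\widehat{\mathfrak{gl}}_{k+M|N})$ is the homomorphism taking $l^{\pm}_{ij}(z)$ to $l^{\pm}_{k+i,k+j}(z)$, and $\psi_k=\omega_{k+M|N}\circ\phi_k\circ\omega_{M|N}$, applied coefficientwise to series. The quantum Berezinian for $\mathrm{U}_q(\widehat{\mathfrak{gl}}_{m|n})$ is $$B_q(L^{\pm}(z))=\sum_{\sigma\in S_m}(-q)^{-l(\sigma)}L^{\pm}(z)_{\sigma(1),1}\cdots L^{\pm}(zq^{2m-2})_{\sigma(m),m}\sum_{\tau\in S_n}(-q)^{-l(\tau)}\bigl(L^{\pm}(zq^{2m-2})^{-1}\bigr)_{m+1,m+\tau(1)}\cdots\bigl(L^{\pm}(zq^{2m-2n})^{-1}\bigr)_{m+n,m+\tau(n)},$$ with argument $zq^{2j-2}$ in the $j$-th factor of the first product and $zq^{2m-2p}$ in the $p$-th factor of the second; $l(\sigma)$ is the length of $\sigma$. For a $k\times k$ submatrix $A(z)$, $\det_q(A(z))=\sum_{\sigma\in S_k}(-q)^{-l(\sigma)}A(z)_{\sigma(1),1}A(zq^2)_{\sigma(2),2}\cdots A(zq^{2k-2})_{\sigma(k),k}$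.
   Formalization: In the relation between L^+(z) and L^-(w), whose coefficients are infinite sums as written, R is expanded in w/z, with f the normalized series solution in x^{-1} of the same equation; φ_k need only be a homomorphism on the subalgebra generated by one sign's L and inverse diagonal zero modes. *)

theory Defs
  imports
    "HOL-Computational_Algebra.Computational_Algebra"
    "HOL-Library.Poly_Mapping"
    "HOL-Library.Type_Length"
    "HOL-Combinatorics.Permutations"
    Complex_Main
begin

section \<open>The base field and the R-matrix\<close>

type_synonym cq = "complex poly fract"

definition qq :: cq where
  "qq = Fract [:0, 1:] 1"

definition parity :: "nat \<Rightarrow> nat \<Rightarrow> nat" where
  "parity m i = (if i \<le> m then 0 else 1)"

definition qi :: "nat \<Rightarrow> nat \<Rightarrow> cq" where
  "qi m i = qq powi (1 - 2 * int (parity m i))"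

text \<open>The coefficient of \<open>E\<^sub>i\<^sub>j \<otimes> E\<^sub>k\<^sub>l\<close> in \<open>R(z,w)\<close> is
  \<open>z * R_z m i j k l + w * R_w m i j k l\<close>.\<close>

definition R_z :: "nat \<Rightarrow> nat \<Rightarrow> nat \<Rightarrow> nat \<Rightarrow> nat \<Rightarrow> cq" where
  "R_z m i j k l =
    (if i = j \<and> k = l then (if i = k then qi m i else 1)
     else if i = l \<and> j = k \<and> i < j then qi m j - inverse (qi m j)
     else 0)"

definition R_w :: "nat \<Rightarrow> nat \<Rightarrow> nat \<Rightarrow> nat \<Rightarrow> nat \<Rightarrow> cq" where
  "R_w m i j k l =
    (if i = j \<and> k = l then (if i = k then - inverse (qi m i) else -1)
     else if i = l \<and> j = k \<and> i > j then qi m j - inverse (qi m j)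
     else 0)"

abbreviation fps_lin :: "cq \<Rightarrow> cq fps" where
  "fps_lin c \<equiv> fps_const c * fps_X"

text \<open>The scalar series \<open>f(x)\<close>; it is uniquely determined when \<open>m \<noteq> n\<close>.\<close>

definition f_zero :: "nat \<Rightarrow> nat \<Rightarrow> cq fps" where
  "f_zero m n = (let c = qq powi (2 * int n - 2 * int m) in
    THE f. fps_nth f 0 = 1 \<and>
      f oo fps_lin c =
        f * ((1 - fps_lin (qq powi (-2))) * (1 - fps_lin (c * qq ^ 2)))
          / ((1 - fps_X) * (1 - fps_lin c)))"

text \<open>The solution of the same functional equation, with constant term 1, as a power series
  in \<open>y = x\<^sup>-\<^sup>1\<close>: numerator and denominator of the factor have been multiplied
  by \<open>y\<^sup>2\<close>, and \<open>x \<mapsto> c x\<close> becomes \<open>y \<mapsto> c\<^sup>-\<^sup>1 y\<close>.\<close>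

definition f_inf :: "nat \<Rightarrow> nat \<Rightarrow> cq fps" where
  "f_inf m n = (let c = qq powi (2 * int n - 2 * int m) in
    THE g. fps_nth g 0 = 1 \<and>
      g oo fps_lin (inverse c) =
        g * ((fps_X - fps_const (qq powi (-2))) * (fps_X - fps_const (c * qq ^ 2)))
          / ((fps_X - 1) * (fps_X - fps_const c)))"

text \<open>\<open>R(x)\<close> as a power series in \<open>x\<close>, and its analogue in \<open>y = x\<^sup>-\<^sup>1\<close>.\<close>

definition R_zero :: "nat \<Rightarrow> nat \<Rightarrow> nat \<Rightarrow> nat \<Rightarrow> nat \<Rightarrow> nat \<Rightarrow> cq fps" where
  "R_zero m n i j k l =
    f_zero m n * ((fps_lin (R_z m i j k l) + fps_const (R_w m i j k l))
      / (fps_lin qq - fps_const (inverse qq)))"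

definition R_inf :: "nat \<Rightarrow> nat \<Rightarrow> nat \<Rightarrow> nat \<Rightarrow> nat \<Rightarrow> nat \<Rightarrow> cq fps" where
  "R_inf m n i j k l =
    f_inf m n * ((fps_const (R_z m i j k l) + fps_lin (R_w m i j k l))
      / (fps_const qq - fps_lin (inverse qq)))"


section \<open>The free algebra on the generators\<close>

datatype pm = Plus | Minus

fun pm_int :: "pm \<Rightarrow> int" where
  "pm_int Plus = 1"
| "pm_int Minus = -1"

fun pm_opp :: "pm \<Rightarrow> pm" where
  "pm_opp Plus = Minus"
| "pm_opp Minus = Plus"

text \<open>\<open>Lgen s r i j\<close> is the generator \<open>l\<^sub>i\<^sub>j\<^sup>s\<^sup>(\<^sup>r\<^sup>)\<close>; \<open>Qc\<close> is
  \<open>q\<^sup>c\<close> and \<open>Qc_inv\<close> its inverse.\<close>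

datatype uq_gen = Lgen pm nat nat nat | Qc | Qc_inv

datatype 'a fword = Word (letters: "'a list")

instantiation fword :: (type) monoid_add
begin

definition zero_fword :: "'a fword" where
  "0 = Word []"

definition plus_fword :: "'a fword \<Rightarrow> 'a fword \<Rightarrow> 'a fword" where
  "v + w = Word (letters v @ letters w)"

instance
  by standard (simp_all add: zero_fword_def plus_fword_def)

end

type_synonym free_alg = "uq_gen fword \<Rightarrow>\<^sub>0 cq"

abbreviation fconst :: "cq \<Rightarrow> free_alg" where
  "fconst c \<equiv> Poly_Mapping.single 0 c"

abbreviation fgen :: "uq_gen \<Rightarrow> free_alg" where
  "fgen g \<equiv> Poly_Mapping.single (Word [g]) 1"

fun gen_parity :: "nat \<Rightarrow> uq_gen \<Rightarrow> nat" where
  "gen_parity m (Lgen s r i j) = parity m i + parity m j"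
| "gen_parity m Qc = 0"
| "gen_parity m Qc_inv = 0"

definition word_parity :: "nat \<Rightarrow> uq_gen fword \<Rightarrow> nat" where
  "word_parity m w = sum_list (map (gen_parity m) (letters w))"


section \<open>The ideal of relations\<close>

text \<open>A family \<open>X i j k l\<close> stands for the even element
  \<open>\<Sum> X i j k l \<otimes> E\<^sub>i\<^sub>j \<otimes> E\<^sub>k\<^sub>l\<close> of the graded tensor product of a
  superalgebra with two copies of the matrix superalgebra; thus \<open>X i j k l\<close> has parity
  \<open>i + j + k + l\<close> (with bars). The sign in the product comes from
  \<open>(x \<otimes> E\<^sub>i\<^sub>a \<otimes> E\<^sub>k\<^sub>c) (y \<otimes> E\<^sub>a\<^sub>j \<otimes> E\<^sub>c\<^sub>l)\<close>: first \<open>y\<close> moves past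
  \<open>E\<^sub>i\<^sub>a \<otimes> E\<^sub>k\<^sub>c\<close>, then \<open>E\<^sub>a\<^sub>j\<close> moves past \<open>E\<^sub>k\<^sub>c\<close>.\<close>

type_synonym 'a tensor2 = "nat \<Rightarrow> nat \<Rightarrow> nat \<Rightarrow> nat \<Rightarrow> 'a"

definition gmul2 :: "nat \<Rightarrow> nat \<Rightarrow> 'a::ring_1 tensor2 \<Rightarrow> 'a tensor2 \<Rightarrow> 'a tensor2" where
  "gmul2 m n X Y = (\<lambda>i j k l. \<Sum>a = 1..m + n. \<Sum>c = 1..m + n.
     (let p = parity m in
       (-1) ^ ((p i + p a + p k + p c) * (p a + p j + p c + p l) + (p k + p c) * (p a + p j)))
     * X i a k c * Y a j c l)"

definition tR :: "(nat \<Rightarrow> nat \<Rightarrow> nat \<Rightarrow> nat \<Rightarrow> cq fps) \<Rightarrow> nat \<Rightarrow> free_alg tensor2" where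
  "tR R p = (\<lambda>i j k l. fconst (fps_nth (R i j k l) p))"

definition tL1 :: "pm \<Rightarrow> nat \<Rightarrow> free_alg tensor2" where
  "tL1 s r = (\<lambda>i j k l. if k = l then fgen (Lgen s r i j) else 0)"

definition tL2 :: "pm \<Rightarrow> nat \<Rightarrow> free_alg tensor2" where
  "tL2 s r = (\<lambda>i j k l. if i = j then fgen (Lgen s r k l) else 0)"

text \<open>The (finitely many) ways to obtain \<open>z\<^sup>a w\<^sup>b\<close> in \<open>R(z/w) L\<^sub>1(z) L\<^sub>2(w)\<close>, where
  \<open>x\<^sup>p\<close> contributes \<open>z\<^sup>p w\<^sup>-\<^sup>p\<close> and the coefficients of index \<open>r\<close> of \<open>L\<^sub>1\<close> and \<open>t\<close> of
  \<open>L\<^sub>2\<close> contribute \<open>z\<^sup>-\<^sup>r w\<^sup>-\<^sup>t\<close> for \<open>L\<^sup>+\<close> and \<open>z\<^sup>r w\<^sup>t\<close> for \<open>L\<^sup>-\<close>.\<close>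

definition rll_index :: "pm \<Rightarrow> int \<Rightarrow> int \<Rightarrow> (nat \<times> nat \<times> nat) set" where
  "rll_index s a b =
    {(p, r, t). int p - pm_int s * int r = a \<and> - int p - pm_int s * int t = b}"

definition rll_same_lhs :: "nat \<Rightarrow> nat \<Rightarrow> pm \<Rightarrow> int \<Rightarrow> int \<Rightarrow> free_alg tensor2" where
  "rll_same_lhs m n s a b = (\<lambda>i j k l. \<Sum>(p, r, t)\<in>rll_index s a b.
     gmul2 m n (gmul2 m n (tR (R_zero m n) p) (tL1 s r)) (tL2 s t) i j k l)"

definition rll_same_rhs :: "nat \<Rightarrow> nat \<Rightarrow> pm \<Rightarrow> int \<Rightarrow> int \<Rightarrow> free_alg tensor2" where
  "rll_same_rhs m n s a b = (\<lambda>i j k l. \<Sum>(p, r, t)\<in>rll_index s a b.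
     gmul2 m n (gmul2 m n (tL2 s t) (tL1 s r)) (tR (R_zero m n) p) i j k l)"

text \<open>The coefficients of \<open>z\<^sup>-\<^sup>a w\<^sup>b\<close> in the two sides of the relation between \<open>L\<^sup>+(z)\<close> and
  \<open>L\<^sup>-(w)\<close>. Since \<open>L\<^sup>+(z)\<close> is a series in \<open>z\<^sup>-\<^sup>1\<close> and \<open>L\<^sup>-(w)\<close> a series in \<open>w\<close>, products
  with a series in \<open>z/w\<close> would have infinite sums as coefficients; the matrices
  \<open>R(z q\<^sup>c/w)\<close> and \<open>R(z q\<^sup>-\<^sup>c/w)\<close> are therefore expanded in powers of \<open>w/z\<close>, so that their
  \<open>p\<close>-th terms carry \<open>(q\<^sup>c)\<^sup>-\<^sup>p\<close> and \<open>(q\<^sup>c)\<^sup>p\<close>. (In the relations above the direction of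
  expansion is immaterial, as the scalar factor cancels.)\<close>

definition rll_mixed_lhs :: "nat \<Rightarrow> nat \<Rightarrow> nat \<Rightarrow> nat \<Rightarrow> free_alg tensor2" where
  "rll_mixed_lhs m n a b = (\<lambda>i j k l. \<Sum>p\<le>min a b. fgen Qc_inv ^ p *
     gmul2 m n (gmul2 m n (tR (R_inf m n) p) (tL1 Plus (a - p))) (tL2 Minus (b - p)) i j k l)"

definition rll_mixed_rhs :: "nat \<Rightarrow> nat \<Rightarrow> nat \<Rightarrow> nat \<Rightarrow> free_alg tensor2" where
  "rll_mixed_rhs m n a b = (\<lambda>i j k l. \<Sum>p\<le>min a b. fgen Qc ^ p *
     gmul2 m n (gmul2 m n (tL2 Minus (b - p)) (tL1 Plus (a - p))) (tR (R_inf m n) p) i j k l)"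

text \<open>The free algebra has generators \<open>l\<^sub>i\<^sub>j\<close> for all natural numbers \<open>i, j\<close>, independently
  of \<open>m\<close> and \<open>n\<close>; those outside the range \<open>1, \<dots>, m + n\<close> are set to zero.\<close>

inductive_set uq_ideal :: "nat \<Rightarrow> nat \<Rightarrow> free_alg set" for m n :: nat where
  zero: "0 \<in> uq_ideal m n"
| add: "x \<in> uq_ideal m n \<Longrightarrow> y \<in> uq_ideal m n \<Longrightarrow> x + y \<in> uq_ideal m n"
| mult_left: "x \<in> uq_ideal m n \<Longrightarrow> a * x \<in> uq_ideal m n"
| mult_right: "x \<in> uq_ideal m n \<Longrightarrow> x * a \<in> uq_ideal m n"
| range: "\<not> (i \<in> {1..m + n} \<and> j \<in> {1..m + n}) \<Longrightarrow> fgen (Lgen s r i j) \<in> uq_ideal m n"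
| qc_right: "fgen Qc * fgen Qc_inv - 1 \<in> uq_ideal m n"
| qc_left: "fgen Qc_inv * fgen Qc - 1 \<in> uq_ideal m n"
| qc_central: "fgen Qc * fgen g - fgen g * fgen Qc \<in> uq_ideal m n"
| upper: "i < j \<Longrightarrow> fgen (Lgen Plus 0 j i) \<in> uq_ideal m n"
| lower: "i < j \<Longrightarrow> fgen (Lgen Minus 0 i j) \<in> uq_ideal m n"
| diag: "i \<in> {1..m + n} \<Longrightarrow>
    fgen (Lgen (pm_opp s) 0 i i) * fgen (Lgen s 0 i i) - 1 \<in> uq_ideal m n"
| rll_same: "{i, j, k, l} \<subseteq> {1..m + n} \<Longrightarrow>
    rll_same_lhs m n s a b i j k l - rll_same_rhs m n s a b i j k l \<in> uq_ideal m n"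
| rll_mixed: "{i, j, k, l} \<subseteq> {1..m + n} \<Longrightarrow>
    rll_mixed_lhs m n d e i j k l - rll_mixed_rhs m n d e i j k l \<in> uq_ideal m n"

lemma uq_ideal_uminus: "x \<in> uq_ideal m n \<Longrightarrow> - x \<in> uq_ideal m n"
  using uq_ideal.mult_left[of x m n "-1"] by simp

lemma uq_ideal_diff: "x \<in> uq_ideal m n \<Longrightarrow> y \<in> uq_ideal m n \<Longrightarrow> x - y \<in> uq_ideal m n"
  using uq_ideal.add[OF _ uq_ideal_uminus] by fastforce


subsection \<open>The ideal is proper\<close>

text \<open>This is needed for the quotient to be in class \<^class>\<open>ring_1\<close>. The character
  used is the counit, \<open>L\<^sup>\<plusminus>(z) \<mapsto> 1\<close> and \<open>q\<^sup>c \<mapsto> 1\<close>.\<close>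

fun counit_gen :: "nat \<Rightarrow> uq_gen \<Rightarrow> cq" where
  "counit_gen N (Lgen s r i j) = (if i = j \<and> r = 0 \<and> i \<in> {1..N} then 1 else 0)"
| "counit_gen N Qc = 1"
| "counit_gen N Qc_inv = 1"

definition counit_word :: "nat \<Rightarrow> uq_gen fword \<Rightarrow> cq" where
  "counit_word N w = prod_list (map (counit_gen N) (letters w))"

definition counit :: "nat \<Rightarrow> free_alg \<Rightarrow> cq" where
  "counit N x = (\<Sum>w\<in>Poly_Mapping.keys x. Poly_Mapping.lookup x w * counit_word N w)"

lemma counit_word_plus: "counit_word N (v + w) = counit_word N v * counit_word N w"
  by (simp add: counit_word_def plus_fword_def)

lemma counit_superset:
  assumes "finite A" "Poly_Mapping.keys x \<subseteq> A"
  shows "counit N x = (\<Sum>w\<in>A. Poly_Mapping.lookup x w * counit_word N w)"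
  unfolding counit_def
  by (rule sum.mono_neutral_left) (use assms in \<open>auto simp: in_keys_iff\<close>)

lemma counit_add: "counit N (x + y) = counit N x + counit N y"
proof -
  let ?A = "Poly_Mapping.keys x \<union> Poly_Mapping.keys y"
  have "counit N (x + y) = (\<Sum>w\<in>?A. Poly_Mapping.lookup (x + y) w * counit_word N w)"
    by (rule counit_superset) (use Poly_Mapping.keys_add[of x y] in auto)
  also have "\<dots> = (\<Sum>w\<in>?A. Poly_Mapping.lookup x w * counit_word N w)
      + (\<Sum>w\<in>?A. Poly_Mapping.lookup y w * counit_word N w)"
    by (simp add: lookup_add algebra_simps sum.distrib)
  also have "\<dots> = counit N x + counit N y"
    using counit_superset[of ?A x N] counit_superset[of ?A y N] by simp
  finally show ?thesis .
qed

lemma counit_zero [simp]: "counit N 0 = 0"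
  by (simp add: counit_def)

lemma counit_single: "counit N (Poly_Mapping.single w c) = c * counit_word N w"
  by (cases "c = 0") (auto simp: counit_def)

lemma counit_one [simp]: "counit N 1 = 1"
  unfolding single_one[symmetric] counit_single
  by (simp add: counit_word_def zero_fword_def)

lemma counit_sum: "counit N (\<Sum>a\<in>A. g a) = (\<Sum>a\<in>A. counit N (g a))"
  by (induction A rule: infinite_finite_induct) (simp_all add: counit_add)

lemma free_alg_decompose:
  "(x :: free_alg) =
    (\<Sum>w\<in>Poly_Mapping.keys x. Poly_Mapping.single w (Poly_Mapping.lookup x w))"
  by (rule poly_mapping_eqI)
    (auto simp: lookup_sum lookup_single when_def sum.delta in_keys_iff)

lemma counit_mult: "counit N (x * y) = counit N x * counit N y"
proof -
  let ?X = "Poly_Mapping.keys x" and ?Y = "Poly_Mapping.keys y"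
  have "x * y = (\<Sum>v\<in>?X. Poly_Mapping.single v (Poly_Mapping.lookup x v)) *
      (\<Sum>w\<in>?Y. Poly_Mapping.single w (Poly_Mapping.lookup y w))"
    using free_alg_decompose by metis
  also have "\<dots> = (\<Sum>v\<in>?X. \<Sum>w\<in>?Y.
      Poly_Mapping.single (v + w) (Poly_Mapping.lookup x v * Poly_Mapping.lookup y w))"
    by (simp add: sum_product mult_single)
  finally have "counit N (x * y) = (\<Sum>v\<in>?X. \<Sum>w\<in>?Y.
      Poly_Mapping.lookup x v * Poly_Mapping.lookup y w * (counit_word N v * counit_word N w))"
    by (simp add: counit_sum counit_single counit_word_plus)
  also have "\<dots> = counit N x * counit N y"
    by (simp add: counit_def sum_product algebra_simps)
  finally show ?thesis .
qed

lemma counit_uminus: "counit N (- x) = - counit N x"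
  using counit_add[of N x "- x"] by (simp add: eq_neg_iff_add_eq_0 add.commute)

lemma counit_diff: "counit N (x - y) = counit N x - counit N y"
  using counit_add[of N x "- y"] by (simp add: counit_uminus)

lemma counit_power: "counit N (x ^ e) = counit N x ^ e"
  by (induction e) (simp_all add: counit_mult)

lemma counit_const: "counit N (fconst c) = c"
  by (simp add: counit_single counit_word_def zero_fword_def)

lemma counit_fgen: "counit N (fgen g) = counit_gen N g"
  by (simp add: counit_single counit_word_def)

lemma counit_gmul2:
  "counit N (gmul2 m n X Y i j k l) =
    gmul2 m n (\<lambda>i j k l. counit N (X i j k l)) (\<lambda>i j k l. counit N (Y i j k l)) i j k l"
  by (simp add: gmul2_def counit_sum counit_mult counit_power counit_uminus Let_def)

lemma gmul2_delta_right:
  assumes "{i, j, k, l} \<subseteq> {1..m + n}"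
    and "\<And>a c. {a, c} \<subseteq> {1..m + n} \<Longrightarrow> Y a j c l = (if a = j \<and> c = l then u else 0)"
  shows "gmul2 m n X Y i j k l = X i j k l * u"
proof -
  have "gmul2 m n X Y i j k l =
      (\<Sum>a = 1..m + n. \<Sum>c = 1..m + n. if a = j \<and> c = l then X i j k l * u else 0)"
    unfolding gmul2_def
    by (intro sum.cong refl) (use assms(2) in \<open>auto simp: Let_def\<close>)
  also have "\<dots> = (\<Sum>a = 1..m + n. if a = j then X i j k l * u else 0)"
    by (intro sum.cong refl) (use assms(1) in auto)
  also have "\<dots> = X i j k l * u"
    using assms(1) by auto
  finally show ?thesis .
qed

lemma gmul2_delta_left:
  assumes "{i, j, k, l} \<subseteq> {1..m + n}"
    and "\<And>a c. {a, c} \<subseteq> {1..m + n} \<Longrightarrow> X i a k c = (if i = a \<and> k = c then u else 0)"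
  shows "gmul2 m n X Y i j k l = u * Y i j k l"
proof -
  have "gmul2 m n X Y i j k l =
      (\<Sum>a = 1..m + n. \<Sum>c = 1..m + n. if i = a \<and> k = c then u * Y i j k l else 0)"
    unfolding gmul2_def
    by (intro sum.cong refl) (use assms(2) in \<open>auto simp: Let_def\<close>)
  also have "\<dots> = (\<Sum>a = 1..m + n. if i = a then u * Y i j k l else 0)"
    by (intro sum.cong refl) (use assms(1) in auto)
  also have "\<dots> = u * Y i j k l"
    using assms(1) by auto
  finally show ?thesis .
qed

lemma counit_tL:
  assumes "{i, j, k, l} \<subseteq> {1..N}"
  shows "counit N (tL1 s r i j k l) = (if i = j \<and> k = l then of_bool (r = 0) else 0)"
    and "counit N (tL2 s r i j k l) = (if i = j \<and> k = l then of_bool (r = 0) else 0)"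
  using assms by (auto simp: tL1_def tL2_def counit_fgen)

lemma counit_rll_left:
  assumes "{i, j, k, l} \<subseteq> {1..m + n}"
  shows "counit (m + n) (gmul2 m n (gmul2 m n X (tL1 s r)) (tL2 s' t) i j k l) =
    counit (m + n) (X i j k l) * of_bool (r = 0) * of_bool (t = 0)"
proof -
  have "counit (m + n) (gmul2 m n (gmul2 m n X (tL1 s r)) (tL2 s' t) i j k l) =
      counit (m + n) (gmul2 m n X (tL1 s r) i j k l) * of_bool (t = 0)"
    unfolding counit_gmul2[where X = "gmul2 m n X (tL1 s r)"]
    by (rule gmul2_delta_right[OF assms], rule counit_tL) (use assms in auto)
  also have "counit (m + n) (gmul2 m n X (tL1 s r) i j k l) =
      counit (m + n) (X i j k l) * of_bool (r = 0)"
    unfolding counit_gmul2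
    by (rule gmul2_delta_right[OF assms], rule counit_tL) (use assms in auto)
  finally show ?thesis .
qed

lemma counit_rll_right:
  assumes "{i, j, k, l} \<subseteq> {1..m + n}"
  shows "counit (m + n) (gmul2 m n (gmul2 m n (tL2 s' t) (tL1 s r)) X i j k l) =
    counit (m + n) (X i j k l) * of_bool (r = 0) * of_bool (t = 0)"
proof -
  have inner: "counit (m + n) (gmul2 m n (tL2 s' t) (tL1 s r) i a k c) =
      (if i = a \<and> k = c then of_bool (r = 0) * of_bool (t = 0) else 0)"
    if "{a, c} \<subseteq> {1..m + n}" for a c
  proof -
    have ac: "{i, a, k, c} \<subseteq> {1..m + n}"
      using assms that by auto
    have "counit (m + n) (gmul2 m n (tL2 s' t) (tL1 s r) i a k c) =
        counit (m + n) (tL2 s' t i a k c) * of_bool (r = 0)"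
      unfolding counit_gmul2
      by (rule gmul2_delta_right[OF ac], rule counit_tL) (use ac in auto)
    then show ?thesis
      using counit_tL(2)[OF ac] by simp
  qed
  have "counit (m + n) (gmul2 m n (gmul2 m n (tL2 s' t) (tL1 s r)) X i j k l) =
      of_bool (r = 0) * of_bool (t = 0) * counit (m + n) (X i j k l)"
    unfolding counit_gmul2[where Y = X]
    by (rule gmul2_delta_left[OF assms], rule inner)
  then show ?thesis
    by (simp add: mult_ac)
qed

lemma counit_uq_ideal: "x \<in> uq_ideal m n \<Longrightarrow> counit (m + n) x = 0"
proof (induction rule: uq_ideal.induct)
  case (rll_same i j k l s a b)
  then show ?case
    by (simp add: counit_diff rll_same_lhs_def rll_same_rhs_def counit_sum split_beta
        counit_rll_left counit_rll_right)
next
  case (rll_mixed i j k l d e)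
  then show ?case
    by (simp add: counit_diff rll_mixed_lhs_def rll_mixed_rhs_def counit_sum counit_mult
        counit_power counit_fgen counit_rll_left counit_rll_right)
qed (auto simp: counit_add counit_mult counit_diff counit_fgen)

lemma one_notin_uq_ideal: "1 \<notin> uq_ideal m n"
  using counit_uq_ideal[of 1 m n] by auto


section \<open>The quantum affine superalgebra\<close>

text \<open>\<open>('m, 'n) uq\<close> is the superalgebra for \<open>m = LENGTH('m)\<close> and \<open>n = LENGTH('n)\<close>; each
  natural number, zero included, is the length of some type in class \<^class>\<open>len0\<close>.\<close>

quotient_type (overloaded) ('m, 'n) uq =
  free_alg / "\<lambda>x y. x - y \<in> uq_ideal LENGTH('m::len0) LENGTH('n::len0)"
proof (rule equivpI)
  let ?I = "uq_ideal LENGTH('m) LENGTH('n)"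
  show "reflp (\<lambda>x y. x - y \<in> ?I)"
    by (simp add: reflp_def uq_ideal.zero)
  show "symp (\<lambda>x y. x - y \<in> ?I)"
    unfolding symp_def using uq_ideal_uminus by fastforce
  show "transp (\<lambda>x y. x - y \<in> ?I)"
    unfolding transp_def using uq_ideal.add by fastforce
qed

instantiation uq :: (len0, len0) ring_1
begin

lift_definition zero_uq :: "('a, 'b) uq" is 0 .

lift_definition one_uq :: "('a, 'b) uq" is 1 .

lift_definition plus_uq :: "('a, 'b) uq \<Rightarrow> ('a, 'b) uq \<Rightarrow> ('a, 'b) uq" is "(+)"
  using uq_ideal.add by (fastforce simp: algebra_simps)

lift_definition uminus_uq :: "('a, 'b) uq \<Rightarrow> ('a, 'b) uq" is uminus
  using uq_ideal_uminus by (fastforce simp: algebra_simps)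

lift_definition minus_uq :: "('a, 'b) uq \<Rightarrow> ('a, 'b) uq \<Rightarrow> ('a, 'b) uq" is "(-)"
  using uq_ideal_diff by (fastforce simp: algebra_simps)

lift_definition times_uq :: "('a, 'b) uq \<Rightarrow> ('a, 'b) uq \<Rightarrow> ('a, 'b) uq" is "(*)"
proof -
  fix x x' y y' :: free_alg
  let ?I = "uq_ideal LENGTH('a) LENGTH('b)"
  assume "x - x' \<in> ?I" "y - y' \<in> ?I"
  then have "(x - x') * y + x' * (y - y') \<in> ?I"
    by (intro uq_ideal.add uq_ideal.mult_left uq_ideal.mult_right)
  then show "x * y - x' * y' \<in> ?I"
    by (simp add: algebra_simps)
qed

instance
proof
  show "(0 :: ('a, 'b) uq) \<noteq> 1"
    by transfer (use uq_ideal_uminus one_notin_uq_ideal in fastforce)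
qed (transfer, simp add: algebra_simps uq_ideal.zero)+

end

lift_definition uconst :: "cq \<Rightarrow> ('m::len0, 'n::len0) uq" is fconst .

lift_definition ugen :: "uq_gen \<Rightarrow> ('m::len0, 'n::len0) uq" is fgen .

definition uq_homogeneous :: "nat \<Rightarrow> ('m::len0, 'n::len0) uq set" where
  "uq_homogeneous e =
    {abs_uq x | x. \<forall>w\<in>Poly_Mapping.keys x. word_parity LENGTH('m) w mod 2 = e mod 2}"


section \<open>Series and matrices\<close>

text \<open>A series in \<open>z\<^sup>-\<^sup>1\<close> (sign \<open>Plus\<close>) or in \<open>z\<close> (sign \<open>Minus\<close>) is an \<^typ>\<open>'a fps\<close>
  in that variable; \<open>qshift s a F\<close> is \<open>F(z q\<^sup>a)\<close>.\<close>

definition qshift :: "pm \<Rightarrow> int \<Rightarrow> ('m::len0, 'n::len0) uq fps \<Rightarrow> ('m, 'n) uq fps" where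
  "qshift s a F = Abs_fps (\<lambda>r. uconst (qq powi (- pm_int s * a * int r)) * fps_nth F r)"

definition coeffwise :: "('a \<Rightarrow> 'b) \<Rightarrow> 'a fps \<Rightarrow> 'b fps" where
  "coeffwise g F = Abs_fps (\<lambda>r. g (fps_nth F r))"

type_synonym 'a smat = "nat \<Rightarrow> nat \<Rightarrow> 'a fps"

definition Lmat :: "pm \<Rightarrow> ('m::len0, 'n::len0) uq smat" where
  "Lmat s = (\<lambda>i j. Abs_fps (\<lambda>r. ugen (Lgen s r i j)))"

text \<open>Product of even elements \<open>\<Sum> A\<^sub>i\<^sub>j \<otimes> E\<^sub>i\<^sub>j\<close> in the graded tensor product, with
  \<open>A\<^sub>i\<^sub>j\<close> of parity \<open>i + j\<close> (with bars).\<close>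

definition gmul :: "nat \<Rightarrow> nat \<Rightarrow> 'a::ring_1 smat \<Rightarrow> 'a smat \<Rightarrow> 'a smat" where
  "gmul m n A B = (\<lambda>i k. \<Sum>j = 1..m + n.
     (-1) ^ ((parity m i + parity m j) * (parity m j + parity m k)) * A i j * B j k)"

definition is_ginv :: "nat \<Rightarrow> nat \<Rightarrow> 'a::ring_1 smat \<Rightarrow> 'a smat \<Rightarrow> bool" where
  "is_ginv m n A B \<longleftrightarrow>
    (\<forall>i\<in>{1..m + n}. \<forall>k\<in>{1..m + n}.
       gmul m n A B i k = (if i = k then 1 else 0) \<and>
       gmul m n B A i k = (if i = k then 1 else 0))"

text \<open>The entries with an index out of range are set to zero to make the inverse unique.\<close>

definition ginv :: "nat \<Rightarrow> nat \<Rightarrow> 'a::ring_1 smat \<Rightarrow> 'a smat" where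
  "ginv m n A = (THE B. is_ginv m n A B \<and>
     (\<forall>i k. \<not> (i \<in> {1..m + n} \<and> k \<in> {1..m + n}) \<longrightarrow> B i k = 0))"

definition ring_inv :: "'a::ring_1 \<Rightarrow> 'a" where
  "ring_inv a = (THE b. a * b = 1 \<and> b * a = 1)"


section \<open>Quantum determinant and quantum Berezinian\<close>

definition perm_length :: "nat \<Rightarrow> (nat \<Rightarrow> nat) \<Rightarrow> nat" where
  "perm_length k \<sigma> = card {(i, j). 1 \<le> i \<and> i < j \<and> j \<le> k \<and> \<sigma> j < \<sigma> i}"

definition qsign :: "nat \<Rightarrow> (nat \<Rightarrow> nat) \<Rightarrow> ('m::len0, 'n::len0) uq fps" where
  "qsign k \<sigma> = fps_const (uconst ((- qq) powi (- int (perm_length k \<sigma>))))"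

definition qdet :: "pm \<Rightarrow> nat \<Rightarrow> ('m::len0, 'n::len0) uq smat \<Rightarrow> ('m, 'n) uq fps" where
  "qdet s k A = (\<Sum>\<sigma> | \<sigma> permutes {1..k}. qsign k \<sigma> *
     prod_list (map (\<lambda>j. qshift s (2 * int j - 2) (A (\<sigma> j) j)) [1..<k + 1]))"

definition berezinian ::
  "pm \<Rightarrow> nat \<Rightarrow> nat \<Rightarrow> ('m::len0, 'n::len0) uq smat \<Rightarrow> ('m, 'n) uq fps" where
  "berezinian s m n A =
    (\<Sum>\<sigma> | \<sigma> permutes {1..m}. qsign m \<sigma> *
       prod_list (map (\<lambda>j. qshift s (2 * int j - 2) (A (\<sigma> j) j)) [1..<m + 1])) *
    (\<Sum>\<tau> | \<tau> permutes {1..n}. qsign n \<tau> *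
       prod_list (map (\<lambda>p. qshift s (2 * int m - 2 * int p) (ginv m n A (m + p) (m + \<tau> p)))
         [1..<n + 1]))"


section \<open>The maps omega and phi\<close>

text \<open>An anti-automorphism of a superalgebra is even and satisfies
  \<open>\<omega>(x y) = (-1)\<^bsup>|x| |y|\<^esup> \<omega>(y) \<omega>(x)\<close>.\<close>

definition super_anti_automorphism ::
  "(('m::len0, 'n::len0) uq \<Rightarrow> ('m, 'n) uq) \<Rightarrow> bool" where
  "super_anti_automorphism \<omega> \<longleftrightarrow>
    bij \<omega> \<and>
    (\<forall>x y. \<omega> (x + y) = \<omega> x + \<omega> y) \<and>
    (\<forall>c. \<omega> (uconst c) = uconst c) \<and>
    (\<forall>e. \<omega> ` uq_homogeneous e \<subseteq> uq_homogeneous e) \<and>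
    (\<forall>d e. \<forall>x\<in>uq_homogeneous d. \<forall>y\<in>uq_homogeneous e.
       \<omega> (x * y) = (-1) ^ (d * e) * \<omega> y * \<omega> x)"

definition is_omega :: "(('m::len0, 'n::len0) uq \<Rightarrow> ('m, 'n) uq) \<Rightarrow> bool" where
  "is_omega \<omega> \<longleftrightarrow>
    super_anti_automorphism \<omega> \<and>
    (\<forall>s. \<forall>i\<in>{1..LENGTH('m) + LENGTH('n)}. \<forall>j\<in>{1..LENGTH('m) + LENGTH('n)}.
       coeffwise \<omega> (Lmat s i j) = ginv LENGTH('m) LENGTH('n) (Lmat s) i j)"

text \<open>The subalgebra generated by the coefficients of \<open>L\<^sup>+(z)\<close>, respectively \<open>L\<^sup>-(z)\<close>, and the
  inverses of the diagonal zero modes. It contains the coefficients of \<open>L\<^sup>\<plusminus>(z)\<^sup>-\<^sup>1\<close>.\<close>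

inductive_set uq_sub :: "pm \<Rightarrow> ('m::len0, 'n::len0) uq set" for s :: pm where
  const: "uconst c \<in> uq_sub s"
| gen: "ugen (Lgen s r i j) \<in> uq_sub s"
| inv: "ugen (Lgen (pm_opp s) 0 i i) \<in> uq_sub s"
| add: "x \<in> uq_sub s \<Longrightarrow> y \<in> uq_sub s \<Longrightarrow> x + y \<in> uq_sub s"
| mult: "x \<in> uq_sub s \<Longrightarrow> y \<in> uq_sub s \<Longrightarrow> x * y \<in> uq_sub s"

definition algebra_hom_on ::
  "('m::len0, 'n::len0) uq set \<Rightarrow> (('m, 'n) uq \<Rightarrow> ('k::len0, 'l::len0) uq) \<Rightarrow> bool" where
  "algebra_hom_on S \<phi> \<longleftrightarrow>
    (\<forall>c. \<phi> (uconst c) = uconst c) \<and>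
    (\<forall>x\<in>S. \<forall>y\<in>S. \<phi> (x + y) = \<phi> x + \<phi> y \<and> \<phi> (x * y) = \<phi> x * \<phi> y)"

text \<open>\<open>\<phi>\<close> is required to be a homomorphism only on the subalgebra \<open>uq_sub s\<close>. In particular
  every homomorphism on the whole superalgebra with the prescribed values qualifies. The latter is
  not demanded because the scalar series in the relation between \<open>L\<^sup>+\<close> and \<open>L\<^sup>-\<close> depends on
  \<open>m - n\<close>: unless \<open>q\<^sup>2\<^sup>c = 1\<close> is imposed, shifting the indices by \<open>k > 0\<close> does not
  preserve that relation, whereas the relations for a single sign are preserved.\<close>

definition is_phi ::
  "pm \<Rightarrow> nat \<Rightarrow> (('m::len0, 'n::len0) uq \<Rightarrow> ('km::len0, 'n) uq) \<Rightarrow> bool" where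
  "is_phi s k \<phi> \<longleftrightarrow>
    algebra_hom_on (uq_sub s) \<phi> \<and>
    (\<forall>i\<in>{1..LENGTH('m) + LENGTH('n)}. \<forall>j\<in>{1..LENGTH('m) + LENGTH('n)}.
       coeffwise \<phi> (Lmat s i j) = Lmat s (k + i) (k + j))"

end

theory Submission
  imports Defs "HOL-Combinatorics.Multiset_Permutations"
begin

text \<open>After a sign twist of the generator matrix, the graded matrix product becomes the ordinary one and
  the relation \<open>R L L = L L R\<close> a quadratic relation between the entries, which also holds over the
  opposite ring with \<open>q\<close> replaced by \<open>q\<^sup>-\<^sup>1\<close>. For every interval of indices, the product of the
  quasideterminants (inverted at odd indices) with suitably shifted arguments is a Berezinian \<open>b\<close>; an
  exchange relation for the quasideterminants of the two ends shows that it can be built up from either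
  end. Over the opposite ring, where the inverse of \<open>L\<close> is a transposed inverse \<open>Y\<close>, one obtains in
  the same way an element \<open>o\<close>.

  The main point is that \<open>b = o\<close>. If all indices have the same parity, both are quantum minors.
  Otherwise crossing symmetry, which says that the diagonal entries of \<open>L(z q\<^sup>2\<^sup>h)\<^sup>-\<^sup>1\<close> and \<open>Y(z)\<close>
  differ by a common factor, yields \<open>b(z) b(z q\<^sup>2) = o(z q\<^sup>2) o(z)\<close> by induction on the interval. The
  coefficients commute and the constant terms agree, so this forces \<open>b = o\<close>.

  Now \<open>\<omega>\<close> maps the diagonal entry \<open>x\<close> of \<open>Y\<close> for the interval from \<open>x\<close> to \<open>M + N\<close> to the Schur
  complement of the indices below \<open>x\<close> in \<open>L\<close>. Hence it exchanges the factors of \<open>o\<close> with the inverses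
  of the factors of \<open>b\<close>, whereas \<open>\<phi>\<^sub>k\<close> shifts the factors of \<open>o\<close>, since they involve only upper intervals.
  Therefore \<open>\<psi>\<^sub>k\<close> maps the Berezinian to the product of the last \<open>M + N\<close> of the \<open>k + M + N\<close> factors of
  the larger one, and the product of the first \<open>k\<close> is the quantum determinant.\<close>

section \<open>Matrices over a ring\<close>

text \<open>Arguments are only ever specialised to z q^a with integer a. As q is not a root of
  unity, the numbers q^(s r) for r = 0, 1, ... are distinct (s = -1 or 1), so an identity valid for
  all a \<noteq> b determines every coefficient and persists at a = b. That is indispensable:
  quasideterminants have to commute with entries at the same argument, where the coefficient q^a -
  q^b in the relation vanishes. Two kinds of intervals are the obstacle that shapes the proof. The
  definition of the Berezinian peels off blocks {1..x}, whereas \<phi>_k respects inverses of blocks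
  {x..M+N}. Passing between them requires b = o; the opposite ring enters because \<omega> reverses
  products, so that what it sends to the inverse of a block of L^-1 is a transposed inverse of a
  block of L. Crossing relates b and o only through an unknown series \<theta>, in the form b(z) =
  o(z q^2) \<theta>(z) and \<theta>(z) b(z q^2) = o(z). Eliminating \<theta> is what makes the
  identity quadratic.\<close>

definition minv :: "'i set \<Rightarrow> ('i \<Rightarrow> 'i \<Rightarrow> 'r::ring_1) \<Rightarrow> ('i \<Rightarrow> 'i \<Rightarrow> 'r) \<Rightarrow> bool" where
  "minv K A B \<longleftrightarrow> (\<forall>i\<in>K. \<forall>k\<in>K.
     (\<Sum>j\<in>K. A i j * B j k) = of_bool (i = k) \<and> (\<Sum>j\<in>K. B i j * A j k) = of_bool (i = k))"

lemma minvD: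
  assumes "minv K A B" "i \<in> K" "k \<in> K"
  shows "(\<Sum>j\<in>K. A i j * B j k) = of_bool (i = k)" "(\<Sum>j\<in>K. B i j * A j k) = of_bool (i = k)"
  using assms by (auto simp: minv_def)

lemma minv_sym: "minv K A B \<Longrightarrow> minv K B A"
  by (auto simp: minv_def)

lemma minv_cong:
  assumes "\<And>i j. i \<in> K \<Longrightarrow> j \<in> K \<Longrightarrow> A i j = A' i j" "\<And>i j. i \<in> K \<Longrightarrow> j \<in> K \<Longrightarrow> B i j = B' i j"
  shows "minv K A B = minv K A' B'"
  using assms by (simp add: minv_def)

lemma minv_unique:
  assumes K: "finite K" and "minv K A B" "minv K A C" "i \<in> K" "k \<in> K"
  shows "B i k = C i k"
proof -
  have "B i k = (\<Sum>j\<in>K. B i j * of_bool (j = k))"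
    using K \<open>k \<in> K\<close> by simp
  also have "\<dots> = (\<Sum>j\<in>K. B i j * (\<Sum>l\<in>K. A j l * C l k))"
    using assms by (intro sum.cong refl) (simp add: minvD)
  also have "\<dots> = (\<Sum>l\<in>K. (\<Sum>j\<in>K. B i j * A j l) * C l k)"
    unfolding sum_distrib_left sum_distrib_right by (subst sum.swap) (simp add: mult.assoc)
  also have "\<dots> = (\<Sum>l\<in>K. of_bool (i = l) * C l k)"
    using assms by (intro sum.cong refl) (simp add: minvD)
  also have "\<dots> = C i k"
    using K \<open>i \<in> K\<close> by simp
  finally show ?thesis .
qed

text \<open>\<open>D\<close> stands for the inverse of the block of \<open>A\<close> on
  \<open>C\<close>. It is an argument of the definition so that any chosen inverse can be
  inserted.\<close>

definition schur :: "'i set \<Rightarrow> ('i \<Rightarrow> 'i \<Rightarrow> 'r::ring_1) \<Rightarrow> ('i \<Rightarrow> 'i \<Rightarrow> 'r) \<Rightarrow> 'i \<Rightarrow> 'i \<Rightarrow> 'r" where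
  "schur C A D i j = A i j - (\<Sum>k\<in>C. \<Sum>l\<in>C. A i k * D k l * A l j)"

text \<open>Block elimination. For a column k outside J, the equation (X A)_ik = 0 trades the part
  of the sum over J for minus the part over the complement; there D cancels against A, and what
  remains completes the sum over J to (X A)_il.\<close>

lemma minv_block:
  assumes K: "finite K" and J: "J \<subseteq> K" and X: "minv K A X" and D: "minv (K - J) A D"
  shows "minv J X (schur (K - J) A D)"
proof -
  let ?C = "K - J"
  have fin: "finite J" "finite ?C"
    using K J finite_subset by auto
  have split: "sum f K = sum f J + sum f ?C" for f :: "'a \<Rightarrow> 'b"
    using sum.subset_diff[OF J K, of f] by (simp add: add.commute)
  have "(\<Sum>j\<in>J. X i j * schur ?C A D j l) = of_bool (i = l)" if "i \<in> J" "l \<in> J" for i l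
  proof -
    have neg: "(\<Sum>j\<in>J. X i j * A j k) = - (\<Sum>c\<in>?C. X i c * A c k)" if "k \<in> ?C" for k
      using minvD(2)[OF X, of i k] split[of "\<lambda>j. X i j * A j k"] that \<open>i \<in> J\<close> J
      by (auto simp: eq_neg_iff_add_eq_0)
    have "(\<Sum>j\<in>J. X i j * (\<Sum>k\<in>?C. \<Sum>r\<in>?C. A j k * D k r * A r l))
        = (\<Sum>j\<in>J. \<Sum>k\<in>?C. \<Sum>r\<in>?C. X i j * A j k * (D k r * A r l))"
      by (simp add: sum_distrib_left mult.assoc)
    also have "\<dots> = (\<Sum>k\<in>?C. \<Sum>r\<in>?C. (\<Sum>j\<in>J. X i j * A j k) * (D k r * A r l))"
      unfolding sum_distrib_right
      by (subst sum.swap, rule sum.cong[OF refl], subst sum.swap) simp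
    also have "\<dots> = (\<Sum>k\<in>?C. \<Sum>r\<in>?C. - (\<Sum>c\<in>?C. X i c * A c k) * (D k r * A r l))"
      by (intro sum.cong refl) (simp add: neg)
    also have "\<dots> = - (\<Sum>k\<in>?C. \<Sum>r\<in>?C. \<Sum>c\<in>?C. X i c * A c k * (D k r * A r l))"
      by (simp add: sum_distrib_right sum_negf)
    also have "\<dots> = - (\<Sum>r\<in>?C. \<Sum>c\<in>?C. X i c * (\<Sum>k\<in>?C. A c k * D k r) * A r l)"
      unfolding sum_distrib_right sum_distrib_left
      by (subst sum.swap, rule arg_cong[of _ _ uminus], rule sum.cong[OF refl], subst sum.swap) (simp add: mult.assoc)
    also have "\<dots> = - (\<Sum>r\<in>?C. \<Sum>c\<in>?C. X i c * of_bool (c = r) * A r l)"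
      by (intro arg_cong[of _ _ uminus] sum.cong refl) (simp add: minvD[OF D])
    also have "\<dots> = - (\<Sum>r\<in>?C. \<Sum>c\<in>?C. if c = r then X i c * A r l else 0)"
      by (intro arg_cong[of _ _ uminus] sum.cong refl) auto
    also have "\<dots> = - (\<Sum>r\<in>?C. X i r * A r l)"
      by (intro arg_cong[of _ _ uminus] sum.cong refl) (simp add: fin)
    finally have *: "(\<Sum>j\<in>J. X i j * (\<Sum>k\<in>?C. \<Sum>r\<in>?C. A j k * D k r * A r l)) = - (\<Sum>r\<in>?C. X i r * A r l)" .
    have "(\<Sum>j\<in>J. X i j * schur ?C A D j l) = (\<Sum>j\<in>K. X i j * A j l)"
      unfolding schur_def split right_diff_distrib sum_subtractf * by simp
    then show ?thesis
      using minvD(2)[OF X, of i l] that subsetD[OF J] by simp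
  qed
  moreover have "(\<Sum>j\<in>J. schur ?C A D i j * X j l) = of_bool (i = l)" if "i \<in> J" "l \<in> J" for i l
  proof -
    have neg: "(\<Sum>j\<in>J. A k j * X j l) = - (\<Sum>c\<in>?C. A k c * X c l)" if "k \<in> ?C" for k
      using minvD(1)[OF X, of k l] split[of "\<lambda>j. A k j * X j l"] that \<open>l \<in> J\<close> J
      by (auto simp: eq_neg_iff_add_eq_0)
    have "(\<Sum>j\<in>J. (\<Sum>k\<in>?C. \<Sum>r\<in>?C. A i k * D k r * A r j) * X j l)
        = (\<Sum>j\<in>J. \<Sum>k\<in>?C. \<Sum>r\<in>?C. A i k * D k r * (A r j * X j l))"
      by (simp add: sum_distrib_right mult.assoc)
    also have "\<dots> = (\<Sum>k\<in>?C. \<Sum>r\<in>?C. A i k * D k r * (\<Sum>j\<in>J. A r j * X j l))"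
      unfolding sum_distrib_left
      by (subst sum.swap, rule sum.cong[OF refl], subst sum.swap) simp
    also have "\<dots> = (\<Sum>k\<in>?C. \<Sum>r\<in>?C. A i k * D k r * - (\<Sum>c\<in>?C. A r c * X c l))"
      by (intro sum.cong refl) (simp add: neg)
    also have "\<dots> = - (\<Sum>k\<in>?C. \<Sum>r\<in>?C. \<Sum>c\<in>?C. A i k * (D k r * A r c) * X c l)"
      by (simp add: sum_distrib_left sum_negf mult.assoc)
    also have "\<dots> = - (\<Sum>k\<in>?C. \<Sum>c\<in>?C. A i k * (\<Sum>r\<in>?C. D k r * A r c) * X c l)"
      unfolding sum_distrib_right sum_distrib_left
      by (rule arg_cong[of _ _ uminus], rule sum.cong[OF refl], subst sum.swap) (simp add: mult.assoc)
    also have "\<dots> = - (\<Sum>k\<in>?C. \<Sum>c\<in>?C. A i k * of_bool (k = c) * X c l)"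
      by (intro arg_cong[of _ _ uminus] sum.cong refl) (simp add: minvD[OF D])
    also have "\<dots> = - (\<Sum>k\<in>?C. \<Sum>c\<in>?C. if k = c then A i k * X c l else 0)"
      by (intro arg_cong[of _ _ uminus] sum.cong refl) auto
    also have "\<dots> = - (\<Sum>k\<in>?C. A i k * X k l)"
      by (intro arg_cong[of _ _ uminus] sum.cong refl) (simp add: fin)
    finally have *: "(\<Sum>j\<in>J. (\<Sum>k\<in>?C. \<Sum>r\<in>?C. A i k * D k r * A r j) * X j l) = - (\<Sum>k\<in>?C. A i k * X k l)" .
    have "(\<Sum>j\<in>J. schur ?C A D i j * X j l) = (\<Sum>j\<in>K. A i j * X j l)"
      unfolding schur_def split left_diff_distrib sum_subtractf * by simp
    then show ?thesis
      using minvD(1)[OF X, of i l] that subsetD[OF J] by simp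
  qed
  ultimately show ?thesis
    by (simp add: minv_def)
qed

lemma schur_unit:
  assumes "finite J" "x \<notin> J" "minv (insert x J) A X" "minv J A D"
  shows "X x x * schur J A D x x = 1" "schur J A D x x * X x x = 1"
  using minv_block[of "insert x J" "{x}" A X D] assms by (auto simp: minv_def)

text \<open>Gaussian elimination of the new index x, where d' inverts its Schur complement. This is
  the induction step by which inverses of all blocks on intervals are constructed.\<close>

lemma minv_border:
  assumes J: "finite J" "x \<notin> J" and D: "minv J A D"
    and d: "schur J A D x x * d' = 1" "d' * schur J A D x x = 1"
  defines "u \<equiv> \<lambda>k. \<Sum>j\<in>J. A x j * D j k" and "v \<equiv> \<lambda>j. \<Sum>k\<in>J. D j k * A k x"
  shows "minv (insert x J) A (\<lambda>i k. if i = x then (if k = x then d' else - (d' * u k))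
    else if k = x then - (v i * d') else D i k + v i * d' * u k)"
proof -
  have uA: "(\<Sum>k\<in>J. u k * A k l) = A x l" if "l \<in> J" for l
  proof -
    have "(\<Sum>k\<in>J. u k * A k l) = (\<Sum>j\<in>J. A x j * (\<Sum>k\<in>J. D j k * A k l))"
      unfolding u_def sum_distrib_left sum_distrib_right by (subst sum.swap) (simp add: mult.assoc)
    also have "\<dots> = (\<Sum>j\<in>J. A x j * of_bool (j = l))"
      using that by (intro sum.cong refl) (simp add: minvD[OF D])
    finally show ?thesis
      using J that by simp
  qed
  have Av: "(\<Sum>k\<in>J. A l k * v k) = A l x" if "l \<in> J" for l
  proof -
    have "(\<Sum>k\<in>J. A l k * v k) = (\<Sum>j\<in>J. (\<Sum>k\<in>J. A l k * D k j) * A j x)"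
      unfolding v_def sum_distrib_left sum_distrib_right by (subst sum.swap) (simp add: mult.assoc)
    also have "\<dots> = (\<Sum>j\<in>J. of_bool (l = j) * A j x)"
      using that by (intro sum.cong refl) (simp add: minvD[OF D])
    finally show ?thesis
      using J that by simp
  qed
  have s1: "schur J A D x x = A x x - (\<Sum>k\<in>J. u k * A k x)"
    unfolding schur_def u_def sum_distrib_right by (subst sum.swap) simp
  have s2: "schur J A D x x = A x x - (\<Sum>k\<in>J. A x k * v k)"
    unfolding schur_def v_def sum_distrib_left by (simp add: mult.assoc)
  have AD: "(\<Sum>j\<in>J. A i j * D j k) = of_bool (i = k)" "(\<Sum>j\<in>J. D i j * A j k) = of_bool (i = k)"
    if "i \<in> J" "k \<in> J" for i k
    using minvD[OF D that] by auto
  have r1: "A x x * d' - (\<Sum>k\<in>J. A x k * v k) * d' = 1"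
    using d(1) unfolding s2 by (simp add: left_diff_distrib)
  have r2: "d' * A x x - d' * (\<Sum>k\<in>J. u k * A k x) = 1"
    using d(2) unfolding s1 by (simp add: right_diff_distrib)
  have e1: "(\<Sum>j\<in>J. A i j * - (v j * d')) = - ((\<Sum>j\<in>J. A i j * v j) * d')" for i
    by (simp add: sum_distrib_right sum_negf mult.assoc)
  have e2: "(\<Sum>j\<in>J. A i j * (D j k + v j * d' * u k)) = (\<Sum>j\<in>J. A i j * D j k) + (\<Sum>j\<in>J. A i j * v j) * d' * u k" for i k
    by (simp add: sum_distrib_right distrib_left sum.distrib mult.assoc)
  have e3: "(\<Sum>j\<in>J. - (d' * u j) * A j k) = - (d' * (\<Sum>j\<in>J. u j * A j k))" for k
    by (simp add: sum_distrib_left sum_negf mult.assoc)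
  have e4: "(\<Sum>j\<in>J. (D i j + v i * d' * u j) * A j k) = (\<Sum>j\<in>J. D i j * A j k) + v i * d' * (\<Sum>j\<in>J. u j * A j k)" for i k
    by (simp add: sum_distrib_left distrib_right sum.distrib mult.assoc)
  have neq: "j \<noteq> x" if "j \<in> J" for j
    using that J by auto
  let ?X = "\<lambda>i k. if i = x then (if k = x then d' else - (d' * u k))
    else if k = x then - (v i * d') else D i k + v i * d' * u k"
  have X1: "(\<Sum>j\<in>J. A i j * ?X j k) = (if k = x then (\<Sum>j\<in>J. A i j * - (v j * d')) else (\<Sum>j\<in>J. A i j * (D j k + v j * d' * u k)))" for i k
    using neq by (auto intro!: sum.cong)
  have X2: "(\<Sum>j\<in>J. ?X i j * A j k) = (if i = x then (\<Sum>j\<in>J. - (d' * u j) * A j k) else (\<Sum>j\<in>J. (D i j + v i * d' * u j) * A j k))" for i k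
    using neq by (auto intro!: sum.cong)
  have vA: "v i = (\<Sum>k\<in>J. D i k * A k x)" for i by (simp add: v_def)
  have uD: "u k = (\<Sum>j\<in>J. A x j * D j k)" for k by (simp add: u_def)
  have c1: "A x x * - (d' * u k) + (u k + (\<Sum>j\<in>J. A x j * v j) * d' * u k) = 0" for k
  proof -
    have "A x x * - (d' * u k) + (u k + (\<Sum>j\<in>J. A x j * v j) * d' * u k) =
      u k - (A x x * d' - (\<Sum>k\<in>J. A x k * v k) * d') * u k"
      by (simp add: algebra_simps)
    then show ?thesis by (simp add: r1)
  qed
  have c2: "- (v i * d') * A x x + (v i + v i * d' * (\<Sum>j\<in>J. u j * A j x)) = 0" for i
  proof -
    have "- (v i * d') * A x x + (v i + v i * d' * (\<Sum>j\<in>J. u j * A j x)) =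
      v i - v i * (d' * A x x - d' * (\<Sum>k\<in>J. u k * A k x))"
      by (simp add: algebra_simps)
    then show ?thesis by (simp add: r2)
  qed
  show ?thesis
    unfolding minv_def
  proof (intro ballI conjI)
    fix i k assume ik: "i \<in> insert x J" "k \<in> insert x J"
    show "(\<Sum>j\<in>insert x J. A i j * ?X j k) = of_bool (i = k)"
      unfolding sum.insert[OF J] X1 e1 e2 using ik neq r1 c1
      by (auto simp: Av AD uD[symmetric] mult.assoc split: if_splits)
    show "(\<Sum>j\<in>insert x J. ?X i j * A j k) = of_bool (i = k)"
      unfolding sum.insert[OF J] X2 e3 e4 using ik neq r2 c2
      by (auto simp: uA AD vA[symmetric] mult.assoc split: if_splits)
  qed
qed

section \<open>RLL relations\<close>

lemma commute_minv:
  assumes K: "finite K" and B: "minv K A B" and y: "\<And>i j. i \<in> K \<Longrightarrow> j \<in> K \<Longrightarrow> y * A i j = A i j * y"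
    and ik: "i \<in> K" "k \<in> K"
  shows "y * B i k = B i k * y"
proof -
  have "y * B i k = (\<Sum>j\<in>K. of_bool (i = j) * (y * B j k))"
    using K ik by simp
  also have "\<dots> = (\<Sum>j\<in>K. (\<Sum>l\<in>K. B i l * A l j) * (y * B j k))"
    using ik by (intro sum.cong refl) (simp add: minvD[OF B])
  also have "\<dots> = (\<Sum>l\<in>K. \<Sum>j\<in>K. B i l * (A l j * y) * B j k)"
    unfolding sum_distrib_right by (subst sum.swap) (simp add: mult.assoc)
  also have "\<dots> = (\<Sum>l\<in>K. \<Sum>j\<in>K. B i l * (y * A l j) * B j k)"
    by (intro sum.cong refl) (simp add: y)
  also have "\<dots> = (\<Sum>l\<in>K. B i l * y * (\<Sum>j\<in>K. A l j * B j k))"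
    by (simp add: sum_distrib_left mult.assoc)
  also have "\<dots> = (\<Sum>l\<in>K. B i l * y * of_bool (l = k))"
    using ik by (intro sum.cong refl) (simp add: minvD[OF B])
  also have "\<dots> = B i k * y"
    using K ik by simp
  finally show ?thesis .
qed

lemma commute_inverse:
  fixes u :: "'r::ring_1"
  assumes "u * v = 1" "v * u = 1" "y * u = u * y"
  shows "y * v = v * y"
proof -
  have "y * v = (v * u) * (y * v)" by (simp add: assms(2))
  also have "\<dots> = v * (u * y) * v" by (simp only: mult.assoc)
  also have "\<dots> = v * y * (u * v)" by (simp only: assms(3)[symmetric] mult.assoc)
  finally show ?thesis by (simp add: assms(1))
qed

text \<open>The exponent in q_i = \<open>q powi gr m i\<close>, kept as an integer because it also
  measures shifts of the argument.\<close>

definition gr :: "nat \<Rightarrow> nat \<Rightarrow> int" where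
  "gr m i = 1 - 2 * int (parity m i)"

lemma parity_cases: "(parity m i = 0 \<Longrightarrow> P) \<Longrightarrow> (parity m i = 1 \<Longrightarrow> P) \<Longrightarrow> P"
  by (cases "i \<le> m") (auto simp: parity_def)

text \<open>An algebra over a field with a distinguished q that is not a root of unity. The same
  theory serves the superalgebra, series over it, and opposite rings with
  \<open>inverse q\<close>.\<close>

locale scalar_ring =
  fixes sc :: "'k::field \<Rightarrow> 'r::ring_1" and q :: 'k
  assumes sc_add: "sc (c + d) = sc c + sc d"
    and sc_mult: "sc (c * d) = sc c * sc d"
    and sc_1 [simp]: "sc 1 = 1"
    and sc_central: "x * sc c = sc c * x"
    and q_nz [simp]: "q \<noteq> 0"
    and q_powi: "q powi n = 1 \<Longrightarrow> n = 0"
begin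

lemma sc_0 [simp]: "sc 0 = 0"
  using sc_add[of 0 0] by simp

lemma sc_minus: "sc (- c) = - sc c"
  using sc_add[of c "- c"] by (simp add: eq_neg_iff_add_eq_0 add.commute)

lemma sc_left: "x * (sc c * y) = sc c * (x * y)"
  by (metis mult.assoc sc_central)

lemma sc_mult_assoc: "sc c * (sc d * y) = sc (c * d) * y"
  by (simp add: sc_mult mult.assoc)

lemma sc_gather: "sc c * (x * (sc d * (y * z)) * w) = sc (c * d) * (x * (y * (z * w)))"
  and sc_gather2: "sc c * (x * (sc d * (y * z)) * w) = sc (c * d) * (x * y * (z * w))"
  by (metis mult.assoc sc_central sc_mult)+

lemma sc_gather3: "sc c * (x * (sc d * (y * z))) = sc (c * d) * (x * y * z)"
  by (metis mult.assoc sc_central sc_mult)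

lemma sc_gather5: "sc c * (x * (sc d * y)) = sc (c * d) * (x * y)"
  by (metis mult.assoc sc_central sc_mult)

lemma sc_gather4: "sc c * (sc d * (x * y) * z) = sc (c * d) * (x * y * z)"
  by (metis mult.assoc sc_mult)

lemma sc_swap2: "sc c * (sc d * u * v) = sc d * (sc c * (u * v))"
  by (metis mult.assoc mult.commute sc_mult)

lemma sc_diff_gather: "sc c * (u * w) + sc (c * - d) * (v * w) = sc c * ((u - sc d * v) * w)"
  by (simp add: sc_mult sc_minus left_diff_distrib right_diff_distrib mult.assoc)

lemma sc_prod: "sc c * x * (sc d * y) = sc (c * d) * (x * y)"
  by (metis mult.assoc sc_central sc_mult)

lemma sc_swap3: "sc c * (sc d * y) = sc d * (sc c * y)"
  by (metis mult.assoc sc_central)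

lemma sc_prod': "sc d * x * (sc c * y) = sc (c * d) * (x * y)"
  by (metis mult.commute sc_prod)

lemma sc_cancel:
  assumes "sc c * x = sc c * y" "c \<noteq> 0"
  shows "x = y"
proof -
  have "sc (inverse c) * (sc c * x) = sc (inverse c) * (sc c * y)"
    using assms by simp
  then show ?thesis
    using assms(2) by (simp add: sc_mult_assoc)
qed

text \<open>A tool for specialising RLL relations: t normalises the relation, and the four new
  coefficients become separate goals in the field.\<close>

lemma sc_scale:
  assumes "sc c1 * P + sc c2 * Q = sc c3 * R + sc c4 * S"
    and "t * c1 = e1" "t * c2 = e2" "t * c3 = e3" "t * c4 = e4"
  shows "sc e1 * P + sc e2 * Q = sc e3 * R + sc e4 * S"
proof -
  have "sc t * (sc c1 * P + sc c2 * Q) = sc t * (sc c3 * R + sc c4 * S)"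
    using assms(1) by simp
  then show ?thesis
    using assms(2-) by (simp add: distrib_left sc_mult_assoc)
qed

lemma q_powi_inj: "q powi a = q powi b \<longleftrightarrow> a = b"
proof
  assume "q powi a = q powi b"
  then have "q powi (a - b) = 1" by (simp add: power_int_diff)
  then show "a = b" using q_powi by fastforce
qed simp

end

definition rho :: "'k::field \<Rightarrow> nat \<Rightarrow> int \<Rightarrow> int \<Rightarrow> nat \<Rightarrow> nat \<Rightarrow> 'k" where
  "rho q m a b i k = (if i = k then q powi a * q powi gr m i - q powi b / q powi gr m i
     else q powi a - q powi b)"

definition xi :: "'k::field \<Rightarrow> int \<Rightarrow> int \<Rightarrow> nat \<Rightarrow> nat \<Rightarrow> 'k" where
  "xi q a b i k = (if i < k then (q - 1 / q) * q powi a
     else if k < i then (q - 1 / q) * q powi b else 0)"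

abbreviation sg :: "nat \<Rightarrow> 'k::field" where "sg n \<equiv> (-1) ^ n"

text \<open>\<open>rho\<close> and \<open>xi\<close> are the diagonal and the exchange coefficients of \<open>R(q\<^sup>a, q\<^sup>b)\<close>, up to
  signs. \<open>T a i j\<close> stands for the \<open>(i, j)\<close>-entry of \<open>L(z)\<close> at \<open>z = q\<^sup>a\<close>, multiplied by the sign
  \<open>tw m i j\<close> below; this turns the product of even supermatrices into the ordinary matrix product and
  accounts for the signs in the relation.\<close>

locale rll = scalar_ring sc q for sc :: "'k::field \<Rightarrow> 'r::ring_1" and q :: 'k +
  fixes m N :: nat and T :: "int \<Rightarrow> nat \<Rightarrow> nat \<Rightarrow> 'r"
  assumes prel: "i \<in> {1..N} \<Longrightarrow> j \<in> {1..N} \<Longrightarrow> k \<in> {1..N} \<Longrightarrow> l \<in> {1..N} \<Longrightarrow>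
    sc (rho q m a b i k * sg (parity m k * (parity m i + parity m j))) * (T a i j * T b k l) +
    sc (xi q a b i k * sg (parity m i * parity m j)) * (T a k j * T b i l) =
    sc (rho q m a b j l * sg (parity m l * (parity m i + parity m j))) * (T b k l * T a i j) +
    sc (xi q a b l j * sg (parity m i * parity m j)) * (T b k j * T a i l)"
begin

text \<open>The relation sandwiched between two copies of X, the inverse at the second argument. Its
  four products only permute the first indices i, k and the second indices j, l, so it restricts to
  the block on K.\<close>

lemma inverse_rel:
  assumes K: "finite K" "K \<subseteq> {1..N}" and X: "minv K (T b) X"
    and ix: "i \<in> K" "j \<in> K" "x \<in> K" "y \<in> K"
  shows "sc (rho q m a b i y * sg (parity m y * (parity m i + parity m j))) * (X x y * T a i j) +
    (if i = y then (\<Sum>c\<in>K. sc (xi q a b i c * sg (parity m i * parity m j)) * (X x c * T a c j)) else 0) =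
    sc (rho q m a b j x * sg (parity m x * (parity m i + parity m j))) * (T a i j * X x y) +
    (if j = x then (\<Sum>c\<in>K. sc (xi q a b c j * sg (parity m i * parity m j)) * (T a i c * X c y)) else 0)"
    (is "?A1 + ?A2 = ?B1 + ?B2")
proof -
  let ?s = "sg (parity m i * parity m j) :: 'k"
  let ?r1 = "\<lambda>k. rho q m a b i k * sg (parity m k * (parity m i + parity m j))"
  let ?r2 = "\<lambda>l. rho q m a b j l * sg (parity m l * (parity m i + parity m j))"
  note TX = minvD[OF X]
  have "(\<Sum>k\<in>K. \<Sum>l\<in>K. X x k * (sc (?r1 k) * (T a i j * T b k l) + sc (xi q a b i k * ?s) * (T a k j * T b i l)) * X l y)
      = (\<Sum>k\<in>K. \<Sum>l\<in>K. X x k * (sc (?r2 l) * (T b k l * T a i j) + sc (xi q a b l j * ?s) * (T b k j * T a i l)) * X l y)"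
    using K(2) ix by (intro sum.cong refl) (subst prel, auto)
  moreover have "(\<Sum>k\<in>K. \<Sum>l\<in>K. X x k * (sc (?r1 k) * (T a i j * T b k l) + sc (xi q a b i k * ?s) * (T a k j * T b i l)) * X l y) = ?A1 + ?A2"
  proof -
    have "(\<Sum>k\<in>K. \<Sum>l\<in>K. X x k * (sc (?r1 k) * (T a i j * T b k l) + sc (xi q a b i k * ?s) * (T a k j * T b i l)) * X l y)
       = (\<Sum>k\<in>K. sc (?r1 k) * (X x k * T a i j * (\<Sum>l\<in>K. T b k l * X l y))) +
         (\<Sum>k\<in>K. sc (xi q a b i k * ?s) * (X x k * T a k j * (\<Sum>l\<in>K. T b i l * X l y)))"
      by (simp add: sum_distrib_left sum.distrib distrib_left distrib_right mult.assoc sc_left)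
    also have "\<dots> = (\<Sum>k\<in>K. if k = y then sc (?r1 k) * (X x k * T a i j) else 0) +
         (\<Sum>k\<in>K. if i = y then sc (xi q a b i k * ?s) * (X x k * T a k j) else 0)"
      using ix by (intro arg_cong2[where f = "(+)"] sum.cong refl) (auto simp: TX)
    also have "\<dots> = ?A1 + ?A2"
      using ix K(1) by auto
    finally show ?thesis .
  qed
  moreover have "(\<Sum>k\<in>K. \<Sum>l\<in>K. X x k * (sc (?r2 l) * (T b k l * T a i j) + sc (xi q a b l j * ?s) * (T b k j * T a i l)) * X l y) = ?B1 + ?B2"
  proof -
    have "(\<Sum>k\<in>K. \<Sum>l\<in>K. X x k * (sc (?r2 l) * (T b k l * T a i j) + sc (xi q a b l j * ?s) * (T b k j * T a i l)) * X l y)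
       = (\<Sum>l\<in>K. \<Sum>k\<in>K. X x k * (sc (?r2 l) * (T b k l * T a i j) + sc (xi q a b l j * ?s) * (T b k j * T a i l)) * X l y)"
      by (rule sum.swap)
    also have "\<dots> = (\<Sum>l\<in>K. sc (?r2 l) * ((\<Sum>k\<in>K. X x k * T b k l) * (T a i j * X l y))) +
         (\<Sum>l\<in>K. sc (xi q a b l j * ?s) * ((\<Sum>k\<in>K. X x k * T b k j) * (T a i l * X l y)))"
      by (simp add: sum_distrib_left sum_distrib_right sum.distrib distrib_left distrib_right mult.assoc sc_left)
    also have "\<dots> = (\<Sum>l\<in>K. if l = x then sc (?r2 l) * (T a i j * X l y) else 0) +
         (\<Sum>l\<in>K. if j = x then sc (xi q a b l j * ?s) * (T a i l * X l y) else 0)"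
      using ix by (intro arg_cong2[where f = "(+)"] sum.cong refl) (auto simp: TX)
    also have "\<dots> = ?B1 + ?B2"
      using ix K(1) by auto
    finally show ?thesis .
  qed
  ultimately show ?thesis by simp
qed

text \<open>In \<open>inverse_rel\<close> with y = x the exchange sums are subject to i = x and j =
  x, which fail here, and the two diagonal coefficients agree. Up to sign they are q^a - q^b, which
  is why equal arguments are excluded.\<close>

lemma commute_inverse_neq:
  assumes K: "finite K" "K \<subseteq> {1..N}" and X: "minv K (T b) X"
    and ix: "i \<in> K - {x}" "j \<in> K - {x}" "x \<in> K" and ab: "a \<noteq> b"
  shows "X x x * T a i j = T a i j * X x x"
proof -
  have "sc (rho q m a b i x * sg (parity m x * (parity m i + parity m j))) * (X x x * T a i j) =
    sc (rho q m a b i x * sg (parity m x * (parity m i + parity m j))) * (T a i j * X x x)"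
    using inverse_rel[OF K X, of i j x x a] ix by (auto simp: rho_def)
  then show ?thesis
    by (rule sc_cancel) (use ix ab q_powi_inj in \<open>auto simp: rho_def\<close>)
qed

text \<open>\<open>inverse_rel\<close> for Y sandwiched between two copies of X, the inverse at the
  first argument. The outcome has the shape of the original relation with row and column
  coefficients exchanged, so the entries of the inverse can be treated like those of T.\<close>

lemma inverse_prel:
  assumes K: "finite K" "K \<subseteq> {1..N}" and X: "minv K (T a) X" and Y: "minv K (T b) Y"
    and ix: "i \<in> K" "j \<in> K" "k \<in> K" "l \<in> K"
  shows "sc (rho q m a b j l * sg (parity m k * (parity m i + parity m j))) * (X i j * Y k l) +
    sc (xi q a b l j * sg (parity m l * parity m j + parity m k * parity m i + parity m k * parity m l)) * (X i l * Y k j) =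
    sc (rho q m a b i k * sg (parity m l * (parity m i + parity m j))) * (Y k l * X i j) +
    sc (xi q a b i k * sg (parity m i * parity m k + parity m l * parity m k + parity m l * parity m j)) * (Y i l * X k j)"
    (is "?A1 + ?A2 = ?B1 + ?B2")
proof -
  note TX = minvD[OF X]
  have fin: "finite K" by fact
  \<comment> \<open>The signs depend on the summation indices. This weight makes them independent of
    j' in the terms where T X is contracted over j', and of i' where X T is contracted over i', so
    that the contractions collapse.\<close>
  let ?w = "\<lambda>i' j'. sg (parity m k * (parity m i + parity m i') + parity m l * (parity m j' + parity m j)) :: 'k"
  let ?A = "\<lambda>i' j'. sc (rho q m a b i' l * sg (parity m l * (parity m i' + parity m j'))) * (Y k l * T a i' j') +
    (if i' = l then (\<Sum>c\<in>K. sc (xi q a b i' c * sg (parity m i' * parity m j')) * (Y k c * T a c j')) else 0)"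
  let ?B = "\<lambda>i' j'. sc (rho q m a b j' k * sg (parity m k * (parity m i' + parity m j'))) * (T a i' j' * Y k l) +
    (if j' = k then (\<Sum>c\<in>K. sc (xi q a b c j' * sg (parity m i' * parity m j')) * (T a i' c * Y c l)) else 0)"
  have eq: "(\<Sum>i'\<in>K. \<Sum>j'\<in>K. sc (?w i' j') * (X i i' * ?A i' j' * X j' j)) =
    (\<Sum>i'\<in>K. \<Sum>j'\<in>K. sc (?w i' j') * (X i i' * ?B i' j' * X j' j))"
    by (intro sum.cong refl) (subst inverse_rel[OF K Y], use ix in auto)
  have sgn1: "?w i' j' * (r * sg (parity m l * (parity m i' + parity m j'))) =
      r * sg (parity m k * (parity m i + parity m i') + parity m l * (parity m i' + parity m j))" for i' j' and r :: 'k
    by (rule parity_cases[of m i']; rule parity_cases[of m j']; rule parity_cases[of m l])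
       (simp_all add: power_add)
  have sgn2: "?w i' j' * (r * sg (parity m k * (parity m i' + parity m j'))) =
      r * sg (parity m k * (parity m i + parity m j') + parity m l * (parity m j' + parity m j))" for i' j' and r :: 'k
    by (rule parity_cases[of m i']; rule parity_cases[of m j']; rule parity_cases[of m k])
       (simp_all add: power_add)
  have sgn3: "?w l j' * (r * sg (parity m l * parity m j')) =
      r * sg (parity m k * (parity m i + parity m l) + parity m l * parity m j)" for j' and r :: 'k
    by (rule parity_cases[of m l]; rule parity_cases[of m j']; simp add: power_add)
  have sgn4: "?w i' k * (r * sg (parity m i' * parity m k)) =
      r * sg (parity m k * parity m i + parity m l * (parity m k + parity m j))" for i' and r :: 'k
    by (rule parity_cases[of m k]; rule parity_cases[of m i']; simp add: power_add)
  have "(\<Sum>i'\<in>K. \<Sum>j'\<in>K. sc (?w i' j') * (X i i' * ?A i' j' * X j' j)) =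
      (\<Sum>i'\<in>K. \<Sum>j'\<in>K. sc (?w i' j') * (X i i' * (sc (rho q m a b i' l * sg (parity m l * (parity m i' + parity m j'))) * (Y k l * T a i' j')) * X j' j)) +
      (\<Sum>i'\<in>K. \<Sum>j'\<in>K. if i' = l then \<Sum>c\<in>K. sc (?w i' j') * (X i i' * (sc (xi q a b i' c * sg (parity m i' * parity m j')) * (Y k c * T a c j')) * X j' j) else 0)"
    unfolding sum.distrib[symmetric]
  proof (intro sum.cong refl)
    fix i' j' assume "i' \<in> K" "j' \<in> K"
    show "sc (?w i' j') * (X i i' * ?A i' j' * X j' j) = sc (?w i' j') * (X i i' * (sc (rho q m a b i' l * sg (parity m l * (parity m i' + parity m j'))) * (Y k l * T a i' j')) * X j' j) + (if i' = l then \<Sum>c\<in>K. sc (?w i' j') * (X i i' * (sc (xi q a b i' c * sg (parity m i' * parity m j')) * (Y k c * T a c j')) * X j' j) else 0)" 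
      by (cases "i' = l") (simp_all only: simp_thms if_True if_False distrib_left distrib_right sum_distrib_left sum_distrib_right mult_zero_left mult_zero_right add_0_right)
  qed
  also have "\<dots> = (\<Sum>i'\<in>K. sc (rho q m a b i' l * sg (parity m k * (parity m i + parity m i') + parity m l * (parity m i' + parity m j)))
        * (X i i' * (Y k l * (\<Sum>j'\<in>K. T a i' j' * X j' j)))) +
      (\<Sum>c\<in>K. sc (xi q a b l c * sg (parity m k * (parity m i + parity m l) + parity m l * parity m j)) * (X i l * (Y k c * (\<Sum>j'\<in>K. T a c j' * X j' j))))"
  proof (rule arg_cong2[where f = "(+)"])
    show "(\<Sum>i'\<in>K. \<Sum>j'\<in>K. sc (?w i' j') * (X i i' * (sc (rho q m a b i' l * sg (parity m l * (parity m i' + parity m j'))) * (Y k l * T a i' j')) * X j' j)) =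
      (\<Sum>i'\<in>K. sc (rho q m a b i' l * sg (parity m k * (parity m i + parity m i') + parity m l * (parity m i' + parity m j)))
        * (X i i' * (Y k l * (\<Sum>j'\<in>K. T a i' j' * X j' j))))"
      unfolding sum_distrib_left by (intro sum.cong refl) (simp only: sc_gather sgn1)
    have "(\<Sum>i'\<in>K. \<Sum>j'\<in>K. if i' = l then \<Sum>c\<in>K. sc (?w i' j') * (X i i' * (sc (xi q a b i' c * sg (parity m i' * parity m j')) * (Y k c * T a c j')) * X j' j) else 0)
      = (\<Sum>i'\<in>K. if i' = l then \<Sum>j'\<in>K. \<Sum>c\<in>K. sc (?w l j') * (X i l * (sc (xi q a b l c * sg (parity m l * parity m j')) * (Y k c * T a c j')) * X j' j) else 0)"
      by (intro sum.cong refl) auto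
    also have "\<dots> = (\<Sum>j'\<in>K. \<Sum>c\<in>K. sc (?w l j') * (X i l * (sc (xi q a b l c * sg (parity m l * parity m j')) * (Y k c * T a c j')) * X j' j))"
      using ix fin by simp
    also have "\<dots> = (\<Sum>c\<in>K. \<Sum>j'\<in>K. sc (xi q a b l c * sg (parity m k * (parity m i + parity m l) + parity m l * parity m j)) * (X i l * (Y k c * (T a c j' * X j' j))))"
      by (subst sum.swap, intro sum.cong refl) (simp only: sc_gather sgn3)
    finally show "(\<Sum>i'\<in>K. \<Sum>j'\<in>K. if i' = l then \<Sum>c\<in>K. sc (?w i' j') * (X i i' * (sc (xi q a b i' c * sg (parity m i' * parity m j')) * (Y k c * T a c j')) * X j' j) else 0) =
      (\<Sum>c\<in>K. sc (xi q a b l c * sg (parity m k * (parity m i + parity m l) + parity m l * parity m j)) * (X i l * (Y k c * (\<Sum>j'\<in>K. T a c j' * X j' j))))"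
      by (simp add: sum_distrib_left)
  qed
  also have "\<dots> = (\<Sum>i'\<in>K. if i' = j then sc (rho q m a b i' l * sg (parity m k * (parity m i + parity m i') + parity m l * (parity m i' + parity m j)))
        * (X i i' * Y k l) else 0) +
      (\<Sum>c\<in>K. if c = j then sc (xi q a b l c * sg (parity m k * (parity m i + parity m l) + parity m l * parity m j)) * (X i l * Y k c) else 0)"
    using ix by (intro arg_cong2[where f = "(+)"] sum.cong refl) (auto simp: TX)
  also have "\<dots> = ?A1 + ?A2"
  proof -
    have "(sg (parity m k * (parity m i + parity m j) + parity m l * (parity m j + parity m j)) :: 'k) = sg (parity m k * (parity m i + parity m j))"
      by (rule parity_cases[of m j]; simp add: power_add power_mult)
    moreover have "(sg (parity m k * (parity m i + parity m l) + parity m l * parity m j) :: 'k) = sg (parity m l * parity m j + parity m k * parity m i + parity m k * parity m l)"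
      by (simp add: algebra_simps)
    ultimately show ?thesis using ix fin by simp
  qed
  finally have L: "(\<Sum>i'\<in>K. \<Sum>j'\<in>K. sc (?w i' j') * (X i i' * ?A i' j' * X j' j)) = ?A1 + ?A2" .
  have "(\<Sum>i'\<in>K. \<Sum>j'\<in>K. sc (?w i' j') * (X i i' * ?B i' j' * X j' j)) =
      (\<Sum>i'\<in>K. \<Sum>j'\<in>K. sc (?w i' j') * (X i i' * (sc (rho q m a b j' k * sg (parity m k * (parity m i' + parity m j'))) * (T a i' j' * Y k l)) * X j' j)) +
      (\<Sum>i'\<in>K. \<Sum>j'\<in>K. if j' = k then \<Sum>c\<in>K. sc (?w i' j') * (X i i' * (sc (xi q a b c j' * sg (parity m i' * parity m j')) * (T a i' c * Y c l)) * X j' j) else 0)"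
    unfolding sum.distrib[symmetric]
  proof (intro sum.cong refl)
    fix i' j' assume "i' \<in> K" "j' \<in> K"
    show "sc (?w i' j') * (X i i' * ?B i' j' * X j' j) = sc (?w i' j') * (X i i' * (sc (rho q m a b j' k * sg (parity m k * (parity m i' + parity m j'))) * (T a i' j' * Y k l)) * X j' j) + (if j' = k then \<Sum>c\<in>K. sc (?w i' j') * (X i i' * (sc (xi q a b c j' * sg (parity m i' * parity m j')) * (T a i' c * Y c l)) * X j' j) else 0)" 
      by (cases "j' = k") (simp_all only: simp_thms if_True if_False distrib_left distrib_right sum_distrib_left sum_distrib_right mult_zero_left mult_zero_right add_0_right)
  qed
  also have "\<dots> = (\<Sum>j'\<in>K. sc (rho q m a b j' k * sg (parity m k * (parity m i + parity m j') + parity m l * (parity m j' + parity m j)))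
        * ((\<Sum>i'\<in>K. X i i' * T a i' j') * (Y k l * X j' j))) +
      (\<Sum>c\<in>K. sc (xi q a b c k * sg (parity m k * parity m i + parity m l * (parity m k + parity m j))) * ((\<Sum>i'\<in>K. X i i' * T a i' c) * (Y c l * X k j)))"
  proof (rule arg_cong2[where f = "(+)"])
    show "(\<Sum>i'\<in>K. \<Sum>j'\<in>K. sc (?w i' j') * (X i i' * (sc (rho q m a b j' k * sg (parity m k * (parity m i' + parity m j'))) * (T a i' j' * Y k l)) * X j' j)) =
      (\<Sum>j'\<in>K. sc (rho q m a b j' k * sg (parity m k * (parity m i + parity m j') + parity m l * (parity m j' + parity m j)))
        * ((\<Sum>i'\<in>K. X i i' * T a i' j') * (Y k l * X j' j)))"
      unfolding sum_distrib_left sum_distrib_right by (subst sum.swap, intro sum.cong refl) (simp only: sc_gather2 sgn2)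
    have "(\<Sum>i'\<in>K. \<Sum>j'\<in>K. if j' = k then \<Sum>c\<in>K. sc (?w i' j') * (X i i' * (sc (xi q a b c j' * sg (parity m i' * parity m j')) * (T a i' c * Y c l)) * X j' j) else 0)
      = (\<Sum>i'\<in>K. \<Sum>j'\<in>K. if j' = k then \<Sum>c\<in>K. sc (?w i' k) * (X i i' * (sc (xi q a b c k * sg (parity m i' * parity m k)) * (T a i' c * Y c l)) * X k j) else 0)"
      by (intro sum.cong refl) auto
    also have "\<dots> = (\<Sum>i'\<in>K. \<Sum>c\<in>K. sc (?w i' k) * (X i i' * (sc (xi q a b c k * sg (parity m i' * parity m k)) * (T a i' c * Y c l)) * X k j))"
      using ix fin by simp
    also have "\<dots> = (\<Sum>c\<in>K. \<Sum>i'\<in>K. sc (xi q a b c k * sg (parity m k * parity m i + parity m l * (parity m k + parity m j))) * (X i i' * T a i' c * (Y c l * X k j)))"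
      by (subst sum.swap, intro sum.cong refl) (simp only: sc_gather2 sgn4)
    finally show "(\<Sum>i'\<in>K. \<Sum>j'\<in>K. if j' = k then \<Sum>c\<in>K. sc (?w i' j') * (X i i' * (sc (xi q a b c j' * sg (parity m i' * parity m j')) * (T a i' c * Y c l)) * X j' j) else 0) =
      (\<Sum>c\<in>K. sc (xi q a b c k * sg (parity m k * parity m i + parity m l * (parity m k + parity m j))) * ((\<Sum>i'\<in>K. X i i' * T a i' c) * (Y c l * X k j)))"
      by (simp add: sum_distrib_left sum_distrib_right)
  qed
  also have "\<dots> = (\<Sum>j'\<in>K. if j' = i then sc (rho q m a b j' k * sg (parity m k * (parity m i + parity m j') + parity m l * (parity m j' + parity m j)))
        * (Y k l * X j' j) else 0) +
      (\<Sum>c\<in>K. if c = i then sc (xi q a b c k * sg (parity m k * parity m i + parity m l * (parity m k + parity m j))) * (Y c l * X k j) else 0)"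
    using ix by (intro arg_cong2[where f = "(+)"] sum.cong refl) (auto simp: TX)
  also have "\<dots> = ?B1 + ?B2"
  proof -
    have "(sg (parity m k * (parity m i + parity m i) + parity m l * (parity m i + parity m j)) :: 'k) = sg (parity m l * (parity m i + parity m j))"
      by (rule parity_cases[of m i]; simp add: power_add power_mult)
    moreover have "(sg (parity m k * parity m i + parity m l * (parity m k + parity m j)) :: 'k) = sg (parity m i * parity m k + parity m l * parity m k + parity m l * parity m j)"
      by (simp add: algebra_simps)
    ultimately show ?thesis using ix fin by simp
  qed
  finally have R: "(\<Sum>i'\<in>K. \<Sum>j'\<in>K. sc (?w i' j') * (X i i' * ?B i' j' * X j' j)) = ?B1 + ?B2" .
  show ?thesis using eq unfolding L R .
qed

lemma q2: "q * q \<noteq> 1"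
  using q_powi[of 2] by (auto simp: power2_eq_square)

text \<open>At w = z q_x^2 the coefficients \<open>rho x x\<close> and \<open>rho y y\<close>
  vanish. Both sides then equal the quantum minor
  \<open>X x x * Y y y - sc Q * (X x y * Y y x)\<close>, expanded once with the inverse of
  \<open>X y y\<close> and once with that of \<open>X x x\<close>. The two indices may also both be
  odd.\<close>

lemma swap_even_even:
  assumes K: "finite K" "K \<subseteq> {1..N}" and xy: "x \<in> K" "y \<in> K" "x < y" "parity m x = parity m y"
    and X: "minv K (T a) X" and Y: "minv K (T (a + 2 * gr m x)) Y"
    and d: "X y y * d = 1" and e: "X x x * e = 1"
  shows "Y y y * (X x x - X x y * d * X y x) = Y x x * (X y y - X y x * e * X x y)"
proof -
  define b where "b = a + 2 * gr m x"
  define Q where "Q = q powi gr m x"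
  define z where "z = q powi a"
  have z: "z \<noteq> 0" and Q: "Q \<noteq> 0" by (simp_all add: z_def Q_def)
  have zb: "q powi b = z * Q * Q"
  proof -
    have "b = a + gr m x + gr m x" by (simp add: b_def)
    then show ?thesis by (simp only: z_def Q_def power_int_add q_nz simp_thms)
  qed
  have Qy: "q powi gr m y = Q"
    using xy by (simp add: Q_def gr_def)
  have Q2: "Q * Q \<noteq> 1"
    using q2 by (rule_tac parity_cases[of m x]) (auto simp: Q_def gr_def power_int_minus field_simps)
  have Qx: "sg (parity m x * parity m x) * (q - 1 / q) = Q - 1 / Q"
    by (rule parity_cases[of m x]) (auto simp: Q_def gr_def power_int_minus field_simps)
  have sgx: "(sg (parity m x * (parity m x + parity m x)) :: 'k) = 1"
    by (rule parity_cases[of m x]) auto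
  have sgx3: "(sg (parity m x * parity m x + parity m x * parity m x + parity m x * parity m x) :: 'k) = sg (parity m x * parity m x)"
    by (rule parity_cases[of m x]) auto
  note Y' = Y[folded b_def]
  note P = inverse_prel[OF K X Y']
  note sc_P = sc_scale[OF P, where t = "1 / (z * (1 - Q * Q))"]
  have xi1: "xi q a b x y * sg (parity m x * parity m x) = z * (Q - 1 / Q)"
  proof -
    have "xi q a b x y * sg (parity m x * parity m x) = z * (sg (parity m x * parity m x) * (q - 1 / q))"
      using xy(3) by (simp add: xi_def z_def)
    then show ?thesis unfolding Qx .
  qed
  have xi2: "xi q a b y x * sg (parity m x * parity m x) = z * Q * Q * (Q - 1 / Q)"
  proof -
    have "xi q a b y x * sg (parity m x * parity m x) = z * Q * Q * (sg (parity m x * parity m x) * (q - 1 / q))"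
      using xy(3) by (simp add: xi_def zb)
    then show ?thesis unfolding Qx .
  qed
  have r0: "rho q m a b x x = 0" "rho q m a b y y = 0"
    using Q by (simp_all add: rho_def zb Qy z_def Q_def)
  have r1: "rho q m a b x y = z * (1 - Q * Q)" "rho q m a b y x = z * (1 - Q * Q)"
    using xy(3) by (simp_all add: rho_def zb z_def[symmetric] right_diff_distrib)
  have f: "1 / (z * (1 - Q * Q)) * (z * (1 - Q * Q)) = 1"
    "1 / (z * (1 - Q * Q)) * (z * (Q - 1 / Q)) = - 1 / Q"
    "1 / (z * (1 - Q * Q)) * (z * Q * Q * (Q - 1 / Q)) = - Q"
    using z Q Q2 by (simp_all add: field_simps)
  have xi0: "xi q a b x x = 0" "xi q a b y y = 0" by (simp_all add: xi_def)
  have S1: "sc 0 * (X x y * Y y y) + sc 0 * (X x y * Y y y) = sc 1 * (Y y y * X x y) + sc (- 1 / Q) * (Y x y * X y y)"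
    by (rule sc_P) (use xy(1,2) in \<open>simp_all only: xy(4)[symmetric] sgx sgx3 xi1 xi2 r0 r1 f xi0 mult_zero_left mult_zero_right mult_1_right\<close>)
  have S2: "sc 0 * (X y x * Y x x) + sc 0 * (X y x * Y x x) = sc 1 * (Y x x * X y x) + sc (- Q) * (Y y x * X x x)"
    by (rule sc_P) (use xy(1,2) in \<open>simp_all only: xy(4)[symmetric] sgx sgx3 xi1 xi2 r0 r1 f xi0 mult_zero_left mult_zero_right mult_1_right\<close>)
  have S3: "sc 1 * (X x x * Y y y) + sc (- Q) * (X x y * Y y x) = sc 1 * (Y y y * X x x) + sc (- 1 / Q) * (Y x y * X y x)"
    by (rule sc_P) (use xy(1,2) in \<open>simp_all only: xy(4)[symmetric] sgx sgx3 xi1 xi2 r0 r1 f xi0 mult_zero_left mult_zero_right mult_1_right\<close>)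
  have S4: "sc 1 * (X x y * Y y x) + sc (- 1 / Q) * (X x x * Y y y) = sc 1 * (Y y x * X x y) + sc (- 1 / Q) * (Y x x * X y y)"
    by (rule sc_P) (use xy(1,2) in \<open>simp_all only: xy(4)[symmetric] sgx sgx3 xi1 xi2 r0 r1 f xi0 mult_zero_left mult_zero_right mult_1_right\<close>)
  have S5: "sc (- Q) * (X x y * Y y x) + sc 1 * (X x x * Y y y) = sc (- Q) * (Y y x * X x y) + sc 1 * (Y x x * X y y)"
    by (rule sc_scale[OF S4, where t = "- Q"]) (use Q in auto)
  have m1: "Y y y * X x y * d = sc (1 / Q) * Y x y"
  proof -
    have "Y y y * X x y = sc (1 / Q) * (Y x y * X y y)" using S1 by (simp add: sc_minus)
    then show ?thesis using d by (simp add: mult.assoc)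
  qed
  have m2: "Y x x * X y x * e = sc Q * Y y x"
  proof -
    have "Y x x * X y x = sc Q * (Y y x * X x x)" using S2 by (simp add: sc_minus)
    then show ?thesis using e by (simp add: mult.assoc)
  qed
  have S3': "X x x * Y y y - sc Q * (X x y * Y y x) = Y y y * X x x - sc (1 / Q) * (Y x y * X y x)"
    using S3 by (simp add: sc_minus)
  have S5': "X x x * Y y y - sc Q * (X x y * Y y x) = Y x x * X y y - sc Q * (Y y x * X x y)"
    using S5 by (simp add: sc_minus)
  have "Y y y * (X x x - X x y * d * X y x) = Y y y * X x x - Y y y * X x y * d * X y x"
    by (simp add: right_diff_distrib mult.assoc)
  also have "\<dots> = Y y y * X x x - sc (1 / Q) * (Y x y * X y x)"
    unfolding m1 by (simp add: mult.assoc)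
  also note S3'[symmetric]
  also note S5'
  also have "Y x x * X y y - sc Q * (Y y x * X x y) = Y x x * X y y - Y x x * X y x * e * X x y"
    unfolding m2 by (simp add: mult.assoc)
  finally show ?thesis
    by (simp add: right_diff_distrib mult.assoc)
qed

text \<open>For different parities the right point is w = z q^-2, where \<open>rho y y\<close>
  vanishes and \<open>rho x x\<close> does not. The right-hand side multiplies out to four terms:
  the last contains \<open>X y x * Y y x\<close>, which is zero, and the mixed ones lose their
  inverses by \<open>ac\<close> and \<open>cd\<close>; what remains is a relation for
  \<open>X y y * Y x x\<close>.\<close>

lemma swap_even_odd:
  assumes K: "finite K" "K \<subseteq> {1..N}" and xy: "x \<in> K" "y \<in> K" "x < y" "parity m x = 0" "parity m y = 1"
    and X: "minv K (T a) X" and Y: "minv K (T (a - 2)) Y"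
    and d: "d * X y y = 1" and e: "Y x x * e = 1"
  shows "X y y * Y x x = (X x x - X x y * d * X y x) * (Y y y - Y y x * e * Y x y)"
proof -
  define b where "b = a - 2"
  define z where "z = q powi a"
  have z: "z \<noteq> 0" by (simp_all add: z_def)
  have zb: "q powi b = z / (q * q)"
    by (simp add: b_def z_def power_int_diff power2_eq_square)
  note P = inverse_prel[OF K X Y[folded b_def]]
  define t where "t = 1 / (z * (1 - 1 / (q * q)))"
  have nz: "1 - 1 / (q * q) \<noteq> 0" using q2 by auto
  \<comment> \<open>Here \<open>rho x x\<close> is z (q - q^-3), which is nonzero because q^4
    \<noteq> 1.\<close>
  have q4: "q * q * q * q \<noteq> 1"
    using q_powi[of 4] by (auto simp: power4_eq_xxxx)
  note sc_P = sc_scale[OF P, where t = t]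
  define r where "r = t * rho q m a b x x"
  have r: "r \<noteq> 0" using z nz q4
    by (auto simp: r_def t_def rho_def gr_def xy zb z_def[symmetric] field_simps)
  have ryy: "rho q m a b y y = 0"
    by (simp add: rho_def gr_def xy zb z_def[symmetric] power_int_minus field_simps)
  have rxy: "t * rho q m a b x y = 1" "t * rho q m a b y x = 1"
    using xy z nz by (simp_all add: t_def rho_def zb z_def[symmetric] field_simps)
  have x1: "t * xi q a b x y = q" "t * xi q a b y x = 1 / q"
    using xy z nz q2 by (simp_all add: t_def xi_def zb z_def[symmetric] field_simps)
  have x0: "xi q a b x x = 0" "xi q a b y y = 0" by (simp_all add: xi_def)
  note S = xy r_def[symmetric] ryy rxy x1 x0 mult.assoc[symmetric]
  have R1: "sc (- r) * (X y x * Y y x) + sc 0 * (X y x * Y y x) = sc 0 * (Y y x * X y x) + sc 0 * (Y y x * X y x)"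
    by (rule sc_P) (use xy in \<open>simp_all add: S\<close>)
  have R2: "sc r * (X x x * Y y x) + sc 0 * (X x x * Y y x) = sc 1 * (Y y x * X x x) + sc q * (Y x x * X y x)"
    by (rule sc_P) (use xy in \<open>simp_all add: S\<close>)
  have R3: "sc r * (X y x * Y x x) + sc 0 * (X y x * Y x x) = sc 1 * (Y x x * X y x) + sc (1 / q) * (Y y x * X x x)"
    by (rule sc_P) (use xy in \<open>simp_all add: S\<close>)
  have R4: "sc (- 1) * (X y x * Y y y) + sc (1 / q) * (X y y * Y y x) = sc 0 * (Y y y * X y x) + sc 0 * (Y y y * X y x)"
    by (rule sc_P) (use xy in \<open>simp_all add: S\<close>)
  have R5: "sc 1 * (X x x * Y y y) + sc (- 1 / q) * (X x y * Y y x) = sc 1 * (Y y y * X x x) + sc (- q) * (Y x y * X y x)"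
    by (rule sc_P) (use xy in \<open>simp_all add: S\<close>)
  have R6: "sc 1 * (X y y * Y x x) + sc q * (X y x * Y x y) = sc 1 * (Y x x * X y y) + sc (1 / q) * (Y y x * X x y)"
    by (rule sc_P) (use xy in \<open>simp_all add: S\<close>)
  have R7: "sc (- 1) * (X x y * Y y x) + sc q * (X x x * Y y y) = sc 1 * (Y y x * X x y) + sc q * (Y x x * X y y)"
    by (rule sc_P) (use xy in \<open>simp_all add: S\<close>)
  have R8: "sc (- 1 / q) * (X x y * Y y x) + sc 1 * (X x x * Y y y) = sc (1 / q) * (Y y x * X x y) + sc 1 * (Y x x * X y y)"
    by (rule sc_scale[OF R7, where t = "1 / q"]) auto
  have R3': "sc (q * r) * (X y x * Y x x) + sc 0 * (X y x * Y x x) = sc q * (Y x x * X y x) + sc 1 * (Y y x * X x x)"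
    by (rule sc_scale[OF R3, where t = q]) auto
  have cc: "X y x * Y y x = 0"
    by (rule sc_cancel[of r]) (use R1 r in \<open>simp_all add: sc_minus\<close>)
  have ac: "X x x * Y y x = sc q * (X y x * Y x x)"
  proof (rule sc_cancel[OF _ r])
    have "sc r * (X x x * Y y x) = sc (q * r) * (X y x * Y x x)"
      using R2 R3' by (simp add: add.commute)
    then show "sc r * (X x x * Y y x) = sc r * (sc q * (X y x * Y x x))"
      by (simp add: sc_mult_assoc mult.commute)
  qed
  have cd: "X y x * Y y y = sc (1 / q) * (X y y * Y y x)"
    using R4 by (simp add: sc_minus)
  have h1: "X x x * (Y y x * e * Y x y) = sc q * (X y x * Y x y)"
  proof -
    have "X x x * (Y y x * e * Y x y) = sc q * (X y x * (Y x x * e) * Y x y)"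
      by (simp add: ac mult.assoc[symmetric])
    then show ?thesis by (simp add: e)
  qed
  have h2: "X x y * d * X y x * Y y y = sc (1 / q) * (X x y * Y y x)"
  proof -
    have "X x y * d * X y x * Y y y = X x y * d * (sc (1 / q) * (X y y * Y y x))"
      by (simp add: mult.assoc cd)
    also have "\<dots> = sc (1 / q) * (X x y * (d * X y y) * Y y x)"
      by (simp only: sc_left mult.assoc)
    finally show ?thesis by (simp add: d)
  qed
  have h3: "X x y * d * X y x * (Y y x * e * Y x y) = 0"
  proof -
    have "X x y * d * X y x * (Y y x * e * Y x y) = X x y * d * (X y x * Y y x) * e * Y x y"
      by (simp add: mult.assoc)
    then show ?thesis by (simp add: cc)
  qed
  have "(X x x - X x y * d * X y x) * (Y y y - Y y x * e * Y x y) =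
     X x x * Y y y - X x x * (Y y x * e * Y x y) - X x y * d * X y x * Y y y + X x y * d * X y x * (Y y x * e * Y x y)"
    by (simp add: left_diff_distrib right_diff_distrib)
  also have "\<dots> = X x x * Y y y - sc q * (X y x * Y x y) - sc (1 / q) * (X x y * Y y x)"
    unfolding h1 h2 h3 by simp
  also have "\<dots> = X y y * Y x x"
    using R6 R8 by (simp add: sc_minus algebra_simps)
  finally show ?thesis by simp
qed

end

text \<open>Passes from an identity between entries of inverse matrices to one between
  quasideterminants, using each inverse on one side.\<close>

lemma inverse_products:
  fixes d :: "'r::ring_1"
  assumes "D * F = A * G" "d * D = 1" "f * F = 1" "G * g = 1" "A * a = 1"
  shows "f * d = g * a"
proof -
  have "f * d = f * d * (A * (G * g) * a)"
    by (simp add: assms)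
  also have "\<dots> = f * d * (A * G) * (g * a)"
    by (simp only: mult.assoc)
  also have "\<dots> = f * (d * D) * F * (g * a)"
    by (simp only: assms(1)[symmetric] mult.assoc)
  also have "\<dots> = g * a"
    by (simp add: assms)
  finally show ?thesis .
qed

lemma commute_mult:
  fixes y :: "'r::ring_1"
  shows "y * u = u * y \<Longrightarrow> y * v = v * y \<Longrightarrow> y * (u * v) = u * v * y"
  by (metis mult.assoc)

lemma commute_prod_list:
  fixes y :: "'r::ring_1"
  shows "(\<And>u. u \<in> set us \<Longrightarrow> y * u = u * y) \<Longrightarrow> y * prod_list us = prod_list us * y"
  by (induction us) (auto intro: commute_mult simp del: mult.assoc)

text \<open>The superdimension of the interval: the number of its even indices minus the number of
  its odd ones.\<close>

definition hh :: "nat \<Rightarrow> nat \<Rightarrow> nat \<Rightarrow> int" where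
  "hh m i j = (\<Sum>t = i..j. gr m t)"

lemma hh_snoc: "1 \<le> i \<Longrightarrow> i \<le> j \<Longrightarrow> hh m i j = hh m i (j - 1) + gr m j"
  unfolding hh_def by (cases j) (auto simp: sum.cl_ivl_Suc)

lemma hh_Cons: "i \<le> j \<Longrightarrow> hh m i j = gr m i + hh m (Suc i) j"
  unfolding hh_def by (rule sum.atLeast_Suc_atMost)

locale rll_inv = rll sc q m N T for sc :: "'k::field \<Rightarrow> 'r::ring_1" and q m N T +
  fixes Ti :: "nat \<Rightarrow> nat \<Rightarrow> int \<Rightarrow> nat \<Rightarrow> nat \<Rightarrow> 'r"
  assumes Ti: "1 \<le> i \<Longrightarrow> j \<le> N \<Longrightarrow> minv {i..j} (T a) (Ti i j a)"
begin

definition dsch :: "nat \<Rightarrow> nat \<Rightarrow> int \<Rightarrow> nat \<Rightarrow> 'r" where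
  "dsch i j a x = schur {i..j} (T a) (Ti i j a) x x"

text \<open>The Schur complement of the other indices is the quasideterminant of the last (\<open>up\<close>) or
  first (\<open>dn\<close>) index of an interval; it is inverted at odd indices, as in a Berezinian. With
  \<open>i = 1\<close> and \<open>j = m + n\<close>, \<open>ber i j e\<close> is the quantum Berezinian at \<open>z q\<^sup>e\<close>.\<close>

definition up :: "nat \<Rightarrow> nat \<Rightarrow> int \<Rightarrow> 'r" where
  "up i j a = (if parity m j = 0 then dsch i (j - 1) a j else Ti i j a j j)"

definition dn :: "nat \<Rightarrow> nat \<Rightarrow> int \<Rightarrow> 'r" where
  "dn i j a = (if parity m i = 0 then dsch (Suc i) j a i else Ti i j a i i)"

definition up_inv :: "nat \<Rightarrow> nat \<Rightarrow> int \<Rightarrow> 'r" where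
  "up_inv i j a = (if parity m j = 0 then Ti i j a j j else dsch i (j - 1) a j)"

definition dn_inv :: "nat \<Rightarrow> nat \<Rightarrow> int \<Rightarrow> 'r" where
  "dn_inv i j a = (if parity m i = 0 then Ti i j a i i else dsch (Suc i) j a i)"

definition ber :: "nat \<Rightarrow> nat \<Rightarrow> int \<Rightarrow> 'r" where
  "ber i j e = prod_list (map (\<lambda>t. up i t (e + 2 * hh m i (t - 1) - 2 * int (parity m t))) [i..<Suc j])"

lemma dsch_up:
  assumes "1 \<le> i" "i \<le> j" "j \<le> N"
  shows "Ti i j a j j * dsch i (j - 1) a j = 1" "dsch i (j - 1) a j * Ti i j a j j = 1"
proof -
  have eq: "insert j {i..j - 1} = {i..j}" and nin: "j \<notin> {i..j - 1}"
    using assms by auto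
  show "Ti i j a j j * dsch i (j - 1) a j = 1" "dsch i (j - 1) a j * Ti i j a j j = 1"
    unfolding dsch_def using schur_unit[OF _ nin, of "T a" "Ti i j a" "Ti i (j - 1) a"] Ti assms
    unfolding eq by auto
qed

lemma dsch_dn:
  assumes "1 \<le> i" "i \<le> j" "j \<le> N"
  shows "Ti i j a i i * dsch (Suc i) j a i = 1" "dsch (Suc i) j a i * Ti i j a i i = 1"
proof -
  have eq: "insert i {Suc i..j} = {i..j}" and nin: "i \<notin> {Suc i..j}"
    using assms by auto
  show "Ti i j a i i * dsch (Suc i) j a i = 1" "dsch (Suc i) j a i * Ti i j a i i = 1"
    unfolding dsch_def using schur_unit[OF _ nin, of "T a" "Ti i j a" "Ti (Suc i) j a"] Ti assms
    unfolding eq by auto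
qed

lemma up_inv: "1 \<le> i \<Longrightarrow> i \<le> j \<Longrightarrow> j \<le> N \<Longrightarrow> up i j a * up_inv i j a = 1"
  "1 \<le> i \<Longrightarrow> i \<le> j \<Longrightarrow> j \<le> N \<Longrightarrow> up_inv i j a * up i j a = 1"
  using dsch_up[of i j a] by (simp_all add: up_def up_inv_def)

lemma dn_inv: "1 \<le> i \<Longrightarrow> i \<le> j \<Longrightarrow> j \<le> N \<Longrightarrow> dn i j a * dn_inv i j a = 1"
  "1 \<le> i \<Longrightarrow> i \<le> j \<Longrightarrow> j \<le> N \<Longrightarrow> dn_inv i j a * dn i j a = 1"
  using dsch_dn[of i j a] by (simp_all add: dn_def dn_inv_def)

text \<open>\<open>minv_block\<close> with the roles of the matrix and its inverse exchanged. The
  block of \<open>Ti i j\<close> at the omitted end is a single entry with inverse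
  \<open>dsch\<close>, and its Schur complement inverts the smaller block of T.\<close>

lemma Ti_shrink:
  assumes "1 \<le> i" "i < j" "j \<le> N"
  shows "Ti i (j - 1) a i i = Ti i j a i i - Ti i j a i j * dsch i (j - 1) a j * Ti i j a j i"
    and "Ti (Suc i) j a j j = Ti i j a j j - Ti i j a j i * dsch (Suc i) j a i * Ti i j a i j"
proof -
  have c1: "{i..j} - {i..j - 1} = {j}" and c2: "{i..j} - {Suc i..j} = {i}"
    using assms by auto
  have "minv {j} (Ti i j a) (\<lambda>_ _. dsch i (j - 1) a j)" "minv {i} (Ti i j a) (\<lambda>_ _. dsch (Suc i) j a i)"
    using assms dsch_up[of i j a] dsch_dn[of i j a] by (auto simp: minv_def)
  then have "minv {i..j - 1} (T a) (schur {j} (Ti i j a) (\<lambda>_ _. dsch i (j - 1) a j))"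
    and "minv {Suc i..j} (T a) (schur {i} (Ti i j a) (\<lambda>_ _. dsch (Suc i) j a i))"
    using minv_block[of "{i..j}" "{i..j - 1}" "Ti i j a" "T a" "\<lambda>_ _. dsch i (j - 1) a j"]
      minv_block[of "{i..j}" "{Suc i..j}" "Ti i j a" "T a" "\<lambda>_ _. dsch (Suc i) j a i"]
      minv_sym[OF Ti[of i j a]] assms unfolding c1 c2 by auto
  then have "Ti i (j - 1) a i i = schur {j} (Ti i j a) (\<lambda>_ _. dsch i (j - 1) a j) i i"
    "Ti (Suc i) j a j j = schur {i} (Ti i j a) (\<lambda>_ _. dsch (Suc i) j a i) j j"
    using minv_unique[OF _ Ti[of i "j - 1" a], of _ i i] minv_unique[OF _ Ti[of "Suc i" j a], of _ j j] assms
    by auto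
  then show "Ti i (j - 1) a i i = Ti i j a i i - Ti i j a i j * dsch i (j - 1) a j * Ti i j a j i"
    "Ti (Suc i) j a j j = Ti i j a j j - Ti i j a j i * dsch (Suc i) j a i * Ti i j a i j"
    by (simp_all add: schur_def)
qed

text \<open>By \<open>Ti_shrink\<close>, all four factors are entries or quasideterminants of the
  2x2 corner of the inverse at i and j, or inverses of these, so the two corner lemmas apply. The
  shifts are those with which the factors occur in \<open>ber\<close> when an interval is extended
  at both ends.\<close>

lemma swap:
  assumes ij: "1 \<le> i" "i < j" "j \<le> N"
  shows "dn i (j - 1) (e - 2 * int (parity m i)) * up i j (e + 2 * gr m i - 2 * int (parity m j)) =
    up (Suc i) j (e - 2 * int (parity m j)) * dn i j (e + 2 * gr m j - 2 * int (parity m i))"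
proof -
  have K: "finite {i..j}" "{i..j} \<subseteq> {1..N}" "i \<in> {i..j}" "j \<in> {i..j}"
    using ij by auto
  note TT = Ti[OF ij(1) ij(3)]
  have j1: "i \<le> j - 1" "j - 1 \<le> N" "Suc i \<le> j" "1 \<le> Suc i" "i \<le> j" using ij by auto
  \<comment> \<open>Even indices precede odd ones, so an odd i with an even j cannot occur.\<close>
  consider "parity m i = 0" "parity m j = 0" | "parity m i = 1" "parity m j = 1" | "parity m i = 0" "parity m j = 1"
    using ij by (cases "i \<le> m"; cases "j \<le> m") (auto simp: parity_def)
  then show ?thesis
  proof cases
    case 1
    have *: "Ti i j (e + 2) j j * Ti i (j - 1) e i i = Ti i j (e + 2) i i * Ti (Suc i) j e j j"
      unfolding Ti_shrink[OF ij]
      by (rule swap_even_even[OF K ij(2) _ TT, where a = e])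
        (use 1 ij dsch_up[OF ij(1) j1(5) ij(3)] dsch_dn[OF ij(1) j1(5) ij(3)] TT[of "e + 2"] in \<open>auto simp: gr_def\<close>)
    have "dsch (Suc i) (j - 1) e i * dsch i (j - 1) (e + 2) j = dsch (Suc i) (j - 1) e j * dsch (Suc i) j (e + 2) i"
      by (rule inverse_products[OF *])
        (use ij j1 dsch_up[of i j "e + 2"] dsch_dn[of i "j - 1" e] dsch_up[of "Suc i" j e] dsch_dn[of i j "e + 2"] in auto)
    then show ?thesis
      using 1 by (simp add: up_def dn_def gr_def)
  next
    case 2
    have b: "e - 4 = e - 2 + 2 * gr m i"
      using 2 by (simp add: gr_def)
    have "Ti i j (e - 4) j j * Ti i (j - 1) (e - 2) i i = Ti i j (e - 4) i i * Ti (Suc i) j (e - 2) j j"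
      unfolding Ti_shrink[OF ij] b
      by (rule swap_even_even[OF K ij(2) _ TT, where a = "e - 2"])
        (use 2 ij dsch_up[OF ij(1) j1(5) ij(3)] dsch_dn[OF ij(1) j1(5) ij(3)] TT in \<open>auto simp: gr_def\<close>)
    \<comment> \<open>For odd indices the factors are the entries themselves, and the identity just
      obtained has them in reverse order on both sides. A corner entry commutes with the block that
      avoids its index, here at a different argument.\<close>
    moreover have "Ti i j (e - 4) j j * Ti i (j - 1) (e - 2) i i = Ti i (j - 1) (e - 2) i i * Ti i j (e - 4) j j"
      by (rule commute_minv[OF _ Ti[of i "j - 1" "e - 2"]])
        (use ij j1 K in \<open>auto intro!: commute_inverse_neq[OF _ _ TT]\<close>)
    moreover have "Ti i j (e - 4) i i * Ti (Suc i) j (e - 2) j j = Ti (Suc i) j (e - 2) j j * Ti i j (e - 4) i i"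
      by (rule commute_minv[OF _ Ti[of "Suc i" j "e - 2"]])
        (use ij j1 K in \<open>auto intro!: commute_inverse_neq[OF _ _ TT]\<close>)
    ultimately show ?thesis
      using 2 by (simp add: up_def dn_def gr_def)
  next
    case 3
    let ?F = "Ti i (j - 1) e i i" and ?G = "Ti (Suc i) j (e - 2) j j"
    have *: "Ti i j e j j * Ti i j (e - 2) i i = ?F * ?G"
      unfolding Ti_shrink[OF ij]
      by (rule swap_even_odd[OF K ij(2) 3 TT TT])
        (use ij dsch_up[OF ij(1) j1(5) ij(3)] dsch_dn[OF ij(1) j1(5) ij(3)] in auto)
    have "dsch (Suc i) (j - 1) e i * Ti i j e j j =
        dsch (Suc i) (j - 1) e i * (Ti i j e j j * Ti i j (e - 2) i i) * dsch (Suc i) j (e - 2) i"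
      using dsch_dn(1)[OF ij(1) j1(5) ij(3)] by (simp add: mult.assoc)
    also have "\<dots> = dsch (Suc i) (j - 1) e i * ?F * (?G * dsch (Suc i) j (e - 2) i)"
      by (simp add: * mult.assoc)
    also have "dsch (Suc i) (j - 1) e i * ?F = 1"
      using dsch_dn(2)[of i "j - 1" e] ij j1 by simp
    finally show ?thesis
      using 3 by (simp add: up_def dn_def gr_def)
  qed
qed

lemma ber_snoc:
  assumes "1 \<le> i" "i \<le> j"
  shows "ber i j e = ber i (j - 1) e * up i j (e + 2 * hh m i (j - 1) - 2 * int (parity m j))"
proof -
  have "[i..<Suc j] = [i..<Suc (j - 1)] @ [j]"
    using assms by (cases j) auto
  then show ?thesis by (simp only: ber_def map_append prod_list.append) simp
qed

lemma ber_empty [simp]: "j < i \<Longrightarrow> ber i j e = 1"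
  by (simp add: ber_def)

lemma up_self: "1 \<le> i \<Longrightarrow> up i i a = dn i i a"
  by (simp add: up_def dn_def dsch_def schur_def)

lemma hh_empty [simp]: "j < i \<Longrightarrow> hh m i j = 0"
  by (simp add: hh_def)

text \<open>Induction on j: \<open>swap\<close> carries the factor of the new last index past the
  factor of the first one, whose argument changes by the contribution of the new index to
  \<open>hh\<close>.\<close>

lemma ber_dn:
  assumes "1 \<le> i" "i \<le> j" "j \<le> N"
  shows "ber i j e = ber (Suc i) j e * dn i j (e + 2 * hh m (Suc i) j - 2 * int (parity m i))"
  using assms(2,3)
proof (induction j rule: dec_induct)
  case base
  then show ?case
    using ber_snoc[of i i e] up_self[of i] assms(1) by simp
next
  case (step n)
  let ?j = "Suc n" and ?e = "e + 2 * hh m (Suc i) n"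
  have "ber i ?j e = ber i n e * up i ?j (e + 2 * hh m i n - 2 * int (parity m ?j))"
    using ber_snoc[of i ?j e] assms(1) step by simp
  also have "\<dots> = ber (Suc i) n e * (dn i n (?e - 2 * int (parity m i)) * up i ?j (?e + 2 * gr m i - 2 * int (parity m ?j)))"
    using step hh_Cons[of i n m] by (simp add: mult.assoc algebra_simps)
  also have "\<dots> = ber (Suc i) n e * up (Suc i) ?j (?e - 2 * int (parity m ?j)) * dn i ?j (?e + 2 * gr m ?j - 2 * int (parity m i))"
    using swap[of i ?j ?e] step assms(1) by (simp add: mult.assoc)
  also have "\<dots> = ber (Suc i) ?j e * dn i ?j (e + 2 * hh m (Suc i) ?j - 2 * int (parity m i))"
    using ber_snoc[of "Suc i" ?j e] hh_snoc[of "Suc i" ?j m] step by (simp add: algebra_simps)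
  finally show ?case .
qed

definition ber_inv :: "nat \<Rightarrow> nat \<Rightarrow> int \<Rightarrow> 'r" where
  "ber_inv i j e = prod_list (rev (map (\<lambda>t. up_inv i t (e + 2 * hh m i (t - 1) - 2 * int (parity m t))) [i..<Suc j]))"

lemma prod_list_inverse:
  fixes f g :: "'a \<Rightarrow> 'b::ring_1"
  assumes "\<And>t. t \<in> set ts \<Longrightarrow> f t * g t = 1 \<and> g t * f t = 1"
  shows "prod_list (map f ts) * prod_list (rev (map g ts)) = 1 \<and> prod_list (rev (map g ts)) * prod_list (map f ts) = 1"
  using assms
proof (induction ts)
  case (Cons t ts)
  let ?P = "prod_list (map f ts)" and ?R = "prod_list (rev (map g ts))"
  have "f t * ?P * (?R * g t) = f t * (?P * ?R) * g t" "?R * g t * (f t * ?P) = ?R * (g t * f t) * ?P"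
    by (simp_all only: mult.assoc)
  then show ?case using Cons by simp
qed simp

lemma ber_inv:
  assumes "1 \<le> i" "j \<le> N"
  shows "ber i j e * ber_inv i j e = 1" "ber_inv i j e * ber i j e = 1"
  using prod_list_inverse[of "[i..<Suc j]"
      "\<lambda>t. up i t (e + 2 * hh m i (t - 1) - 2 * int (parity m t))"
      "\<lambda>t. up_inv i t (e + 2 * hh m i (t - 1) - 2 * int (parity m t))"] assms
  by (auto simp: ber_def ber_inv_def up_inv simp del: upt_Suc)

end

text \<open>\<open>commute_inverse_neq\<close> gives this for a \<noteq> b. At a = b the coefficient
  in the relation vanishes; for series this case is supplied by a comparison of
  coefficients.\<close>

locale rll_comm = rll_inv +
  assumes comm: "1 \<le> i \<Longrightarrow> i \<le> j \<Longrightarrow> j \<le> N \<Longrightarrow> x = i \<or> x = j \<Longrightarrow> k \<in> {i..j} - {x} \<Longrightarrow> l \<in> {i..j} - {x} \<Longrightarrow>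
    Ti i j b x x * T a k l = T a k l * Ti i j b x x"
begin

lemma commute_Ti:
  assumes "1 \<le> i" "j \<le> N" and "\<And>k l. k \<in> {i..j} \<Longrightarrow> l \<in> {i..j} \<Longrightarrow> y * T a k l = T a k l * y"
    and "k \<in> {i..j}" "l \<in> {i..j}"
  shows "y * Ti i j a k l = Ti i j a k l * y"
  using commute_minv[OF _ Ti[OF assms(1,2)]] assms by auto

lemma commute_up:
  assumes ij: "1 \<le> i" "i \<le> j" "j \<le> N" and y: "\<And>k l. k \<in> {i..j} \<Longrightarrow> l \<in> {i..j} \<Longrightarrow> y * T a k l = T a k l * y"
  shows "y * up i j a = up i j a * y"
proof -
  have "y * Ti i j a j j = Ti i j a j j * y"
    by (rule commute_Ti) (use assms in auto)
  then show ?thesis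
    using commute_inverse[OF up_inv(2)[OF ij, of a] up_inv(1)[OF ij, of a], of y]
    by (auto simp: up_def up_inv_def split: if_splits)
qed

lemma commute_ber:
  assumes ij: "1 \<le> i" "j \<le> N" and y: "\<And>k l a. k \<in> {i..j} \<Longrightarrow> l \<in> {i..j} \<Longrightarrow> y * T a k l = T a k l * y"
  shows "y * ber i j e = ber i j e * y"
  unfolding ber_def
  by (rule commute_prod_list) (use assms in \<open>auto intro!: commute_up simp del: upt_Suc\<close>)

lemma up_comm:
  assumes "1 \<le> i" "i \<le> j" "j \<le> N" "k \<in> {i..j - 1}" "l \<in> {i..j - 1}"
  shows "up i j b * T a k l = T a k l * up i j b"
proof -
  have "T a k l * Ti i j b j j = Ti i j b j j * T a k l"
  proof -
    have "k \<in> {i..j} - {j}" "l \<in> {i..j} - {j}" using assms by auto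
    then show ?thesis using comm[of i j j k l b a] assms by simp
  qed
  then have "T a k l * up i j b = up i j b * T a k l"
    using commute_inverse[OF up_inv(2)[OF assms(1-3), of b] up_inv(1)[OF assms(1-3), of b], of "T a k l"]
    by (auto simp: up_def up_inv_def split: if_splits)
  then show ?thesis by simp
qed

lemma dn_comm:
  assumes "1 \<le> i" "i \<le> j" "j \<le> N" "k \<in> {Suc i..j}" "l \<in> {Suc i..j}"
  shows "dn i j b * T a k l = T a k l * dn i j b"
proof -
  have "T a k l * Ti i j b i i = Ti i j b i i * T a k l"
  proof -
    have "k \<in> {i..j} - {i}" "l \<in> {i..j} - {i}" using assms by auto
    then show ?thesis using comm[of i j i k l b a] assms by simp
  qed
  then have "T a k l * dn i j b = dn i j b * T a k l"
    using commute_inverse[OF dn_inv(2)[OF assms(1-3), of b] dn_inv(1)[OF assms(1-3), of b], of "T a k l"]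
    by (auto simp: dn_def dn_inv_def split: if_splits)
  then show ?thesis by simp
qed

text \<open>With all indices equal the exchange terms vanish and \<open>inverse_prel\<close> becomes
  \<open>rho\<close> times a commutator. This factor vanishes only for a - b = -2 gr, and then not
  after interchanging a and b.\<close>

lemma Ti_diag_comm:
  assumes ij: "1 \<le> i" "i \<le> j" "j \<le> N" "x \<in> {i..j}"
  shows "Ti i j a x x * Ti i j b x x = Ti i j b x x * Ti i j a x x"
proof -
  have *: "Ti i j a x x * Ti i j b x x = Ti i j b x x * Ti i j a x x" if "a - b \<noteq> - 2 * gr m x" for a b
  proof -
    have "sc (rho q m a b x x) * (Ti i j a x x * Ti i j b x x) = sc (rho q m a b x x) * (Ti i j b x x * Ti i j a x x)"
      using inverse_prel[of "{i..j}" a "Ti i j a" b "Ti i j b" x x x x] Ti assms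
      by (rule_tac parity_cases[of m x]) (auto simp: xi_def)
    moreover have "rho q m a b x x \<noteq> 0"
    proof
      assume "rho q m a b x x = 0"
      then have "q powi (a + gr m x) = q powi (b - gr m x)"
        by (simp add: rho_def power_int_add power_int_diff)
      then show False using that by (simp add: q_powi_inj)
    qed
    ultimately show ?thesis by (rule sc_cancel)
  qed
  show ?thesis
  proof (cases "a - b = - 2 * gr m x")
    case True
    then have "b - a \<noteq> - 2 * gr m x"
      by (rule_tac parity_cases[of m x]) (auto simp: gr_def)
    then show ?thesis using *[of b a] by simp
  qed (use * in auto)
qed

lemma up_up_comm:
  assumes ij: "1 \<le> i" "i \<le> j" "j \<le> N"
  shows "up i j a * up i j b = up i j b * up i j a"
proof (cases "parity m j = 0")
  case False
  then show ?thesis using Ti_diag_comm[of i j j a b] ij by (simp add: up_def)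
next
  case True
  have i: "up_inv i j a * up i j a = 1" "up i j a * up_inv i j a = 1" for a
    using up_inv[OF ij] by auto
  have "up_inv i j a * up_inv i j b = up_inv i j b * up_inv i j a"
    using True Ti_diag_comm[of i j j a b] ij by (simp add: up_inv_def)
  then have "up_inv i j a * up i j b = up i j b * up_inv i j a"
    using commute_inverse[OF i(1)[of b] i(2)[of b]] by metis
  then show ?thesis
    using commute_inverse[OF i(1)[of a] i(2)[of a], of "up i j b"] by metis
qed

text \<open>The last factor commutes with the entries of the smaller block at every argument, equal
  arguments included, and the last factors commute among themselves.\<close>

lemma ber_ber_comm:
  assumes "1 \<le> i" "j \<le> N"
  shows "ber i j e * ber i j e' = ber i j e' * ber i j e"
proof (cases "i \<le> j")
  case True
  from True assms(2) show ?thesis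
  proof (induction j rule: nat_induct_at_least)
    case base
    then show ?case using ber_snoc[of i i] up_up_comm[of i i] assms by simp
  next
    case (Suc n)
    let ?U = "\<lambda>e. up i (Suc n) (e + 2 * hh m i n - 2 * int (parity m (Suc n)))"
    have s: "ber i (Suc n) e = ber i n e * ?U e" for e
      using ber_snoc[of i "Suc n" e] assms Suc by simp
    have c: "?U e * ber i n e' = ber i n e' * ?U e" for e e'
      by (rule commute_ber) (use Suc assms in \<open>auto intro!: up_comm\<close>)
    have "ber i n e' * (ber i n e * ?U e) = ber i n e * ?U e * ber i n e'"
      using Suc assms c by (intro commute_mult) simp_all
    moreover have "?U e' * (ber i n e * ?U e) = ber i n e * ?U e * ?U e'"
      using up_up_comm[of i "Suc n"] Suc assms c by (intro commute_mult) simp_all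
    ultimately have "ber i n e * ?U e * (ber i n e' * ?U e') = ber i n e' * ?U e' * (ber i n e * ?U e)"
      by (intro commute_mult) simp_all
    then show ?case unfolding s .
  qed
qed simp

end

section \<open>Quantum minors\<close>

text \<open>Smaller elements of the tail are counted as a set, so this is the usual inversion number
  for lists with distinct entries.\<close>

fun inversions :: "nat list \<Rightarrow> nat" where
  "inversions [] = 0"
| "inversions (x # xs) = card {y \<in> set xs. y < x} + inversions xs"

lemma perm_length_inversions:
  assumes "\<sigma> permutes {1..k}"
  shows "perm_length k \<sigma> = inversions (map \<sigma> [1..<k + 1])"
proof -
  have inj: "inj \<sigma>" using assms by (rule permutes_inj)
  have "inversions (map \<sigma> [i..<k + 1]) = card {(i', j). i \<le> i' \<and> i' < j \<and> j \<le> k \<and> \<sigma> j < \<sigma> i'}"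
    if "i \<le> k + 1" for i
    using that
  proof (induction i rule: inc_induct)
    case base
    have "{(i', j). Suc k \<le> i' \<and> i' < j \<and> j \<le> k \<and> \<sigma> j < \<sigma> i'} = {}" by auto
    then show ?case by (simp only: Suc_eq_plus1[symmetric] card.empty) simp
  next
    case (step i)
    have fin: "finite {(i', j). c \<le> i' \<and> i' < j \<and> j \<le> k \<and> \<sigma> j < \<sigma> i'}" for c
      by (rule finite_subset[of _ "{..k} \<times> {..k}"]) auto
    have eq1: "{(i', j). i \<le> i' \<and> i' < j \<and> j \<le> k \<and> \<sigma> j < \<sigma> i'} =
      Pair i ` {j. i < j \<and> j \<le> k \<and> \<sigma> j < \<sigma> i} \<union> {(i', j). Suc i \<le> i' \<and> i' < j \<and> j \<le> k \<and> \<sigma> j < \<sigma> i'}"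
      by (auto simp: Suc_le_eq le_less)
    have eq2: "card (Pair i ` {j. i < j \<and> j \<le> k \<and> \<sigma> j < \<sigma> i}) = card {j. i < j \<and> j \<le> k \<and> \<sigma> j < \<sigma> i}"
      by (rule card_image) (auto simp: inj_on_def)
    have c: "card {(i', j). i \<le> i' \<and> i' < j \<and> j \<le> k \<and> \<sigma> j < \<sigma> i'} =
      card {j. i < j \<and> j \<le> k \<and> \<sigma> j < \<sigma> i} + card {(i', j). Suc i \<le> i' \<and> i' < j \<and> j \<le> k \<and> \<sigma> j < \<sigma> i'}"
    proof -
      have "card (Pair i ` {j. i < j \<and> j \<le> k \<and> \<sigma> j < \<sigma> i} \<union> {(i', j). Suc i \<le> i' \<and> i' < j \<and> j \<le> k \<and> \<sigma> j < \<sigma> i'}) =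
        card (Pair i ` {j. i < j \<and> j \<le> k \<and> \<sigma> j < \<sigma> i}) + card {(i', j). Suc i \<le> i' \<and> i' < j \<and> j \<le> k \<and> \<sigma> j < \<sigma> i'}"
        by (rule card_Un_disjoint) (use fin[of "Suc i"] in auto)
      then show ?thesis by (simp only: eq1 eq2)
    qed
    have "{y \<in> set (map \<sigma> [Suc i..<k + 1]). y < \<sigma> i} = \<sigma> ` {j. i < j \<and> j \<le> k \<and> \<sigma> j < \<sigma> i}"
      by auto
    then have "card {y \<in> set (map \<sigma> [Suc i..<k + 1]). y < \<sigma> i} = card {j. i < j \<and> j \<le> k \<and> \<sigma> j < \<sigma> i}"
      using inj by (simp add: card_image inj_on_def)
    moreover have "[i..<k + 1] = i # [Suc i..<k + 1]"
      using step by (simp add: upt_conv_Cons)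
    ultimately show ?case
      using step c by simp
  qed
  from this[of 1] show ?thesis
    by (simp add: perm_length_def)
qed

lemma bij_betw_permutes_permutations_of_set:
  "bij_betw (\<lambda>\<sigma>. map \<sigma> [1..<k + 1]) {\<sigma>. \<sigma> permutes {1..k}} (permutations_of_set {1..k})"
proof -
  let ?f = "\<lambda>\<sigma>. map \<sigma> [1..<k + 1]"
  have inj: "inj_on ?f {\<sigma>. \<sigma> permutes {1..k}}"
  proof (rule inj_onI, rule ext)
    fix \<sigma> \<tau> :: "nat \<Rightarrow> nat" and x
    assume *: "\<sigma> \<in> {\<sigma>. \<sigma> permutes {1..k}}" "\<tau> \<in> {\<sigma>. \<sigma> permutes {1..k}}" "?f \<sigma> = ?f \<tau>"
    show "\<sigma> x = \<tau> x"
    proof (cases "x \<in> {1..k}")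
      case True
      then show ?thesis using *(3) by (simp add: map_eq_conv del: upt_Suc)
    next
      case False
      then show ?thesis using * permutes_not_in by (metis mem_Collect_eq)
    qed
  qed
  have sub: "?f ` {\<sigma>. \<sigma> permutes {1..k}} \<subseteq> permutations_of_set {1..k}"
  proof (rule image_subsetI, rule permutations_of_setI)
    fix \<sigma> :: "nat \<Rightarrow> nat" assume "\<sigma> \<in> {\<sigma>. \<sigma> permutes {1..k}}"
    then have s: "\<sigma> permutes {1..k}" by simp
    have "set [1..<k + 1] = {1..k}" by auto
    then show "set (?f \<sigma>) = {1..k}" using permutes_image[OF s] by (simp del: upt_Suc)
    show "distinct (?f \<sigma>)" using permutes_inj_on[OF s] by (simp add: distinct_map del: upt_Suc)
  qed
  have "card (?f ` {\<sigma>. \<sigma> permutes {1..k}}) = card (permutations_of_set {1..k})"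
    using card_image[OF inj] card_permutations[of "{1..k}" k] by simp
  then show ?thesis
    using inj sub card_subset_eq[OF _ sub] by (auto simp: bij_betw_def)
qed

text \<open>The q-commutation at arguments in ratio q^2 that makes a column-ordered determinant
  q-alternating. It holds for even blocks of L, for odd ones with q and the argument inverted, and
  for transposed odd blocks of L^-1 with the argument inverted.\<close>

locale qminor = scalar_ring sc q for sc :: "'k::field \<Rightarrow> 'r::ring_1" and q :: 'k +
  fixes A :: "int \<Rightarrow> nat \<Rightarrow> nat \<Rightarrow> 'r" and I :: "nat set"
  assumes minor_same: "i \<in> I \<Longrightarrow> k \<in> I \<Longrightarrow> j \<in> I \<Longrightarrow> i < k \<Longrightarrow>
    A a i j * A (a + 2) k j = sc (1 / q) * (A a k j * A (a + 2) i j)"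
  and minor_swap: "i \<in> I \<Longrightarrow> k \<in> I \<Longrightarrow> j \<in> I \<Longrightarrow> l \<in> I \<Longrightarrow> i < k \<Longrightarrow> j < l \<Longrightarrow>
    A a i l * A (a + 2) k j - sc (1 / q) * (A a k l * A (a + 2) i j) =
    sc (- 1 / q) * (A a i j * A (a + 2) k l - sc (1 / q) * (A a k j * A (a + 2) i l))"
begin

text \<open>The quantum minor with rows S and columns cs, by expansion along the first column.
  Columns form a list that need not be sorted or distinct, because the vanishing for repeated
  columns is what proves Cramer's rule.\<close>

fun qm :: "nat list \<Rightarrow> int \<Rightarrow> nat set \<Rightarrow> 'r" where
  "qm [] a S = 1"
| "qm (c # cs) a S = (\<Sum>x\<in>S. sc ((- 1 / q) ^ card {y \<in> S. y < x}) * (A a x c * qm cs (a + 2) (S - {x})))"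

text \<open>Pairing the two orders of each pair of rows turns the expansion along two columns into a
  sum over 2x2 minors, to which the relations of the locale apply directly.\<close>

lemma qm_expand2:
  assumes "finite S"
  shows "qm (c # d # cs) a S = (\<Sum>(x, y)\<in>{(x, y). x \<in> S \<and> y \<in> S \<and> x < y}.
    sc ((- 1 / q) ^ (card {z \<in> S. z < x} + card {z \<in> S. z < y} - 1)) *
    ((A a x c * A (a + 2) y d - sc (1 / q) * (A a y c * A (a + 2) x d)) * qm cs (a + 2 + 2) (S - {x, y})))"
proof -
  let ?n = "\<lambda>x. card {z \<in> S. z < x}"
  let ?f = "\<lambda>x y. sc ((- 1 / q) ^ (?n x + card {z \<in> S - {x}. z < y})) * (A a x c * A (a + 2) y d * qm cs (a + 2 + 2) (S - {x, y}))"
  let ?P = "{(x, y). x \<in> S \<and> y \<in> S \<and> x < y}"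
  have finP: "finite ?P"
    by (rule finite_subset[of _ "S \<times> S"]) (use assms in auto)
  have "qm (c # d # cs) a S = (\<Sum>x\<in>S. \<Sum>y\<in>S - {x}. ?f x y)"
    by (simp only: qm.simps sum_distrib_left sc_gather3 power_add Diff_insert2[of S _ "{_}"])
  also have "\<dots> = (\<Sum>(x, y)\<in>(SIGMA x:S. S - {x}). ?f x y)"
    using assms by (subst sum.Sigma) auto
  also have "(SIGMA x:S. S - {x}) = ?P \<union> prod.swap ` ?P"
    by (auto simp: image_iff)
  also have "(\<Sum>(x, y)\<in>?P \<union> prod.swap ` ?P. ?f x y) = (\<Sum>(x, y)\<in>?P. ?f x y) + (\<Sum>(x, y)\<in>prod.swap ` ?P. ?f x y)"
    by (rule sum.union_disjoint) (use finP in auto)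
  also have "(\<Sum>(x, y)\<in>prod.swap ` ?P. ?f x y) = (\<Sum>(x, y)\<in>?P. ?f y x)"
    by (subst sum.reindex) (auto simp: inj_on_def split_def prod.swap_def intro!: sum.cong)
  also have "(\<Sum>(x, y)\<in>?P. ?f x y) + (\<Sum>(x, y)\<in>?P. ?f y x) = (\<Sum>(x, y)\<in>?P. ?f x y + ?f y x)"
    by (simp add: sum.distrib split_def)
  also have "\<dots> = (\<Sum>(x, y)\<in>?P. sc ((- 1 / q) ^ (?n x + ?n y - 1)) *
    ((A a x c * A (a + 2) y d - sc (1 / q) * (A a y c * A (a + 2) x d)) * qm cs (a + 2 + 2) (S - {x, y})))"
  proof (intro sum.cong refl, clarify)
    fix x y assume xy: "x \<in> S" "y \<in> S" "x < y"
    \<comment> \<open>Removing the row x < y lowers the number of rows smaller than y by one: hence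
      the subtracted 1 in the exponent and the extra factor -1/q for the other order.\<close>
    have "{z \<in> S. z < y} = insert x {z \<in> S - {x}. z < y}" using xy by auto
    then have n1: "?n y = Suc (card {z \<in> S - {x}. z < y})" using assms by simp
    have n2: "{z \<in> S - {y}. z < x} = {z \<in> S. z < x}" using xy by auto
    have S: "S - {y, x} = S - {x, y}" by auto
    have e: "?n x + ?n y - 1 = ?n x + card {z \<in> S - {x}. z < y}" using n1 by simp
    have p: "(- 1 / q) ^ (?n y + ?n x) = (- 1 / q) ^ (?n x + card {z \<in> S - {x}. z < y}) * (- (1 / q))"
      unfolding n1 by (simp add: power_add)
    show "?f x y + ?f y x = sc ((- 1 / q) ^ (?n x + ?n y - 1)) *
      ((A a x c * A (a + 2) y d - sc (1 / q) * (A a y c * A (a + 2) x d)) * qm cs (a + 2 + 2) (S - {x, y}))"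
      unfolding n2 S e p sc_diff_gather ..
  qed
  finally show ?thesis .
qed

lemma qm_adjacent: "finite S \<Longrightarrow> S \<subseteq> I \<Longrightarrow> c \<in> I \<Longrightarrow> qm (c # c # cs) a S = 0"
  unfolding qm_expand2 by (rule sum.neutral) (auto simp: minor_same subset_eq)

lemma qm_exchange_less:
  assumes "finite S" "S \<subseteq> I" "c \<in> I" "d \<in> I" "c < d"
  shows "qm (d # c # cs) a S = sc (- 1 / q) * qm (c # d # cs) a S"
  unfolding qm_expand2[OF assms(1)] sum_distrib_left
proof (intro sum.cong refl, clarify)
  fix x y assume "x \<in> S" "y \<in> S" "x < y"
  then have *: "A a x d * A (a + 2) y c - sc (1 / q) * (A a y d * A (a + 2) x c) =
    sc (- 1 / q) * (A a x c * A (a + 2) y d - sc (1 / q) * (A a y c * A (a + 2) x d))"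
    using assms by (intro minor_swap) auto
  show "sc ((- 1 / q) ^ (card {z \<in> S. z < x} + card {z \<in> S. z < y} - 1)) *
       ((A a x d * A (a + 2) y c - sc (1 / q) * (A a y d * A (a + 2) x c)) * qm cs (a + 2 + 2) (S - {x, y})) =
       sc (- 1 / q) * (sc ((- 1 / q) ^ (card {z \<in> S. z < x} + card {z \<in> S. z < y} - 1)) *
       ((A a x c * A (a + 2) y d - sc (1 / q) * (A a y c * A (a + 2) x d)) * qm cs (a + 2 + 2) (S - {x, y})))"
    unfolding * sc_swap2 ..
qed

lemma qm_exchange:
  assumes "finite S" "S \<subseteq> I" "c \<in> I" "d \<in> I" "qm (d # c # cs) a S = 0"
  shows "qm (c # d # cs) a S = 0"
proof (cases c d rule: linorder_cases)
  case less
  have "sc (- 1 / q) * qm (c # d # cs) a S = sc (- 1 / q) * 0"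
    using qm_exchange_less[OF assms(1-4) less, of cs a] assms(5) by simp
  then show ?thesis by (rule sc_cancel) simp
next
  case equal
  then show ?thesis using assms by simp
next
  case greater
  then show ?thesis using qm_exchange_less[OF assms(1,2,4,3) greater, of cs a] assms(5) by simp
qed

text \<open>Exchanging the head with its successor brings the repeated column one step closer to its
  copy; for adjacent copies every 2x2 minor vanishes.\<close>

lemma qm_repeated_head:
  "finite S \<Longrightarrow> S \<subseteq> I \<Longrightarrow> set (c # p) \<subseteq> I \<Longrightarrow> qm (c # p @ c # r) a S = 0"
proof (induction p arbitrary: S a)
  case Nil
  then show ?case using qm_adjacent[of S c r a] by (simp del: qm.simps)
next
  case (Cons d p)
  have "qm (c # p @ c # r) (a + 2) (S - {x}) = 0" for x
    using Cons.prems by (intro Cons.IH) auto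
  then have "qm (d # c # p @ c # r) a S = 0"
    by (subst qm.simps) simp
  then show ?case
    using qm_exchange[of S c d "p @ c # r" a] Cons.prems by (simp del: qm.simps)
qed

lemma qm_not_distinct:
  "finite S \<Longrightarrow> S \<subseteq> I \<Longrightarrow> set cs \<subseteq> I \<Longrightarrow> \<not> distinct cs \<Longrightarrow> qm cs a S = 0"
proof (induction cs arbitrary: S a)
  case (Cons c cs)
  show ?case
  proof (cases "c \<in> set cs")
    case True
    then obtain p r where "cs = p @ c # r" by (meson split_list)
    then show ?thesis using qm_repeated_head[of S c p r a] Cons.prems by (simp del: qm.simps)
  next
    case False
    then have "qm cs (a + 2) (S - {x}) = 0" for x
      using Cons.prems by (intro Cons.IH) auto
    then show ?thesis by simp
  qed
qed simp

text \<open>Expanding along the first and the last column in either order gives the same double sum.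
  If the row y of the last column is smaller than the row x of the first, each of the two is counted
  once by the other, on both sides; otherwise neither is.\<close>

lemma qm_snoc:
  "finite S \<Longrightarrow> card S = Suc (length cs) \<Longrightarrow> qm (cs @ [c]) a S =
    (\<Sum>x\<in>S. sc ((- 1 / q) ^ card {y \<in> S. x < y}) * (qm cs a (S - {x}) * A (a + 2 * int (length cs)) x c))"
proof (induction cs arbitrary: S a)
  case Nil
  then obtain x where "S = {x}" by (auto simp: card_1_singleton_iff)
  moreover have "{y \<in> {x}. y < x} = {}" "{y \<in> {x}. x < y} = {}" by auto
  ultimately show ?case by (simp only: append_Nil qm.simps sum.insert_remove finite.emptyI) simp
next
  case (Cons d cs)
  let ?b = "a + 2 * int (length (d # cs))"
  let ?f = "\<lambda>x y. sc ((- 1 / q) ^ card {z \<in> S. z < x}) * (A a x d *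
    (sc ((- 1 / q) ^ card {z \<in> S - {x}. y < z}) * (qm cs (a + 2) (S - {x} - {y}) * A ?b y c)))"
  let ?g = "\<lambda>x y. sc ((- 1 / q) ^ card {z \<in> S. y < z}) *
    (sc ((- 1 / q) ^ card {z \<in> S - {y}. z < x}) * (A a x d * qm cs (a + 2) (S - {y} - {x})) * A ?b y c)"
  have b: "a + 2 + 2 * int (length cs) = ?b" by simp
  have "qm ((d # cs) @ [c]) a S = (\<Sum>x\<in>S. sc ((- 1 / q) ^ card {z \<in> S. z < x}) * (A a x d * qm (cs @ [c]) (a + 2) (S - {x})))"
    by simp
  also have "\<dots> = (\<Sum>x\<in>S. \<Sum>y\<in>S - {x}. ?f x y)"
    using Cons.prems by (intro sum.cong refl, subst Cons.IH) (auto simp: b sum_distrib_left simp del: of_nat_Suc)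
  also have "\<dots> = (\<Sum>x\<in>S. \<Sum>y\<in>S. if x = y then 0 else ?f x y)"
  proof (rule sum.cong[OF refl])
    fix x assume "x \<in> S"
    have "(\<Sum>y\<in>S - {x}. ?f x y) = (\<Sum>y\<in>S - {x}. if x = y then 0 else ?f x y)"
      by (rule sum.cong) auto
    also have "\<dots> = (\<Sum>y\<in>S. if x = y then 0 else ?f x y)"
      by (rule sum.mono_neutral_left) (use Cons.prems in auto)
    finally show "(\<Sum>y\<in>S - {x}. ?f x y) = (\<Sum>y\<in>S. if x = y then 0 else ?f x y)" .
  qed
  also have "\<dots> = (\<Sum>x\<in>S. \<Sum>y\<in>S. if x = y then 0 else ?g x y)"
  proof (intro sum.cong refl)
    fix x y assume xy: "x \<in> S" "y \<in> S"
    show "(if x = y then 0 else ?f x y) = (if x = y then 0 else ?g x y)"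
    proof (cases "x = y")
      case False
      have fin: "finite S" by fact
      have "card {z \<in> S. z < x} + card {z \<in> S - {x}. y < z} = card {z \<in> S. y < z} + card {z \<in> S - {y}. z < x}"
      proof (cases "x < y")
        case True
        have "{z \<in> S - {x}. y < z} = {z \<in> S. y < z}" "{z \<in> S - {y}. z < x} = {z \<in> S. z < x}" using True by auto
        then show ?thesis by simp
      next
        case False
        then have "y < x" using \<open>x \<noteq> y\<close> by simp
        then have "{z \<in> S. y < z} = insert x {z \<in> S - {x}. y < z}" "{z \<in> S. z < x} = insert y {z \<in> S - {y}. z < x}"
          using xy by auto
        then show ?thesis using fin by simp
      qed
      then have p: "(- 1 / q) ^ card {z \<in> S. z < x} * (- 1 / q) ^ card {z \<in> S - {x}. y < z} =
        (- 1 / q) ^ card {z \<in> S. y < z} * (- 1 / q) ^ card {z \<in> S - {y}. z < x}"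
        by (simp only: power_add[symmetric])
      have S: "S - {y} - {x} = S - {x} - {y}" by auto
      have "?f x y = ?g x y"
        unfolding sc_gather3 sc_gather4 p S ..
      then show ?thesis by simp
    qed simp
  qed
  also have "\<dots> = (\<Sum>y\<in>S. \<Sum>x\<in>S. if x = y then 0 else ?g x y)"
    by (rule sum.swap)
  also have "\<dots> = (\<Sum>y\<in>S. \<Sum>x\<in>S - {y}. ?g x y)"
  proof (rule sum.cong[OF refl])
    fix y assume "y \<in> S"
    have "(\<Sum>x\<in>S - {y}. ?g x y) = (\<Sum>x\<in>S - {y}. if x = y then 0 else ?g x y)"
      by (rule sum.cong) auto
    also have "\<dots> = (\<Sum>x\<in>S. if x = y then 0 else ?g x y)"
      by (rule sum.mono_neutral_left) (use Cons.prems in auto)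
    finally show "(\<Sum>x\<in>S. if x = y then 0 else ?g x y) = (\<Sum>x\<in>S - {y}. ?g x y)" ..
  qed
  also have "\<dots> = (\<Sum>y\<in>S. sc ((- 1 / q) ^ card {z \<in> S. y < z}) * (qm (d # cs) a (S - {y}) * A ?b y c))"
    by (simp only: qm.simps sum_distrib_left sum_distrib_right)
  finally show ?case .
qed

text \<open>Cramer's rule. By \<open>qm_snoc\<close> the signed complementary minors times the last
  matrix A give the minor with last column c, which vanishes for c \<noteq> j since a column is
  repeated. Multiplying by B isolates the complementary minor of row j, whose sign is
  trivial.\<close>

lemma qm_last:
  assumes I: "{i..j} \<subseteq> I" and ij: "i \<le> j"
    and B: "minv {i..j} (A (a + 2 * int (j - i))) B"
  shows "qm [i..<j] a {i..<j} = qm [i..<Suc j] a {i..j} * B j j"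
proof -
  let ?b = "a + 2 * int (j - i)"
  let ?\<mu> = "\<lambda>x. sc ((- 1 / q) ^ card {y \<in> {i..j}. x < y}) * qm [i..<j] a ({i..j} - {x})"
  have e: "(\<Sum>x\<in>{i..j}. ?\<mu> x * A ?b x c) = of_bool (c = j) * qm [i..<Suc j] a {i..j}" if c: "c \<in> {i..j}" for c
  proof -
    have "(\<Sum>x\<in>{i..j}. ?\<mu> x * A ?b x c) = qm ([i..<j] @ [c]) a {i..j}"
      by (subst qm_snoc) (use ij in \<open>auto simp: mult.assoc Suc_diff_le\<close>)
    also have "\<dots> = of_bool (c = j) * qm [i..<Suc j] a {i..j}"
    proof (cases "c = j")
      case False
      then have "qm ([i..<j] @ [c]) a {i..j} = 0"
        using c I by (intro qm_not_distinct) auto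
      then show ?thesis using False by simp
    qed (use ij in simp)
    finally show ?thesis .
  qed
  have "?\<mu> j = (\<Sum>x\<in>{i..j}. ?\<mu> x * of_bool (x = j))"
    using ij by simp
  also have "\<dots> = (\<Sum>x\<in>{i..j}. ?\<mu> x * (\<Sum>c\<in>{i..j}. A ?b x c * B c j))"
    by (intro sum.cong refl, subst minvD(1)[OF B]) (use ij in auto)
  also have "\<dots> = (\<Sum>c\<in>{i..j}. (\<Sum>x\<in>{i..j}. ?\<mu> x * A ?b x c) * B c j)"
    unfolding sum_distrib_left sum_distrib_right by (subst sum.swap) (simp only: mult.assoc)
  also have "\<dots> = (\<Sum>c\<in>{i..j}. if c = j then qm [i..<Suc j] a {i..j} * B c j else 0)"
    by (intro sum.cong refl, subst e) (auto simp del: qm.simps upt_Suc)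
  also have "\<dots> = qm [i..<Suc j] a {i..j} * B j j"
    using ij by simp
  finally have "?\<mu> j = qm [i..<Suc j] a {i..j} * B j j" .
  moreover have "{y \<in> {i..j}. j < y} = {}" "{i..j} - {j} = {i..<j}" by auto
  ultimately show ?thesis by (simp only: card.empty power_0 sc_1 mult_1)
qed

text \<open>Cramer's rule for the first column. There the entries of A stand to the left of the
  complementary minors, so A has to be inverted with products in reverse order: hence the form of
  the hypothesis on B, which a transposed inverse satisfies.\<close>

lemma qm_first:
  assumes I: "{i..j} \<subseteq> I" and ij: "i \<le> j"
    and B: "\<And>x y. x \<in> {i..j} \<Longrightarrow> y \<in> {i..j} \<Longrightarrow> (\<Sum>c\<in>{i..j}. B c y * A a x c) = of_bool (x = y)"
  shows "qm [Suc i..<Suc j] (a + 2) {Suc i..j} = B i i * qm [i..<Suc j] a {i..j}"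
proof -
  let ?\<nu> = "\<lambda>x. sc ((- 1 / q) ^ card {y \<in> {i..j}. y < x}) * qm [Suc i..<Suc j] (a + 2) ({i..j} - {x})"
  have e: "(\<Sum>x\<in>{i..j}. A a x c * ?\<nu> x) = of_bool (c = i) * qm [i..<Suc j] a {i..j}" if c: "c \<in> {i..j}" for c
  proof -
    have "(\<Sum>x\<in>{i..j}. A a x c * ?\<nu> x) = qm (c # [Suc i..<Suc j]) a {i..j}"
      by (simp only: qm.simps sc_left)
    also have "\<dots> = of_bool (c = i) * qm [i..<Suc j] a {i..j}"
    proof (cases "c = i")
      case False
      then have "qm (c # [Suc i..<Suc j]) a {i..j} = 0"
        using c I by (intro qm_not_distinct) auto
      then show ?thesis using False by simp
    next
      case True
      have "[i..<Suc j] = i # [Suc i..<Suc j]" using ij by (simp add: upt_conv_Cons)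
      then show ?thesis using True by simp
    qed
    finally show ?thesis .
  qed
  have "?\<nu> i = (\<Sum>x\<in>{i..j}. of_bool (x = i) * ?\<nu> x)"
    using ij by simp
  also have "\<dots> = (\<Sum>x\<in>{i..j}. (\<Sum>c\<in>{i..j}. B c i * A a x c) * ?\<nu> x)"
    by (intro sum.cong refl) (use ij in \<open>simp add: B\<close>)
  also have "\<dots> = (\<Sum>c\<in>{i..j}. B c i * (\<Sum>x\<in>{i..j}. A a x c * ?\<nu> x))"
    unfolding sum_distrib_left sum_distrib_right by (subst sum.swap) (simp only: mult.assoc)
  also have "\<dots> = (\<Sum>c\<in>{i..j}. if c = i then B c i * qm [i..<Suc j] a {i..j} else 0)"
    by (intro sum.cong refl, subst e) (auto simp del: qm.simps upt_Suc)
  also have "\<dots> = B i i * qm [i..<Suc j] a {i..j}"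
    using ij by simp
  finally have "?\<nu> i = B i i * qm [i..<Suc j] a {i..j}" .
  moreover have "{y \<in> {i..j}. y < i} = {}" "{i..j} - {i} = {Suc i..j}" by auto
  ultimately show ?thesis by (simp only: card.empty power_0 sc_1 mult_1)
qed

lemma qm_lists:
  assumes "finite S" "card S = length cs"
  shows "qm cs a S = (\<Sum>xs\<in>permutations_of_set S. sc ((- 1 / q) ^ inversions xs) *
    prod_list (map (\<lambda>t. A (a + 2 * int t) (xs ! t) (cs ! t)) [0..<length cs]))"
  using assms
proof (induction cs arbitrary: S a)
  case (Cons c cs)
  let ?w = "\<lambda>cs a xs. prod_list (map (\<lambda>t. A (a + 2 * int t) (xs ! t) (cs ! t)) [0..<length cs])"
  have ne: "S \<noteq> {}" and fin: "finite S" using Cons.prems by auto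
  have w: "?w (c # cs) a (x # xs) = A a x c * ?w cs (a + 2) xs" for x xs
  proof -
    have "[0..<length (c # cs)] = 0 # map Suc [0..<length cs]"
      by (simp only: map_Suc_upt length_Cons) (simp add: upt_conv_Cons del: upt_Suc)
    then have "?w (c # cs) a (x # xs) = prod_list (map (\<lambda>t. A (a + 2 * int t) ((x # xs) ! t) ((c # cs) ! t)) (0 # map Suc [0..<length cs]))"
      by (simp only:)
    also have "\<dots> = A a x c * ?w cs (a + 2) xs"
      by (simp add: o_def algebra_simps del: upt_Suc)
    finally show ?thesis .
  qed
  have "(\<Sum>xs\<in>permutations_of_set S. sc ((- 1 / q) ^ inversions xs) * ?w (c # cs) a xs)
      = (\<Sum>x\<in>S. \<Sum>xs\<in>(#) x ` permutations_of_set (S - {x}). sc ((- 1 / q) ^ inversions xs) * ?w (c # cs) a xs)"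
    unfolding permutations_of_set_nonempty[OF ne] by (rule sum.UNION_disjoint) (use fin in auto)
  also have "\<dots> = (\<Sum>x\<in>S. \<Sum>xs\<in>permutations_of_set (S - {x}). sc ((- 1 / q) ^ inversions (x # xs)) * ?w (c # cs) a (x # xs))"
    by (rule sum.cong[OF refl], subst sum.reindex) (simp_all only: inj_on_def o_def list.inject simp_thms ball_simps ball_triv)
  also have "\<dots> = (\<Sum>x\<in>S. sc ((- 1 / q) ^ card {y \<in> S. y < x}) * (A a x c *
      (\<Sum>xs\<in>permutations_of_set (S - {x}). sc ((- 1 / q) ^ inversions xs) * ?w cs (a + 2) xs)))"
    unfolding sum_distrib_left
  proof (intro sum.cong refl)
    fix x xs assume "x \<in> S" "xs \<in> permutations_of_set (S - {x})"
    then have "set xs = S - {x}" by (simp add: permutations_of_setD)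
    then have "{y \<in> set xs. y < x} = {y \<in> S. y < x}" by auto
    then have "(- 1 / q) ^ inversions (x # xs) = (- 1 / q) ^ card {y \<in> S. y < x} * (- 1 / q) ^ inversions xs"
      by (simp add: power_add)
    then show "sc ((- 1 / q) ^ inversions (x # xs)) * ?w (c # cs) a (x # xs) =
      sc ((- 1 / q) ^ card {y \<in> S. y < x}) * (A a x c * (sc ((- 1 / q) ^ inversions xs) * ?w cs (a + 2) xs))"
      unfolding w by (simp only: sc_gather5)
  qed
  also have "\<dots> = qm (c # cs) a S"
    unfolding qm.simps by (intro sum.cong refl, subst Cons.IH) (use Cons.prems in auto)
  finally show ?case ..
qed simp

lemma qm_permutes:
  "qm [1..<k + 1] a {1..k} = (\<Sum>\<sigma> | \<sigma> permutes {1..k}. sc ((- q) powi (- int (perm_length k \<sigma>))) *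
     prod_list (map (\<lambda>j. A (a + (2 * int j - 2)) (\<sigma> j) j) [1..<k + 1]))"
proof -
  have p: "(- q) powi (- int n) = (- 1 / q) ^ n" for n
    by (simp add: power_int_minus power_one_over[symmetric] field_simps)
  have "qm [1..<k + 1] a {1..k} = (\<Sum>xs\<in>permutations_of_set {1..k}. sc ((- 1 / q) ^ inversions xs) *
    prod_list (map (\<lambda>t. A (a + 2 * int t) (xs ! t) ([1..<k + 1] ! t)) [0..<k]))"
    by (subst qm_lists) (auto simp del: upt_Suc)
  also have "\<dots> = (\<Sum>\<sigma> | \<sigma> permutes {1..k}. sc ((- 1 / q) ^ inversions (map \<sigma> [1..<k + 1])) *
    prod_list (map (\<lambda>t. A (a + 2 * int t) (map \<sigma> [1..<k + 1] ! t) ([1..<k + 1] ! t)) [0..<k]))"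
    by (rule sum.reindex_bij_betw[OF bij_betw_permutes_permutations_of_set, symmetric])
  also have "\<dots> = (\<Sum>\<sigma> | \<sigma> permutes {1..k}. sc ((- q) powi (- int (perm_length k \<sigma>))) *
     prod_list (map (\<lambda>j. A (a + (2 * int j - 2)) (\<sigma> j) j) [1..<k + 1]))"
  proof (intro sum.cong refl arg_cong2[where f = "(*)"])
    fix \<sigma> assume "\<sigma> \<in> {\<sigma>. \<sigma> permutes {1..k}}"
    then show "sc ((- 1 / q) ^ inversions (map \<sigma> [1..<k + 1])) = sc ((- q) powi (- int (perm_length k \<sigma>)))"
      by (simp add: p perm_length_inversions del: upt_Suc)
    have u: "[1..<k + 1] = map Suc [0..<k]" by (simp add: map_Suc_upt)
    show "prod_list (map (\<lambda>t. A (a + 2 * int t) (map \<sigma> [1..<k + 1] ! t) ([1..<k + 1] ! t)) [0..<k]) =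
      prod_list (map (\<lambda>j. A (a + (2 * int j - 2)) (\<sigma> j) j) [1..<k + 1])"
      unfolding u map_map by (intro arg_cong[of _ _ prod_list] map_cong refl) (auto simp: algebra_simps)
  qed
  finally show ?thesis .
qed

end

section \<open>The opposite ring\<close>

text \<open>A type of its own, so that everything proved in the locales is available with products
  reversed.\<close>

typedef 'a opp = "UNIV :: 'a set" morphisms unop Op ..

lemma unop_Op [simp]: "unop (Op x) = x"
  by (rule Op_inverse) simp

lemma Op_eq_iff [simp]: "Op x = Op y \<longleftrightarrow> x = y"
  by (simp add: Op_inject)

lemma opp_eqI: "unop x = unop y \<Longrightarrow> x = y"
  by (simp add: unop_inject)

instantiation opp :: (ring_1) ring_1
begin

definition "0 = Op 0"
definition "1 = Op 1"
definition "x + y = Op (unop x + unop y)"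
definition "x - y = Op (unop x - unop y)"
definition "- x = Op (- unop x)"
definition "x * y = Op (unop y * unop x)"

instance
  by standard (auto intro!: opp_eqI simp: zero_opp_def one_opp_def plus_opp_def minus_opp_def
      uminus_opp_def times_opp_def algebra_simps)

end

lemma unop_simps [simp]: "unop 0 = 0" "unop 1 = 1" "unop (x + y) = unop x + unop y"
  "unop (x - y) = unop x - unop y" "unop (- x) = - unop x" "unop (x * y) = unop y * unop x"
  by (simp_all add: zero_opp_def one_opp_def plus_opp_def minus_opp_def uminus_opp_def times_opp_def)

lemma unop_sum: "unop (\<Sum>i\<in>I. f i) = (\<Sum>i\<in>I. unop (f i))"
  by (induction I rule: infinite_finite_induct) simp_all

lemma unop_of_bool [simp]: "unop (of_bool b) = of_bool b"
  by (cases b) simp_all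

lemma minv_opp:
  "minv K (\<lambda>i j. Op (A i j)) (\<lambda>i j. Op (B i j)) \<longleftrightarrow> (\<forall>i\<in>K. \<forall>k\<in>K.
    (\<Sum>j\<in>K. B j k * A i j) = of_bool (i = k) \<and> (\<Sum>j\<in>K. A j k * B i j) = of_bool (i = k))"
  by (auto simp: minv_def unop_inject[symmetric] unop_sum)

lemma scalar_ring_opp: "scalar_ring sc q \<Longrightarrow> scalar_ring (\<lambda>c. Op (sc c)) (inverse q)"
proof -
  assume "scalar_ring sc q"
  then interpret scalar_ring sc q .
  show ?thesis
  proof
    show "Op (sc (c + d)) = Op (sc c) + Op (sc d)" for c d
      by (rule opp_eqI) (simp add: sc_add)
    show "Op (sc (c * d)) = Op (sc c) * Op (sc d)" for c d
      by (rule opp_eqI) (simp add: sc_mult[symmetric] mult.commute)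
    show "Op (sc 1) = 1"
      by (rule opp_eqI) simp
    show "x * Op (sc c) = Op (sc c) * x" for x c
      by (rule opp_eqI) (simp add: sc_central[of "unop x"])
    show "inverse q powi n = 1 \<Longrightarrow> n = 0" for n
      using q_powi[of n] by (simp add: power_int_inverse)
  qed simp
qed

lemma rho_inverse: "rho (inverse q) m a b i k = - rho q m (- b) (- a) i k"
  by (simp add: rho_def power_int_inverse power_int_minus divide_inverse)

lemma xi_inverse: "xi (inverse q) a b i k = - xi q (- b) (- a) k i"
  by (simp add: xi_def power_int_inverse power_int_minus algebra_simps divide_inverse)

definition tw :: "nat \<Rightarrow> nat \<Rightarrow> nat \<Rightarrow> 'k::field" where
  "tw m i j = sg (parity m j * (parity m i + 1))"

lemma tw_tw [simp]: "tw m i j * tw m i j = 1"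
  by (rule parity_cases[of m i]; rule parity_cases[of m j]; simp add: tw_def)

text \<open>The sign twist exchanges ordinary and transposed multiplication of supermatrices: it turns a
  solution of the RLL relations into one over the opposite ring, with \<open>q\<close> and the spectral
  parameter inverted.\<close>

lemma rll_opp:
  fixes sc :: "'k::field \<Rightarrow> 'r::ring_1"
  assumes "rll sc q m N T"
  shows "rll (\<lambda>c. Op (sc c)) (inverse q) m N (\<lambda>a i j. Op (sc (tw m i j) * T (- a) i j))"
proof -
  interpret rll sc q m N T by fact
  show ?thesis
  proof (intro rll.intro rll_axioms.intro scalar_ring_opp scalar_ring_axioms)
    fix i j k l a b
    assume I: "i \<in> {1..N}" "j \<in> {1..N}" "k \<in> {1..N}" "l \<in> {1..N}"
    have e: "sc c1 * (T (- b) k l * T (- a) i j) + sc c2 * (T (- b) i l * T (- a) k j) =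
      sc c3 * (T (- a) i j * T (- b) k l) + sc c4 * (T (- a) i l * T (- b) k j)"
      if "tw m i j * tw m k l * u * (rho q m (- b) (- a) k i * sg (parity m i * (parity m k + parity m l))) = c1"
        "tw m i j * tw m k l * u * (xi q (- b) (- a) k i * sg (parity m k * parity m l)) = c2"
        "tw m i j * tw m k l * u * (rho q m (- b) (- a) l j * sg (parity m j * (parity m k + parity m l))) = c3"
        "tw m i j * tw m k l * u * (xi q (- b) (- a) j l * sg (parity m k * parity m l)) = c4"
      for c1 c2 c3 c4 u
      using sc_scale[OF prel[of k l i j "- b" "- a"] that] I by blast
    \<comment> \<open>Reversing products interchanges the two factors, so the given relation is
      taken with (i, j) and (k, l) interchanged, at the arguments -b and -a. The coefficients then
      agree up to this sign, whose leading minus comes from \<open>rho_inverse\<close> and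
      \<open>xi_inverse\<close>.\<close>
    let ?u = "- sg (parity m i * parity m l + parity m k * parity m j) :: 'k"
    have r: "rho q m (- b) (- a) k i = rho q m (- b) (- a) i k" "rho q m (- b) (- a) l j = rho q m (- b) (- a) j l"
      by (auto simp: rho_def)
    have x: "sc c1 * (T (- b) k l * T (- a) i j) + sc c2 * (T (- b) i l * T (- a) k j) =
      sc c3 * (T (- a) i j * T (- b) k l) + sc c4 * (T (- a) i l * T (- b) k j)"
      if "c1 = tw m i j * tw m k l * (rho (inverse q) m a b i k * sg (parity m k * (parity m i + parity m j)))"
        "c2 = tw m k j * tw m i l * (xi (inverse q) a b i k * sg (parity m i * parity m j))"
        "c3 = tw m i j * tw m k l * (rho (inverse q) m a b j l * sg (parity m l * (parity m i + parity m j)))"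
        "c4 = tw m k j * tw m i l * (xi (inverse q) a b l j * sg (parity m i * parity m j))" for c1 c2 c3 c4
      by (rule e[of ?u]; unfold that rho_inverse xi_inverse r tw_def;
          rule parity_cases[of m i]; rule parity_cases[of m j]; rule parity_cases[of m k]; rule parity_cases[of m l]; simp)
    have g: "sc c * (sc t * x * (sc t' * y)) = sc (t * t' * c) * (x * y)" for c t t' x y
      by (simp only: sc_prod sc_mult_assoc mult.commute[of c])
    have g': "sc c * (sc t * x * (sc t' * y)) = sc (t' * t * c) * (x * y)" for c t t' x y
      unfolding g by (simp only: mult.commute[of t t'])
    show "Op (sc (rho (inverse q) m a b i k * sg (parity m k * (parity m i + parity m j)))) *
         (Op (sc (tw m i j) * T (- a) i j) * Op (sc (tw m k l) * T (- b) k l)) +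
         Op (sc (xi (inverse q) a b i k * sg (parity m i * parity m j))) *
         (Op (sc (tw m k j) * T (- a) k j) * Op (sc (tw m i l) * T (- b) i l)) =
         Op (sc (rho (inverse q) m a b j l * sg (parity m l * (parity m i + parity m j)))) *
         (Op (sc (tw m k l) * T (- b) k l) * Op (sc (tw m i j) * T (- a) i j)) +
         Op (sc (xi (inverse q) a b l j * sg (parity m i * parity m j))) *
         (Op (sc (tw m k j) * T (- b) k j) * Op (sc (tw m i l) * T (- a) i l))"
    proof (rule opp_eqI)
      show "unop (Op (sc (rho (inverse q) m a b i k * sg (parity m k * (parity m i + parity m j)))) *
         (Op (sc (tw m i j) * T (- a) i j) * Op (sc (tw m k l) * T (- b) k l)) +
         Op (sc (xi (inverse q) a b i k * sg (parity m i * parity m j))) *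
         (Op (sc (tw m k j) * T (- a) k j) * Op (sc (tw m i l) * T (- b) i l))) =
         unop (Op (sc (rho (inverse q) m a b j l * sg (parity m l * (parity m i + parity m j)))) *
         (Op (sc (tw m k l) * T (- b) k l) * Op (sc (tw m i j) * T (- a) i j)) +
         Op (sc (xi (inverse q) a b l j * sg (parity m i * parity m j))) *
         (Op (sc (tw m k j) * T (- b) k j) * Op (sc (tw m i l) * T (- a) i l)))"
        unfolding unop_simps unop_Op sc_central[of "_ * _"] g
        by (rule x; simp only: mult.assoc mult.commute mult.left_commute)
    qed
  qed
qed

section \<open>Series with shifts of the spectral parameter\<close>

text \<open>s is the exponent of z in the variable of the series: -1 for L^+, a series in z^-1, and
  1 for L^-. For nonzero s the shifts separate the coefficients.\<close>

locale shifts = scalar_ring sc q for sc :: "'k::field \<Rightarrow> 'a::ring_1" and q :: 'k +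
  fixes s :: int
  assumes s_nz: "s \<noteq> 0"
begin

definition shift :: "int \<Rightarrow> 'a fps \<Rightarrow> 'a fps" where
  "shift a F = Abs_fps (\<lambda>n. sc (q powi (s * a * int n)) * fps_nth F n)"

lemma shift_nth [simp]: "fps_nth (shift a F) n = sc (q powi (s * a * int n)) * fps_nth F n"
  by (simp add: shift_def)

definition fsc :: "'k \<Rightarrow> 'a fps" where
  "fsc c = fps_const (sc c)"

lemma fsc_nth: "fps_nth (fsc c * F) n = sc c * fps_nth F n"
  by (simp add: fsc_def)

lemma scalar_ring_fsc: "scalar_ring fsc q"
proof
  fix c d :: 'k and x :: "'a fps" and n :: int
  show "fsc (c + d) = fsc c + fsc d" by (simp add: fsc_def sc_add)
  show "fsc (c * d) = fsc c * fsc d" by (simp add: fsc_def sc_mult)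
  show "fsc 1 = 1" by (simp add: fsc_def)
  show "x * fsc c = fsc c * x"
    by (rule fps_ext) (simp add: fsc_def sc_central)
  show "q \<noteq> 0" by simp
  show "q powi n = 1 \<Longrightarrow> n = 0" by (rule q_powi)
qed

lemma shift_add: "shift a (F + G) = shift a F + shift a G"
  by (rule fps_ext) (simp add: distrib_left)

lemma shift_diff: "shift a (F - G) = shift a F - shift a G"
  by (rule fps_ext) (simp add: right_diff_distrib)

lemma shift_mult: "shift a (F * G) = shift a F * shift a G"
proof (rule fps_ext)
  fix n
  have "sc (q powi (s * a * int n)) * (fps_nth F i * fps_nth G (n - i)) =
    sc (q powi (s * a * int i)) * fps_nth F i * (sc (q powi (s * a * int (n - i))) * fps_nth G (n - i))" if "i \<le> n" for i
  proof -
    have "s * a * int n = s * a * int i + s * a * int (n - i)"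
      using that by (simp add: of_nat_diff algebra_simps)
    then have "q powi (s * a * int n) = q powi (s * a * int i) * q powi (s * a * int (n - i))"
      by (simp only: power_int_add q_nz simp_thms)
    then show ?thesis by (simp only: sc_prod)
  qed
  then show "fps_nth (shift a (F * G)) n = fps_nth (shift a F * shift a G) n"
    by (simp add: fps_mult_nth sum_distrib_left)
qed

lemma shift_0 [simp]: "shift a 0 = 0"
  by (rule fps_ext) simp

lemma shift_1 [simp]: "shift a 1 = 1"
  by (rule fps_ext) simp

lemma shift_fsc [simp]: "shift a (fsc c) = fsc c"
  by (rule fps_ext) (simp add: fsc_def)

lemma shift_of_bool [simp]: "shift a (of_bool b) = of_bool b"
  by (cases b) simp_all

lemma shift_sum: "shift a (\<Sum>i\<in>I. f i) = (\<Sum>i\<in>I. shift a (f i))"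
  by (induction I rule: infinite_finite_induct) (simp_all add: shift_add)

lemma shift_prod_list: "shift a (prod_list xs) = prod_list (map (shift a) xs)"
  by (induction xs) (simp_all add: shift_mult)

lemma shift_shift: "shift a (shift b F) = shift (a + b) F"
proof (rule fps_ext)
  fix n
  have "s * (a + b) * int n = s * a * int n + s * b * int n"
    by (simp add: algebra_simps)
  then show "fps_nth (shift a (shift b F)) n = fps_nth (shift (a + b) F) n"
    by (simp only: shift_nth sc_mult_assoc power_int_add q_nz simp_thms)
qed

lemma shift_zero_arg [simp]: "shift 0 F = F"
  by (rule fps_ext) simp

lemma minv_shift: "minv K A B \<Longrightarrow> minv K (\<lambda>i j. shift a (A i j)) (\<lambda>i j. shift a (B i j))"
proof -
  assume h: "minv K A B"
  show ?thesis
    unfolding minv_def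
    by (intro ballI conjI) (simp_all only: shift_mult[symmetric] shift_sum[symmetric] minvD[OF h] shift_of_bool)
qed

text \<open>A family of series that depends on two spectral parameters like the product of
  \<open>F(z)\<close> and \<open>G(w)\<close> at \<open>z = q\<^sup>a x\<close> and \<open>w = q\<^sup>b x\<close>.\<close>

definition bianalytic :: "(int \<Rightarrow> int \<Rightarrow> 'a fps) \<Rightarrow> bool" where
  "bianalytic \<beta> \<longleftrightarrow> (\<exists>x. \<forall>a b n. fps_nth (\<beta> a b) n =
     (\<Sum>r\<le>n. sc (q powi (s * a * int r) * q powi (s * b * int (n - r))) * x r (n - r)))"

lemma shift_mult_nth: "fps_nth (shift a F * shift b G) n =
  (\<Sum>r\<le>n. sc (q powi (s * a * int r) * q powi (s * b * int (n - r))) * (fps_nth F r * fps_nth G (n - r)))"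
  by (simp only: fps_mult_nth atMost_atLeast0 shift_nth sc_prod)

lemma shift_mult_nth': "fps_nth (shift b G * shift a F) n =
  (\<Sum>r\<le>n. sc (q powi (s * a * int r) * q powi (s * b * int (n - r))) * (fps_nth G (n - r) * fps_nth F r))"
proof -
  have "fps_nth (shift b G * shift a F) n = (\<Sum>r\<le>n. fps_nth (shift b G) r * fps_nth (shift a F) (n - r))"
    by (simp only: fps_mult_nth atMost_atLeast0)
  also have "\<dots> = (\<Sum>r\<le>n. fps_nth (shift b G) (n - r) * fps_nth (shift a F) r)"
    by (rule sum.reindex_bij_witness[of _ "\<lambda>r. n - r" "\<lambda>r. n - r"]) auto
  finally show ?thesis
    by (simp only: shift_nth sc_prod')
qed

lemma bianalytic_mult: "bianalytic (\<lambda>a b. shift a F * shift b G)"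
  unfolding bianalytic_def shift_mult_nth by (rule exI, intro allI, rule refl)

lemma bianalytic_mult': "bianalytic (\<lambda>a b. shift b G * shift a F)"
  unfolding bianalytic_def shift_mult_nth' by (rule exI, intro allI, rule refl)

lemma bianalytic_add: "bianalytic \<beta> \<Longrightarrow> bianalytic \<gamma> \<Longrightarrow> bianalytic (\<lambda>a b. \<beta> a b + \<gamma> a b)"
  unfolding bianalytic_def
proof (elim exE)
  fix x y
  assume *: "\<forall>a b n. fps_nth (\<beta> a b) n = (\<Sum>r\<le>n. sc (q powi (s * a * int r) * q powi (s * b * int (n - r))) * x r (n - r))"
    "\<forall>a b n. fps_nth (\<gamma> a b) n = (\<Sum>r\<le>n. sc (q powi (s * a * int r) * q powi (s * b * int (n - r))) * y r (n - r))"
  show "\<exists>x. \<forall>a b n. fps_nth (\<beta> a b + \<gamma> a b) n =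
      (\<Sum>r\<le>n. sc (q powi (s * a * int r) * q powi (s * b * int (n - r))) * x r (n - r))"
    by (rule exI[of _ "\<lambda>r t. x r t + y r t"]) (simp add: * distrib_left sum.distrib)
qed

lemma bianalytic_scale: "bianalytic \<beta> \<Longrightarrow> bianalytic (\<lambda>a b. fsc c * \<beta> a b)"
  unfolding bianalytic_def
proof (elim exE)
  fix x
  assume *: "\<forall>a b n. fps_nth (\<beta> a b) n = (\<Sum>r\<le>n. sc (q powi (s * a * int r) * q powi (s * b * int (n - r))) * x r (n - r))"
  show "\<exists>x. \<forall>a b n. fps_nth (fsc c * \<beta> a b) n =
      (\<Sum>r\<le>n. sc (q powi (s * a * int r) * q powi (s * b * int (n - r))) * x r (n - r))"
    by (rule exI[of _ "\<lambda>r t. sc c * x r t"])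
      (simp only: * fsc_nth sum_distrib_left sc_swap3 simp_thms)
qed

lemma bianalytic_diff: "bianalytic \<beta> \<Longrightarrow> bianalytic \<gamma> \<Longrightarrow> bianalytic (\<lambda>a b. \<beta> a b - \<gamma> a b)"
  using bianalytic_add[of \<beta> "\<lambda>a b. fsc (- 1) * \<gamma> a b"] bianalytic_scale[of \<gamma> "- 1"]
  by (simp add: fsc_def sc_minus fps_const_neg[symmetric])

lemma bianalytic_0: "bianalytic (\<lambda>a b. 0)"
  using bianalytic_scale[OF bianalytic_mult[of 0 0], of 0] by simp

lemma bianalytic_sum: "(\<And>i. i \<in> I \<Longrightarrow> bianalytic (\<beta> i)) \<Longrightarrow> bianalytic (\<lambda>a b. \<Sum>i\<in>I. \<beta> i a b)"
  by (induction I rule: infinite_finite_induct) (auto intro!: bianalytic_add bianalytic_0)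

text \<open>Elimination of one node: multiplying each x r by \<mu> r - \<mu> i removes the node i
  and preserves the hypothesis. The unknowns lie in a noncommutative ring, but only scalars get
  cancelled. The powers start at 1 because a = 0 is to be avoided in the application.\<close>

lemma vandermonde:
  assumes "finite I" "inj_on \<mu> I" "\<And>r. r \<in> I \<Longrightarrow> \<mu> r \<noteq> 0"
    and "\<And>a::nat. a \<ge> 1 \<Longrightarrow> (\<Sum>r\<in>I. sc (\<mu> r ^ a) * x r) = 0" and "r \<in> I"
  shows "x r = (0 :: 'a)"
  using assms
proof (induction I arbitrary: x r rule: finite_induct)
  case (insert i I)
  have *: "x r = 0" if "r \<in> I" for r
  proof -
    have "sc (\<mu> r - \<mu> i) * x r = 0"
    proof (rule insert.IH)
      fix a :: nat assume a: "a \<ge> 1"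
      have "(\<Sum>r\<in>I. sc (\<mu> r ^ a) * (sc (\<mu> r - \<mu> i) * x r)) =
        (\<Sum>r\<in>insert i I. sc (\<mu> r ^ a) * (sc (\<mu> r - \<mu> i) * x r))"
        using insert by simp
      also have "\<dots> = (\<Sum>r\<in>insert i I. sc (\<mu> r ^ Suc a) * x r) - sc (\<mu> i) * (\<Sum>r\<in>insert i I. sc (\<mu> r ^ a) * x r)"
        unfolding sum_distrib_left sum_subtractf[symmetric]
      proof (intro sum.cong refl)
        fix r
        have "\<mu> r ^ a * (\<mu> r - \<mu> i) = \<mu> r ^ Suc a + - (\<mu> i * \<mu> r ^ a)"
          by (simp add: algebra_simps)
        then show "sc (\<mu> r ^ a) * (sc (\<mu> r - \<mu> i) * x r) = sc (\<mu> r ^ Suc a) * x r - sc (\<mu> i) * (sc (\<mu> r ^ a) * x r)"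
          by (simp only: sc_mult_assoc sc_add sc_minus distrib_right) (simp only: diff_conv_add_uminus mult_minus_left)
      qed
      also have "\<dots> = 0"
        using insert.prems(3)[of a] insert.prems(3)[of "Suc a"] a by (simp only:) simp
      finally show "(\<Sum>r\<in>I. sc (\<mu> r ^ a) * (sc (\<mu> r - \<mu> i) * x r)) = 0" .
    qed (use insert.prems that in \<open>auto simp: inj_on_insert\<close>)
    moreover have "\<mu> r - \<mu> i \<noteq> 0"
      using insert.prems(1) insert.hyps(2) that by (auto simp: inj_on_def)
    ultimately show ?thesis using sc_cancel[of "\<mu> r - \<mu> i" "x r" 0] by simp
  qed
  have "sc (\<mu> i) * x i = 0"
    using insert.prems(3)[of 1] insert.hyps * by simp
  then have "x i = 0"
    using sc_cancel[of "\<mu> i" "x i" 0] insert.prems(2)[of i] by simp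
  then show ?case using * insert.prems(4) by auto
qed simp

text \<open>The values at b = 0 and a = 1, 2, ... avoid the diagonal a = b and already determine all
  coefficients, because the nodes q^(s r) are distinct.\<close>

lemma bianalytic_eq_0:
  assumes "bianalytic \<beta>" "\<And>a b. a \<noteq> b \<Longrightarrow> \<beta> a b = 0"
  shows "\<beta> a b = 0"
proof -
  obtain x where x: "\<And>a b n. fps_nth (\<beta> a b) n =
     (\<Sum>r\<le>n. sc (q powi (s * a * int r) * q powi (s * b * int (n - r))) * x r (n - r))"
    using assms(1) unfolding bianalytic_def by blast
  have "x r (n - r) = 0" if "r \<le> n" for r n
  proof (rule vandermonde[of "{..n}" "\<lambda>r. q powi (s * int r)" "\<lambda>r. x r (n - r)"])
    show "inj_on (\<lambda>r. q powi (s * int r)) {..n}"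
      using s_nz by (auto simp: inj_on_def q_powi_inj)
    fix a :: nat assume "a \<ge> 1"
    then have "fps_nth (\<beta> (int a) 0) n = 0" using assms(2)[of "int a" 0] by simp
    moreover have "(q powi (s * int r)) ^ a = q powi (s * int a * int r)" for r
      by (simp add: power_int_mult[symmetric] power_int_of_nat[symmetric] mult_ac del: power_int_of_nat)
    ultimately show "(\<Sum>r\<le>n. sc ((q powi (s * int r)) ^ a) * x r (n - r)) = 0"
      by (simp add: x)
  qed (use that in auto)
  then show ?thesis
    by (intro fps_ext) (simp add: x)
qed

end

context scalar_ring
begin

lemma scalar_ring_power: "parity m i = p \<Longrightarrow> scalar_ring sc (q powi gr m i)"
proof
  show "n = 0" if "(q powi gr m i) powi n = 1" for n
  proof -
    have "gr m i * n = 0"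
      using that by (intro q_powi) (simp add: power_int_mult)
    moreover have "gr m i \<noteq> 0" by (rule parity_cases[of m i]) (simp_all add: gr_def)
    ultimately show ?thesis by simp
  qed
qed (rule sc_add sc_mult sc_1 sc_central | simp)+

end

context rll
begin

text \<open>At this b the coefficient \<open>rho j j\<close> vanishes, which gives the first
  relation. For the second, the relations with columns (j, l) and (l, j) have proportional
  right-hand sides, so the products in reversed order can be eliminated.\<close>

lemma minor_relations:
  assumes I: "i \<in> {1..N}" "j \<in> {1..N}" "k \<in> {1..N}" "l \<in> {1..N}" and ik: "i < k"
    and par: "parity m j = parity m i" "parity m k = parity m i" "parity m l = parity m i"
    and b: "b = a + 2 * gr m i" and Q: "Q = q powi gr m i"
  shows "T a i j * T b k j = sc (1 / Q) * (T a k j * T b i j)" (is ?same)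
    and "j < l \<Longrightarrow> T a i l * T b k j - sc (1 / Q) * (T a k l * T b i j) =
      sc (- 1 / Q) * (T a i j * T b k l - sc (1 / Q) * (T a k j * T b i l))" (is "_ \<Longrightarrow> ?swap")
proof -
  define z where "z = q powi a"
  have z: "z \<noteq> 0" and Qnz: "Q \<noteq> 0" by (simp_all add: z_def Q)
  have "b = a + gr m i + gr m i" by (simp add: b)
  then have zb: "q powi b = z * Q * Q"
    by (simp only: z_def Q power_int_add q_nz simp_thms)
  have Q2: "Q * Q \<noteq> 1"
    using q2 by (rule_tac parity_cases[of m i]) (auto simp: Q gr_def power_int_minus field_simps)
  have Qx: "sg (parity m i * parity m i) * (q - 1 / q) = Q - 1 / Q"
    by (rule parity_cases[of m i]) (auto simp: Q gr_def power_int_minus field_simps)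
  have sg1: "(sg (parity m i * (parity m i + parity m i)) :: 'k) = 1"
    by (rule parity_cases[of m i]) auto
  define t where "t = 1 / (z * (1 - Q * Q))"
  have f: "t * (z * (1 - Q * Q)) = 1" "t * (z * (Q - 1 / Q)) = - 1 / Q" "t * (z * Q * Q * (Q - 1 / Q)) = - Q"
    unfolding t_def using z Qnz Q2 by (simp_all add: field_simps)
  have r1: "t * rho q m a b x y = 1" if "x \<noteq> y" for x y
    using that f(1) by (simp add: rho_def zb z_def[symmetric] right_diff_distrib mult.assoc)
  have r0: "t * rho q m a b j j = 0"
 by (simp add: rho_def gr_def par zb z_def[symmetric] Q[unfolded gr_def, symmetric])
  have x1: "t * (xi q a b x y * sg (parity m i * parity m i)) = - 1 / Q" if "x < y" for x y
  proof -
    have "t * (xi q a b x y * sg (parity m i * parity m i)) = t * (z * (sg (parity m i * parity m i) * (q - 1 / q)))"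
      using that by (simp add: xi_def z_def)
    also have "\<dots> = - 1 / Q"
      unfolding Qx f ..
    finally show ?thesis .
  qed
  have x2: "t * (xi q a b x y * sg (parity m i * parity m i)) = - Q" if "y < x" for x y
  proof -
    have "t * (xi q a b x y * sg (parity m i * parity m i)) = t * (z * Q * Q * (sg (parity m i * parity m i) * (q - 1 / q)))"
      using that by (simp add: xi_def zb)
    also have "\<dots> = - Q"
      unfolding Qx f ..
    finally show ?thesis .
  qed
  have x0: "xi q a b j j = 0" by (simp add: xi_def)
  have ne: "i \<noteq> k" using ik by simp
  note P = sc_scale[where t = t]
  have "sc 1 * (T a i j * T b k j) + sc (- 1 / Q) * (T a k j * T b i j) = sc 0 * (T b k j * T a i j) + sc 0 * (T b k j * T a i j)"
    by (rule P[OF prel[of i j k j a b]])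
      (use I in \<open>simp_all only: par sg1 mult_1_right r1[OF ne] r0 x1[OF ik] x0 mult_zero_left mult_zero_right\<close>)
  then show ?same by (simp add: sc_minus)
  assume jl: "j < l"
  then have jl': "j \<noteq> l" "l \<noteq> j" by auto
  have e1: "sc 1 * (T a i j * T b k l) + sc (- 1 / Q) * (T a k j * T b i l) = sc 1 * (T b k l * T a i j) + sc (- Q) * (T b k j * T a i l)"
    by (rule P[OF prel[of i j k l a b]])
      (use I in \<open>simp_all only: par sg1 mult_1_right r1[OF ne] r1[OF jl'(1)] x1[OF ik] x2[OF jl]\<close>)
  have e2: "sc 1 * (T a i l * T b k j) + sc (- 1 / Q) * (T a k l * T b i j) = sc 1 * (T b k j * T a i l) + sc (- 1 / Q) * (T b k l * T a i j)"
    by (rule P[OF prel[of i l k j a b]])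
      (use I in \<open>simp_all only: par sg1 mult_1_right r1[OF ne] r1[OF jl'(2)] x1[OF ik] x1[OF jl]\<close>)
  have e3: "sc (- 1 / Q) * (T a i j * T b k l) + sc (1 / (Q * Q)) * (T a k j * T b i l) = sc (- 1 / Q) * (T b k l * T a i j) + sc 1 * (T b k j * T a i l)"
    by (rule sc_scale[OF e1, where t = "- 1 / Q"]) (use Qnz in \<open>simp_all add: field_simps\<close>)
  have "T a i l * T b k j - sc (1 / Q) * (T a k l * T b i j) = sc 1 * (T a i l * T b k j) + sc (- 1 / Q) * (T a k l * T b i j)"
    by (simp add: sc_minus)
  also have "\<dots> = sc (- 1 / Q) * (T a i j * T b k l) + sc (1 / (Q * Q)) * (T a k j * T b i l)"
    unfolding e2 e3 by (simp only: add.commute)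
  also have "\<dots> = sc (- 1 / Q) * (T a i j * T b k l - sc (1 / Q) * (T a k j * T b i l))"
    by (simp add: right_diff_distrib sc_mult_assoc sc_minus)
  finally show ?swap .
qed

end

text \<open>\<open>Ti i j\<close> is the inverse of the block of \<open>T\<close> on the interval \<open>{i..j}\<close>, and \<open>Yi i j\<close> that of the
  untwisted block over the opposite ring, so that \<open>\<Sum>k. Y\<^sub>k\<^sub>j L\<^sub>i\<^sub>k = \<delta>\<^sub>i\<^sub>j\<close>.\<close>

locale rll_affine = shifts sc q s for sc :: "'k::field \<Rightarrow> 'a::ring_1" and q :: 'k and s :: int +
  fixes m N :: nat and T :: "nat \<Rightarrow> nat \<Rightarrow> 'a fps" and Ti Yi :: "nat \<Rightarrow> nat \<Rightarrow> nat \<Rightarrow> nat \<Rightarrow> 'a fps"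
    and z zi :: "nat \<Rightarrow> 'a"
  assumes rel: "rll fsc q m N (\<lambda>a i j. shift a (T i j))"
    and Ti: "1 \<le> i \<Longrightarrow> j \<le> N \<Longrightarrow> minv {i..j} T (Ti i j)"
    and Yi: "1 \<le> i \<Longrightarrow> j \<le> N \<Longrightarrow> minv {i..j} (\<lambda>k l. Op (fsc (tw m k l) * T k l)) (\<lambda>k l. Op (Yi i j k l))"
    and Ti_const: "1 \<le> i \<Longrightarrow> i \<le> j \<Longrightarrow> j \<le> N \<Longrightarrow> fps_nth (Ti i j j j) 0 = z j"
    and Yi_const: "1 \<le> i \<Longrightarrow> i \<le> j \<Longrightarrow> j \<le> N \<Longrightarrow> fps_nth (Yi i j i i) 0 = z i"
    and z: "t \<in> {1..N} \<Longrightarrow> z t * zi t = 1" "t \<in> {1..N} \<Longrightarrow> zi t * z t = 1"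
begin

abbreviation "To a i j \<equiv> Op (fsc (tw m i j) * shift (- a) (T i j))"

lemma Yi_shift:
  assumes "1 \<le> i" "j \<le> N"
  shows "minv {i..j} (To a) (\<lambda>k l. Op (shift (- a) (Yi i j k l)))"
proof -
  have "fsc (tw m k l) * shift (- a) (T k l) = shift (- a) (fsc (tw m k l) * T k l)" for k l
    by (simp add: shift_mult)
  then show ?thesis
    using Yi[OF assms] unfolding minv_opp
    by (simp only: shift_mult[symmetric] shift_sum[symmetric]) (auto simp del: of_bool_eq_iff)
qed

text \<open>The commutator of a corner entry of the inverse with an entry of the remaining block
  depends bianalytically on the two arguments and vanishes for a \<noteq> b, so
  \<open>bianalytic_eq_0\<close> covers a = b.\<close>

sublocale ord: rll_comm fsc q m N "\<lambda>a i j. shift a (T i j)" "\<lambda>i j a k l. shift a (Ti i j k l)"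
proof -
  interpret r: rll fsc q m N "\<lambda>a i j. shift a (T i j)" by (rule rel)
  show "rll_comm fsc q m N (\<lambda>a i j. shift a (T i j)) (\<lambda>i j a k l. shift a (Ti i j k l))"
  proof unfold_locales
    fix i j :: nat and a :: int assume "1 \<le> i" "j \<le> N"
    then show minv: "minv {i..j} (\<lambda>k l. shift a (T k l)) (\<lambda>k l. shift a (Ti i j k l))"
      by (intro minv_shift Ti)
  next
    fix i j x k l :: nat and a b :: int
    assume ij: "1 \<le> i" "i \<le> j" "j \<le> N" "x = i \<or> x = j" "k \<in> {i..j} - {x}" "l \<in> {i..j} - {x}"
    have "shift b (Ti i j x x) * shift a (T k l) - shift a (T k l) * shift b (Ti i j x x) = 0"
    proof (rule bianalytic_eq_0[where \<beta> = "\<lambda>a b. shift b (Ti i j x x) * shift a (T k l) - shift a (T k l) * shift b (Ti i j x x)"])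
      show "bianalytic (\<lambda>a b. shift b (Ti i j x x) * shift a (T k l) - shift a (T k l) * shift b (Ti i j x x))"
        by (intro bianalytic_diff bianalytic_mult bianalytic_mult')
      fix a b :: int assume "a \<noteq> b"
      then show "shift b (Ti i j x x) * shift a (T k l) - shift a (T k l) * shift b (Ti i j x x) = 0"
        using r.commute_inverse_neq[OF _ _ minv_shift[OF Ti[of i j], of b], of k x l a] ij by auto
    qed
    then show "shift b (Ti i j x x) * shift a (T k l) = shift a (T k l) * shift b (Ti i j x x)" by simp
  qed
qed

sublocale op: rll_comm "\<lambda>c. Op (fsc c)" "inverse q" m N To "\<lambda>i j a k l. Op (shift (- a) (Yi i j k l))"
proof -
  interpret r: rll "\<lambda>c. Op (fsc c)" "inverse q" m N To by (rule rll_opp[OF rel])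
  show "rll_comm (\<lambda>c. Op (fsc c)) (inverse q) m N To (\<lambda>i j a k l. Op (shift (- a) (Yi i j k l)))"
  proof unfold_locales
    fix i j :: nat and a :: int assume "1 \<le> i" "j \<le> N"
    then show minv: "minv {i..j} (To a) (\<lambda>k l. Op (shift (- a) (Yi i j k l)))"
      by (rule Yi_shift)
  next
    fix i j x k l :: nat and a b :: int
    assume ij: "1 \<le> i" "i \<le> j" "j \<le> N" "x = i \<or> x = j" "k \<in> {i..j} - {x}" "l \<in> {i..j} - {x}"
    let ?\<beta> = "\<lambda>a b. fsc (tw m k l) * (shift a (T k l) * shift b (Yi i j x x)) - fsc (tw m k l) * (shift b (Yi i j x x) * shift a (T k l))"
    have "?\<beta> (- a) (- b) = 0"
    proof (rule bianalytic_eq_0[where \<beta> = ?\<beta>])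
      show "bianalytic ?\<beta>"
        by (intro bianalytic_diff bianalytic_scale bianalytic_mult bianalytic_mult')
      fix a b :: int assume "a \<noteq> b"
      then have "Op (shift (- (- b)) (Yi i j x x)) * To (- a) k l = To (- a) k l * Op (shift (- (- b)) (Yi i j x x))"
        using ij by (intro r.commute_inverse_neq[OF _ _ Yi_shift[of i j "- b"], of k x l "- a"]) auto
      then have "unop (Op (shift (- (- b)) (Yi i j x x)) * To (- a) k l) = unop (To (- a) k l * Op (shift (- (- b)) (Yi i j x x)))"
        by simp
      then show "?\<beta> a b = 0"
        by (simp add: ord.sc_left mult.assoc)
    qed
    then have "unop (Op (shift (- b) (Yi i j x x)) * To a k l) = unop (To a k l * Op (shift (- b) (Yi i j x x)))"
      by (simp add: ord.sc_left mult.assoc)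
    then show "Op (shift (- b) (Yi i j x x)) * To a k l = To a k l * Op (shift (- b) (Yi i j x x))"
      by (rule opp_eqI)
  qed
qed

end

lemma unop_prod_list: "unop (prod_list xs) = prod_list (rev (map unop xs))"
  by (induction xs) simp_all

context rll_affine
begin

lemma even_parity: "parity m j = 0 \<Longrightarrow> i \<le> j \<Longrightarrow> parity m i = 0"
  by (auto simp: parity_def split: if_splits)

lemma odd_parity: "parity m i = 1 \<Longrightarrow> i \<le> j \<Longrightarrow> parity m j = 1"
  by (auto simp: parity_def split: if_splits)

text \<open>The element o at z q^e. Arguments are inverted over the opposite ring; the offset 2 - 2
  hh is such that, when o is built from its first index, the factor of index t stands at the same
  argument as in \<open>ord.ber i j e\<close>.\<close>

abbreviation (input) ob :: "nat \<Rightarrow> nat \<Rightarrow> int \<Rightarrow> 'a fps" where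
  "ob i j e \<equiv> unop (op.ber i j (2 - 2 * hh m i j - e))"

lemma ob_dn:
  assumes "1 \<le> i" "i \<le> j" "j \<le> N"
  shows "ob i j e = unop (op.dn i j (2 * int (parity m i) - e)) * ob (Suc i) j (e + 2 * gr m i)"
proof -
  have e1: "2 - 2 * hh m i j - e = 2 - 2 * hh m (Suc i) j - (e + 2 * gr m i)"
    using hh_Cons[OF assms(2), of m] by simp
  have e2: "2 - 2 * hh m i j - e + 2 * hh m (Suc i) j - 2 * int (parity m i) = 2 * int (parity m i) - e"
    using hh_Cons[OF assms(2), of m] by (simp add: gr_def)
  show ?thesis
    unfolding op.ber_dn[OF assms, of "2 - 2 * hh m i j - e"] unop_simps e2 unfolding e1 ..
qed

lemma ob_up:
  assumes "1 \<le> i" "i \<le> j"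
  shows "ob i j e = unop (op.up i j (2 * int (parity m j) - e)) * ob i (j - 1) (e + 2 * gr m j)"
proof -
  have e1: "2 - 2 * hh m i j - e = 2 - 2 * hh m i (j - 1) - (e + 2 * gr m j)"
    using hh_snoc[OF assms, of m] by simp
  have e2: "2 - 2 * hh m i j - e + 2 * hh m i (j - 1) - 2 * int (parity m j) = 2 * int (parity m j) - e"
    using hh_snoc[OF assms, of m] by (simp add: gr_def)
  show ?thesis
    unfolding op.ber_snoc[OF assms, of "2 - 2 * hh m i j - e"] unop_simps e2 unfolding e1 ..
qed

lemma shift_dsch: "shift c (ord.dsch i j a x) = ord.dsch i j (a + c) x"
  by (simp add: ord.dsch_def schur_def shift_diff shift_sum shift_mult shift_shift add.commute)

lemma shift_up: "shift c (ord.up i j a) = ord.up i j (a + c)"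
  by (simp add: ord.up_def shift_dsch shift_shift add.commute)

lemma shift_ber: "shift c (ord.ber i j e) = ord.ber i j (e + c)"
  by (simp add: ord.ber_def shift_prod_list shift_up o_def algebra_simps del: upt_Suc)

lemma shift_op_dsch: "shift c (unop (op.dsch i j a x)) = unop (op.dsch i j (a - c) x)"
  by (simp add: op.dsch_def schur_def shift_diff shift_sum shift_mult shift_shift unop_sum)

lemma shift_op_up: "shift c (unop (op.up i j a)) = unop (op.up i j (a - c))"
  by (simp add: op.up_def shift_op_dsch shift_shift)

lemma shift_op_ber: "shift c (unop (op.ber i j e)) = unop (op.ber i j (e - c))"
  by (simp add: op.ber_def unop_prod_list shift_prod_list rev_map[symmetric] shift_op_up o_def algebra_simps del: upt_Suc)

text \<open>Commutation at all integer shifts is separated into commutation of coefficients by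
  \<open>vandermonde\<close>, applied to the terms of total degree r + t.\<close>

lemma commute_coeff:
  assumes "\<And>a b. shift a F * shift b G = shift b G * shift a F"
  shows "fps_nth F r * fps_nth G t = fps_nth G t * fps_nth F r"
proof -
  let ?n = "r + t"
  have "fps_nth F r * fps_nth G (?n - r) - fps_nth G (?n - r) * fps_nth F r = 0"
  proof (rule vandermonde[of "{..?n}" "\<lambda>r. q powi (s * int r)"
        "\<lambda>r. fps_nth F r * fps_nth G (?n - r) - fps_nth G (?n - r) * fps_nth F r"])
    show "inj_on (\<lambda>r. q powi (s * int r)) {..?n}"
      using s_nz by (auto simp: inj_on_def q_powi_inj)
    fix a :: nat
    have p: "(q powi (s * int r)) ^ a = q powi (s * int a * int r)" for r
      by (simp add: power_int_mult[symmetric] power_int_of_nat[symmetric] mult_ac del: power_int_of_nat)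
    have "0 = fps_nth (shift (int a) F * shift 0 G) ?n - fps_nth (shift 0 G * shift (int a) F) ?n"
      using assms[of "int a" 0] by simp
    also have "fps_nth (shift (int a) F * shift 0 G) ?n = (\<Sum>r\<le>?n. sc (q powi (s * int a * int r)) * (fps_nth F r * fps_nth G (?n - r)))"
      by (simp add: fps_mult_nth atMost_atLeast0 mult.assoc)
    also have "fps_nth (shift 0 G * shift (int a) F) ?n = (\<Sum>r\<le>?n. fps_nth G r * fps_nth (shift (int a) F) (?n - r))"
      by (simp add: fps_mult_nth atMost_atLeast0)
    also have "\<dots> = (\<Sum>r\<le>?n. fps_nth G (?n - r) * fps_nth (shift (int a) F) r)"
      by (rule sum.reindex_bij_witness[of _ "\<lambda>r. ?n - r" "\<lambda>r. ?n - r"]) auto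
    also have "\<dots> = (\<Sum>r\<le>?n. sc (q powi (s * int a * int r)) * (fps_nth G (?n - r) * fps_nth F r))"
      by (intro sum.cong refl) (simp add: sc_left)
    finally show "(\<Sum>r\<le>?n. sc ((q powi (s * int r)) ^ a) * (fps_nth F r * fps_nth G (?n - r) - fps_nth G (?n - r) * fps_nth F r)) = 0"
      by (simp add: p right_diff_distrib sum_subtractf)
  qed auto
  then show ?thesis by simp
qed

lemma inverse_const:
  assumes "F * G = 1" "fps_nth F 0 = u" "v * u = 1"
  shows "fps_nth G 0 = (v :: 'a)"
proof -
  have "fps_nth F 0 * fps_nth G 0 = 1"
    using assms(1) by (metis fps_mult_nth_0 fps_one_nth)
  then have "v * (u * fps_nth G 0) = v" using assms by simp
  then show ?thesis using assms by (simp add: mult.assoc[symmetric])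
qed

lemma up_const:
  assumes "1 \<le> i" "i \<le> j" "j \<le> N"
  shows "fps_nth (ord.up i j a) 0 = (if parity m j = 0 then zi j else z j)"
  using inverse_const[OF ord.dsch_up(1)[OF assms, of a], of "z j" "zi j"] Ti_const[OF assms] z[of j] assms
  by (auto simp: ord.up_def)

lemma op_dn_const:
  assumes "1 \<le> i" "i \<le> j" "j \<le> N"
  shows "fps_nth (unop (op.dn i j a)) 0 = (if parity m i = 0 then zi i else z i)"
proof -
  have "shift (- a) (Yi i j i i) * unop (op.dsch (Suc i) j a i) = 1"
    using arg_cong[OF op.dsch_dn(2)[OF assms, of a], of unop] by simp
  then show ?thesis
    using inverse_const[of "shift (- a) (Yi i j i i)" "unop (op.dsch (Suc i) j a i)" "z i" "zi i"]
      Yi_const[OF assms] z[of i] assms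
    by (auto simp: op.dn_def)
qed

lemma ber_const:
  assumes "1 \<le> i" "j \<le> N"
  shows "fps_nth (ord.ber i j e) 0 = prod_list (map (\<lambda>t. if parity m t = 0 then zi t else z t) [i..<Suc j])"
  using assms(2)
proof (induction j)
  case (Suc j)
  show ?case
  proof (cases "i \<le> Suc j")
    case True
    then show ?thesis
      using Suc ord.ber_snoc[of i "Suc j" e] assms up_const[of i "Suc j"] by simp
  qed simp
qed (use assms in simp)

lemma ob_const:
  assumes "1 \<le> i" "j \<le> N"
  shows "fps_nth (ob i j e) 0 = prod_list (map (\<lambda>t. if parity m t = 0 then zi t else z t) [i..<Suc j])"
proof (cases "i \<le> Suc j")
  case True
  then show ?thesis using assms(1)
  proof (induction i arbitrary: e rule: inc_induct)
    case (step n)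
    have "[n..<Suc j] = n # [Suc n..<Suc j]" using step by (simp add: upt_conv_Cons)
    then show ?case
      using step ob_dn[of n j e] assms op_dn_const[of n j] by (simp del: upt_Suc)
  qed simp
qed simp

section \<open>Equality of the two products on intervals of constant parity\<close>

lemma qminor_even:
  assumes "j \<le> N" and even: "parity m j = 0"
  shows "qminor fsc q (\<lambda>a i j. shift a (T i j)) {1..j}"
proof unfold_locales
  fix x y u v :: nat and a :: int
  assume "x \<in> {1..j}" "y \<in> {1..j}" "u \<in> {1..j}" "x < y"
  then show "shift a (T x u) * shift (a + 2) (T y u) = fsc (1 / q) * (shift a (T y u) * shift (a + 2) (T x u))"
    using ord.minor_relations(1)[of x u y u "a + 2" a q] even_parity[OF even] assms by (auto simp: gr_def)
next
  fix x y u v :: nat and a :: int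
  assume "x \<in> {1..j}" "y \<in> {1..j}" "u \<in> {1..j}" "v \<in> {1..j}" "x < y" "u < v"
  then show "shift a (T x v) * shift (a + 2) (T y u) - fsc (1 / q) * (shift a (T y v) * shift (a + 2) (T x u)) =
     fsc (- 1 / q) * (shift a (T x u) * shift (a + 2) (T y v) - fsc (1 / q) * (shift a (T y u) * shift (a + 2) (T x v)))"
    using ord.minor_relations(2)[of x u y v "a + 2" a q] even_parity[OF even] assms by (auto simp: gr_def)
qed

text \<open>Both are the quantum minor of the interval: b grows at its right end by
  \<open>qm_last\<close>, and o at its left end by \<open>qm_first\<close>. On even indices the sign
  twist is trivial, so Y is a transposed inverse of T itself.\<close>

lemma ber_eq_ob_even:
  assumes ij: "1 \<le> i" "j \<le> N" and even: "parity m j = 0"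
  shows "ord.ber i j e = ob i j e"
    and "ord.ber i j e = qminor.qm fsc q (\<lambda>a i j. shift a (T i j)) [i..<Suc j] e {i..j}"
proof -
  interpret qm: qminor fsc q "\<lambda>a i j. shift a (T i j)" "{1..j}"
    by (rule qminor_even[OF ij(2) even])
  have hh: "hh m i k = int (k + 1 - i)" if "k \<le> j" for i k
    using even_parity[OF even] that by (cases "i \<le> k + 1") (auto simp: hh_def gr_def of_nat_diff)
  have "ord.ber i k e = qm.qm [i..<Suc k] e {i..k}" if "k \<le> j" for k
    using that
  proof (induction k)
    case 0
    then show ?case using ij by simp
  next
    case (Suc k)
    show ?case
    proof (cases "i \<le> Suc k")
      case True
      let ?a = "e + 2 * int (Suc k - i)"
      let ?B = "shift ?a (Ti i (Suc k) (Suc k) (Suc k))"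
      have p: "parity m (Suc k) = 0" using even_parity[OF even] Suc by simp
      have "e + 2 * hh m i k - 2 * int (parity m (Suc k)) = ?a"
        using hh[of k i] Suc p by simp
      then have "ord.ber i (Suc k) e = ord.ber i k e * ord.dsch i k ?a (Suc k)"
        using ord.ber_snoc[of i "Suc k" e] True ij p by (simp add: ord.up_def)
      also have "ord.ber i k e = qm.qm [i..<Suc k] e {i..<Suc k}"
        using Suc by (simp add: atLeastLessThanSuc_atLeastAtMost del: upt_Suc)
      also have "\<dots> = qm.qm [i..<Suc (Suc k)] e {i..Suc k} * ?B"
        by (rule qm.qm_last[OF _ True]) (use ij Suc in \<open>auto intro!: minv_shift Ti\<close>)
      also have "\<dots> * ord.dsch i k ?a (Suc k) = qm.qm [i..<Suc (Suc k)] e {i..Suc k}"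
        using ord.dsch_up(1)[of i "Suc k" ?a] True ij Suc by (simp add: mult.assoc del: upt_Suc qm.qm.simps)
      finally show ?thesis .
    qed simp
  qed
  then show b: "ord.ber i j e = qm.qm [i..<Suc j] e {i..j}" by simp
  have "ob n j e = qm.qm [n..<Suc j] e {n..j}" if "n \<le> Suc j" "1 \<le> n" for n e
    using that
  proof (induction n arbitrary: e rule: inc_induct)
    case (step n)
    let ?B = "\<lambda>x y. shift e (Yi n j x y)"
    have p: "parity m n = 0" using even_parity[OF even] step by simp
    have "ob n j e = unop (op.dsch (Suc n) j (- e) n) * ob (Suc n) j (e + 2)"
      using ob_dn[of n j e] step ij p by (simp add: op.dn_def gr_def)
    also have "ob (Suc n) j (e + 2) = qm.qm [Suc n..<Suc j] (e + 2) {Suc n..j}"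
      using step.IH[of "e + 2"] by (simp del: upt_Suc)
    also have "\<dots> = ?B n n * qm.qm [n..<Suc j] e {n..j}"
    proof (rule qm.qm_first[where B = ?B])
      fix x y assume xy: "x \<in> {n..j}" "y \<in> {n..j}"
      have "(\<Sum>c\<in>{n..j}. ?B c y * shift e (T x c)) = (\<Sum>c\<in>{n..j}. ?B c y * (fsc (tw m x c) * shift e (T x c)))"
        using xy even_parity[OF even] by (intro sum.cong refl) (simp add: tw_def ord.sc_1)
      also have "\<dots> = of_bool (x = y)"
        using Yi_shift[of n j "- e"] step ij xy unfolding minv_opp by simp
      finally show "(\<Sum>c\<in>{n..j}. ?B c y * shift e (T x c)) = of_bool (x = y)" .
    qed (use step in auto)
    also have "unop (op.dsch (Suc n) j (- e) n) * (?B n n * qm.qm [n..<Suc j] e {n..j}) = qm.qm [n..<Suc j] e {n..j}"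
      using arg_cong[OF op.dsch_dn(1)[of n j "- e"], of unop] step ij
      by (simp add: mult.assoc[symmetric] del: upt_Suc qm.qm.simps)
    finally show ?case .
  qed simp
  then show "ord.ber i j e = ob i j e"
    using b ij by (cases "i \<le> Suc j") auto
qed

text \<open>For odd indices the factors are entries of inverses, so both products invert the quantum
  minor for q^-1, with arguments decreasing from z q^(e-2): b is a right inverse of it and o a left
  inverse, hence they agree.\<close>

lemma ber_eq_ob_odd:
  assumes ij: "1 \<le> i" "j \<le> N" and odd: "parity m i = 1"
  shows "ord.ber i j e = ob i j e"
proof (cases "i \<le> j")
  case False
  then show ?thesis by simp
next
  case True
  interpret qm: qminor fsc "inverse q" "\<lambda>a i j. shift (- a) (T i j)" "{i..j}"
  proof (intro qminor.intro qminor_axioms.intro)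
    show "scalar_ring fsc (inverse q)"
      using ord.scalar_ring_power[OF odd] odd by (simp add: gr_def power_int_minus)
    fix x y u v :: nat and a :: int
    assume "x \<in> {i..j}" "y \<in> {i..j}" "u \<in> {i..j}" "x < y"
    then show "shift (- a) (T x u) * shift (- (a + 2)) (T y u) = fsc (1 / inverse q) * (shift (- a) (T y u) * shift (- (a + 2)) (T x u))"
      using ord.minor_relations(1)[of x u y u "- (a + 2)" "- a" "inverse q"] odd_parity[OF odd] ij
      by (auto simp: gr_def power_int_minus)
  next
    fix x y u v :: nat and a :: int
    assume "x \<in> {i..j}" "y \<in> {i..j}" "u \<in> {i..j}" "v \<in> {i..j}" "x < y" "u < v"
    then show "shift (- a) (T x v) * shift (- (a + 2)) (T y u) - fsc (1 / inverse q) * (shift (- a) (T y v) * shift (- (a + 2)) (T x u)) =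
       fsc (- 1 / inverse q) * (shift (- a) (T x u) * shift (- (a + 2)) (T y v) - fsc (1 / inverse q) * (shift (- a) (T y u) * shift (- (a + 2)) (T x v)))"
      using ord.minor_relations(2)[of x u y v "- (a + 2)" "- a" "inverse q"] odd_parity[OF odd] ij
      by (auto simp: gr_def power_int_minus)
  qed
  have hh: "hh m i k = - int (k + 1 - i)" for k
    using odd_parity[OF odd] by (cases "i \<le> k + 1") (auto simp: hh_def gr_def of_nat_diff sum_negf)
  have D: "qm.qm [i..<Suc k] (2 - e) {i..k} * ord.ber i k e = 1" if "k \<le> j" for k
    using that
  proof (induction k)
    case 0
    then show ?case using ij by simp
  next
    case (Suc k)
    show ?case
    proof (cases "i \<le> Suc k")
      case True
      let ?a = "2 - e + 2 * int (Suc k - i)"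
      let ?U = "shift (- ?a) (Ti i (Suc k) (Suc k) (Suc k))"
      have p: "parity m (Suc k) = 1" using odd_parity[OF odd] True by simp
      have "e + 2 * hh m i k - 2 * int (parity m (Suc k)) = - ?a"
        using hh[of k] p by simp
      then have U: "ord.up i (Suc k) (e + 2 * hh m i k - 2 * int (parity m (Suc k))) = ?U"
        using p by (simp only: ord.up_def) simp
      \<comment> \<open>\<open>qm_last\<close> puts the entry of the inverse directly to the right
        of the minor, so the new factor has to move in front of the earlier ones.\<close>
      have "?U * ord.ber i k e = ord.ber i k e * ?U"
        unfolding U[symmetric] by (rule ord.commute_ber) (use ij True Suc in \<open>auto intro!: ord.up_comm\<close>)
      then have "ord.ber i (Suc k) e = ?U * ord.ber i k e"
        using ord.ber_snoc[of i "Suc k" e] True ij U by simp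
      then have "qm.qm [i..<Suc (Suc k)] (2 - e) {i..Suc k} * ord.ber i (Suc k) e =
          qm.qm [i..<Suc (Suc k)] (2 - e) {i..Suc k} * ?U * ord.ber i k e"
        by (simp only: mult.assoc)
      also have "qm.qm [i..<Suc (Suc k)] (2 - e) {i..Suc k} * ?U = qm.qm [i..<Suc k] (2 - e) {i..<Suc k}"
        by (rule qm.qm_last[OF _ True, symmetric]) (use ij Suc in \<open>auto intro!: minv_shift Ti\<close>)
      also have "\<dots> * ord.ber i k e = 1"
        using Suc by (simp add: atLeastLessThanSuc_atLeastAtMost del: upt_Suc qm.qm.simps)
      finally show ?thesis .
    qed simp
  qed
  have "ob n j e * qm.qm [n..<Suc j] (2 - e) {n..j} = 1" if "n \<le> Suc j" "i \<le> n" for n e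
    using that
  proof (induction n arbitrary: e rule: inc_induct)
    case (step n)
    let ?B = "\<lambda>x y. shift (- (2 - e)) (Yi n j x y)"
    have p: "parity m n = 1" using odd_parity[OF odd] step by simp
    have n: "1 \<le> n" "n \<le> j" using step ij by auto
    have dn: "op.dn n j (2 - e) = Op (?B n n)"
      using p by (simp add: op.dn_def)
    have "op.dn n j (2 - e) * op.ber (Suc n) j (2 - 2 * hh m (Suc n) j - (e - 2)) =
        op.ber (Suc n) j (2 - 2 * hh m (Suc n) j - (e - 2)) * op.dn n j (2 - e)"
      by (rule op.commute_ber) (use n ij in \<open>auto intro!: op.dn_comm simp del: unop_simps\<close>)
    from arg_cong[OF this, of unop]
    have "ob n j e = ob (Suc n) j (e - 2) * ?B n n"
      using ob_dn[of n j e] n ij p unfolding dn by (simp add: gr_def dn)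
    then have "ob n j e * qm.qm [n..<Suc j] (2 - e) {n..j} = ob (Suc n) j (e - 2) * (?B n n * qm.qm [n..<Suc j] (2 - e) {n..j})"
      by (simp only: mult.assoc)
    also have "?B n n * qm.qm [n..<Suc j] (2 - e) {n..j} = qm.qm [Suc n..<Suc j] (2 - e + 2) {Suc n..j}"
    proof (rule qm.qm_first[where B = ?B, symmetric])
      fix x y assume xy: "x \<in> {n..j}" "y \<in> {n..j}"
      have "(\<Sum>c\<in>{n..j}. ?B c y * shift (- (2 - e)) (T x c)) = (\<Sum>c\<in>{n..j}. ?B c y * (fsc (tw m x c) * shift (- (2 - e)) (T x c)))"
        using xy odd_parity[OF odd] step by (intro sum.cong refl) (simp add: tw_def ord.sc_1)
      also have "\<dots> = of_bool (x = y)"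
        using Yi_shift[of n j "2 - e"] n ij xy unfolding minv_opp by simp
      finally show "(\<Sum>c\<in>{n..j}. ?B c y * shift (- (2 - e)) (T x c)) = of_bool (x = y)" .
    qed (use step in auto)
    also have "2 - e + 2 = 2 - (e - 2)" by simp
    also have "ob (Suc n) j (e - 2) * qm.qm [Suc n..<Suc j] (2 - (e - 2)) {Suc n..j} = 1"
      using step.IH[of "e - 2"] step.prems by (simp del: upt_Suc)
    finally show ?case .
  qed simp
  from this[of i e] have "ob i j e * qm.qm [i..<Suc j] (2 - e) {i..j} = 1" using True by (simp del: upt_Suc)
  moreover have "ob i j e * qm.qm [i..<Suc j] (2 - e) {i..j} * ord.ber i j e = ob i j e"
    using D[of j] by (simp only: mult.assoc) simp
  ultimately show ?thesis by simp
qed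

section \<open>Crossing symmetry\<close>

text \<open>The left null vector of the matrix \<open>cross\<close> at \<open>w = z q\<^sup>2\<^sup>h\<close>.\<close>

definition cv :: "nat \<Rightarrow> nat \<Rightarrow> 'k" where
  "cv i t = sg (parity m t) * q powi (- 2 * hh m i (t - 1)) / q powi gr m t"

text \<open>Up to signs, the partially transposed R-matrix on the span of the vectors e_t \<otimes>
  e_t.\<close>

definition cross :: "int \<Rightarrow> int \<Rightarrow> nat \<Rightarrow> nat \<Rightarrow> 'k" where
  "cross a b t u = (if t = u then sg (parity m t) * rho q m a b t t else xi q a b t u)"

lemma cv_nz: "cv i t \<noteq> 0"
  by (simp add: cv_def)

lemma cv_step:
  assumes "1 \<le> i" "i \<le> t"
  shows "(q - 1 / q) * cv i t = q powi (- 2 * hh m i (t - 1)) - q powi (- 2 * hh m i t)"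
proof -
  have h: "- 2 * hh m i t = - 2 * hh m i (t - 1) + (- 2 * gr m t)"
    using hh_snoc[OF assms, of m] by simp
  have "q powi (- 2 * hh m i t) = q powi (- 2 * hh m i (t - 1)) * q powi (- 2 * gr m t)"
    unfolding h by (simp only: power_int_add q_nz simp_thms)
  then show ?thesis
    by (rule_tac parity_cases[of m t])
      (auto simp: cv_def gr_def power_int_minus field_simps power2_eq_square)
qed

lemma cv_sum:
  assumes "1 \<le> i" "i \<le> u" "u \<le> v"
  shows "(\<Sum>t = u..<v. (q - 1 / q) * cv i t) = q powi (- 2 * hh m i (u - 1)) - q powi (- 2 * hh m i (v - 1))"
  using assms(3)
proof (induction v rule: dec_induct)
  case (step v)
  then show ?case using cv_step[of i v] assms by simp
qed simp

text \<open>By \<open>cv_step\<close> the weighted entries above and below the diagonal telescope;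
  together with the diagonal entry the sum no longer depends on u. It vanishes for a = b - 2h, the
  crossing point.\<close>

lemma cross_column:
  assumes "1 \<le> i" "u \<in> {i..j}"
  shows "(\<Sum>t = i..j. cv i t * cross a b t u) = q powi a - q powi b * q powi (- 2 * hh m i j)"
proof -
  have iu: "i \<le> u" "u \<le> j" using assms by auto
  have "(\<Sum>t = i..j. cv i t * cross a b t u) = (\<Sum>t = i..<Suc j. cv i t * cross a b t u)"
    by (simp add: atLeastLessThanSuc_atLeastAtMost)
  also have "\<dots> = (\<Sum>t = i..<u. cv i t * cross a b t u) + (\<Sum>t = u..<Suc j. cv i t * cross a b t u)"
    using iu by (simp add: sum.atLeastLessThan_concat)
  also have "(\<Sum>t = u..<Suc j. cv i t * cross a b t u) = cv i u * cross a b u u + (\<Sum>t = Suc u..<Suc j. cv i t * cross a b t u)"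
    by (rule sum.atLeast_Suc_lessThan) (use iu in simp)
  also have "(\<Sum>t = i..<u. cv i t * cross a b t u) = (\<Sum>t = i..<u. q powi a * ((q - 1 / q) * cv i t))"
    by (intro sum.cong refl) (simp add: cross_def xi_def)
  also have "\<dots> = q powi a * (1 - q powi (- 2 * hh m i (u - 1)))"
    using cv_sum[of i i u] iu assms by (simp only: sum_distrib_left[of "q powi a", symmetric]) simp
  also have "(\<Sum>t = Suc u..<Suc j. cv i t * cross a b t u) = (\<Sum>t = Suc u..<Suc j. q powi b * ((q - 1 / q) * cv i t))"
    by (intro sum.cong refl) (simp add: cross_def xi_def)
  also have "\<dots> = q powi b * (q powi (- 2 * hh m i u) - q powi (- 2 * hh m i j))"
    using cv_sum[of i "Suc u" "Suc j"] iu assms by (simp only: sum_distrib_left[of "q powi b", symmetric]) simp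
  also have "cv i u * cross a b u u = q powi a * q powi (- 2 * hh m i (u - 1)) - q powi b * q powi (- 2 * hh m i u)"
  proof -
    have h: "- 2 * hh m i u = - 2 * hh m i (u - 1) + (- 2 * gr m u)"
      using hh_snoc[OF assms(1) iu(1), of m] by simp
    have "q powi (- 2 * hh m i u) = q powi (- 2 * hh m i (u - 1)) * q powi (- 2 * gr m u)"
      unfolding h by (simp only: power_int_add q_nz simp_thms)
    then show ?thesis
      by (rule_tac parity_cases[of m u])
        (auto simp: cv_def cross_def rho_def gr_def power_int_minus field_simps power2_eq_square)
  qed
  finally show ?thesis by (simp add: algebra_simps)
qed

text \<open>The entries of T and of its inverse multiplied in the order opposite to that of the
  matrix product in \<open>contr\<close>, with the weights \<open>cv\<close>. For a = b,
  \<open>contr\<close> is the identity matrix.\<close>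

definition Theta :: "nat \<Rightarrow> nat \<Rightarrow> int \<Rightarrow> int \<Rightarrow> nat \<Rightarrow> nat \<Rightarrow> 'a fps" where
  "Theta i j a b k l = (\<Sum>t = i..j. fsc (cv i t * sg (parity m t * (parity m k + parity m l))) *
     (shift a (T t l) * shift b (Ti i j k t)))"

definition contr :: "nat \<Rightarrow> nat \<Rightarrow> int \<Rightarrow> int \<Rightarrow> nat \<Rightarrow> nat \<Rightarrow> 'a fps" where
  "contr i j a b k l = (\<Sum>t = i..j. shift b (Ti i j k t) * shift a (T t l))"

text \<open>\<open>inverse_rel\<close> at (i, j, x, y) = (t, l, k, t), weighted by \<open>cv\<close>
  and a sign and summed over t. The left-hand side collapses to \<open>contr\<close> because all
  columns of \<open>cross\<close> have the same weighted sum; the right-hand side consists of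
  entries of \<open>Theta\<close>.\<close>

lemma crossing:
  assumes ij: "1 \<le> i" "j \<le> N" and kl: "k \<in> {i..j}" "l \<in> {i..j}"
  shows "fsc (q powi a - q powi b * q powi (- 2 * hh m i j)) * contr i j a b k l =
    (if l = k then (\<Sum>u = i..j. fsc (cross a b u l) * Theta i j a b u u)
     else fsc ((q powi a - q powi b) * sg (parity m k * parity m l)) * Theta i j a b k l)"
proof -
  let ?K = "{i..j}"
  let ?X = "\<lambda>k t. shift b (Ti i j k t)" and ?T = "\<lambda>t l. shift a (T t l)"
  let ?w = "\<lambda>t. cv i t * sg (parity m t * parity m l)"
  have K: "finite ?K" "?K \<subseteq> {1..N}" using ij by auto
  have dl: "fsc w * (fsc r * A + (\<Sum>c\<in>?K. fsc (x c) * B c)) = fsc (w * r) * A + (\<Sum>c\<in>?K. fsc (w * x c) * B c)" for w r A x B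
    by (simp add: distrib_left sum_distrib_left ord.sc_mult_assoc)
  have dl2: "(\<Sum>t\<in>?K. fsc (w t) * (A t + (if l = k then B t else 0))) =
    (\<Sum>t\<in>?K. fsc (w t) * A t) + (if l = k then \<Sum>t\<in>?K. fsc (w t) * B t else 0)" for w A B
    by (simp add: distrib_left sum.distrib)
  have "fsc (q powi a - q powi b * q powi (- 2 * hh m i j)) * contr i j a b k l =
    (\<Sum>c\<in>?K. fsc (\<Sum>t\<in>?K. cv i t * cross a b t c) * (?X k c * ?T c l))"
    unfolding contr_def sum_distrib_left using cross_column[OF ij(1), of _ j a b] by (intro sum.cong refl) simp
  also have "\<dots> = (\<Sum>c\<in>?K. \<Sum>t\<in>?K. fsc (cv i t * cross a b t c) * (?X k c * ?T c l))"
  proof (rule sum.cong[OF refl])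
    fix c
    have "fsc (sum f J) = (\<Sum>t\<in>J. fsc (f t))" for f :: "nat \<Rightarrow> 'k" and J
      by (induction J rule: infinite_finite_induct) (simp_all add: ord.sc_add)
    then show "fsc (\<Sum>t\<in>?K. cv i t * cross a b t c) * (?X k c * ?T c l) = (\<Sum>t\<in>?K. fsc (cv i t * cross a b t c) * (?X k c * ?T c l))"
      by (simp add: sum_distrib_right)
  qed
  also have "\<dots> = (\<Sum>t\<in>?K. \<Sum>c\<in>?K. fsc (cv i t * cross a b t c) * (?X k c * ?T c l))"
    by (rule sum.swap)
  also have "\<dots> = (\<Sum>t\<in>?K. fsc (?w t) * (fsc (rho q m a b t t * sg (parity m t * (parity m t + parity m l))) * (?X k t * ?T t l) +
      (\<Sum>c\<in>?K. fsc (xi q a b t c * sg (parity m t * parity m l)) * (?X k c * ?T c l))))"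
  proof (rule sum.cong[OF refl])
    fix t assume t: "t \<in> ?K"
    have s1: "?w t * (rho q m a b t t * sg (parity m t * (parity m t + parity m l))) = cv i t * cross a b t t"
      by (rule parity_cases[of m t]; rule parity_cases[of m l]; simp add: cross_def)
    have s2: "?w t * (xi q a b t c * sg (parity m t * parity m l)) = (if c = t then 0 else cv i t * cross a b t c)" for c
      by (rule parity_cases[of m t]; rule parity_cases[of m l]; simp add: cross_def xi_def)
    have "(\<Sum>c\<in>?K. fsc (cv i t * cross a b t c) * (?X k c * ?T c l)) =
      fsc (cv i t * cross a b t t) * (?X k t * ?T t l) + (\<Sum>c\<in>?K. fsc (if c = t then 0 else cv i t * cross a b t c) * (?X k c * ?T c l))"
    proof -
      have "(\<Sum>c\<in>?K. fsc (if c = t then 0 else cv i t * cross a b t c) * (?X k c * ?T c l)) =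
        (\<Sum>c\<in>?K - {t}. fsc (cv i t * cross a b t c) * (?X k c * ?T c l))"
        by (rule sum.mono_neutral_cong_right) (use K in auto)
      then show ?thesis by (simp only: sum.remove[OF K(1) t])
    qed
    then show "(\<Sum>c\<in>?K. fsc (cv i t * cross a b t c) * (?X k c * ?T c l)) = fsc (?w t) * (fsc (rho q m a b t t * sg (parity m t * (parity m t + parity m l))) * (?X k t * ?T t l) +
      (\<Sum>c\<in>?K. fsc (xi q a b t c * sg (parity m t * parity m l)) * (?X k c * ?T c l)))"
      by (simp only: dl s1 s2)
  qed
  also have "\<dots> = (\<Sum>t\<in>?K. fsc (?w t) * (fsc (rho q m a b l k * sg (parity m k * (parity m t + parity m l))) * (?T t l * ?X k t) +
      (if l = k then \<Sum>c\<in>?K. fsc (xi q a b c l * sg (parity m t * parity m l)) * (?T t c * ?X c t) else 0)))"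
  proof (rule sum.cong[OF refl])
    fix t assume t: "t \<in> ?K"
    show "fsc (?w t) * (fsc (rho q m a b t t * sg (parity m t * (parity m t + parity m l))) * (?X k t * ?T t l) +
      (\<Sum>c\<in>?K. fsc (xi q a b t c * sg (parity m t * parity m l)) * (?X k c * ?T c l))) =
      fsc (?w t) * (fsc (rho q m a b l k * sg (parity m k * (parity m t + parity m l))) * (?T t l * ?X k t) +
      (if l = k then \<Sum>c\<in>?K. fsc (xi q a b c l * sg (parity m t * parity m l)) * (?T t c * ?X c t) else 0))"
      using ord.inverse_rel[OF K ord.Ti[OF ij, of b] t kl(2) kl(1) t, of a] by simp
  qed
  also have "\<dots> = fsc (rho q m a b l k * sg (parity m k * parity m l)) * Theta i j a b k l +
      (if l = k then \<Sum>c\<in>?K. fsc (xi q a b c l) * Theta i j a b c c else 0)"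
  proof -
    have s1: "?w t * (rho q m a b l k * sg (parity m k * (parity m t + parity m l))) =
      rho q m a b l k * sg (parity m k * parity m l) * (cv i t * sg (parity m t * (parity m k + parity m l)))" for t
      by (rule parity_cases[of m t]; rule parity_cases[of m l]; rule parity_cases[of m k]; simp)
    have s2: "?w t * (xi q a b c l * sg (parity m t * parity m l)) =
      xi q a b c l * (cv i t * sg (parity m t * (parity m c + parity m c)))" for t c
      by (rule parity_cases[of m t]; rule parity_cases[of m l]; rule parity_cases[of m c]; simp)
    have "(\<Sum>t\<in>?K. fsc (?w t) * (fsc (rho q m a b l k * sg (parity m k * (parity m t + parity m l))) * (?T t l * ?X k t))) =
      fsc (rho q m a b l k * sg (parity m k * parity m l)) * Theta i j a b k l"
      unfolding Theta_def sum_distrib_left ord.sc_mult_assoc s1 ..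
    moreover have "(\<Sum>t\<in>?K. fsc (?w t) * (\<Sum>c\<in>?K. fsc (xi q a b c l * sg (parity m t * parity m l)) * (?T t c * ?X c t))) =
      (\<Sum>c\<in>?K. fsc (xi q a b c l) * Theta i j a b c c)"
      unfolding Theta_def sum_distrib_left ord.sc_mult_assoc s2 by (rule sum.swap)
    ultimately show ?thesis
      unfolding dl2 by (cases "l = k") (simp_all only: if_True if_False simp_thms add_0_right)
  qed
  also have "\<dots> = (if l = k then (\<Sum>u = i..j. fsc (cross a b u l) * Theta i j a b u u)
     else fsc ((q powi a - q powi b) * sg (parity m k * parity m l)) * Theta i j a b k l)"
  proof (cases "l = k")
    case True
    have "rho q m a b k k * sg (parity m k * parity m k) = cross a b k k"
      by (rule parity_cases[of m k]; simp add: cross_def)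
    moreover have "(\<Sum>u\<in>?K. fsc (cross a b u k) * Theta i j a b u u) = fsc (cross a b k k) * Theta i j a b k k +
      (\<Sum>u\<in>?K. fsc (xi q a b u k) * Theta i j a b u u)"
    proof -
      have "(\<Sum>u\<in>?K. fsc (xi q a b u k) * Theta i j a b u u) = (\<Sum>u\<in>?K - {k}. fsc (cross a b u k) * Theta i j a b u u)"
        by (rule sum.mono_neutral_cong_right) (use K in \<open>auto simp: xi_def cross_def\<close>)
      then show ?thesis by (simp only: sum.remove[OF K(1) kl(1)])
    qed
    ultimately show ?thesis using True by simp
  qed (simp add: rho_def)
  finally show ?thesis .
qed

text \<open>The columns u and u + 1 of \<open>cross\<close> differ only in the rows u and u + 1, so
  subtracting the two diagonal relations leaves two entries of \<open>Theta\<close>, with a common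
  factor q^a - q^b.\<close>

lemma crossing_diff:
  assumes ij: "1 \<le> i" "j \<le> N" and u: "u \<in> {i..j}" "Suc u \<in> {i..j}"
  shows "fsc (q powi a - q powi b * q powi (- 2 * hh m i j)) * (contr i j a b u u - contr i j a b (Suc u) (Suc u)) =
    fsc (q powi a - q powi b) * (fsc (sg (parity m u) / q powi gr m u) * Theta i j a b u u -
      fsc (sg (parity m (Suc u)) * q powi gr m (Suc u)) * Theta i j a b (Suc u) (Suc u))"
proof -
  let ?D = "\<lambda>c. cross a b c u - cross a b c (Suc u)"
  have D0: "?D c = 0" if "c \<noteq> u" "c \<noteq> Suc u" for c
    using that by (auto simp: cross_def xi_def)
  have D1: "?D u = (q powi a - q powi b) * (sg (parity m u) / q powi gr m u)"
    by (rule parity_cases[of m u]) (auto simp: cross_def xi_def rho_def gr_def power_int_minus field_simps)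
  have D2: "?D (Suc u) = - ((q powi a - q powi b) * (sg (parity m (Suc u)) * q powi gr m (Suc u)))"
    by (rule parity_cases[of m "Suc u"]) (auto simp: cross_def xi_def rho_def gr_def power_int_minus field_simps)
  have "fsc (q powi a - q powi b * q powi (- 2 * hh m i j)) * (contr i j a b u u - contr i j a b (Suc u) (Suc u)) =
    (\<Sum>c = i..j. fsc (cross a b c u) * Theta i j a b c c) - (\<Sum>c = i..j. fsc (cross a b c (Suc u)) * Theta i j a b c c)"
    using crossing[OF ij u(1) u(1), of a b] crossing[OF ij u(2) u(2), of a b] by (simp add: right_diff_distrib)
  also have "\<dots> = (\<Sum>c = i..j. fsc (?D c) * Theta i j a b c c)"
  proof -
    have "fsc (c - d) = fsc c - fsc d" for c d
      by (simp only: diff_conv_add_uminus ord.sc_add ord.sc_minus)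
    then show ?thesis by (simp only: left_diff_distrib sum_subtractf)
  qed
  also have "\<dots> = (\<Sum>c\<in>{u, Suc u}. fsc (?D c) * Theta i j a b c c)"
    by (rule sum.mono_neutral_right) (use u D0 in auto)
  also have "\<dots> = fsc (?D u) * Theta i j a b u u + fsc (?D (Suc u)) * Theta i j a b (Suc u) (Suc u)"
    by simp
  also have "\<dots> = fsc (q powi a - q powi b) * (fsc (sg (parity m u) / q powi gr m u) * Theta i j a b u u -
      fsc (sg (parity m (Suc u)) * q powi gr m (Suc u)) * Theta i j a b (Suc u) (Suc u))"
    unfolding D1 D2 right_diff_distrib ord.sc_mult_assoc ord.sc_minus by simp
  finally show ?thesis .
qed

lemma bianalytic_Theta: "bianalytic (\<lambda>a b. Theta i j a b k l)"
  unfolding Theta_def by (intro bianalytic_sum bianalytic_scale bianalytic_mult)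

lemma bianalytic_contr: "bianalytic (\<lambda>a b. contr i j a b k l)"
  unfolding contr_def by (intro bianalytic_sum bianalytic_mult')

lemma contr_same:
  assumes "1 \<le> i" "j \<le> N" "k \<in> {i..j}" "l \<in> {i..j}"
  shows "contr i j a a k l = of_bool (k = l)"
  using minvD(2)[OF ord.Ti[OF assms(1,2), of a] assms(3,4)] by (simp add: contr_def)

text \<open>For \<open>h = 0\<close> the crossing relation at the special point is empty, and the relation for
  \<open>z \<noteq> w\<close>, divided by \<open>z - w\<close>, is extended to \<open>z = w\<close> instead.\<close>

lemma Theta_special:
  assumes ij: "1 \<le> i" "j \<le> N" and ab: "a = b - 2 * hh m i j"
  shows "k \<in> {i..j} \<Longrightarrow> l \<in> {i..j} \<Longrightarrow> k \<noteq> l \<Longrightarrow> Theta i j a b k l = 0"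
    and "u \<in> {i..j} \<Longrightarrow> Suc u \<in> {i..j} \<Longrightarrow> fsc (sg (parity m u) / q powi gr m u) * Theta i j a b u u =
      fsc (sg (parity m (Suc u)) * q powi gr m (Suc u)) * Theta i j a b (Suc u) (Suc u)"
proof -
  have k0: "q powi a - q powi b * q powi (- 2 * hh m i j) = 0"
    by (simp add: ab power_int_diff power_int_minus divide_inverse)
  show "Theta i j a b k l = 0" if kl: "k \<in> {i..j}" "l \<in> {i..j}" "k \<noteq> l" for k l
  proof (cases "hh m i j = 0")
    case False
    then have "a \<noteq> b" using ab by simp
    then have "(q powi a - q powi b) * sg (parity m k * parity m l) \<noteq> 0"
      by (simp add: q_powi_inj)
    moreover have "fsc ((q powi a - q powi b) * sg (parity m k * parity m l)) * Theta i j a b k l = 0"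
      using crossing[OF ij kl(1,2), of a b] kl(3) k0 by simp
    ultimately show ?thesis using ord.sc_cancel[of _ "Theta i j a b k l" 0] by simp
  next
    case True
    have "contr i j a b k l - fsc (sg (parity m k * parity m l)) * Theta i j a b k l = 0" for a b
    proof (rule bianalytic_eq_0[where \<beta> = "\<lambda>a b. contr i j a b k l - fsc (sg (parity m k * parity m l)) * Theta i j a b k l"])
      fix a b :: int assume "a \<noteq> b"
      then have nz: "q powi a - q powi b \<noteq> 0" by (simp add: q_powi_inj)
      have "fsc (q powi a - q powi b) * contr i j a b k l =
        fsc (q powi a - q powi b) * (fsc (sg (parity m k * parity m l)) * Theta i j a b k l)"
        using crossing[OF ij kl(1,2), of a b] kl(3) True by (simp add: ord.sc_mult_assoc)
      then show "contr i j a b k l - fsc (sg (parity m k * parity m l)) * Theta i j a b k l = 0"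
        using ord.sc_cancel[OF _ nz] by simp
    qed (intro bianalytic_diff bianalytic_scale bianalytic_contr bianalytic_Theta)
    from this[of a b] have "fsc (sg (parity m k * parity m l)) * Theta i j a b k l = fsc (sg (parity m k * parity m l)) * 0"
      using contr_same[OF ij kl(1,2), of a] kl(3) True ab by simp
    then show ?thesis by (rule ord.sc_cancel) simp
  qed
  let ?L = "\<lambda>a b u. fsc (sg (parity m u) / q powi gr m u) * Theta i j a b u u -
      fsc (sg (parity m (Suc u)) * q powi gr m (Suc u)) * Theta i j a b (Suc u) (Suc u)"
  show "fsc (sg (parity m u) / q powi gr m u) * Theta i j a b u u =
      fsc (sg (parity m (Suc u)) * q powi gr m (Suc u)) * Theta i j a b (Suc u) (Suc u)"
    if u: "u \<in> {i..j}" "Suc u \<in> {i..j}" for u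
  proof (cases "hh m i j = 0")
    case False
    then have "a \<noteq> b" using ab by simp
    then have nz: "q powi a - q powi b \<noteq> 0" by (simp add: q_powi_inj)
    have "fsc (q powi a - q powi b) * ?L a b u = fsc (q powi a - q powi b) * 0"
      using crossing_diff[OF ij u, of a b] k0 by simp
    then show ?thesis using ord.sc_cancel[OF _ nz] by fastforce
  next
    case True
    have "contr i j a b u u - contr i j a b (Suc u) (Suc u) - ?L a b u = 0" for a b
    proof (rule bianalytic_eq_0[where \<beta> = "\<lambda>a b. contr i j a b u u - contr i j a b (Suc u) (Suc u) - ?L a b u"])
      fix a b :: int assume "a \<noteq> b"
      then have nz: "q powi a - q powi b \<noteq> 0" by (simp add: q_powi_inj)
      have "fsc (q powi a - q powi b) * (contr i j a b u u - contr i j a b (Suc u) (Suc u)) =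
        fsc (q powi a - q powi b) * ?L a b u"
        using crossing_diff[OF ij u, of a b] True by simp
      then show "contr i j a b u u - contr i j a b (Suc u) (Suc u) - ?L a b u = 0"
        using ord.sc_cancel[OF _ nz] by simp
    qed (intro bianalytic_diff bianalytic_scale bianalytic_contr bianalytic_Theta)
    from this[of a b] show ?thesis
      using contr_same[OF ij u(1,1), of a] contr_same[OF ij u(2,2), of a] True ab by simp
  qed
qed

text \<open>The two-term recursion in \<open>Theta_special\<close> is also satisfied by the weights
  \<open>cv\<close>, so both sequences are proportional.\<close>

lemma Theta_diag:
  assumes ij: "1 \<le> i" "j \<le> N" and ab: "a = b - 2 * hh m i j" and u: "u \<in> {i..j}"
  shows "Theta i j a b u u = fsc (cv i u) * (fsc (1 / cv i i) * Theta i j a b i i)"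
proof -
  from u have "i \<le> u" "u \<le> j" by auto
  then show ?thesis
  proof (induction u rule: dec_induct)
    case base
    then show ?case using cv_nz[of i i] by (simp add: ord.sc_mult_assoc)
  next
    case (step u)
    have h: "- 2 * hh m i u = - 2 * hh m i (u - 1) + (- 2 * gr m u)"
      using hh_snoc[of i u m] step ij by simp
    have G: "q powi (- 2 * hh m i u) = q powi (- 2 * hh m i (u - 1)) * q powi (- 2 * gr m u)"
      unfolding h by (simp only: power_int_add q_nz simp_thms)
    have c: "sg (parity m u) / q powi gr m u * cv i u = sg (parity m (Suc u)) * q powi gr m (Suc u) * cv i (Suc u)"
      unfolding cv_def diff_Suc_1 G
      by (rule parity_cases[of m u]; rule parity_cases[of m "Suc u"]) (auto simp: gr_def power_int_minus field_simps power2_eq_square)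
    have "fsc (sg (parity m (Suc u)) * q powi gr m (Suc u)) * Theta i j a b (Suc u) (Suc u) =
      fsc (sg (parity m u) / q powi gr m u) * Theta i j a b u u"
      using Theta_special(2)[OF ij ab, of u] step by simp
    also have "Theta i j a b u u = fsc (cv i u) * (fsc (1 / cv i i) * Theta i j a b i i)"
      using step by simp
    also have "fsc (sg (parity m u) / q powi gr m u) * (fsc (cv i u) * (fsc (1 / cv i i) * Theta i j a b i i)) =
      fsc (sg (parity m (Suc u)) * q powi gr m (Suc u)) * (fsc (cv i (Suc u)) * (fsc (1 / cv i i) * Theta i j a b i i))"
      by (simp only: ord.sc_mult_assoc[of _ _ "_ * Theta _ _ _ _ _ _"] c)
    finally show ?case by (rule ord.sc_cancel) simp
  qed
qed

text \<open>At the crossing point \<open>Theta\<close> is diagonal, equal to \<open>cv\<close> times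
  a factor \<theta>. Contracting its row k with column k of Y leaves Y_kk \<theta> on one side; on
  the other, Y cancels T and leaves the diagonal entry of the inverse.\<close>

lemma theta:
  assumes ij: "1 \<le> i" "j \<le> N"
  shows "\<exists>\<theta>. \<forall>k\<in>{i..j}. shift b (Ti i j k k) = shift (b - 2 * hh m i j) (Yi i j k k) * \<theta>"
proof -
  define a where "a = b - 2 * hh m i j"
  let ?\<theta> = "fsc (1 / cv i i) * Theta i j a b i i"
  let ?Y = "\<lambda>k l. shift a (Yi i j k l)" and ?T = "\<lambda>k l. shift a (T k l)" and ?X = "\<lambda>k l. shift b (Ti i j k l)"
  have "?X k k = ?Y k k * ?\<theta>" if k: "k \<in> {i..j}" for k
  proof -
    have Y: "(\<Sum>l = i..j. ?Y l k * (fsc (tw m t l) * ?T t l)) = of_bool (t = k)" if "t \<in> {i..j}" for t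
      using Yi_shift[OF ij, of "- a"] that k unfolding minv_opp by simp
    have "(\<Sum>l = i..j. fsc (sg (parity m l)) * (?Y l k * Theta i j a b k l)) =
      (\<Sum>l = i..j. if l = k then fsc (sg (parity m k)) * (?Y k k * (fsc (cv i k) * ?\<theta>)) else 0)"
      using Theta_special(1)[OF ij a_def k] Theta_diag[OF ij a_def k] by (intro sum.cong refl) auto
    also have "\<dots> = fsc (sg (parity m k) * cv i k) * (?Y k k * ?\<theta>)"
      using k by (simp add: ord.sc_gather5)
    finally have 1: "(\<Sum>l = i..j. fsc (sg (parity m l)) * (?Y l k * Theta i j a b k l)) = fsc (sg (parity m k) * cv i k) * (?Y k k * ?\<theta>)" .
    have sgn: "sg (parity m l) * (cv i t * sg (parity m t * (parity m k + parity m l))) = cv i t * sg (parity m t * parity m k) * tw m t l" for t l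
      by (rule parity_cases[of m t]; rule parity_cases[of m l]; rule parity_cases[of m k]; simp add: tw_def)
    have g: "fsc c * (y * (fsc d * (x * z))) = fsc (c * d) * (y * x * z)" for c d x y z
      by (simp only: ord.sc_gather5 mult.assoc)
    have g': "fsc (c * d) * (y * x * z) = fsc c * (y * (fsc d * x) * z)" for c d x y z
      by (simp only: ord.sc_gather5[symmetric] mult.assoc)
    have "(\<Sum>l = i..j. fsc (sg (parity m l)) * (?Y l k * Theta i j a b k l)) =
      (\<Sum>l = i..j. \<Sum>t = i..j. fsc (cv i t * sg (parity m t * parity m k) * tw m t l) * (?Y l k * ?T t l * ?X k t))"
      unfolding Theta_def sum_distrib_left g sgn ..
    also have "\<dots> = (\<Sum>t = i..j. \<Sum>l = i..j. fsc (cv i t * sg (parity m t * parity m k) * tw m t l) * (?Y l k * ?T t l * ?X k t))"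
      by (rule sum.swap)
    also have "\<dots> = (\<Sum>t = i..j. fsc (cv i t * sg (parity m t * parity m k)) * ((\<Sum>l = i..j. ?Y l k * (fsc (tw m t l) * ?T t l)) * ?X k t))"
      unfolding g' sum_distrib_left sum_distrib_right ..
    also have "\<dots> = (\<Sum>t = i..j. if t = k then fsc (cv i k * sg (parity m k * parity m k)) * ?X k k else 0)"
      by (intro sum.cong refl, subst Y) auto
    also have "\<dots> = fsc (sg (parity m k) * cv i k) * ?X k k"
      using k by (rule_tac parity_cases[of m k]) (auto simp: mult.commute)
    finally have "fsc (sg (parity m k) * cv i k) * ?X k k = fsc (sg (parity m k) * cv i k) * (?Y k k * ?\<theta>)"
      using 1 by simp
    then show ?thesis by (rule ord.sc_cancel) (simp add: cv_nz)
  qed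
  then show ?thesis unfolding a_def by blast
qed

text \<open>At the even end i, b and o contain inverses of the entries related by \<theta>, which
  gives \<theta> b(z q^2) = o(z); at the odd end j they contain the entries themselves, which gives
  b(z) = o(z q^2) \<theta>. Having one end of each parity is what allows \<theta> to be
  eliminated.\<close>

lemma ber_ob_product:
  assumes ij: "1 \<le> i" "j \<le> N" and par: "parity m i = 0" "parity m j = 1"
    and IH: "\<And>e. ord.ber (Suc i) j e = ob (Suc i) j e" "\<And>e. ord.ber i (j - 1) e = ob i (j - 1) e"
  shows "ord.ber i j u * ord.ber i j (u + 2) = ob i j (u + 2) * ob i j u"
proof -
  have lt: "i < j"
    using par by (auto simp: parity_def split: if_splits)
  then have le: "i \<le> j" by simp
  define h where "h = hh m i j"
  have h1: "hh m (Suc i) j = h - 1"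
    using hh_Cons[OF le, of m] par by (simp add: h_def gr_def)
  have h2: "hh m i (j - 1) = h + 1"
    using hh_snoc[OF ij(1) le, of m] par by (simp add: h_def gr_def)
  obtain \<theta> where \<theta>: "\<And>k. k \<in> {i..j} \<Longrightarrow> shift (u + 2 * h) (Ti i j k k) = shift u (Yi i j k k) * \<theta>"
    using theta[OF ij, of "u + 2 * h"] unfolding h_def by auto
  let ?D = "unop (op.dn i j (- u))" and ?d = "ord.dn i j (u + 2 * h)"
  have D: "?D * shift u (Yi i j i i) = 1"
    using arg_cong[OF op.dsch_dn(1)[OF ij(1) le ij(2), of "- u"], of unop] par by (simp add: op.dn_def)
  have d: "shift (u + 2 * h) (Ti i j i i) * ?d = 1"
    using ord.dsch_dn(1)[OF ij(1) le ij(2), of "u + 2 * h"] par by (simp add: ord.dn_def)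
  have "?d * ord.ber (Suc i) j (u + 2) = ord.ber (Suc i) j (u + 2) * ?d"
    by (rule ord.commute_ber) (use ij le in \<open>auto intro!: ord.dn_comm\<close>)
  then have b2: "ord.ber i j (u + 2) = ?d * ord.ber (Suc i) j (u + 2)"
    using ord.ber_dn[OF ij(1) le ij(2), of "u + 2"] par h1 by (simp add: algebra_simps)
  have "\<theta> = ?D * shift u (Yi i j i i) * \<theta>"
    using D by simp
  also have "\<dots> = ?D * shift (u + 2 * h) (Ti i j i i)"
    using \<theta>[of i] le by (simp add: mult.assoc)
  finally have "\<theta> * ord.ber i j (u + 2) = ?D * (shift (u + 2 * h) (Ti i j i i) * ?d) * ord.ber (Suc i) j (u + 2)"
    unfolding b2 by (simp only: mult.assoc)
  also have "\<dots> = ?D * ob (Suc i) j (u + 2)"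
    unfolding d IH by simp
  also have "\<dots> = ob i j u"
    using ob_dn[OF ij(1) le ij(2), of u] par by (simp add: gr_def)
  finally have e1: "\<theta> * ord.ber i j (u + 2) = ob i j u" .
  have "ord.ber i j u = ord.ber i (j - 1) u * shift (u + 2 * h) (Ti i j j j)"
    using ord.ber_snoc[OF ij(1) le, of u] par h2 by (simp add: ord.up_def algebra_simps)
  also have "\<dots> = ob i (j - 1) u * shift u (Yi i j j j) * \<theta>"
    using \<theta>[of j] le IH by (simp add: mult.assoc)
  also have "ob i (j - 1) u * shift u (Yi i j j j) = ob i j (u + 2)"
  proof -
    have up: "op.up i j (- u) = Op (shift u (Yi i j j j))"
      using par by (simp add: op.up_def)
    have "op.up i j (- u) * op.ber i (j - 1) (2 - 2 * hh m i (j - 1) - u) = op.ber i (j - 1) (2 - 2 * hh m i (j - 1) - u) * op.up i j (- u)"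
      by (rule op.commute_ber) (use ij le in \<open>auto intro!: op.up_comm simp del: unop_simps\<close>)
    from arg_cong[OF this, of unop] show ?thesis
      using ob_up[OF ij(1) le, of "u + 2"] par unfolding up by (simp add: gr_def up)
  qed
  finally have "ord.ber i j u * ord.ber i j (u + 2) = ob i j (u + 2) * (\<theta> * ord.ber i j (u + 2))"
    by (simp only: mult.assoc)
  then show ?thesis unfolding e1 .
qed

text \<open>The coefficient of \<open>z\<^sup>n\<close> in \<open>F(z) F(z q\<^sup>2)\<close> contains the unknown \<open>F\<^sub>n\<close> only in the term
  \<open>(1 + q\<^sup>2\<^sup>n) F\<^sub>0 F\<^sub>n\<close>.\<close>

lemma shift_square_unique:
  assumes F: "\<And>a b. shift a F * shift b F = shift b F * shift a F"
    and G: "\<And>a b. shift a G * shift b G = shift b G * shift a G"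
    and eq: "F * shift 2 F = shift 2 G * G"
    and F0: "fps_nth F 0 = fps_nth G 0" and v: "v * fps_nth F 0 = 1"
  shows "F = G"
proof (rule fps_ext)
  fix n
  note FF = commute_coeff[OF F] and GG = commute_coeff[OF G]
  let ?t = "\<lambda>n. q powi (s * 2 * int n)"
  show "fps_nth F n = fps_nth G n"
  proof (induction n rule: less_induct)
    case (less n)
    show ?case
    proof (cases "n = 0")
      case False
      have "(\<Sum>r\<le>n. sc (?t (n - r)) * (fps_nth F r * fps_nth F (n - r))) = fps_nth (F * shift 2 F) n"
        unfolding fps_mult_nth atMost_atLeast0 shift_nth by (intro sum.cong refl) (simp only: sc_left)
      also have "\<dots> = (\<Sum>r\<le>n. fps_nth (shift 2 G) r * fps_nth G (n - r))"
        unfolding eq fps_mult_nth atMost_atLeast0 ..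
      also have "\<dots> = (\<Sum>r\<le>n. fps_nth (shift 2 G) (n - r) * fps_nth G r)"
        by (rule sum.reindex_bij_witness[of _ "\<lambda>r. n - r" "\<lambda>r. n - r"]) auto
      also have "\<dots> = (\<Sum>r\<le>n. sc (?t (n - r)) * (fps_nth G r * fps_nth G (n - r)))"
        unfolding shift_nth by (intro sum.cong refl) (simp only: mult.assoc GG[of "n - _"])
      finally have "(\<Sum>r\<le>n. sc (?t (n - r)) * (fps_nth F r * fps_nth F (n - r) - fps_nth G r * fps_nth G (n - r))) = 0"
        by (simp only: right_diff_distrib sum_subtractf) simp
      also have "(\<Sum>r\<le>n. sc (?t (n - r)) * (fps_nth F r * fps_nth F (n - r) - fps_nth G r * fps_nth G (n - r))) =
        (\<Sum>r\<in>{0, n}. sc (?t (n - r)) * (fps_nth F r * fps_nth F (n - r) - fps_nth G r * fps_nth G (n - r)))"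
        by (rule sum.mono_neutral_right) (use less in auto)
      also have "\<dots> = sc (?t n) * (fps_nth F 0 * (fps_nth F n - fps_nth G n)) + fps_nth F 0 * (fps_nth F n - fps_nth G n)"
        using False F0 FF[of n 0] GG[of n 0] by (simp add: right_diff_distrib)
      also have "\<dots> = sc (?t n + 1) * (fps_nth F 0 * (fps_nth F n - fps_nth G n))"
        by (simp add: sc_add distrib_right)
      finally have "sc (?t n + 1) * (fps_nth F 0 * (fps_nth F n - fps_nth G n)) = sc (?t n + 1) * 0" by simp
      moreover have "?t n + 1 \<noteq> 0"
      proof
        assume "?t n + 1 = 0"
        then have "?t n = - 1" by (simp add: eq_neg_iff_add_eq_0)
        then have "?t n * ?t n = 1" by simp
        then have "q powi (s * 2 * int n + s * 2 * int n) = 1"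
          by (simp only: power_int_add q_nz simp_thms)
        then show False using q_powi[of "s * 2 * int n + s * 2 * int n"] s_nz False by simp
      qed
      ultimately have "fps_nth F 0 * (fps_nth F n - fps_nth G n) = 0"
        using sc_cancel by blast
      then have "v * fps_nth F 0 * (fps_nth F n - fps_nth G n) = 0"
        by (simp add: mult.assoc)
      then show ?thesis using v by simp
    qed (simp add: F0)
  qed
qed

text \<open>Intervals of constant parity are the base cases. A mixed interval begins with an even
  index and ends with an odd one, as the crossing argument requires, and both shortened intervals
  are covered by induction.\<close>

theorem ber_eq_ob:
  assumes "1 \<le> i" "j \<le> N"
  shows "ord.ber i j e = ob i j e"
  using assms
proof (induction "Suc j - i" arbitrary: i j e rule: less_induct)
  case less
  note ij = less.prems
  show ?case
  proof (cases "i \<le> j")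
    case True
    show ?thesis
    proof (cases "parity m j = 0")
      case True
      then show ?thesis using ber_eq_ob_even[OF ij] by blast
    next
      case False
      then have pj: "parity m j = 1" by (rule_tac parity_cases[of m j]) auto
      show ?thesis
      proof (cases "parity m i = 1")
        case True
        then show ?thesis using ber_eq_ob_odd[OF ij] by blast
      next
        case False
        then have pi: "parity m i = 0" by (rule_tac parity_cases[of m i]) auto
        let ?F = "ord.ber i j 0" and ?G = "ob i j 0"
        have sF: "shift c ?F = ord.ber i j c" for c by (simp add: shift_ber)
        have sG: "shift c ?G = ob i j c" for c by (simp add: shift_op_ber)
        have "?F = ?G"
        proof (rule shift_square_unique)
          show "shift a ?F * shift b ?F = shift b ?F * shift a ?F" for a b
            unfolding sF by (rule ord.ber_ber_comm[OF ij])
          show "shift a ?G * shift b ?G = shift b ?G * shift a ?G" for a b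
            unfolding sG unop_simps(6)[symmetric] by (rule arg_cong[of _ _ unop], rule op.ber_ber_comm[OF ij])
          have "ord.ber i j 0 * ord.ber i j (0 + 2) = ob i j (0 + 2) * ob i j 0"
          proof (rule ber_ob_product[OF ij pi pj])
            show "ord.ber (Suc i) j e = ob (Suc i) j e" for e
              by (rule less.hyps) (use ij \<open>i \<le> j\<close> in auto)
            show "ord.ber i (j - 1) e = ob i (j - 1) e" for e
              by (rule less.hyps) (use ij \<open>i \<le> j\<close> in auto)
          qed
          then show "?F * shift 2 ?F = shift 2 ?G * ?G"
            unfolding sF sG by simp
          show "fps_nth ?F 0 = fps_nth ?G 0"
            unfolding ber_const[OF ij] ob_const[OF ij] ..
          show "fps_nth (ord.ber_inv i j 0) 0 * fps_nth ?F 0 = 1"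
          proof -
            have "fps_nth (ord.ber_inv i j 0 * ?F) 0 = 1"
              unfolding ord.ber_inv(2)[OF ij] by simp
            then show ?thesis by simp
          qed
        qed
        then have "shift e ?F = shift e ?G" by (rule arg_cong)
        then show ?thesis unfolding sF sG .
      qed
    qed
  qed simp
qed

end

section \<open>The relations of the quantum affine superalgebra\<close>

lemma qq_power: "qq ^ n = Fract (monom 1 n) 1"
proof (induction n)
  case 0
  then show ?case by (simp add: One_fract_def monom_0 one_pCons)
next
  case (Suc n)
  then show ?case by (simp add: qq_def monom_Suc)
qed

lemma qq_power_eq_1: "qq ^ n = 1 \<Longrightarrow> n = 0"
proof -
  assume "qq ^ n = 1"
  then have "monom 1 n = (1 :: complex poly)"
    by (simp add: qq_power One_fract_def eq_fract)
  then have "degree (monom (1 :: complex) n) = degree (1 :: complex poly)"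
    by (rule arg_cong)
  then show "n = 0" by (simp add: degree_monom_eq)
qed

lemma qq_nz: "qq \<noteq> 0"
  by (simp add: qq_def Zero_fract_def eq_fract)

lemma qq_powi_eq_1: "qq powi n = 1 \<Longrightarrow> n = 0"
  using qq_power_eq_1[of "nat \<bar>n\<bar>"] by (cases "n \<ge> 0") (auto simp: power_int_def power_inverse)

lemma fconst_central: "fconst c * x = x * fconst c"
proof -
  have "fconst c * Poly_Mapping.single w d = Poly_Mapping.single w d * fconst c" for w d
    by (simp add: mult_single mult.commute)
  then have "fconst c * (\<Sum>w\<in>Poly_Mapping.keys x. Poly_Mapping.single w (Poly_Mapping.lookup x w)) =
    (\<Sum>w\<in>Poly_Mapping.keys x. Poly_Mapping.single w (Poly_Mapping.lookup x w)) * fconst c"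
    by (simp add: sum_distrib_left sum_distrib_right)
  then show ?thesis using free_alg_decompose[of x] by simp
qed

lemma scalar_ring_uconst: "scalar_ring (uconst :: cq \<Rightarrow> ('m::len0, 'n::len0) uq) qq"
proof
  fix c d :: cq and x :: "('m, 'n) uq" and n :: int
  show "(uconst (c + d) :: ('m, 'n) uq) = uconst c + uconst d"
    by transfer (simp add: single_add uq_ideal.zero)
  show "(uconst (c * d) :: ('m, 'n) uq) = uconst c * uconst d"
    by transfer (simp add: mult_single uq_ideal.zero)
  show "(uconst 1 :: ('m, 'n) uq) = 1"
    by transfer (simp add: uq_ideal.zero)
  show "x * uconst c = uconst c * x"
    by transfer (simp add: fconst_central uq_ideal.zero)
  show "qq \<noteq> 0" by (rule qq_nz)
  show "qq powi n = 1 \<Longrightarrow> n = 0" by (rule qq_powi_eq_1)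
qed

interpretation uq: scalar_ring uconst qq
  by (rule scalar_ring_uconst)

interpretation uqs: shifts uconst qq "- pm_int s" for s
  by unfold_locales (cases s; simp)

lemma qshift_eq: "qshift s a F = uqs.shift s a F"
  by (simp add: qshift_def uqs.shift_def)

subsection \<open>The scalar series\<close>

lemma fps_mult_fps_lin_nth: "fps_nth (f oo fps_lin c) n = c ^ n * fps_nth f n"
  by (simp add: fps_compose_linear)

text \<open>The coefficients of the solution of f(c x) = f(x) g(x) with g(0) = 1, where
  \<open>d n\<close> stands for c^n - 1.\<close>

fun qrec :: "(nat \<Rightarrow> cq) \<Rightarrow> (nat \<Rightarrow> cq) \<Rightarrow> nat \<Rightarrow> cq" where
  "qrec g d n = (if n = 0 then 1 else (\<Sum>i<n. qrec g d i * g (n - i)) / d n)"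

declare qrec.simps [simp del]

text \<open>For f(c x) = f(x) g(x) with g(0) = 1, the coefficient of x^k reads (c^k - 1) f_k = sum
  of f_i g_(k-i) over i < k. As m \<noteq> n, c is not a root of unity; so there is exactly one
  solution, and the definite description denotes it.\<close>

lemma f_zero_0:
  assumes "m \<noteq> n"
  shows "fps_nth (f_zero m n) 0 = 1"
proof -
  define c where "c = qq powi (2 * int n - 2 * int m)"
  define g where "g = ((1 - fps_lin (qq powi (-2))) * (1 - fps_lin (c * qq ^ 2))) / ((1 - fps_X) * (1 - fps_lin c))"
  define P where "P = (\<lambda>f. fps_nth f 0 = 1 \<and> f oo fps_lin c =
        f * ((1 - fps_lin (qq powi (-2))) * (1 - fps_lin (c * qq ^ 2)))
          / ((1 - fps_X) * (1 - fps_lin c)))"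
  have u: "fps_nth ((1 - fps_X) * (1 - fps_lin c)) 0 \<noteq> 0" by simp
  have g0: "fps_nth g 0 = 1"
    unfolding g_def using u by (simp add: fps_divide_unit)
  have P: "P f \<longleftrightarrow> fps_nth f 0 = 1 \<and> f oo fps_lin c = f * g" for f
    unfolding P_def g_def using u by (simp add: fps_divide_unit mult.assoc)
  have c: "c ^ k \<noteq> 1" if "k > 0" for k
  proof
    assume "c ^ k = 1"
    then have "qq powi ((2 * int n - 2 * int m) * int k) = 1"
      by (simp add: c_def power_int_mult)
    then show False using qq_powi_eq_1 assms that by fastforce
  qed
  have step: "(f oo fps_lin c = f * g) \<longleftrightarrow> (\<forall>k>0. (c ^ k - 1) * fps_nth f k = (\<Sum>i<k. fps_nth f i * fps_nth g (k - i)))" for f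
  proof -
    have "fps_nth (f * g) k = fps_nth f k + (\<Sum>i<k. fps_nth f i * fps_nth g (k - i))" for k
      unfolding fps_mult_nth atLeast0AtMost lessThan_Suc_atMost[symmetric] by (simp add: g0)
    moreover have "c ^ k * a = a + b \<longleftrightarrow> (c ^ k - 1) * a = b" for k and a b :: cq
      by (auto simp: left_diff_distrib)
    ultimately have "(f oo fps_lin c = f * g) \<longleftrightarrow> (\<forall>k. (c ^ k - 1) * fps_nth f k = (\<Sum>i<k. fps_nth f i * fps_nth g (k - i)))"
      by (simp only: fps_eq_iff fps_mult_fps_lin_nth)
    also have "\<dots> \<longleftrightarrow> (\<forall>k>0. (c ^ k - 1) * fps_nth f k = (\<Sum>i<k. fps_nth f i * fps_nth g (k - i)))"
    proof (intro iffI allI impI)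
      fix k assume *: "\<forall>k>0. (c ^ k - 1) * fps_nth f k = (\<Sum>i<k. fps_nth f i * fps_nth g (k - i))"
      show "(c ^ k - 1) * fps_nth f k = (\<Sum>i<k. fps_nth f i * fps_nth g (k - i))"
        using * by (cases "k = 0") auto
    qed blast
    finally show ?thesis .
  qed
  have ex: "P (Abs_fps (qrec (fps_nth g) (\<lambda>k. c ^ k - 1)))"
    unfolding P step
  proof (intro conjI allI impI)
    let ?f = "qrec (fps_nth g) (\<lambda>k. c ^ k - 1)"
    show "fps_nth (Abs_fps ?f) 0 = 1"
      by (simp add: qrec.simps[of _ _ 0])
    fix k :: nat assume "k > 0"
    then have "c ^ k - 1 \<noteq> 0" "?f k = (\<Sum>i<k. ?f i * fps_nth g (k - i)) / (c ^ k - 1)"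
      using c[of k] qrec.simps[of "fps_nth g" "\<lambda>k. c ^ k - 1" k] by auto
    then show "(c ^ k - 1) * fps_nth (Abs_fps ?f) k = (\<Sum>i<k. fps_nth (Abs_fps ?f) i * fps_nth g (k - i))"
      by simp
  qed
  have uniq: "f = f'" if "P f" "P f'" for f f'
  proof (rule fps_ext)
    fix k show "fps_nth f k = fps_nth f' k"
    proof (induction k rule: less_induct)
      case (less k)
      show ?case
      proof (cases "k = 0")
        case False
        then have "(c ^ k - 1) * fps_nth f k = (c ^ k - 1) * fps_nth f' k"
          using that less unfolding P step by simp
        then show ?thesis using c[of k] False by simp
      qed (use that in \<open>simp add: P\<close>)
    qed
  qed
  have "f_zero m n = (THE f. P f)"
    by (simp add: f_zero_def P_def c_def Let_def)
  then have "P (f_zero m n)"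
    using theI'[of P] ex uniq by metis
  then show ?thesis by (simp add: P)
qed

text \<open>The scalar factor common to all entries of R(x). It can be cancelled from the relations
  because its constant term is nonzero.\<close>

definition u_zero :: "nat \<Rightarrow> nat \<Rightarrow> cq fps" where
  "u_zero m n = f_zero m n * inverse (fps_lin qq - fps_const (inverse qq))"

lemma u_zero_0: "m \<noteq> n \<Longrightarrow> fps_nth (u_zero m n) 0 \<noteq> 0"
  by (simp add: u_zero_def f_zero_0 qq_nz)

lemma R_zero_nth: "fps_nth (R_zero m n i j k l) p =
  R_w m i j k l * fps_nth (u_zero m n) p + (if p = 0 then 0 else R_z m i j k l * fps_nth (u_zero m n) (p - 1))"
proof -
  have "R_zero m n i j k l = (fps_lin (R_z m i j k l) + fps_const (R_w m i j k l)) * u_zero m n"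
    unfolding R_zero_def u_zero_def by (subst fps_divide_unit) (auto simp: qq_nz)
  then show ?thesis
    by (cases p) (simp_all add: distrib_right mult.assoc)
qed

subsection \<open>Cancellation of the scalar series\<close>

text \<open>The hypotheses are coefficients of u(z/w) times a homogeneous polynomial of degree n + 1
  in z and w. They are triangular in its coefficients H k, with diagonal u 0, and force these to
  vanish; the conclusion evaluates the polynomial at z = x, w = y.\<close>

lemma cancel_series:
  fixes Fz Fw :: "nat \<Rightarrow> nat \<Rightarrow> 'a::ring_1" and u :: "nat \<Rightarrow> 'k::field"
  assumes sr: "scalar_ring sc q" and u: "u 0 \<noteq> 0"
    and rel: "\<And>n a. a \<le> n + 1 \<Longrightarrow> (\<Sum>r\<le>min a n. sc (u (a - r)) * Fw r (n - r) +
      (if r < a then sc (u (a - r - 1)) * Fz r (n - r) else 0)) = 0"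
  shows "(\<Sum>r\<le>n. sc (x ^ r * y ^ (n - r)) * (sc x * Fz r (n - r) + sc y * Fw r (n - r))) = 0"
proof -
  interpret scalar_ring sc q by fact
  \<comment> \<open>The coefficient of z^k w^(n+1-k). The factor z of \<open>Fz\<close> raises the
    first exponent, whence the index k - 1; the factor w of \<open>Fw\<close> raises the
    second.\<close>
  define H where "H = (\<lambda>k. (if k > 0 then Fz (k - 1) (n + 1 - k) else 0) + (if k \<le> n then Fw k (n - k) else 0))"
  have e: "(\<Sum>r\<le>min a n. sc (u (a - r)) * Fw r (n - r) + (if r < a then sc (u (a - r - 1)) * Fz r (n - r) else 0)) =
    (\<Sum>k\<le>a. sc (u (a - k)) * H k)" if a: "a \<le> n + 1" for a
  proof -
    have "(\<Sum>r\<le>min a n. sc (u (a - r)) * Fw r (n - r)) = (\<Sum>r\<le>a. sc (u (a - r)) * (if r \<le> n then Fw r (n - r) else 0))"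
      by (rule sum.mono_neutral_cong_left) auto
    moreover have "(\<Sum>r\<le>min a n. if r < a then sc (u (a - r - 1)) * Fz r (n - r) else 0) = (\<Sum>k\<le>a. sc (u (a - k)) * (if k > 0 then Fz (k - 1) (n + 1 - k) else 0))"
    proof -
      have "(\<Sum>r\<le>min a n. if r < a then sc (u (a - r - 1)) * Fz r (n - r) else 0) = (\<Sum>r<a. sc (u (a - r - 1)) * Fz r (n - r))"
        by (rule sum.mono_neutral_cong_right) (use a in auto)
      also have "\<dots> = (\<Sum>k\<in>{1..a}. sc (u (a - k)) * Fz (k - 1) (n + 1 - k))"
        by (rule sum.reindex_bij_witness[of _ "\<lambda>k. k - 1" Suc]) auto
      also have "\<dots> = (\<Sum>k\<le>a. sc (u (a - k)) * (if k > 0 then Fz (k - 1) (n + 1 - k) else 0))"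
        by (rule sum.mono_neutral_cong_left) auto
      finally show ?thesis .
    qed
    ultimately show ?thesis
      by (simp only: sum.distrib H_def distrib_left add.commute)
  qed
  have H0: "H k = 0" if "k \<le> n + 1" for k
    using that
  proof (induction k rule: less_induct)
    case (less k)
    have "0 = (\<Sum>l\<le>k. sc (u (k - l)) * H l)"
      using e[OF less.prems] rel[OF less.prems] by simp
    also have "\<dots> = (\<Sum>l<k. sc (u (k - l)) * H l) + sc (u 0) * H k"
      by (simp add: lessThan_Suc_atMost[symmetric])
    also have "(\<Sum>l<k. sc (u (k - l)) * H l) = 0"
      by (rule sum.neutral) (use less in auto)
    finally show ?case using sc_cancel[of "u 0" "H k" 0] u by simp
  qed
  have "0 = (\<Sum>k\<le>n + 1. sc (x ^ k * y ^ (n + 1 - k)) * H k)"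
    by (rule sum.neutral[symmetric]) (use H0 in auto)
  also have "\<dots> = (\<Sum>k\<le>n + 1. sc (x ^ k * y ^ (n + 1 - k)) * (if k > 0 then Fz (k - 1) (n + 1 - k) else 0)) +
    (\<Sum>k\<le>n + 1. sc (x ^ k * y ^ (n + 1 - k)) * (if k \<le> n then Fw k (n - k) else 0))"
    by (simp only: H_def distrib_left sum.distrib)
  also have "(\<Sum>k\<le>n + 1. sc (x ^ k * y ^ (n + 1 - k)) * (if k > 0 then Fz (k - 1) (n + 1 - k) else 0)) =
    (\<Sum>k\<in>{1..n + 1}. sc (x ^ k * y ^ (n + 1 - k)) * Fz (k - 1) (n + 1 - k))"
    by (rule sum.mono_neutral_cong_right) auto
  also have "\<dots> = (\<Sum>r\<le>n. sc (x ^ Suc r * y ^ (n - r)) * Fz r (n - r))"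
    by (rule sum.reindex_bij_witness[of _ Suc "\<lambda>k. k - 1"]) (auto simp del: power_Suc)
  also have "\<dots> = (\<Sum>r\<le>n. sc (x ^ r * y ^ (n - r)) * (sc x * Fz r (n - r)))"
    by (simp add: sc_mult_assoc mult_ac)
  also have "(\<Sum>k\<le>n + 1. sc (x ^ k * y ^ (n + 1 - k)) * (if k \<le> n then Fw k (n - k) else 0)) =
    (\<Sum>r\<le>n. sc (x ^ r * y ^ (n - r)) * (sc y * Fw r (n - r)))"
    by (rule sum.mono_neutral_cong_right) (auto simp: sc_mult_assoc mult_ac Suc_diff_le)
  finally show ?thesis by (simp only: sum.distrib distrib_left)
qed

subsection \<open>The componentwise relations\<close>

lemma abs_uq_hom:
  "abs_uq (x + y) = (abs_uq x + abs_uq y :: ('m::len0, 'n::len0) uq)"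
  "abs_uq (x - y) = (abs_uq x - abs_uq y :: ('m::len0, 'n::len0) uq)"
  "abs_uq (- x) = (- abs_uq x :: ('m::len0, 'n::len0) uq)"
  "abs_uq (x * y) = (abs_uq x * abs_uq y :: ('m::len0, 'n::len0) uq)"
  "abs_uq 0 = (0 :: ('m::len0, 'n::len0) uq)"
  "abs_uq 1 = (1 :: ('m::len0, 'n::len0) uq)"
  by (simp_all add: plus_uq.abs_eq minus_uq.abs_eq uminus_uq.abs_eq times_uq.abs_eq zero_uq_def one_uq_def)

lemma abs_uq_power: "abs_uq (x ^ k) = (abs_uq x ^ k :: ('m::len0, 'n::len0) uq)"
  by (induction k) (simp_all add: abs_uq_hom)

lemma abs_uq_sum: "abs_uq (\<Sum>i\<in>I. f i) = (\<Sum>i\<in>I. abs_uq (f i) :: ('m::len0, 'n::len0) uq)"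
  by (induction I rule: infinite_finite_induct) (simp_all add: abs_uq_hom)

lemma abs_uq_gens: "abs_uq (fgen g) = (ugen g :: ('m::len0, 'n::len0) uq)"
  "abs_uq (fconst c) = (uconst c :: ('m::len0, 'n::len0) uq)"
  by (simp_all add: ugen_def uconst_def)

lemma abs_uq_ideal:
  assumes "x \<in> uq_ideal LENGTH('m::len0) LENGTH('n::len0)"
  shows "abs_uq x = (0 :: ('m, 'n) uq)"
  unfolding zero_uq_def uq.abs_eq_iff using assms by simp

lemma sum_delta2:
  assumes "finite K" "x \<in> K" "y \<in> K"
  shows "(\<Sum>c\<in>K. \<Sum>a\<in>K. if c = x then if a = y then v else 0 else 0) = (v :: 'a::comm_monoid_add)"
proof -
  have "(\<Sum>a\<in>K. if c = x then if a = y then v else 0 else 0) = (if c = x then v else 0)" for c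
    using assms by (cases "c = x") auto
  then show ?thesis using assms by simp
qed

text \<open>R has components E_ii \<otimes> E_kk and E_ik \<otimes> E_ki only, so two terms of the
  contraction survive. They coincide for i = k, which the conditional accounts for.\<close>

lemma gmul2_R_L1:
  fixes A :: "nat \<Rightarrow> nat \<Rightarrow> 'a::ring_1"
  assumes I: "i \<in> {1..m + n}" "k \<in> {1..m + n}"
    and X: "\<And>a c. a \<in> {1..m + n} \<Longrightarrow> c \<in> {1..m + n} \<Longrightarrow> \<not> (i = a \<and> k = c) \<Longrightarrow> \<not> (i = c \<and> k = a) \<Longrightarrow> X i a k c = 0"
    and J: "j \<in> {1..m + n}" "l \<in> {1..m + n}"
  shows "gmul2 m n (gmul2 m n X (\<lambda>i j k l. if k = l then A i j else 0)) (\<lambda>i j k l. if i = j then B k l else 0) i j k l =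
    (-1) ^ ((parity m i + parity m j) * (parity m k + parity m l)) * X i i k k * A i j * B k l +
    (if i = k then 0 else (-1) ^ ((parity m k + parity m j) * (parity m k + parity m l)) * X i k k i * A k j * B i l)"
proof -
  let ?p = "parity m" and ?K = "{1..m + n}"
  have inner: "gmul2 m n X (\<lambda>i j k l. if k = l then A i j else 0) i a k c =
    (\<Sum>a'\<in>?K. (-1) ^ ((?p i + ?p a' + ?p k + ?p c) * (?p a' + ?p a + ?p c + ?p c) + (?p k + ?p c) * (?p a' + ?p a)) * X i a' k c * A a' a)"
    if "c \<in> ?K" for a c
  proof -
    have "gmul2 m n X (\<lambda>i j k l. if k = l then A i j else 0) i a k c =
      (\<Sum>a'\<in>?K. \<Sum>c'\<in>?K. if c' = c then (-1) ^ ((?p i + ?p a' + ?p k + ?p c) * (?p a' + ?p a + ?p c + ?p c) + (?p k + ?p c) * (?p a' + ?p a)) * X i a' k c * A a' a else 0)"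
      unfolding gmul2_def Let_def by (intro sum.cong refl) auto
    then show ?thesis using that by simp
  qed
  have "gmul2 m n (gmul2 m n X (\<lambda>i j k l. if k = l then A i j else 0)) (\<lambda>i j k l. if i = j then B k l else 0) i j k l =
    (\<Sum>a\<in>?K. \<Sum>c\<in>?K. if a = j then (-1) ^ ((?p i + ?p j + ?p k + ?p c) * (?p j + ?p j + ?p c + ?p l) + (?p k + ?p c) * (?p j + ?p j)) *
      gmul2 m n X (\<lambda>i j k l. if k = l then A i j else 0) i j k c * B c l else 0)"
    unfolding gmul2_def[of m n "gmul2 m n X _"] Let_def by (intro sum.cong refl) auto
  also have "\<dots> = (\<Sum>a\<in>?K. if a = j then (\<Sum>c\<in>?K. (-1) ^ ((?p i + ?p j + ?p k + ?p c) * (?p j + ?p j + ?p c + ?p l) + (?p k + ?p c) * (?p j + ?p j)) *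
      gmul2 m n X (\<lambda>i j k l. if k = l then A i j else 0) i j k c * B c l) else 0)"
    by (intro sum.cong refl) auto
  also have "\<dots> = (\<Sum>c\<in>?K. (-1) ^ ((?p i + ?p j + ?p k + ?p c) * (?p j + ?p j + ?p c + ?p l) + (?p k + ?p c) * (?p j + ?p j)) *
      gmul2 m n X (\<lambda>i j k l. if k = l then A i j else 0) i j k c * B c l)"
    using J by simp
  also have "\<dots> = (\<Sum>c\<in>?K. \<Sum>a\<in>?K. (-1) ^ ((?p i + ?p j + ?p k + ?p c) * (?p j + ?p j + ?p c + ?p l) + (?p k + ?p c) * (?p j + ?p j)) *
      ((-1) ^ ((?p i + ?p a + ?p k + ?p c) * (?p a + ?p j + ?p c + ?p c) + (?p k + ?p c) * (?p a + ?p j)) * X i a k c * A a j) * B c l)"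
    by (intro sum.cong refl) (simp add: inner sum_distrib_left sum_distrib_right)
  also have "\<dots> = (\<Sum>c\<in>?K. \<Sum>a\<in>?K. (if c = k then if a = i then (-1) ^ ((?p i + ?p j) * (?p k + ?p l)) * X i i k k * A i j * B k l else 0 else 0) +
      (if c = i then if a = k then (if i = k then 0 else (-1) ^ ((?p k + ?p j) * (?p k + ?p l)) * X i k k i * A k j * B i l) else 0 else 0))"
  proof (intro sum.cong refl)
    fix c a assume ca: "c \<in> ?K" "a \<in> ?K"
    show "(-1) ^ ((?p i + ?p j + ?p k + ?p c) * (?p j + ?p j + ?p c + ?p l) + (?p k + ?p c) * (?p j + ?p j)) *
      ((-1) ^ ((?p i + ?p a + ?p k + ?p c) * (?p a + ?p j + ?p c + ?p c) + (?p k + ?p c) * (?p a + ?p j)) * X i a k c * A a j) * B c l =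
      (if c = k then if a = i then (-1) ^ ((?p i + ?p j) * (?p k + ?p l)) * X i i k k * A i j * B k l else 0 else 0) +
      (if c = i then if a = k then (if i = k then 0 else (-1) ^ ((?p k + ?p j) * (?p k + ?p l)) * X i k k i * A k j * B i l) else 0 else 0)"
    proof (cases "a = i \<and> c = k \<or> a = k \<and> c = i")
      case False
      then have "X i a k c = 0" using X[OF ca(2,1)] by auto
      then show ?thesis using False by auto
    next
      case True
      then show ?thesis
      proof
        assume ac: "a = i \<and> c = k"
        show ?thesis
          by (rule parity_cases[of m i]; rule parity_cases[of m k]; rule parity_cases[of m j]; rule parity_cases[of m l])
            (use ac in \<open>auto simp: mult.assoc\<close>)
      next
        assume ac: "a = k \<and> c = i"
        show ?thesis
          by (rule parity_cases[of m i]; rule parity_cases[of m k]; rule parity_cases[of m j]; rule parity_cases[of m l])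
            (use ac in \<open>auto simp: mult.assoc\<close>)
      qed
    qed
  qed
  also have "\<dots> = (-1) ^ ((parity m i + parity m j) * (parity m k + parity m l)) * X i i k k * A i j * B k l +
    (if i = k then 0 else (-1) ^ ((parity m k + parity m j) * (parity m k + parity m l)) * X i k k i * A k j * B i l)"
    by (simp only: sum.distrib sum_delta2[OF finite_atLeastAtMost I(2) I(1)] sum_delta2[OF finite_atLeastAtMost I(1) I(2)])
  finally show ?thesis .
qed

lemma gmul2_L2_L1_R:
  fixes A :: "nat \<Rightarrow> nat \<Rightarrow> 'a::ring_1"
  assumes I: "i \<in> {1..m + n}" "k \<in> {1..m + n}"
    and X: "\<And>a c. a \<in> {1..m + n} \<Longrightarrow> c \<in> {1..m + n} \<Longrightarrow> \<not> (j = a \<and> l = c) \<Longrightarrow> \<not> (j = c \<and> l = a) \<Longrightarrow> X a j c l = 0"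
    and J: "j \<in> {1..m + n}" "l \<in> {1..m + n}"
  shows "gmul2 m n (gmul2 m n (\<lambda>i j k l. if i = j then B k l else 0) (\<lambda>i j k l. if k = l then A i j else 0)) X i j k l =
    B k l * A i j * X j j l l +
    (if j = l then 0 else (-1) ^ ((parity m k + parity m j) * (parity m l + parity m j)) * B k j * A i l * X l j j l)"
proof -
  let ?p = "parity m" and ?K = "{1..m + n}"
  have inner: "gmul2 m n (\<lambda>i j k l. if i = j then B k l else 0) (\<lambda>i j k l. if k = l then A i j else 0) i a k c = B k c * A i a"
    if "c \<in> ?K" for a c
  proof -
    have "gmul2 m n (\<lambda>i j k l. if i = j then B k l else 0) (\<lambda>i j k l. if k = l then A i j else 0) i a k c =
      (\<Sum>a'\<in>?K. \<Sum>c'\<in>?K. if a' = i then if c' = c then B k c * A i a else 0 else 0)"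
      unfolding gmul2_def Let_def
      by (intro sum.cong refl; rule parity_cases[of m i]; rule parity_cases[of m k]; rule parity_cases[of m a]; rule parity_cases[of m c]) auto
    also have "\<dots> = (\<Sum>a'\<in>?K. if a' = i then B k c * A i a else 0)"
      using that by (intro sum.cong refl) simp
    finally show ?thesis using I by simp
  qed
  have "gmul2 m n (gmul2 m n (\<lambda>i j k l. if i = j then B k l else 0) (\<lambda>i j k l. if k = l then A i j else 0)) X i j k l =
    (\<Sum>a\<in>?K. \<Sum>c\<in>?K. (-1) ^ ((?p i + ?p a + ?p k + ?p c) * (?p a + ?p j + ?p c + ?p l) + (?p k + ?p c) * (?p a + ?p j)) *
      (B k c * A i a) * X a j c l)"
    unfolding gmul2_def[of m n "gmul2 m n _ _"] Let_def by (intro sum.cong refl) (simp add: inner)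
  also have "\<dots> = (\<Sum>a\<in>?K. \<Sum>c\<in>?K. (if a = j then if c = l then B k l * A i j * X j j l l else 0 else 0) +
      (if a = l then if c = j then (if j = l then 0 else (-1) ^ ((?p k + ?p j) * (?p l + ?p j)) * B k j * A i l * X l j j l) else 0 else 0))"
  proof (intro sum.cong refl)
    fix a c assume ca: "a \<in> ?K" "c \<in> ?K"
    show "(-1) ^ ((?p i + ?p a + ?p k + ?p c) * (?p a + ?p j + ?p c + ?p l) + (?p k + ?p c) * (?p a + ?p j)) * (B k c * A i a) * X a j c l =
      (if a = j then if c = l then B k l * A i j * X j j l l else 0 else 0) +
      (if a = l then if c = j then (if j = l then 0 else (-1) ^ ((?p k + ?p j) * (?p l + ?p j)) * B k j * A i l * X l j j l) else 0 else 0)"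
    proof (cases "a = j \<and> c = l \<or> a = l \<and> c = j")
      case False
      then have "X a j c l = 0" using X[OF ca] by auto
      then show ?thesis using False by auto
    next
      case True
      then show ?thesis
      proof
        assume ac: "a = j \<and> c = l"
        show ?thesis
          by (rule parity_cases[of m i]; rule parity_cases[of m k]; rule parity_cases[of m j]; rule parity_cases[of m l])
            (use ac in \<open>auto simp: mult.assoc\<close>)
      next
        assume ac: "a = l \<and> c = j"
        show ?thesis
          by (rule parity_cases[of m i]; rule parity_cases[of m k]; rule parity_cases[of m j]; rule parity_cases[of m l])
            (use ac in \<open>auto simp: mult.assoc\<close>)
      qed
    qed
  qed
  also have "\<dots> = B k l * A i j * X j j l l +
    (if j = l then 0 else (-1) ^ ((parity m k + parity m j) * (parity m l + parity m j)) * B k j * A i l * X l j j l)"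
    by (simp only: sum.distrib sum_delta2[OF finite_atLeastAtMost J(1) J(2)] sum_delta2[OF finite_atLeastAtMost J(2) J(1)])
  finally show ?thesis .
qed

lemma uconst_sg: "uconst ((-1) ^ e) = ((-1) ^ e :: ('m::len0, 'n::len0) uq)"
  by (induction e) (simp_all add: uq.sc_mult uq.sc_minus)

text \<open>The (i, j, k, l) component of c L_1 L_2 - L_2 L_1 c in the coefficients of index r and
  t, for a family c supported like R. Linearity in c separates the scalar series from
  \<open>R_z\<close> and \<open>R_w\<close>.\<close>

definition Frel :: "(nat \<Rightarrow> nat \<Rightarrow> nat \<Rightarrow> nat \<Rightarrow> cq) \<Rightarrow> pm \<Rightarrow> nat \<Rightarrow> nat \<Rightarrow> nat \<Rightarrow> nat \<Rightarrow> nat \<Rightarrow> nat \<Rightarrow> ('m::len0, 'n::len0) uq" where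
  "Frel c s i j k l r t = (let p = parity LENGTH('m); g = (\<lambda>r i j. ugen (Lgen s r i j)) in
    uconst (sg ((p i + p j) * (p k + p l)) * c i i k k) * (g r i j * g t k l) +
    uconst (if i = k then 0 else sg ((p k + p j) * (p k + p l)) * c i k k i) * (g r k j * g t i l) -
    uconst (c j j l l) * (g t k l * g r i j) -
    uconst (if j = l then 0 else sg ((p k + p j) * (p l + p j)) * c l j j l) * (g t k j * g r i l))"

lemma Frel_add: "Frel (\<lambda>i j k l. c i j k l + d i j k l) s i j k l r t = Frel c s i j k l r t + Frel d s i j k l r t"
  by (simp add: Frel_def Let_def uq.sc_add distrib_left distrib_right)

lemma Frel_scale: "Frel (\<lambda>i j k l. x * c i j k l) s i j k l r t = uconst x * Frel c s i j k l r t"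
proof -
  have e: "uconst (y * (x * z)) = uconst x * uconst (y * z)" for y z
    by (metis mult.left_commute uq.sc_mult)
  have e2: "uconst (if b then 0 else y * (x * z)) = uconst x * uconst (if b then 0 else y * z)" for b y z
    by (simp add: e)
  show ?thesis
    unfolding Frel_def Let_def e e2 uq.sc_mult[of x] by (simp only: distrib_left right_diff_distrib mult.assoc)
qed

lemma R_zero_nth_0:
  assumes "\<not> (i = j \<and> k = l)" "\<not> (i = l \<and> k = j)"
  shows "fps_nth (R_zero m n i j k l) p = 0"
  using assms by (auto simp: R_zero_nth R_z_def R_w_def)

lemma abs_uq_rll_term:
  fixes i j k l :: nat
  defines "M \<equiv> LENGTH('m::len0)" and "N \<equiv> LENGTH('n::len0)"
  assumes I: "{i, j, k, l} \<subseteq> {1..M + N}"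
  shows "abs_uq (gmul2 M N (gmul2 M N (tR (R_zero M N) p) (tL1 s r)) (tL2 s t) i j k l -
      gmul2 M N (gmul2 M N (tL2 s t) (tL1 s r)) (tR (R_zero M N) p) i j k l) =
    (Frel (\<lambda>i j k l. fps_nth (R_zero M N i j k l) p) s i j k l r t :: ('m, 'n) uq)"
proof -
  let ?X = "tR (R_zero M N) p"
  have L: "gmul2 M N (gmul2 M N ?X (tL1 s r)) (tL2 s t) i j k l =
    (-1) ^ ((parity M i + parity M j) * (parity M k + parity M l)) * ?X i i k k * fgen (Lgen s r i j) * fgen (Lgen s t k l) +
    (if i = k then 0 else (-1) ^ ((parity M k + parity M j) * (parity M k + parity M l)) * ?X i k k i * fgen (Lgen s r k j) * fgen (Lgen s t i l))"
    unfolding tL1_def tL2_def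
    by (rule gmul2_R_L1) (use I in \<open>auto simp: tR_def R_zero_nth_0\<close>)
  have R: "gmul2 M N (gmul2 M N (tL2 s t) (tL1 s r)) ?X i j k l =
    fgen (Lgen s t k l) * fgen (Lgen s r i j) * ?X j j l l +
    (if j = l then 0 else (-1) ^ ((parity M k + parity M j) * (parity M l + parity M j)) * fgen (Lgen s t k j) * fgen (Lgen s r i l) * ?X l j j l)"
    unfolding tL1_def tL2_def
    by (rule gmul2_L2_L1_R) (use I in \<open>auto simp: tR_def R_zero_nth_0\<close>)
  have s1: "(-1) ^ e * uconst c * x * y = uconst ((-1) ^ e * c) * (x * y)" for e c and x y :: "('m, 'n) uq"
    by (simp only: uq.sc_mult uconst_sg mult.assoc)
  have s2: "(-1) ^ e * x * y * uconst c = uconst ((-1) ^ e * c) * (x * y)" for e c and x y :: "('m, 'n) uq"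
    by (simp only: uq.sc_mult uconst_sg mult.assoc uq.sc_central[of "y"] uq.sc_left)
  have s3: "x * y * uconst c = uconst c * (x * y)" for c and x y :: "('m, 'n) uq"
    by (rule uq.sc_central)
  have s4: "uconst (if b then 0 else c) * ((-1) ^ e * x * y) = uconst (if b then 0 else (-1) ^ e * c) * (x * y)" for b e c and x y :: "('m, 'n) uq"
    by (cases b) (simp_all only: if_True if_False uq.sc_0 mult_zero_left uq.sc_mult uconst_sg mult.assoc uq.sc_left)
  have if_d: "abs_uq (if b then 0 else x) = (if b then 0 else abs_uq x :: ('m, 'n) uq)" for b x
    by (simp add: abs_uq_hom)
  have if_u: "(if b then 0 else uconst c * x) = uconst (if b then 0 else c) * x" for b c and x :: "('m, 'n) uq"
    by simp
  show ?thesis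
    unfolding L R
    unfolding abs_uq_hom if_d abs_uq_power abs_uq_gens tR_def s1 s2 s3 if_u s4 Frel_def Let_def M_def
    by (simp only: diff_diff_add add_diff_eq diff_add_eq)
qed

lemma rll_index_Minus:
  "rll_index Minus (int a) (int n - int a) = (\<lambda>r. (a - r, r, n - r)) ` {..min a n}"
proof -
  have "(p, r, t) \<in> rll_index Minus (int a) (int n - int a) \<longleftrightarrow> r \<le> min a n \<and> p = a - r \<and> t = n - r" for p r t
    by (auto simp: rll_index_def)
  then show ?thesis by (auto simp: image_iff)
qed

lemma rll_index_Plus:
  "rll_index Plus (int a - int n) (- int a) = (\<lambda>t. (a - t, n - t, t)) ` {..min a n}"
proof -
  have "(p, r, t) \<in> rll_index Plus (int a - int n) (- int a) \<longleftrightarrow> t \<le> min a n \<and> p = a - t \<and> r = n - t" for p r t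
    by (auto simp: rll_index_def)
  then show ?thesis by (auto simp: image_iff)
qed

lemma Frel_R_zero:
  "Frel (\<lambda>i j k l. fps_nth (R_zero m n i j k l) p) s i j k l r t =
    uconst (fps_nth (u_zero m n) p) * Frel (R_w m) s i j k l r t +
    (if 0 < p then uconst (fps_nth (u_zero m n) (p - 1)) * Frel (R_z m) s i j k l r t else 0)"
proof -
  have "fps_nth (R_zero m n i j k l) p = fps_nth (u_zero m n) p * R_w m i j k l +
    (if 0 < p then fps_nth (u_zero m n) (p - 1) else 0) * R_z m i j k l" for i j k l
    by (simp add: R_zero_nth)
  then show ?thesis
    by (simp only: Frel_add Frel_scale) simp
qed

lemma rll_sum:
  fixes i j k l :: nat
  defines "M \<equiv> LENGTH('m::len0)" and "N \<equiv> LENGTH('n::len0)"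
  assumes I: "{i, j, k, l} \<subseteq> {1..M + N}"
  shows "(\<Sum>(p, r, t)\<in>rll_index s a b. Frel (\<lambda>i j k l. fps_nth (R_zero M N i j k l) p) s i j k l r t) = (0 :: ('m, 'n) uq)"
proof -
  have "(\<Sum>(p, r, t)\<in>rll_index s a b. Frel (\<lambda>i j k l. fps_nth (R_zero M N i j k l) p) s i j k l r t) =
    (abs_uq (rll_same_lhs M N s a b i j k l - rll_same_rhs M N s a b i j k l) :: ('m, 'n) uq)"
    unfolding rll_same_lhs_def rll_same_rhs_def sum_subtractf[symmetric] abs_uq_sum
    by (intro sum.cong refl) (use I in \<open>auto simp: M_def N_def abs_uq_rll_term\<close>)
  also have "\<dots> = 0"
    unfolding M_def N_def by (rule abs_uq_ideal, rule uq_ideal.rll_same) (use I in \<open>simp add: M_def N_def\<close>)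
  finally show ?thesis .
qed

lemma Frel_series:
  fixes i j k l :: nat
  defines "M \<equiv> LENGTH('m::len0)" and "N \<equiv> LENGTH('n::len0)"
  assumes MN: "M \<noteq> N" and I: "{i, j, k, l} \<subseteq> {1..M + N}"
  shows "(\<Sum>r\<le>n. uconst (qq powi (- pm_int s * a * int r) * qq powi (- pm_int s * b * int (n - r))) *
    (uconst (qq powi a) * Frel (R_z M) s i j k l r (n - r) + uconst (qq powi b) * Frel (R_w M) s i j k l r (n - r))) = (0 :: ('m, 'n) uq)"
proof (cases s)
  case Minus
  have "(\<Sum>r\<le>n. uconst ((qq powi a) ^ r * (qq powi b) ^ (n - r)) *
    (uconst (qq powi a) * Frel (R_z M) s i j k l r (n - r) + uconst (qq powi b) * Frel (R_w M) s i j k l r (n - r))) = (0 :: ('m, 'n) uq)"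
  proof (rule cancel_series[OF scalar_ring_uconst, of "fps_nth (u_zero M N)"])
    show "fps_nth (u_zero M N) 0 \<noteq> 0" using MN by (rule u_zero_0)
    fix n' a' :: nat
    show "(\<Sum>r\<le>min a' n'. uconst (fps_nth (u_zero M N) (a' - r)) * Frel (R_w M) s i j k l r (n' - r) +
      (if r < a' then uconst (fps_nth (u_zero M N) (a' - r - 1)) * Frel (R_z M) s i j k l r (n' - r) else 0)) = (0 :: ('m, 'n) uq)"
      using rll_sum[where 'm = 'm and 'n = 'n, of i j k l Minus "int a'" "int n' - int a'"] I
      unfolding rll_index_Minus M_def N_def Minus
      by (simp add: sum.reindex inj_on_def Frel_R_zero)
  qed
  then show ?thesis
    by (simp add: Minus power_int_mult del: of_nat_diff)
next
  case Plus
  \<comment> \<open>L^+ is a series in the inverse variables, and z/w = w^-1 / z^-1, so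
    \<open>cancel_series\<close> is applied with w^-1 first and z^-1 second. The factor q^(a+b) in
    \<open>?g\<close> then turns w^-1 R_z + z^-1 R_w into z R_z + w R_w.\<close>
  have z: "(\<Sum>t\<le>n. uconst ((qq powi (- b)) ^ t * (qq powi (- a)) ^ (n - t)) *
    (uconst (qq powi (- b)) * Frel (R_z M) s i j k l (n - t) t + uconst (qq powi (- a)) * Frel (R_w M) s i j k l (n - t) t)) = (0 :: ('m, 'n) uq)"
  proof (rule cancel_series[OF scalar_ring_uconst, of "fps_nth (u_zero M N)" "\<lambda>t r. Frel (R_w M) s i j k l r t" "\<lambda>t r. Frel (R_z M) s i j k l r t"])
    show "fps_nth (u_zero M N) 0 \<noteq> 0" using MN by (rule u_zero_0)
    fix n' a' :: nat
    show "(\<Sum>t\<le>min a' n'. uconst (fps_nth (u_zero M N) (a' - t)) * Frel (R_w M) s i j k l (n' - t) t +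
      (if t < a' then uconst (fps_nth (u_zero M N) (a' - t - 1)) * Frel (R_z M) s i j k l (n' - t) t else 0)) = (0 :: ('m, 'n) uq)"
      using rll_sum[where 'm = 'm and 'n = 'n, of i j k l Plus "int a' - int n'" "- int a'"] I
      unfolding rll_index_Plus M_def N_def Plus
      by (simp add: sum.reindex inj_on_def Frel_R_zero)
  qed
  let ?f = "\<lambda>r. uconst (qq powi (- pm_int s * a * int r) * qq powi (- pm_int s * b * int (n - r))) *
    (uconst (qq powi a) * Frel (R_z M) s i j k l r (n - r) + uconst (qq powi b) * Frel (R_w M) s i j k l r (n - r)) :: ('m, 'n) uq"
  let ?g = "\<lambda>t. uconst (qq powi (a + b)) * (uconst ((qq powi (- b)) ^ t * (qq powi (- a)) ^ (n - t)) *
    (uconst (qq powi (- b)) * Frel (R_z M) s i j k l (n - t) t + uconst (qq powi (- a)) * Frel (R_w M) s i j k l (n - t) t)) :: ('m, 'n) uq"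
  have "?g (n - r) = ?f r" if "r \<le> n" for r
  proof -
    have p: "(qq powi (- b)) ^ (n - r) = qq powi (- (b * int (n - r)))" "(qq powi (- a)) ^ r = qq powi (- (a * int r))"
      by (simp_all add: power_int_mult[symmetric] power_int_of_nat[symmetric] del: power_int_of_nat)
    have e: "qq powi (- b) * (qq powi (a + b) * x) = qq powi a * x" "qq powi (- a) * (qq powi (a + b) * x) = qq powi b * x" for x
      by (simp_all add: power_int_add power_int_minus qq_nz field_simps)
    show ?thesis
      using that by (simp add: p Plus distrib_left uq.sc_mult_assoc e mult_ac)
  qed
  then have "(\<Sum>r\<le>n. ?f r) = (\<Sum>t\<le>n. ?g t)"
    by (intro sum.reindex_bij_witness[of _ "\<lambda>t. n - t" "\<lambda>r. n - r"]) auto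
  also have "\<dots> = 0"
    unfolding sum_distrib_left[symmetric] z by simp
  finally show ?thesis .
qed

definition Lt :: "pm \<Rightarrow> nat \<Rightarrow> nat \<Rightarrow> ('m::len0, 'n::len0) uq fps" where
  "Lt s i j = uqs.fsc (tw LENGTH('m) i j) * Lmat s i j"

text \<open>The twisted coefficients of the four terms are those of \<open>Frel\<close> times one
  common sign \<open>?w\<close>, as a check over all parities shows. The two lengths differ, so the
  scalar series is well defined and has been cancelled in \<open>Frel_series\<close>.\<close>

lemma rll_uq:
  assumes MN: "LENGTH('m::len0) \<noteq> LENGTH('n::len0)"
  shows "rll (uqs.fsc :: _ \<Rightarrow> ('m, 'n) uq fps) qq LENGTH('m) (LENGTH('m) + LENGTH('n)) (\<lambda>a i j. uqs.shift s a (Lt s i j))"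
proof (intro rll.intro rll_axioms.intro uqs.scalar_ring_fsc)
  fix i j k l :: nat and a b :: int
  define M where "M = LENGTH('m)"
  define N where "N = LENGTH('n)"
  let ?p = "parity M"
  assume I: "i \<in> {1..LENGTH('m) + LENGTH('n)}" "j \<in> {1..LENGTH('m) + LENGTH('n)}"
    "k \<in> {1..LENGTH('m) + LENGTH('n)}" "l \<in> {1..LENGTH('m) + LENGTH('n)}"
  let ?L = "\<lambda>i j. Lmat s i j :: ('m, 'n) uq fps" and ?sh = "uqs.shift s :: int \<Rightarrow> ('m, 'n) uq fps \<Rightarrow> _"
  let ?c1 = "rho qq M a b i k * sg (?p k * (?p i + ?p j))" and ?c2 = "xi qq a b i k * sg (?p i * ?p j)"
  let ?c3 = "rho qq M a b j l * sg (?p l * (?p i + ?p j))" and ?c4 = "xi qq a b l j * sg (?p i * ?p j)"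
  let ?w = "tw M i j * tw M k l * sg (?p l * (?p i + ?p j)) :: cq"
  let ?R = "\<lambda>i j k l. qq powi a * R_z M i j k l + qq powi b * R_w M i j k l"
  have qi: "qi M i = qq powi gr M i" for i by (simp add: qi_def gr_def)
  have qi2: "qq powi gr M i - inverse (qq powi gr M i) = sg (?p i) * (qq - 1 / qq)" for i
    by (rule parity_cases[of M i]) (auto simp: gr_def power_int_minus divide_inverse)
  have R1: "?R i i k k = rho qq M a b i k" for i k
    by (auto simp: R_z_def R_w_def rho_def qi divide_inverse)
  have R2: "?R i k k i = sg (?p k) * xi qq a b i k" if "i \<noteq> k" for i k
    using that by (auto simp: R_z_def R_w_def xi_def qi qi2)
  have xi0: "xi qq a b i i = 0" for i by (simp add: xi_def)
  have k1: "?c1 * (tw M i j * tw M k l) = ?w * (sg ((?p i + ?p j) * (?p k + ?p l)) * ?R i i k k)"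
    unfolding R1 by (rule parity_cases[of M i]; rule parity_cases[of M j]; rule parity_cases[of M k]; rule parity_cases[of M l]; simp add: tw_def)
  have k2: "?c2 * (tw M k j * tw M i l) = ?w * (if i = k then 0 else sg ((?p k + ?p j) * (?p k + ?p l)) * ?R i k k i)"
  proof (cases "i = k")
    case False
    then show ?thesis unfolding R2[OF False]
      by (rule_tac parity_cases[of M i]; rule_tac parity_cases[of M j]; rule_tac parity_cases[of M k]; rule_tac parity_cases[of M l]; simp add: tw_def)
  qed (simp add: xi0)
  have k3: "?c3 * (tw M i j * tw M k l) = ?w * ?R j j l l"
    unfolding R1 by simp
  have k4: "?c4 * (tw M k j * tw M i l) = ?w * (if j = l then 0 else sg ((?p k + ?p j) * (?p l + ?p j)) * ?R l j j l)"
  proof (cases "j = l")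
    case False
    then have "l \<noteq> j" by simp
    show ?thesis unfolding R2[OF \<open>l \<noteq> j\<close>] using False
      by (rule_tac parity_cases[of M i]; rule_tac parity_cases[of M j]; rule_tac parity_cases[of M k]; rule_tac parity_cases[of M l]; simp add: tw_def)
  qed (simp add: xi0)
  have pull: "uqs.fsc c * (?sh x (Lt s i j) * ?sh y (Lt s k l)) = uqs.fsc (c * (tw M i j * tw M k l)) * (?sh x (?L i j) * ?sh y (?L k l))"
    for c x y i j k l
  proof -
    interpret f: scalar_ring "uqs.fsc :: _ \<Rightarrow> ('m, 'n) uq fps" qq by (rule uqs.scalar_ring_fsc)
    show ?thesis
      by (simp only: Lt_def M_def uqs.shift_mult uqs.shift_fsc f.sc_prod f.sc_mult_assoc)
  qed
  have pull': "uqs.fsc c * (?sh x (Lt s k l) * ?sh y (Lt s i j)) = uqs.fsc (c * (tw M i j * tw M k l)) * (?sh x (?L k l) * ?sh y (?L i j))"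
    for c x y i j k l
    unfolding pull by (simp only: mult.commute[of "tw M i j"])
  let ?F = "\<lambda>c r n. Frel c s i j k l r (n - r) :: ('m, 'n) uq"
  let ?e = "\<lambda>r n. uconst (qq powi (- pm_int s * a * int r) * qq powi (- pm_int s * b * int (n - r))) :: ('m, 'n) uq"
  have "uqs.fsc (?c1 * (tw M i j * tw M k l)) * (?sh a (?L i j) * ?sh b (?L k l)) +
    uqs.fsc (?c2 * (tw M k j * tw M i l)) * (?sh a (?L k j) * ?sh b (?L i l)) =
    uqs.fsc (?c3 * (tw M i j * tw M k l)) * (?sh b (?L k l) * ?sh a (?L i j)) +
    uqs.fsc (?c4 * (tw M k j * tw M i l)) * (?sh b (?L k j) * ?sh a (?L i l))" (is "?lhs = ?rhs")
  proof (rule fps_ext)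
    fix n
    let ?g = "\<lambda>r i j. ugen (Lgen s r i j) :: ('m, 'n) uq"
    have nth: "fps_nth (uqs.fsc c * (?sh a (?L x y) * ?sh b (?L u v))) n = (\<Sum>r\<le>n. ?e r n * (uconst c * (?g r x y * ?g (n - r) u v)))"
      "fps_nth (uqs.fsc c * (?sh b (?L u v) * ?sh a (?L x y))) n = (\<Sum>r\<le>n. ?e r n * (uconst c * (?g (n - r) u v * ?g r x y)))" for c x y u v
      by (simp_all only: uqs.fsc_nth uqs.shift_mult_nth[where a = a and b = b] uqs.shift_mult_nth'[where a = a and b = b] sum_distrib_left uq.sc_mult_assoc mult.commute[of c] Lmat_def fps_nth_Abs_fps)
    have comb0: "uconst (w * A) * X + uconst (w * B) * Y - uconst (w * C) * Z - uconst (w * D) * V =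
      uconst w * (uconst A * X + uconst B * Y - uconst C * Z - uconst D * V)" for w A B C D and X Y Z V :: "('m, 'n) uq"
      by (simp only: uq.sc_mult mult.assoc distrib_left right_diff_distrib)
    have comb: "uconst (?w * (sg ((?p i + ?p j) * (?p k + ?p l)) * ?R i i k k)) * (?g r i j * ?g (n - r) k l) +
      uconst (?w * (if i = k then 0 else sg ((?p k + ?p j) * (?p k + ?p l)) * ?R i k k i)) * (?g r k j * ?g (n - r) i l) -
      uconst (?w * ?R j j l l) * (?g (n - r) k l * ?g r i j) -
      uconst (?w * (if j = l then 0 else sg ((?p k + ?p j) * (?p l + ?p j)) * ?R l j j l)) * (?g (n - r) k j * ?g r i l) =
      uconst ?w * (uconst (qq powi a) * ?F (R_z M) r n + uconst (qq powi b) * ?F (R_w M) r n)" for r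
      unfolding Frel_scale[where x = "qq powi a", symmetric] Frel_scale[where x = "qq powi b", symmetric] Frel_add[symmetric] comb0
      unfolding Frel_def Let_def M_def[symmetric] by (rule refl)
    have "fps_nth ?lhs n - fps_nth ?rhs n = (\<Sum>r\<le>n. ?e r n * (uconst ?w * (uconst (qq powi a) * ?F (R_z M) r n + uconst (qq powi b) * ?F (R_w M) r n)))"
      unfolding fps_add_nth nth k1 k2 k3 k4 comb[symmetric]
      by (simp only: sum.distrib[symmetric] sum_subtractf[symmetric] right_diff_distrib distrib_left diff_diff_add)
    also have "\<dots> = uconst ?w * (\<Sum>r\<le>n. ?e r n * (uconst (qq powi a) * ?F (R_z M) r n + uconst (qq powi b) * ?F (R_w M) r n))"
      by (simp only: sum_distrib_left uq.sc_swap3)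
    also have "\<dots> = 0"
      using Frel_series[where 'm = 'm and 'n = 'n, OF MN, of i j k l s a b n] I unfolding M_def by simp
    finally show "fps_nth ?lhs n = fps_nth ?rhs n" by simp
  qed
  then show "uqs.fsc (rho qq LENGTH('m) a b i k * sg (parity LENGTH('m) k * (parity LENGTH('m) i + parity LENGTH('m) j))) *
       (?sh a (Lt s i j) * ?sh b (Lt s k l)) +
       uqs.fsc (xi qq a b i k * sg (parity LENGTH('m) i * parity LENGTH('m) j)) * (?sh a (Lt s k j) * ?sh b (Lt s i l)) =
       uqs.fsc (rho qq LENGTH('m) a b j l * sg (parity LENGTH('m) l * (parity LENGTH('m) i + parity LENGTH('m) j))) *
       (?sh b (Lt s k l) * ?sh a (Lt s i j)) +
       uqs.fsc (xi qq a b l j * sg (parity LENGTH('m) i * parity LENGTH('m) j)) * (?sh b (Lt s k j) * ?sh a (Lt s i l))"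
    unfolding pull pull'[of _ _ k l _ i j] M_def
    by (simp only: mult.commute[of "tw _ i l"] mult.commute[of "tw _ k l"])
qed

subsection \<open>Inverses of the generator matrices\<close>

text \<open>A grading modulo 2, indexed by natural numbers because parities occur as sums. It is
  used for the homogeneous elements of the subalgebra \<open>uq_sub\<close>, since \<omega> is
  controlled on homogeneous elements and \<phi> on that subalgebra.\<close>

locale graded_ring =
  fixes H :: "nat \<Rightarrow> 'r::ring_1 set"
  assumes H_0: "0 \<in> H e"
    and H_add: "x \<in> H e \<Longrightarrow> y \<in> H e \<Longrightarrow> x + y \<in> H e"
    and H_uminus: "x \<in> H e \<Longrightarrow> - x \<in> H e"
    and H_mult: "x \<in> H d \<Longrightarrow> y \<in> H e \<Longrightarrow> x * y \<in> H (d + e)"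
    and H_cong: "d mod 2 = e mod 2 \<Longrightarrow> H d = H e"
begin

lemma H_diff: "x \<in> H e \<Longrightarrow> y \<in> H e \<Longrightarrow> x - y \<in> H e"
  using H_add[of x e "- y"] H_uminus by simp

lemma H_sum: "(\<And>i. i \<in> I \<Longrightarrow> f i \<in> H e) \<Longrightarrow> (\<Sum>i\<in>I. f i) \<in> H e"
  by (induction I rule: infinite_finite_induct) (auto simp: H_0 H_add)

lemma H_mult': "x \<in> H d \<Longrightarrow> y \<in> H e \<Longrightarrow> (d + e) mod 2 = f mod 2 \<Longrightarrow> x * y \<in> H f"
  using H_mult[of x d y e] H_cong[of "d + e" f] by simp

lemma H_schur:
  assumes "\<And>k l. k \<in> insert x J \<Longrightarrow> l \<in> insert x J \<Longrightarrow> A k l \<in> H (p k + p l)"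
    and "\<And>k l. k \<in> J \<Longrightarrow> l \<in> J \<Longrightarrow> D k l \<in> H (p k + p l)"
  shows "schur J A D x x \<in> H 0"
  unfolding schur_def
proof (intro H_diff H_sum)
  show "A x x \<in> H 0" using assms(1)[of x x] H_cong[of "p x + p x" 0] by simp
  fix k l assume kl: "k \<in> J" "l \<in> J"
  have "A x k * D k l \<in> H (p x + p l)"
    by (rule H_mult'[OF assms(1) assms(2)]) (use kl in \<open>auto, presburger\<close>)
  then show "A x k * D k l * A l x \<in> H 0"
    by (rule H_mult'[OF _ assms(1)]) (use kl in \<open>auto, presburger\<close>)
qed

text \<open>Blocks are inverted by bordering. \<epsilon> takes the constant term; as the constant
  term of A is triangular, every product through both the border row and the border column vanishes
  under \<epsilon>. So the Schur complement has the constant term of the new diagonal entry and is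
  invertible by \<open>inv\<close>.\<close>

lemma graded_minv:
  fixes \<epsilon> :: "'r \<Rightarrow> 's::ring_1" and p :: "nat \<Rightarrow> nat" and i j N :: nat
  assumes hom: "\<And>x y. \<epsilon> (x + y) = \<epsilon> x + \<epsilon> y" "\<And>x y. \<epsilon> (x * y) = \<epsilon> x * \<epsilon> y"
    and inv: "\<And>x t. t \<in> {1..N} \<Longrightarrow> x \<in> H 0 \<Longrightarrow> \<epsilon> x = a t \<Longrightarrow> \<exists>y\<in>H 0. x * y = 1 \<and> y * x = 1 \<and> \<epsilon> y = z t"
    and A: "\<And>k l. k \<in> {1..N} \<Longrightarrow> l \<in> {1..N} \<Longrightarrow> A k l \<in> H (p k + p l)"
    and At: "\<And>t. t \<in> {1..N} \<Longrightarrow> \<epsilon> (A t t) = a t"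
    and tri: "(\<forall>k l. k < l \<longrightarrow> \<epsilon> (A l k) = 0) \<or> (\<forall>k l. k < l \<longrightarrow> \<epsilon> (A k l) = 0)"
    and "1 \<le> i" "j \<le> N"
  shows "\<exists>X. minv {i..j} A X \<and> (\<forall>k\<in>{i..j}. \<forall>l\<in>{i..j}. X k l \<in> H (p k + p l)) \<and>
    (i \<le> j \<longrightarrow> \<epsilon> (X i i) = z i \<and> \<epsilon> (X j j) = z j)"
  using \<open>j \<le> N\<close>
proof (induction j)
  case 0
  then show ?case using \<open>1 \<le> i\<close> by (auto simp: minv_def)
next
  case (Suc j)
  show ?case
  proof (cases "i \<le> Suc j")
    case False
    then show ?thesis by (auto simp: minv_def)
  next
    case True
    define J x where "J = {i..j}" and "x = Suc j"
    have \<epsilon>0: "\<epsilon> 0 = 0" using hom(1)[of 0 0] by simp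
    have \<epsilon>m: "\<epsilon> (- y) = - \<epsilon> y" for y
      using hom(1)[of y "- y"] \<epsilon>0 by (simp add: eq_neg_iff_add_eq_0 add.commute)
    have \<epsilon>s: "\<epsilon> (\<Sum>k\<in>J. f k) = (\<Sum>k\<in>J. \<epsilon> (f k))" for f and J :: "nat set"
      by (induction J rule: infinite_finite_induct) (simp_all add: \<epsilon>0 hom)
    have eq: "{i..Suc j} = insert x J" and xJ: "finite J" "x \<notin> J"
      using True by (auto simp: J_def x_def)
    have xN: "x \<in> {1..N}" "\<And>k. k \<in> J \<Longrightarrow> k \<in> {1..N}" "\<And>k. k \<in> J \<Longrightarrow> k < x"
      using Suc.prems \<open>1 \<le> i\<close> by (auto simp: J_def x_def)
    obtain D where DD: "minv {i..j} A D" "\<forall>k\<in>{i..j}. \<forall>l\<in>{i..j}. D k l \<in> H (p k + p l)"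
      "i \<le> j \<longrightarrow> \<epsilon> (D i i) = z i \<and> \<epsilon> (D j j) = z j"
      using Suc.IH[OF Suc_leD[OF Suc.prems]] by blast
    have D: "minv J A D" and DH: "\<And>k l. k \<in> J \<Longrightarrow> l \<in> J \<Longrightarrow> D k l \<in> H (p k + p l)"
      using DD unfolding J_def by blast+
    have tri': "(\<forall>k\<in>J. \<epsilon> (A x k) = 0) \<or> (\<forall>k\<in>J. \<epsilon> (A k x) = 0)"
      using tri xN(3) by blast
    have "\<epsilon> (A x k * D k l * A l x) = 0" if "k \<in> J" "l \<in> J" for k l
      using tri' that by (auto simp: hom)
    then have "\<epsilon> (schur J A D x x) = \<epsilon> (A x x)"
      by (simp add: schur_def hom(1)[of _ "- _", simplified] \<epsilon>m \<epsilon>s)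
    moreover have "schur J A D x x \<in> H 0"
      by (rule H_schur[where p = p]) (use A DH xN in auto)
    ultimately obtain d' where d': "d' \<in> H 0" "schur J A D x x * d' = 1" "d' * schur J A D x x = 1" "\<epsilon> d' = z x"
      using inv[OF xN(1)] At[OF xN(1)] by auto
    define u v where "u = (\<lambda>k. \<Sum>j\<in>J. A x j * D j k)" and "v = (\<lambda>j. \<Sum>k\<in>J. D j k * A k x)"
    define X where "X = (\<lambda>i k. if i = x then (if k = x then d' else - (d' * u k))
      else if k = x then - (v i * d') else D i k + v i * d' * u k)"
    have X: "minv (insert x J) A X"
      unfolding X_def u_def v_def by (rule minv_border[OF xJ D d'(2,3)])
    have uH: "u k \<in> H (p x + p k)" if "k \<in> J" for k
      unfolding u_def by (intro H_sum H_mult'[OF A DH]) (use that xN in \<open>auto, presburger\<close>)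
    have vH: "v k \<in> H (p k + p x)" if "k \<in> J" for k
      unfolding v_def by (intro H_sum H_mult'[OF DH A]) (use that xN in \<open>auto, presburger\<close>)
    have XH: "X k l \<in> H (p k + p l)" if "k \<in> insert x J" "l \<in> insert x J" for k l
    proof -
      have 1: "d' \<in> H (p x + p x)" using d'(1) H_cong[of "p x + p x" 0] by simp
      have 2: "- (d' * u l) \<in> H (p x + p l)" if "l \<in> J" for l
        by (intro H_uminus H_mult'[OF d'(1) uH[OF that]]) simp
      have 3: "v k * d' \<in> H (p k + p x)" if "k \<in> J" for k
        by (intro H_mult'[OF vH[OF that] d'(1)]) simp
      have 4: "D k l + v k * d' * u l \<in> H (p k + p l)" if "k \<in> J" "l \<in> J" for k l
        by (rule H_add[OF DH[OF that] H_mult'[OF 3[OF that(1)] uH[OF that(2)]]]) presburger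
      show ?thesis
        unfolding X_def using that 1 2[of l] H_uminus[OF 3[of k]] 4[of k l] by (cases "k = x"; cases "l = x") simp_all
    qed
    have "\<epsilon> (v i * d' * u i) = 0"
      using tri' by (auto simp: hom u_def v_def \<epsilon>s)
    then have "\<epsilon> (X i i) = z i"
      using DD(3) d'(4) True by (auto simp: X_def x_def hom)
    moreover have "\<epsilon> (X x x) = z x"
      using d'(4) by (simp add: X_def)
    ultimately show ?thesis
      using X XH unfolding eq x_def by (intro exI[of _ X] conjI ballI impI)
  qed
qed

end

lemma abs_uq_homogeneous:
  "(\<And>w. w \<in> Poly_Mapping.keys x \<Longrightarrow> word_parity LENGTH('m) w mod 2 = e mod 2) \<Longrightarrow>
    (abs_uq x :: ('m::len0, 'n::len0) uq) \<in> uq_homogeneous e"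
  by (auto simp: uq_homogeneous_def)

lemma ugen_homogeneous: "(ugen g :: ('m::len0, 'n::len0) uq) \<in> uq_homogeneous (gen_parity LENGTH('m) g)"
  unfolding ugen.abs_eq by (rule abs_uq_homogeneous) (simp add: word_parity_def)

lemma uconst_homogeneous: "(uconst c :: ('m::len0, 'n::len0) uq) \<in> uq_homogeneous 0"
  unfolding uconst.abs_eq by (rule abs_uq_homogeneous) (auto simp: word_parity_def zero_fword_def split: if_splits)

lemma word_parity_add: "word_parity m (v + w) = word_parity m v + word_parity m w"
  by (simp add: word_parity_def plus_fword_def)

lemma graded_ring_uq: "graded_ring (\<lambda>e. uq_sub s \<inter> uq_homogeneous e :: ('m::len0, 'n::len0) uq set)"
proof
  fix d e :: nat
  have add: "x + y \<in> uq_homogeneous e" if "x \<in> uq_homogeneous e" "y \<in> uq_homogeneous e" for x y :: "('m, 'n) uq"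
  proof -
    obtain X Y where X: "x = abs_uq X" "\<forall>w\<in>Poly_Mapping.keys X. word_parity LENGTH('m) w mod 2 = e mod 2"
      and Y: "y = abs_uq Y" "\<forall>w\<in>Poly_Mapping.keys Y. word_parity LENGTH('m) w mod 2 = e mod 2"
      using \<open>x \<in> _\<close> \<open>y \<in> _\<close> by (auto simp: uq_homogeneous_def)
    show ?thesis
      unfolding X(1) Y(1) abs_uq_hom(1)[symmetric]
      by (rule abs_uq_homogeneous) (use X(2) Y(2) Poly_Mapping.keys_add[of X Y] in blast)
  qed
  have mult: "x * y \<in> uq_homogeneous (d + e)" if "x \<in> uq_homogeneous d" "y \<in> uq_homogeneous e" for x y :: "('m, 'n) uq" and d e
  proof -
    obtain X Y where X: "x = abs_uq X" "\<And>w. w\<in>Poly_Mapping.keys X \<Longrightarrow> word_parity LENGTH('m) w mod 2 = d mod 2"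
      and Y: "y = abs_uq Y" "\<And>w. w\<in>Poly_Mapping.keys Y \<Longrightarrow> word_parity LENGTH('m) w mod 2 = e mod 2"
      using \<open>x \<in> _\<close> \<open>y \<in> _\<close> by (auto simp: uq_homogeneous_def)
    have "abs_uq (X * Y) \<in> (uq_homogeneous (d + e) :: ('m, 'n) uq set)"
    proof (rule abs_uq_homogeneous)
      fix w assume "w \<in> Poly_Mapping.keys (X * Y)"
      then obtain v v' where "v \<in> Poly_Mapping.keys X" "v' \<in> Poly_Mapping.keys Y" "w = v + v'"
        using Poly_Mapping.keys_mult[of X Y] by blast
      then show "word_parity LENGTH('m) w mod 2 = (d + e) mod 2"
        using X(2)[of v] Y(2)[of v'] by (simp add: word_parity_add) (metis mod_add_eq)
    qed
    then show ?thesis by (simp add: X(1) Y(1) abs_uq_hom)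
  qed
  have "(0 :: ('m, 'n) uq) \<in> uq_homogeneous e"
    unfolding zero_uq_def by (rule abs_uq_homogeneous) simp
  moreover have "(0 :: ('m, 'n) uq) \<in> uq_sub s"
    using uq_sub.const[of 0] by simp
  ultimately show "(0 :: ('m, 'n) uq) \<in> uq_sub s \<inter> uq_homogeneous e" by simp
  fix x y :: "('m, 'n) uq"
  show "x \<in> uq_sub s \<inter> uq_homogeneous e \<Longrightarrow> y \<in> uq_sub s \<inter> uq_homogeneous e \<Longrightarrow> x + y \<in> uq_sub s \<inter> uq_homogeneous e"
    using add by (auto intro: uq_sub.add)
  show "x \<in> uq_sub s \<inter> uq_homogeneous d \<Longrightarrow> y \<in> uq_sub s \<inter> uq_homogeneous e \<Longrightarrow> x * y \<in> uq_sub s \<inter> uq_homogeneous (d + e)"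
    using mult by (auto intro: uq_sub.mult)
  have "- x = uconst (- 1) * x" by (simp add: uq.sc_minus)
  then show "- x \<in> uq_sub s \<inter> uq_homogeneous e" if "x \<in> uq_sub s \<inter> uq_homogeneous e"
    using mult[OF uconst_homogeneous[of "- 1"], of x e] that by (simp add: uq_sub.const uq_sub.mult)
  show "d mod 2 = e mod 2 \<Longrightarrow> uq_sub s \<inter> uq_homogeneous d = uq_sub s \<inter> (uq_homogeneous e :: ('m, 'n) uq set)"
    by (simp add: uq_homogeneous_def)
qed

interpretation uqg: graded_ring "\<lambda>e. uq_sub s \<inter> uq_homogeneous e" for s
  by (rule graded_ring_uq)

definition graded_series :: "pm \<Rightarrow> nat \<Rightarrow> ('m::len0, 'n::len0) uq fps set" where
  "graded_series s e = {F. \<forall>r. fps_nth F r \<in> uq_sub s \<inter> uq_homogeneous e}"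

interpretation gs: graded_ring "graded_series s" for s
proof
  show "x * y \<in> graded_series s (d + e)" if "x \<in> graded_series s d" "y \<in> graded_series s e"
    for d e and x y :: "('m::len0, 'n::len0) uq fps"
    using that unfolding graded_series_def mem_Collect_eq fps_mult_nth
    by (intro allI uqg.H_sum uqg.H_mult) blast+
  show "d mod 2 = e mod 2 \<Longrightarrow> graded_series s d = graded_series s e" for d e
    by (simp only: graded_series_def uqg.H_cong[of d e])
  show "0 \<in> graded_series s e" for e
    unfolding graded_series_def mem_Collect_eq fps_zero_nth by (intro allI uqg.H_0)
  show "x + y \<in> graded_series s e" if "x \<in> graded_series s e" "y \<in> graded_series s e" for e and x y :: "('m::len0, 'n::len0) uq fps"
    using that unfolding graded_series_def mem_Collect_eq fps_add_nth by (intro allI uqg.H_add) blast+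
  show "- x \<in> graded_series s e" if "x \<in> graded_series s e" for e and x :: "('m::len0, 'n::len0) uq fps"
    using that unfolding graded_series_def mem_Collect_eq fps_neg_nth by (intro allI uqg.H_uminus) blast
qed

interpretation gso: graded_ring "\<lambda>e. Op ` graded_series s e" for s
proof
  show "x * y \<in> Op ` graded_series s (d + e)" if xy: "x \<in> Op ` graded_series s d" "y \<in> Op ` graded_series s e"
    for d e and x y :: "('m::len0, 'n::len0) uq fps opp"
  proof -
    obtain F G where "x = Op F" "y = Op G" "F \<in> graded_series s d" "G \<in> graded_series s e" using xy by auto
    then show ?thesis
      using gs.H_mult[of G s e F d] by (auto simp: times_opp_def add.commute)
  qed
  show "x + y \<in> Op ` graded_series s e" if "x \<in> Op ` graded_series s e" "y \<in> Op ` graded_series s e"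
    for e and x y :: "('m::len0, 'n::len0) uq fps opp"
    using that by (auto simp: plus_opp_def intro!: imageI gs.H_add)
  show "- x \<in> Op ` graded_series s e" if "x \<in> Op ` graded_series s e" for e and x :: "('m::len0, 'n::len0) uq fps opp"
    using that by (auto simp: uminus_opp_def intro!: imageI gs.H_uminus)
  show "0 \<in> Op ` graded_series s e" for e
    using gs.H_0 by (auto simp: zero_opp_def)
  show "d mod 2 = e mod 2 \<Longrightarrow> Op ` graded_series s d = Op ` graded_series s e" for d e
    using gs.H_cong by blast
qed

text \<open>The recursion for the left inverse stays in the even part of \<open>uq_sub\<close>, and
  the left inverse is two-sided because a right inverse exists as well.\<close>

lemma graded_series_inverse:
  assumes F: "F \<in> graded_series s 0" and c: "c * fps_nth F 0 = 1" "fps_nth F 0 * c = 1" "c \<in> uq_sub s \<inter> uq_homogeneous 0"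
  shows "\<exists>G\<in>graded_series s 0. F * G = 1 \<and> G * F = 1 \<and> fps_nth G 0 = c"
proof -
  let ?G = "fps_left_inverse F c"
  have l: "?G * F = 1" using c(1) by (rule fps_left_inverse)
  have r: "F * fps_right_inverse F c = 1" using c(2) by (rule fps_right_inverse)
  have "?G * F * fps_right_inverse F c = ?G" by (simp only: mult.assoc r mult_1_right)
  then have "?G = fps_right_inverse F c" by (simp only: l mult_1_left)
  then have r: "F * ?G = 1" using r by (simp only:)
  have FH: "fps_nth F r \<in> uq_sub s \<inter> uq_homogeneous 0" for r
    using F unfolding graded_series_def by blast
  have "fps_left_inverse_constructor F c r \<in> uq_sub s \<inter> uq_homogeneous 0" for r
  proof (induction r rule: less_induct)
    case (less r)
    show ?case
    proof (cases r)
      case (Suc n)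
      have "(\<Sum>i = 0..n. fps_left_inverse_constructor F c i * fps_nth F (Suc n - i)) \<in> uq_sub s \<inter> uq_homogeneous (0 + 0)"
      proof (rule uqg.H_sum)
        fix i assume "i \<in> {0..n}"
        then have "i < r" using Suc by simp
        then show "fps_left_inverse_constructor F c i * fps_nth F (Suc n - i) \<in> uq_sub s \<inter> uq_homogeneous (0 + 0)"
          by (rule uqg.H_mult[OF less.IH FH])
      qed
      from uqg.H_mult[OF uqg.H_uminus[OF this] c(3)] show ?thesis
        unfolding Suc fps_left_inverse_constructor.simps(2) add_0 .
    next
      case 0
      show ?thesis unfolding 0 fps_left_inverse_constructor.simps(1) by (rule c(3))
    qed
  qed
  then have "?G \<in> graded_series s 0" unfolding graded_series_def mem_Collect_eq fps_nth_Abs_fps by (rule allI)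
  moreover have "fps_nth ?G 0 = c" by (simp only: fps_nth_Abs_fps fps_left_inverse_constructor.simps(1))
  ultimately show ?thesis using l r by blast
qed

lemma ugen_triangular:
  assumes "i < j"
  shows "ugen (Lgen Plus 0 j i) = (0 :: ('m::len0, 'n::len0) uq)" "ugen (Lgen Minus 0 i j) = (0 :: ('m, 'n) uq)"
  using assms by (simp_all add: abs_uq_gens(1)[symmetric] abs_uq_ideal uq_ideal.upper uq_ideal.lower)

lemma ugen_diag:
  assumes "t \<in> {1..LENGTH('m::len0) + LENGTH('n::len0)}"
  shows "ugen (Lgen (pm_opp s) 0 t t) * ugen (Lgen s 0 t t) = (1 :: ('m, 'n) uq)"
    and "ugen (Lgen s 0 t t) * ugen (Lgen (pm_opp s) 0 t t) = (1 :: ('m, 'n) uq)"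
proof -
  have *: "ugen (Lgen (pm_opp s) 0 t t) * ugen (Lgen s 0 t t) - 1 = (0 :: ('m, 'n) uq)" for s
    using abs_uq_ideal[OF uq_ideal.diag[OF assms, of s]] by (simp only: abs_uq_hom abs_uq_gens)
  show "ugen (Lgen (pm_opp s) 0 t t) * ugen (Lgen s 0 t t) = (1 :: ('m, 'n) uq)" using *[of s] by simp
  have "pm_opp (pm_opp s) = s" by (cases s) simp_all
  then show "ugen (Lgen s 0 t t) * ugen (Lgen (pm_opp s) 0 t t) = (1 :: ('m, 'n) uq)" using *[of "pm_opp s"] by simp
qed

lemma Lmat_const: "fps_nth (Lmat s i j) 0 = ugen (Lgen s 0 i j)"
  by (simp add: Lmat_def)

lemma Lt_const: "fps_nth (Lt s i j :: ('m::len0, 'n::len0) uq fps) 0 = uconst (tw LENGTH('m) i j) * ugen (Lgen s 0 i j)"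
  by (simp only: Lt_def uqs.fsc_nth Lmat_const)

lemma Lmat_graded: "(Lmat s i j :: ('m::len0, 'n::len0) uq fps) \<in> graded_series s (parity LENGTH('m) i + parity LENGTH('m) j)"
  unfolding graded_series_def Lmat_def mem_Collect_eq fps_nth_Abs_fps
  using ugen_homogeneous[of "Lgen s _ i j"] by (auto intro: uq_sub.gen)

lemma fsc_graded: "F \<in> graded_series s e \<Longrightarrow> uqs.fsc c * F \<in> graded_series s e"
proof -
  assume "F \<in> graded_series s e"
  then have F: "fps_nth F r \<in> uq_sub s \<inter> uq_homogeneous e" for r unfolding graded_series_def by blast
  have "uconst c * fps_nth F r \<in> uq_sub s \<inter> uq_homogeneous (0 + e)" for r
    by (rule uqg.H_mult[OF _ F]) (simp add: uq_sub.const uconst_homogeneous)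
  then show ?thesis unfolding graded_series_def mem_Collect_eq uqs.fsc_nth add_0 by (rule allI)
qed

lemma tw_diag [simp]: "tw m t t = 1"
  by (rule parity_cases[of m t]) (simp_all add: tw_def)

lemma ugen_inv_graded: "(ugen (Lgen (pm_opp s) 0 t t) :: ('m::len0, 'n::len0) uq) \<in> uq_sub s \<inter> uq_homogeneous 0"
proof -
  have "(ugen (Lgen (pm_opp s) 0 t t) :: ('m, 'n) uq) \<in> uq_sub s \<inter> uq_homogeneous (parity LENGTH('m) t + parity LENGTH('m) t)"
    using ugen_homogeneous[of "Lgen (pm_opp s) 0 t t"] by (simp add: uq_sub.inv)
  also have "\<dots> = uq_sub s \<inter> uq_homogeneous 0" by (rule uqg.H_cong) simp
  finally show ?thesis .
qed

text \<open>What is remembered of a chosen inverse: homogeneity within \<open>uq_sub\<close>, and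
  the constant terms at both ends, from which those of b and o are computed.\<close>

definition is_inv_family :: "pm \<Rightarrow> nat \<Rightarrow> nat \<Rightarrow> (nat \<Rightarrow> nat \<Rightarrow> ('m::len0, 'n::len0) uq fps) \<Rightarrow> bool" where
  "is_inv_family s i j X \<longleftrightarrow>
    (\<forall>k\<in>{i..j}. \<forall>l\<in>{i..j}. X k l \<in> graded_series s (parity LENGTH('m) k + parity LENGTH('m) l)) \<and>
    (i \<le> j \<longrightarrow> fps_nth (X i i) 0 = ugen (Lgen (pm_opp s) 0 i i) \<and> fps_nth (X j j) 0 = ugen (Lgen (pm_opp s) 0 j j))"

lemma ex_Tinv:
  assumes ij: "1 \<le> i" "j \<le> LENGTH('m::len0) + LENGTH('n::len0)"
  shows "\<exists>X. minv {i..j} (Lt s) X \<and> is_inv_family s i j (X :: nat \<Rightarrow> nat \<Rightarrow> ('m, 'n) uq fps)"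
proof -
  let ?z = "\<lambda>t. ugen (Lgen (pm_opp s) 0 t t) :: ('m, 'n) uq"
  have "\<exists>X. minv {i..j} (Lt s :: nat \<Rightarrow> nat \<Rightarrow> ('m, 'n) uq fps) X \<and>
    (\<forall>k\<in>{i..j}. \<forall>l\<in>{i..j}. X k l \<in> graded_series s (parity LENGTH('m) k + parity LENGTH('m) l)) \<and>
    (i \<le> j \<longrightarrow> fps_nth (X i i) 0 = ?z i \<and> fps_nth (X j j) 0 = ?z j)"
  proof (rule gs.graded_minv[where N = "LENGTH('m) + LENGTH('n)" and a = "\<lambda>t. ugen (Lgen s 0 t t)"])
    fix x :: "('m, 'n) uq fps" and t
    assume t: "t \<in> {1..LENGTH('m) + LENGTH('n)}" and x: "x \<in> graded_series s 0" and x0: "fps_nth x 0 = ugen (Lgen s 0 t t)"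
    show "\<exists>y\<in>graded_series s 0. x * y = 1 \<and> y * x = 1 \<and> fps_nth y 0 = ?z t"
      by (rule graded_series_inverse[OF x]) (use x0 ugen_diag[OF t, of s] ugen_inv_graded[of s t] in auto)
  next
    show "(\<forall>k l. k < l \<longrightarrow> fps_nth (Lt s l k :: ('m, 'n) uq fps) 0 = 0) \<or> (\<forall>k l. k < l \<longrightarrow> fps_nth (Lt s k l :: ('m, 'n) uq fps) 0 = 0)"
      by (cases s) (simp_all add: Lt_const ugen_triangular)
    next
    show "(Lt s k l :: ('m, 'n) uq fps) \<in> graded_series s (parity LENGTH('m) k + parity LENGTH('m) l)" for k l
      unfolding Lt_def by (rule fsc_graded[OF Lmat_graded])
  qed (use ij in \<open>simp_all add: Lt_const\<close>)
  then show ?thesis unfolding is_inv_family_def .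
qed

lemma ex_Yinv:
  assumes ij: "1 \<le> i" "j \<le> LENGTH('m::len0) + LENGTH('n::len0)"
  shows "\<exists>X. minv {i..j} (\<lambda>k l. Op (Lmat s k l)) (\<lambda>k l. Op (X k l)) \<and> is_inv_family s i j (X :: nat \<Rightarrow> nat \<Rightarrow> ('m, 'n) uq fps)"
proof -
  let ?z = "\<lambda>t. ugen (Lgen (pm_opp s) 0 t t) :: ('m, 'n) uq"
  have "\<exists>X. minv {i..j} (\<lambda>k l. Op (Lmat s k l :: ('m, 'n) uq fps)) X \<and>
    (\<forall>k\<in>{i..j}. \<forall>l\<in>{i..j}. X k l \<in> Op ` graded_series s (parity LENGTH('m) k + parity LENGTH('m) l)) \<and>
    (i \<le> j \<longrightarrow> Op (fps_nth (unop (X i i)) 0) = Op (?z i) \<and> Op (fps_nth (unop (X j j)) 0) = Op (?z j))"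
  proof (rule gso.graded_minv[where N = "LENGTH('m) + LENGTH('n)" and a = "\<lambda>t. Op (ugen (Lgen s 0 t t))"])
    fix x :: "('m, 'n) uq fps opp" and t
    assume t: "t \<in> {1..LENGTH('m) + LENGTH('n)}" and x: "x \<in> Op ` graded_series s 0" and x0: "Op (fps_nth (unop x) 0) = Op (ugen (Lgen s 0 t t))"
    obtain F where F: "x = Op F" "F \<in> graded_series s 0" using x by blast
    have "\<exists>y\<in>graded_series s 0. F * y = 1 \<and> y * F = 1 \<and> fps_nth y 0 = ?z t"
      by (rule graded_series_inverse[OF F(2)]) (use x0 F(1) ugen_diag[OF t, of s] ugen_inv_graded[of s t] in auto)
    then obtain y where y: "y \<in> graded_series s 0" "F * y = 1" "y * F = 1" "fps_nth y 0 = ?z t" by blast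
    then show "\<exists>y\<in>Op ` graded_series s 0. x * y = 1 \<and> y * x = 1 \<and> Op (fps_nth (unop y) 0) = Op (?z t)"
      by (intro bexI[of _ "Op y"]) (simp_all add: F(1) times_opp_def one_opp_def)
  next
    show "(\<forall>k l. k < l \<longrightarrow> Op (fps_nth (unop (Op (Lmat s l k :: ('m, 'n) uq fps))) 0) = 0) \<or> (\<forall>k l. k < l \<longrightarrow> Op (fps_nth (unop (Op (Lmat s k l :: ('m, 'n) uq fps))) 0) = 0)"
      by (cases s) (simp_all add: Lmat_const ugen_triangular zero_opp_def)
  qed (use ij in \<open>simp_all add: Lmat_const Lmat_graded plus_opp_def times_opp_def\<close>)
  then obtain X where X: "minv {i..j} (\<lambda>k l. Op (Lmat s k l :: ('m, 'n) uq fps)) X"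
    "\<forall>k\<in>{i..j}. \<forall>l\<in>{i..j}. X k l \<in> Op ` graded_series s (parity LENGTH('m) k + parity LENGTH('m) l)"
    "i \<le> j \<longrightarrow> fps_nth (unop (X i i)) 0 = ?z i \<and> fps_nth (unop (X j j)) 0 = ?z j" by auto
  have "X = (\<lambda>k l. Op (unop (X k l)))" by (intro ext opp_eqI) simp
  moreover have "is_inv_family s i j (\<lambda>k l. unop (X k l))"
    unfolding is_inv_family_def using X(2,3) by fastforce
  ultimately show ?thesis using X(1) by (intro exI[of _ "\<lambda>k l. unop (X k l)"]) simp
qed

definition Tinv :: "pm \<Rightarrow> nat \<Rightarrow> nat \<Rightarrow> nat \<Rightarrow> nat \<Rightarrow> ('m::len0, 'n::len0) uq fps" where
  "Tinv s i j = (SOME X. minv {i..j} (Lt s) X \<and> is_inv_family s i j X)"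

definition Yinv :: "pm \<Rightarrow> nat \<Rightarrow> nat \<Rightarrow> nat \<Rightarrow> nat \<Rightarrow> ('m::len0, 'n::len0) uq fps" where
  "Yinv s i j = (SOME X. minv {i..j} (\<lambda>k l. Op (Lmat s k l)) (\<lambda>k l. Op (X k l)) \<and> is_inv_family s i j X)"

lemma Tinv:
  assumes "1 \<le> i" "j \<le> LENGTH('m::len0) + LENGTH('n::len0)"
  shows "minv {i..j} (Lt s) (Tinv s i j :: nat \<Rightarrow> nat \<Rightarrow> ('m, 'n) uq fps)" "is_inv_family s i j (Tinv s i j :: nat \<Rightarrow> nat \<Rightarrow> ('m, 'n) uq fps)"
  using someI_ex[OF ex_Tinv[OF assms]] unfolding Tinv_def by blast+

lemma Yinv:
  assumes "1 \<le> i" "j \<le> LENGTH('m::len0) + LENGTH('n::len0)"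
  shows "minv {i..j} (\<lambda>k l. Op (Lmat s k l)) (\<lambda>k l. Op (Yinv s i j k l :: ('m, 'n) uq fps))"
    "is_inv_family s i j (Yinv s i j :: nat \<Rightarrow> nat \<Rightarrow> ('m, 'n) uq fps)"
  using someI_ex[OF ex_Yinv[OF assms]] unfolding Yinv_def by blast+

lemma fsc_tw_Lt: "uqs.fsc (tw LENGTH('m) i j) * Lt s i j = (Lmat s i j :: ('m::len0, 'n::len0) uq fps)"
  by (rule fps_ext) (simp add: Lt_def uqs.fsc_nth uq.sc_mult_assoc)

lemma rll_affine_uq:
  assumes MN: "LENGTH('m::len0) \<noteq> LENGTH('n::len0)"
  shows "rll_affine uconst qq (- pm_int s) LENGTH('m) (LENGTH('m) + LENGTH('n)) (Lt s :: nat \<Rightarrow> nat \<Rightarrow> ('m, 'n) uq fps)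
    (Tinv s) (Yinv s) (\<lambda>t. ugen (Lgen (pm_opp s) 0 t t)) (\<lambda>t. ugen (Lgen s 0 t t))"
proof (intro rll_affine.intro rll_affine_axioms.intro uqs.shifts_axioms rll_uq[OF MN] Tinv(1))
  fix i j assume ij: "(1::nat) \<le> i" "j \<le> LENGTH('m) + LENGTH('n)"
  show "minv {i..j} (\<lambda>k l. Op (uqs.fsc (tw LENGTH('m) k l) * Lt s k l :: ('m, 'n) uq fps)) (\<lambda>k l. Op (Yinv s i j k l))"
    unfolding fsc_tw_Lt by (rule Yinv(1)[OF ij])
  show "fps_nth (Tinv s i j j j :: ('m, 'n) uq fps) 0 = ugen (Lgen (pm_opp s) 0 j j)" if "i \<le> j"
    using Tinv(2)[where 'm = 'm and 'n = 'n, OF ij, of s] that by (auto simp: is_inv_family_def)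
  show "fps_nth (Yinv s i j i i :: ('m, 'n) uq fps) 0 = ugen (Lgen (pm_opp s) 0 i i)" if "i \<le> j"
    using Yinv(2)[where 'm = 'm and 'n = 'n, OF ij, of s] that by (auto simp: is_inv_family_def)
qed (simp_all add: ugen_diag)

subsection \<open>Formulas for the Berezinian\<close>

context rll_affine
begin

text \<open>On odd indices all signs in \<open>inverse_prel\<close> are constant, and transposing
  the inverse and negating the arguments turns it into the relation for n even indices. This makes
  the second sum of the Berezinian a quantum minor with the usual order of arguments.\<close>

lemma transposed_inverse_rll:
  assumes N: "N = m + n"
  shows "rll fsc q n n (\<lambda>a i j. shift (- a) (Ti 1 N (m + j) (m + i)))"
proof (intro rll.intro rll_axioms.intro scalar_ring_fsc)
  fix j i l k :: nat and a b :: int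
  assume I: "j \<in> {1..n}" "i \<in> {1..n}" "l \<in> {1..n}" "k \<in> {1..n}"
  \<comment> \<open>Multiplication by -q^(a+b) turns q^-a - q^-b into q^a - q^b.\<close>
  let ?t = "- (q powi (a + b))"
  have odd: "parity m (m + x) = 1" if "x \<in> {1..n}" for x using that by (simp add: parity_def)
  have even: "parity n x = 0" if "x \<in> {1..n}" for x using that by (simp add: parity_def)
  have r: "?t * (rho q m (- a) (- b) (m + x) (m + y) * sg (1 * (1 + 1))) = rho q n a b x y * sg (0 * (0 + 0))"
    if "x \<in> {1..n}" "y \<in> {1..n}" for x y
    using that by (simp add: rho_def odd even gr_def power_int_add power_int_minus field_simps)
  have x: "?t * (xi q (- a) (- b) (m + x) (m + y) * sg (1 * 1 + 1 * 1 + 1 * 1)) = xi q a b y x * sg (0 * 0)" for x y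
    by (simp add: xi_def power_int_add power_int_minus field_simps)
  show "fsc (rho q n a b j l * sg (parity n l * (parity n j + parity n i))) *
       (shift (- a) (Ti 1 N (m + i) (m + j)) * shift (- b) (Ti 1 N (m + k) (m + l))) +
       fsc (xi q a b j l * sg (parity n j * parity n i)) *
       (shift (- a) (Ti 1 N (m + i) (m + l)) * shift (- b) (Ti 1 N (m + k) (m + j))) =
       fsc (rho q n a b i k * sg (parity n k * (parity n j + parity n i))) *
       (shift (- b) (Ti 1 N (m + k) (m + l)) * shift (- a) (Ti 1 N (m + i) (m + j))) +
       fsc (xi q a b k i * sg (parity n j * parity n i)) *
       (shift (- b) (Ti 1 N (m + i) (m + l)) * shift (- a) (Ti 1 N (m + k) (m + j)))"
    unfolding even[OF I(1)] even[OF I(2)] even[OF I(3)] even[OF I(4)]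
    by (rule ord.sc_scale[OF ord.inverse_prel[where K = "{1..N}" and a = "- a" and b = "- b" and i = "m + i" and j = "m + j" and k = "m + k" and l = "m + l"], where t = ?t])
      (use I N in \<open>simp_all only: odd r x\<close>, use I N Ti[of 1 N] in \<open>auto intro: minv_shift\<close>)
qed

lemma qminor_transposed_inverse:
  assumes N: "N = m + n"
  shows "qminor fsc q (\<lambda>a i j. shift (- a) (Ti 1 N (m + j) (m + i))) {1..n}"
proof -
  let ?A = "\<lambda>a i j. shift (- a) (Ti 1 N (m + j) (m + i))"
  interpret A: rll fsc q n n ?A by (rule transposed_inverse_rll[OF N])
  show ?thesis
  proof unfold_locales
    fix x y u v :: nat and a :: int
    assume "x \<in> {1..n}" "y \<in> {1..n}" "u \<in> {1..n}" "x < y"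
    then show "?A a x u * ?A (a + 2) y u = fsc (1 / q) * (?A a y u * ?A (a + 2) x u)"
      by (intro A.minor_relations(1)) (auto simp: gr_def parity_def)
  next
    fix x y u v :: nat and a :: int
    assume "x \<in> {1..n}" "y \<in> {1..n}" "u \<in> {1..n}" "v \<in> {1..n}" "x < y" "u < v"
    then show "?A a x v * ?A (a + 2) y u - fsc (1 / q) * (?A a y v * ?A (a + 2) x u) =
       fsc (- 1 / q) * (?A a x u * ?A (a + 2) y v - fsc (1 / q) * (?A a y u * ?A (a + 2) x v))"
      by (intro A.minor_relations(2)) (auto simp: gr_def parity_def)
  qed
qed

text \<open>\<open>qm_first\<close> peels off one index at a time: by \<open>minv_block\<close>, the
  block of L^-1 on {m+i..N} is inverted by the Schur complement of the lower indices in L, whose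
  corner entry is the inverse of \<open>ord.up\<close>.\<close>

lemma qm_transposed_inverse:
  assumes N: "N = m + n"
  shows "qminor.qm fsc q (\<lambda>a i j. shift (- a) (Ti 1 N (m + j) (m + i))) [1..<n + 1] a {1..n} =
    prod_list (map (\<lambda>t. ord.up 1 (m + t) (2 - a - 2 * int t)) [1..<n + 1])"
proof -
  let ?A = "\<lambda>a i j. shift (- a) (Ti 1 N (m + j) (m + i))"
  interpret qm: qminor fsc q ?A "{1..n}" by (rule qminor_transposed_inverse[OF N])
  have "qm.qm [i..<Suc n] a {i..n} = prod_list (map (\<lambda>t. ord.up 1 (m + t) (2 * int i - a - 2 * int t)) [i..<Suc n])"
    if "i \<le> Suc n" "1 \<le> i" for i a
    using that
  proof (induction i arbitrary: a rule: inc_induct)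
    case (step i)
    let ?J = "{m + i..N}"
    let ?S = "schur {1..m + i - 1} (\<lambda>k l. shift (- a) (T k l)) (\<lambda>k l. shift (- a) (Ti 1 (m + i - 1) k l))"
    have diff: "{1..N} - ?J = {1..m + i - 1}" using step N by auto
    have D: "minv ({1..N} - ?J) (\<lambda>k l. shift (- a) (T k l)) (\<lambda>k l. shift (- a) (Ti 1 (m + i - 1) k l))"
      unfolding diff by (rule minv_shift[OF Ti]) (use step N in auto)
    have S: "minv ?J (\<lambda>k l. shift (- a) (Ti 1 N k l)) ?S"
      unfolding diff[symmetric] by (rule minv_block[OF _ _ minv_shift[OF Ti] D]) (use step in auto)
    have odd: "parity m (m + i) = 1" using step by (simp add: parity_def)
    have Sii: "?S (m + i) (m + i) = ord.up_inv 1 (m + i) (- a)"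
      by (simp add: ord.up_inv_def ord.dsch_def odd)
    have first: "qm.qm [Suc i..<Suc n] (a + 2) {Suc i..n} = ?S (m + i) (m + i) * qm.qm [i..<Suc n] a {i..n}"
    proof (rule qm.qm_first[where B = "\<lambda>c y. ?S (m + y) (m + c)"])
      fix x y assume xy: "x \<in> {i..n}" "y \<in> {i..n}"
      have "(\<Sum>c\<in>{i..n}. ?S (m + y) (m + c) * shift (- a) (Ti 1 N (m + c) (m + x))) =
        (\<Sum>c\<in>?J. ?S (m + y) c * shift (- a) (Ti 1 N c (m + x)))"
        unfolding N by (rule sum.reindex_bij_witness[of _ "\<lambda>c. c - m" "\<lambda>c. m + c"]) auto
      also have "\<dots> = of_bool (x = y)"
        using minvD(2)[OF S, of "m + y" "m + x"] xy N by auto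
      finally show "(\<Sum>c\<in>{i..n}. ?S (m + y) (m + c) * shift (- a) (Ti 1 N (m + c) (m + x))) = of_bool (x = y)" .
    qed (use step in auto)
    have "qm.qm [i..<Suc n] a {i..n} = ord.up 1 (m + i) (- a) * qm.qm [Suc i..<Suc n] (a + 2) {Suc i..n}"
      unfolding first Sii mult.assoc[symmetric] using ord.up_inv(1)[of 1 "m + i" "- a"] step N by (simp del: upt_Suc qm.qm.simps)
    also have "\<dots> = prod_list (map (\<lambda>t. ord.up 1 (m + t) (2 * int i - a - 2 * int t)) (i # [Suc i..<Suc n]))"
      using step.IH[of "a + 2"] by (simp add: algebra_simps del: upt_Suc)
    also have "i # [Suc i..<Suc n] = [i..<Suc n]"
      using step by (simp add: upt_rec)
    finally show ?case .
  qed (simp del: One_nat_def)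
  from this[of 1 a] show ?thesis by (simp del: upt_Suc qm.qm.simps)
qed

text \<open>For the last even index and beyond, \<open>hh m 1 (m + t)\<close> is m - t. So the p-th
  odd factor stands at z q^(e+2m-2p), the argument in the second product of the Berezinian.\<close>

lemma ber_split:
  assumes "N = m + n"
  shows "ord.ber 1 N e = ord.ber 1 m e * prod_list (map (\<lambda>t. ord.up 1 (m + t) (e + 2 * int m - 2 * int t)) [1..<n + 1])"
proof -
  have hh: "hh m 1 (m + t) = int m - int t" for t
  proof (induction t)
    case 0
    have "hh m 1 m = (\<Sum>t = 1..m. 1)" unfolding hh_def by (rule sum.cong) (auto simp: gr_def parity_def)
    then show ?case by simp
  next
    case (Suc t)
    then show ?case using hh_snoc[of 1 "m + Suc t" m] by (simp add: gr_def parity_def)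
  qed
  have "[1..<Suc N] = [1..<Suc m] @ [Suc m..<Suc N]"
    using assms upt_add_eq_append[of 1 "Suc m" n] by simp
  then have "ord.ber 1 N e = ord.ber 1 m e * prod_list (map (\<lambda>t. ord.up 1 t (e + 2 * hh m 1 (t - 1) - 2 * int (parity m t))) [Suc m..<Suc N])"
    by (simp add: ord.ber_def del: upt_Suc)
  also have "[Suc m..<Suc N] = map (\<lambda>t. m + t) [1..<n + 1]"
    using assms by (intro nth_equalityI) (auto simp del: upt_Suc)
  also have "map (\<lambda>t. ord.up 1 t (e + 2 * hh m 1 (t - 1) - 2 * int (parity m t))) (map (\<lambda>t. m + t) [1..<n + 1]) =
    map (\<lambda>t. ord.up 1 (m + t) (e + 2 * int m - 2 * int t)) [1..<n + 1]"
    unfolding map_map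
  proof (rule map_cong[OF refl])
    fix t assume "t \<in> set [1..<n + 1]"
    then have "0 < t" by (simp del: upt_Suc)
    then obtain u where t: "t = Suc u" using gr0_implies_Suc by blast
    show "((\<lambda>t. ord.up 1 t (e + 2 * hh m 1 (t - 1) - 2 * int (parity m t))) \<circ> (\<lambda>t. m + t)) t =
      ord.up 1 (m + t) (e + 2 * int m - 2 * int t)"
      unfolding t o_apply by (rule arg_cong[of _ _ "ord.up 1 (m + Suc u)"]) (use hh[of u] in \<open>simp add: parity_def\<close>)
  qed
  finally show ?thesis .
qed

end

section \<open>Graded inverse, quantum determinant and Berezinian in terms of
  quasideterminants\<close>

lemma tw_sign:
  "tw m i k * (tw m i j * tw m j k) = (sg ((parity m i + parity m j) * (parity m j + parity m k)) :: 'k::field)"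
  by (rule parity_cases[of m i]; rule parity_cases[of m j]; rule parity_cases[of m k]; simp add: tw_def)

lemma gmul_tw:
  "gmul LENGTH('m) LENGTH('n) A B i k = uqs.fsc (tw LENGTH('m) i k) * (\<Sum>j = 1..LENGTH('m) + LENGTH('n).
    (uqs.fsc (tw LENGTH('m) i j) * A i j) * (uqs.fsc (tw LENGTH('m) j k) * (B j k :: ('m::len0, 'n::len0) uq fps)))"
proof -
  interpret f: scalar_ring "uqs.fsc :: _ \<Rightarrow> ('m, 'n) uq fps" qq by (rule uqs.scalar_ring_fsc)
  have fsg: "(-1) ^ e = (uqs.fsc (sg e :: cq) :: ('m, 'n) uq fps)" for e :: nat
    by (induction e) (simp_all add: f.sc_mult f.sc_minus f.sc_1)
  show ?thesis
    unfolding gmul_def sum_distrib_left fsg f.sc_prod f.sc_mult_assoc tw_sign by (simp only: mult.assoc)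
qed

lemma is_ginv_iff:
  "is_ginv LENGTH('m) LENGTH('n) A (B :: ('m::len0, 'n::len0) uq smat) \<longleftrightarrow>
    minv {1..LENGTH('m) + LENGTH('n)} (\<lambda>i j. uqs.fsc (tw LENGTH('m) i j) * A i j) (\<lambda>i j. uqs.fsc (tw LENGTH('m) i j) * B i j)"
proof -
  interpret f: scalar_ring "uqs.fsc :: _ \<Rightarrow> ('m, 'n) uq fps" qq by (rule uqs.scalar_ring_fsc)
  have "uqs.fsc (tw LENGTH('m) i k) * X = (if i = k then 1 else 0) \<longleftrightarrow> X = of_bool (i = k)" for i k and X :: "('m, 'n) uq fps"
  proof
    assume h: "uqs.fsc (tw LENGTH('m) i k) * X = (if i = k then 1 else 0)"
    have "X = uqs.fsc (tw LENGTH('m) i k) * (uqs.fsc (tw LENGTH('m) i k) * X)"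
      by (simp add: f.sc_mult_assoc f.sc_1)
    then show "X = of_bool (i = k)" unfolding h by (auto simp: f.sc_1)
  qed (auto simp: f.sc_1)
  then show ?thesis
    unfolding is_ginv_def minv_def gmul_tw by simp
qed

lemma ginv_eq:
  fixes A X :: "('m::len0, 'n::len0) uq smat"
  assumes X: "minv {1..LENGTH('m) + LENGTH('n)} (\<lambda>i j. uqs.fsc (tw LENGTH('m) i j) * A i j) X"
    and ij: "i \<in> {1..LENGTH('m) + LENGTH('n)}" "j \<in> {1..LENGTH('m) + LENGTH('n)}"
  shows "ginv LENGTH('m) LENGTH('n) A i j = uqs.fsc (tw LENGTH('m) i j) * X i j"
proof -
  interpret f: scalar_ring "uqs.fsc :: _ \<Rightarrow> ('m, 'n) uq fps" qq by (rule uqs.scalar_ring_fsc)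
  let ?K = "{1..LENGTH('m) + LENGTH('n)}" and ?t = "\<lambda>i j. uqs.fsc (tw LENGTH('m) i j) :: ('m, 'n) uq fps"
  have tt: "?t i j * (?t i j * F) = F" for i j F by (simp add: f.sc_mult_assoc f.sc_1)
  define B where "B = (\<lambda>i j. if i \<in> ?K \<and> j \<in> ?K then ?t i j * X i j else 0)"
  have "ginv LENGTH('m) LENGTH('n) A = B"
    unfolding ginv_def
  proof (rule the_equality)
    have "minv ?K (\<lambda>i j. ?t i j * A i j) (\<lambda>i j. ?t i j * B i j)"
      by (rule iffD2[OF minv_cong X]) (auto simp: B_def tt)
    then show "is_ginv LENGTH('m) LENGTH('n) A B \<and> (\<forall>i k. \<not> (i \<in> ?K \<and> k \<in> ?K) \<longrightarrow> B i k = 0)"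
      unfolding is_ginv_iff by (auto simp: B_def)
    fix C assume C: "is_ginv LENGTH('m) LENGTH('n) A C \<and> (\<forall>i k. \<not> (i \<in> ?K \<and> k \<in> ?K) \<longrightarrow> C i k = 0)"
    show "C = B"
    proof (intro ext)
      fix i k
      show "C i k = B i k"
      proof (cases "i \<in> ?K \<and> k \<in> ?K")
        case True
        have "?t i k * C i k = X i k"
          by (rule minv_unique[OF _ _ X]) (use C True in \<open>simp_all add: is_ginv_iff\<close>)
        then have "?t i k * X i k = ?t i k * (?t i k * C i k)" by simp
        then show ?thesis using True unfolding tt by (simp add: B_def)
      next
        case False
        then show ?thesis using C[THEN conjunct2, rule_format, OF False] unfolding B_def by (simp only: if_not_P[OF False] if_False)
      qed
    qed
  qed
  then show ?thesis using ij by (simp add: B_def)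
qed

abbreviation (input) qshift_mat :: "pm \<Rightarrow> int \<Rightarrow> ('m::len0, 'n::len0) uq smat" where
  "qshift_mat s e \<equiv> (\<lambda>i j. qshift s e (Lmat s i j))"

lemma fsc_tw_shift: "uqs.fsc (tw LENGTH('m) i j) * qshift s e (Lmat s i j) = uqs.shift s e (Lt s i j :: ('m::len0, 'n::len0) uq fps)"
  by (simp only: qshift_eq Lt_def uqs.shift_mult uqs.shift_fsc)

lemma ginv_shift:
  assumes ij: "i \<in> {1..LENGTH('m) + LENGTH('n)}" "j \<in> {1..LENGTH('m) + LENGTH('n)}"
  shows "ginv LENGTH('m) LENGTH('n) (qshift_mat s e :: ('m::len0, 'n::len0) uq smat) i j =
    uqs.fsc (tw LENGTH('m) i j) * uqs.shift s e (Tinv s 1 (LENGTH('m) + LENGTH('n)) i j)"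
  by (rule ginv_eq[OF _ ij]) (simp only: fsc_tw_shift uqs.minv_shift Tinv order_refl)

text \<open>The \<open>itself\<close> arguments carry the type variables, which s alone does not
  determine.\<close>

locale uq_affine =
  fixes s :: pm and mt :: "'m::len0 itself" and nt :: "'n::len0 itself"
  assumes MN: "LENGTH('m) \<noteq> LENGTH('n)"

sublocale uq_affine \<subseteq> rll_affine uconst qq "- pm_int s" "LENGTH('m)" "LENGTH('m) + LENGTH('n)"
  "Lt s :: nat \<Rightarrow> nat \<Rightarrow> ('m, 'n) uq fps" "Tinv s" "Yinv s"
  "\<lambda>t. ugen (Lgen (pm_opp s) 0 t t)" "\<lambda>t. ugen (Lgen s 0 t t)"
  by (rule rll_affine_uq[OF MN])

context uq_affine
begin

lemma qdet_eq_ber: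
  assumes "k \<le> LENGTH('m)"
  shows "qdet s k (qshift_mat s e :: ('m, 'n) uq smat) = ord.ber 1 k e"
proof -
  let ?A = "\<lambda>a i j. shift a (Lt s i j :: ('m, 'n) uq fps)"
  have jN: "k \<le> LENGTH('m) + LENGTH('n)" and p: "parity LENGTH('m) k = 0"
    using assms by (simp_all add: parity_def)
  have "ord.ber 1 k e = qminor.qm fsc qq ?A [1..<k + 1] e {1..k}"
    using ber_eq_ob_even(2)[of 1 k e] assms by (simp add: parity_def)
  also have "\<dots> = qdet s k (qshift_mat s e)"
    unfolding qminor.qm_permutes[OF qminor_even[OF jN p]] qdet_def qsign_def fsc_def[symmetric]
  proof (intro sum.cong refl arg_cong2[where f = "(*)"] arg_cong[where f = prod_list] map_cong)
    fix \<sigma> j assume "\<sigma> \<in> {\<sigma>. \<sigma> permutes {1..k}}" "j \<in> set [1..<k + 1]"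
    then have "\<sigma> j \<le> LENGTH('m)" "j \<le> LENGTH('m)"
      using permutes_in_image[of \<sigma> "{1..k}" j] assms by (auto simp del: upt_Suc)
    then have "(tw LENGTH('m) (\<sigma> j) j :: cq) = 1" by (simp add: tw_def parity_def)
    then show "shift (e + (2 * int j - 2)) (Lt s (\<sigma> j) j :: ('m, 'n) uq fps) = qshift s (2 * int j - 2) (qshift s e (Lmat s (\<sigma> j) j))"
      by (simp add: qshift_eq shift_shift Lt_def ord.sc_1 add.commute)
  qed
  finally show ?thesis ..
qed

text \<open>The first sum is the quantum determinant of size m. The second is a minor of the
  transposed inverse; its initial argument 2 - e - 2m is the negative of the exponent e + 2m - 2 at
  p = 1.\<close>

lemma berezinian_eq_ber:
  "berezinian s LENGTH('m) LENGTH('n) (qshift_mat s e :: ('m, 'n) uq smat) = ord.ber 1 (LENGTH('m) + LENGTH('n)) e"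
proof -
  let ?A = "\<lambda>a i j. shift (- a) (Tinv s 1 (LENGTH('m) + LENGTH('n)) (LENGTH('m) + j) (LENGTH('m) + i) :: ('m, 'n) uq fps)"
  let ?n = "LENGTH('n)" and ?m = "LENGTH('m)"
  have "(\<Sum>\<tau> | \<tau> permutes {1..?n}. qsign ?n \<tau> * prod_list (map (\<lambda>p. qshift s (2 * int ?m - 2 * int p)
      (ginv ?m ?n (qshift_mat s e :: ('m, 'n) uq smat) (?m + p) (?m + \<tau> p))) [1..<?n + 1])) =
    qminor.qm fsc qq ?A [1..<?n + 1] (2 - e - 2 * int ?m) {1..?n}"
    unfolding qminor.qm_permutes[OF qminor_transposed_inverse[OF refl]] qsign_def fsc_def[symmetric]
  proof (intro sum.cong refl arg_cong2[where f = "(*)"] arg_cong[where f = prod_list] map_cong)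
    fix \<tau> p assume "\<tau> \<in> {\<tau>. \<tau> permutes {1..?n}}" "p \<in> set [1..<?n + 1]"
    then have p: "p \<in> {1..?n}" "\<tau> p \<in> {1..?n}"
      using permutes_in_image[of \<tau> "{1..?n}" p] by (auto simp del: upt_Suc)
    then have "(tw ?m (?m + p) (?m + \<tau> p) :: cq) = 1" by (simp add: tw_def parity_def)
    then show "qshift s (2 * int ?m - 2 * int p) (ginv ?m ?n (qshift_mat s e :: ('m, 'n) uq smat) (?m + p) (?m + \<tau> p)) =
      shift (- (2 - e - 2 * int ?m + (2 * int p - 2))) (Tinv s 1 (?m + ?n) (?m + p) (?m + \<tau> p))"
      using p by (subst ginv_shift) (auto simp: qshift_eq shift_shift ord.sc_1 algebra_simps)
  qed
  also have "\<dots> = prod_list (map (\<lambda>t. ord.up 1 (?m + t) (e + 2 * int ?m - 2 * int t)) [1..<?n + 1])"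
    unfolding qm_transposed_inverse[OF refl] by (simp add: algebra_simps del: upt_Suc)
  finally show ?thesis
    using qdet_eq_ber[of ?m e] unfolding berezinian_def qdet_def ber_split[OF refl] by simp
qed

end

section \<open>Transport along omega and phi\<close>

lemma coeffwise_nth [simp]: "fps_nth (coeffwise g F) r = g (fps_nth F r)"
  by (simp add: coeffwise_def)

lemma left_right_inverse_eq_ring:
  fixes a :: "'r::ring_1"
  shows "b * a = 1 \<Longrightarrow> a * c = 1 \<Longrightarrow> b = c"
  by (metis mult.assoc mult_1_left mult_1_right)

lemma shift_graded:
  assumes F: "F \<in> graded_series s e"
  shows "uqs.shift t a F \<in> graded_series s e"
proof -
  have F: "fps_nth F r \<in> uq_sub s \<inter> uq_homogeneous e" for r using F unfolding graded_series_def by blast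
  have "uconst c * fps_nth F r \<in> uq_sub s \<inter> uq_homogeneous (0 + e)" for c r
    by (rule uqg.H_mult[OF _ F]) (simp add: uq_sub.const uconst_homogeneous)
  then show ?thesis unfolding graded_series_def mem_Collect_eq uqs.shift_nth add_0 by blast
qed

lemma one_graded: "1 \<in> graded_series s 0"
proof -
  have "(1 :: ('m::len0, 'n::len0) uq) \<in> uq_sub s \<inter> uq_homogeneous 0"
    using uq_sub.const[of 1 s] uconst_homogeneous[of 1] by (simp add: uq.sc_1)
  then show ?thesis unfolding graded_series_def using uqg.H_0[of s 0] by auto
qed

lemma prod_list_graded: "(\<And>F. F \<in> set Fs \<Longrightarrow> F \<in> graded_series s 0) \<Longrightarrow> prod_list Fs \<in> graded_series s 0"
  by (induction Fs) (auto simp: one_graded intro!: gs.H_mult'[where d = 0 and e = 0])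

section \<open>Anti-automorphisms applied to series\<close>

locale super_anti =
  fixes \<omega> :: "('m::len0, 'n::len0) uq \<Rightarrow> ('m, 'n) uq"
  assumes omega: "super_anti_automorphism \<omega>"
begin

lemma omega_add: "\<omega> (x + y) = \<omega> x + \<omega> y"
  and omega_const: "\<omega> (uconst c) = uconst c"
  and omega_mult: "x \<in> uq_homogeneous d \<Longrightarrow> y \<in> uq_homogeneous e \<Longrightarrow> \<omega> (x * y) = (-1) ^ (d * e) * \<omega> y * \<omega> x"
  using omega by (simp_all add: super_anti_automorphism_def)

lemma omega_0: "\<omega> 0 = 0"
  using omega_add[of 0 0] by simp

lemma omega_sum: "\<omega> (\<Sum>i\<in>I. f i) = (\<Sum>i\<in>I. \<omega> (f i))"
  by (induction I rule: infinite_finite_induct) (simp_all add: omega_0 omega_add)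

lemma coeffwise_1: "coeffwise \<omega> 1 = 1"
  by (rule fps_ext) (use omega_const[of 1] in \<open>simp add: uq.sc_1 omega_0\<close>)

lemma coeffwise_sum: "coeffwise \<omega> (\<Sum>i\<in>I. f i) = (\<Sum>i\<in>I. coeffwise \<omega> (f i))"
  by (rule fps_ext) (simp add: fps_sum_nth omega_sum)

lemma coeffwise_of_bool: "coeffwise \<omega> (of_bool b) = of_bool b"
  by (cases b) (simp_all add: coeffwise_1, simp add: fps_eq_iff omega_0)

lemma coeffwise_mult:
  assumes F: "F \<in> graded_series s d" and G: "G \<in> graded_series s e"
  shows "coeffwise \<omega> (F * G) = uqs.fsc (sg (d * e)) * (coeffwise \<omega> G * coeffwise \<omega> F)"
proof (rule fps_ext)
  fix n
  have FG: "fps_nth F i \<in> uq_homogeneous d" "fps_nth G i \<in> uq_homogeneous e" for i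
    using F G unfolding graded_series_def by blast+
  have "fps_nth (coeffwise \<omega> (F * G)) n = (\<Sum>i\<le>n. (-1) ^ (d * e) * \<omega> (fps_nth G (n - i)) * \<omega> (fps_nth F i))"
    unfolding coeffwise_nth fps_mult_nth atMost_atLeast0 omega_sum using omega_mult[OF FG] by simp
  also have "\<dots> = (\<Sum>i\<le>n. (-1) ^ (d * e) * \<omega> (fps_nth G i) * \<omega> (fps_nth F (n - i)))"
    by (rule sum.reindex_bij_witness[of _ "\<lambda>i. n - i" "\<lambda>i. n - i"]) auto
  also have "\<dots> = fps_nth (uqs.fsc (sg (d * e)) * (coeffwise \<omega> G * coeffwise \<omega> F)) n"
    unfolding uqs.fsc_nth uconst_sg
    by (subst fps_mult_nth) (simp add: sum_distrib_left mult.assoc atMost_atLeast0)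
  finally show "fps_nth (coeffwise \<omega> (F * G)) n = fps_nth (uqs.fsc (sg (d * e)) * (coeffwise \<omega> G * coeffwise \<omega> F)) n" .
qed

lemma coeffwise_mult_even:
  assumes "F \<in> graded_series s 0" "G \<in> graded_series s 0"
  shows "coeffwise \<omega> (F * G) = coeffwise \<omega> G * coeffwise \<omega> F"
  using coeffwise_mult[OF assms] by (simp add: uqs.fsc_def uq.sc_1)

lemma coeffwise_prod_list:
  assumes "\<And>F. F \<in> set Fs \<Longrightarrow> F \<in> graded_series s 0"
  shows "coeffwise \<omega> (prod_list Fs) = prod_list (rev (map (coeffwise \<omega>) Fs))"
  using assms
proof (induction Fs)
  case (Cons F Fs)
  then show ?case
    using coeffwise_mult_even[of F s "prod_list Fs"] prod_list_graded[of Fs s] by simp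
qed (simp add: coeffwise_1)

lemma coeffwise_shift:
  assumes F: "F \<in> graded_series s e"
  shows "coeffwise \<omega> (uqs.shift t a F) = uqs.shift t a (coeffwise \<omega> F)"
proof (rule fps_ext)
  fix n
  have "fps_nth F n \<in> uq_homogeneous e" using F unfolding graded_series_def by blast
  from omega_mult[OF uconst_homogeneous this]
  have "\<omega> (uconst c * fps_nth F n) = uconst c * \<omega> (fps_nth F n)" for c
    by (simp only: mult_0 power_0 mult_1_left omega_const uq.sc_central)
  then show "fps_nth (coeffwise \<omega> (uqs.shift t a F)) n = fps_nth (uqs.shift t a (coeffwise \<omega> F)) n"
    by (simp only: coeffwise_nth uqs.shift_nth)
qed

end

context rll_affine
begin

text \<open>All intervals in this form end at the last index N, so they are upper intervals, to
  which \<omega> and \<phi> can be applied.\<close>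

lemma ob_eq_prod:
  assumes "1 \<le> i" "i \<le> Suc N"
  shows "ob i N e = prod_list (map (\<lambda>x. unop (op.dn x N (2 * int (parity m x) - (e + 2 * hh m i (x - 1))))) [i..<Suc N])"
  using assms(2,1)
proof (induction i arbitrary: e rule: inc_induct)
  case (step i)
  let ?a = "\<lambda>i e x. 2 * int (parity m x) - (e + 2 * hh m i (x - 1))"
  have h: "?a (Suc i) (e + 2 * gr m i) x = ?a i e x" if "x \<in> set [Suc i..<Suc N]" for x
  proof -
    have "hh m i (x - 1) = gr m i + hh m (Suc i) (x - 1)" using that by (intro hh_Cons) auto
    then show ?thesis by simp
  qed
  have "ob i N e = unop (op.dn i N (2 * int (parity m i) - e)) * ob (Suc i) N (e + 2 * gr m i)"
    using step by (intro ob_dn) auto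
  also have "ob (Suc i) N (e + 2 * gr m i) = prod_list (map (\<lambda>x. unop (op.dn x N (2 * int (parity m x) - (e + 2 * hh m i (x - 1))))) [Suc i..<Suc N])"
    unfolding step.IH[OF le_SucI[OF step.prems]] by (intro arg_cong[of _ _ prod_list] map_cong refl) (simp only: h)
  also have "unop (op.dn i N (2 * int (parity m i) - e)) * \<dots> =
    prod_list (map (\<lambda>x. unop (op.dn x N (2 * int (parity m x) - (e + 2 * hh m i (x - 1))))) (i # [Suc i..<Suc N]))"
    using step by simp
  also have "i # [Suc i..<Suc N] = [i..<Suc N]"
    using step by (simp add: upt_rec)
  finally show ?case .
qed simp

lemma op_dsch_inverse:
  assumes "x \<in> {1..N}"
  shows "shift (- a) (Yi x N x x) * unop (op.dsch (Suc x) N a x) = 1"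
    "unop (op.dsch (Suc x) N a x) * shift (- a) (Yi x N x x) = 1"
  using arg_cong[OF op.dsch_dn(1)[of x N a], of unop] arg_cong[OF op.dsch_dn(2)[of x N a], of unop] assms by simp_all

lemma op_dn_inverse:
  assumes "x \<in> {1..N}"
  shows "unop (op.dn x N a) * unop (op.dn_inv x N a) = 1" "unop (op.dn_inv x N a) * unop (op.dn x N a) = 1"
  using op_dsch_inverse[OF assms] by (simp_all add: op.dn_def op.dn_inv_def)

end

context uq_affine
begin

lemma Yinv_graded:
  assumes "1 \<le> i" "k \<in> {i..LENGTH('m) + LENGTH('n)}" "l \<in> {i..LENGTH('m) + LENGTH('n)}"
  shows "(Yinv s i (LENGTH('m) + LENGTH('n)) k l :: ('m, 'n) uq fps) \<in> graded_series s (parity LENGTH('m) k + parity LENGTH('m) l)"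
  using Yinv(2)[of i "LENGTH('m) + LENGTH('n)" s, where 'm = 'm and 'n = 'n] assms by (simp add: is_inv_family_def)

lemma op_dsch_graded:
  assumes "x \<in> {1..LENGTH('m) + LENGTH('n)}"
  shows "unop (op.dsch (Suc x) (LENGTH('m) + LENGTH('n)) a x) \<in> graded_series s 0"
proof -
  have To: "To a i j = Op (shift (- a) (Lmat s i j))" for i j
    by (simp only: Op_eq_iff fsc_tw_Lt[symmetric] shift_mult shift_fsc)
  have "op.dsch (Suc x) (LENGTH('m) + LENGTH('n)) a x \<in> Op ` graded_series s 0"
    unfolding op.dsch_def To
    by (rule gso.H_schur[where p = "parity LENGTH('m)"]) (use assms in \<open>auto intro!: imageI shift_graded Lmat_graded Yinv_graded\<close>)
  then show ?thesis by auto
qed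

lemma Yinv_diag_graded:
  assumes "x \<in> {1..LENGTH('m) + LENGTH('n)}"
  shows "shift a (Yinv s x (LENGTH('m) + LENGTH('n)) x x :: ('m, 'n) uq fps) \<in> graded_series s 0"
proof (rule shift_graded)
  have "Yinv s x (LENGTH('m) + LENGTH('n)) x x \<in> (graded_series s (parity LENGTH('m) x + parity LENGTH('m) x) :: ('m, 'n) uq fps set)"
    using assms by (intro Yinv_graded) auto
  from gs.H_cong[THEN equalityD1, THEN subsetD, OF _ this, of 0]
  show "(Yinv s x (LENGTH('m) + LENGTH('n)) x x :: ('m, 'n) uq fps) \<in> graded_series s 0" by simp
qed

lemma op_dn_graded:
  assumes "x \<in> {1..LENGTH('m) + LENGTH('n)}"
  shows "unop (op.dn x (LENGTH('m) + LENGTH('n)) a) \<in> graded_series s 0" "unop (op.dn_inv x (LENGTH('m) + LENGTH('n)) a) \<in> graded_series s 0"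
  using op_dsch_graded[OF assms] Yinv_diag_graded[OF assms] by (simp_all add: op.dn_def op.dn_inv_def)

end

locale uq_omega = uq_affine s mt nt + super_anti \<omega>
  for s and mt :: "'m::len0 itself" and nt :: "'n::len0 itself" and \<omega> :: "('m, 'n) uq \<Rightarrow> ('m, 'n) uq" +
  assumes is_omega: "is_omega \<omega>"
begin

lemma omega_Lmat:
  assumes "i \<in> {1..LENGTH('m) + LENGTH('n)}" "j \<in> {1..LENGTH('m) + LENGTH('n)}"
  shows "coeffwise \<omega> (Lmat s i j) = fsc (tw LENGTH('m) i j) * Tinv s 1 (LENGTH('m) + LENGTH('n)) i j"
  using is_omega ginv_shift[OF assms, of s 0] assms by (simp add: is_omega_def qshift_eq)

text \<open>Applying \<omega> to the transposed inverse equations of Y reverses the products and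
  replaces L by L^-1. Hence the twisted image of Y is an ordinary inverse of the block of L^-1 on
  {x..M+N}, which by \<open>minv_block\<close> is the Schur complement of {1..x-1} in L.\<close>

lemma omega_Yinv:
  assumes x: "x \<in> {1..LENGTH('m) + LENGTH('n)}"
  shows "coeffwise \<omega> (Yinv s x (LENGTH('m) + LENGTH('n)) x x) = ord.dsch 1 (x - 1) 0 x"
proof -
  let ?J = "{x..LENGTH('m) + LENGTH('n)}" and ?m = "LENGTH('m)"
  let ?p = "parity ?m" and ?tw = "tw LENGTH('m) :: nat \<Rightarrow> nat \<Rightarrow> cq"
  let ?Y = "Yinv s x (LENGTH('m) + LENGTH('n)) :: nat \<Rightarrow> nat \<Rightarrow> ('m, 'n) uq fps" and ?T' = "Tinv s 1 (LENGTH('m) + LENGTH('n)) :: nat \<Rightarrow> nat \<Rightarrow> ('m, 'n) uq fps"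
  let ?W = "\<lambda>j k. fsc (?tw j k) * coeffwise \<omega> (?Y j k)"
  have J: "\<And>i. i \<in> ?J \<Longrightarrow> i \<in> {1..LENGTH('m) + LENGTH('n)}" using x by auto
  have sgE: "fsc (sg ((?p j + ?p k) * (?p i + ?p j)) * ?tw i j) = (fsc (?tw i k * ?tw j k) :: ('m, 'n) uq fps)"
    "fsc (sg ((?p i + ?p j) * (?p j + ?p k)) * ?tw j k) = (fsc (?tw i k * ?tw i j) :: ('m, 'n) uq fps)" for i j k
    by (rule parity_cases[of ?m i]; rule parity_cases[of ?m j]; rule parity_cases[of ?m k]; simp add: tw_def)+
  have fb: "X = of_bool (i = k)" if "of_bool (i = k) = fsc (?tw i k) * X" for i k and X :: "('m, 'n) uq fps"
  proof -
    have "X = fsc (?tw i k) * (fsc (?tw i k) * X)" by (simp add: ord.sc_mult_assoc ord.sc_1)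
    also have "\<dots> = of_bool (i = k)" unfolding that[symmetric] by (auto simp: ord.sc_1)
    finally show ?thesis .
  qed
  have Y: "(\<Sum>j\<in>?J. ?Y j k * Lmat s i j) = of_bool (i = k)" "(\<Sum>j\<in>?J. Lmat s j k * ?Y i j) = of_bool (i = k)"
    if "i \<in> ?J" "k \<in> ?J" for i k
    using Yinv(1)[of x "LENGTH('m) + LENGTH('n)" s, where 'm = 'm and 'n = 'n] that x unfolding minv_opp by auto
  have "minv ?J ?T' ?W"
    unfolding minv_def
  proof (intro ballI conjI)
    fix i k assume ik: "i \<in> ?J" "k \<in> ?J"
    have "coeffwise \<omega> (?Y j k * Lmat s i j) = fsc (?tw i k) * (?T' i j * ?W j k)" if "j \<in> ?J" for j
    proof -
      have "coeffwise \<omega> (?Y j k * Lmat s i j) = fsc (sg ((?p j + ?p k) * (?p i + ?p j))) * (coeffwise \<omega> (Lmat s i j) * coeffwise \<omega> (?Y j k))"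
        by (rule coeffwise_mult[OF Yinv_graded Lmat_graded]) (use ik that x in auto)
      also have "\<dots> = fsc (sg ((?p j + ?p k) * (?p i + ?p j)) * ?tw i j) * (?T' i j * coeffwise \<omega> (?Y j k))"
        using omega_Lmat[OF J[OF ik(1)] J[OF that]] by (simp add: ord.sc_mult mult.assoc)
      also have "\<dots> = fsc (?tw i k) * (?T' i j * ?W j k)"
        unfolding sgE(1) by (simp only: ord.sc_gather5)
      finally show ?thesis .
    qed
    then have "of_bool (i = k) = fsc (?tw i k) * (\<Sum>j\<in>?J. ?T' i j * ?W j k)"
      using arg_cong[OF Y(1)[OF ik], of "coeffwise \<omega>"] by (simp add: coeffwise_sum coeffwise_of_bool sum_distrib_left)
    then show "(\<Sum>j\<in>?J. ?T' i j * ?W j k) = of_bool (i = k)" by (rule fb)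
    have "coeffwise \<omega> (Lmat s j k * ?Y i j) = fsc (?tw i k) * (?W i j * ?T' j k)" if "j \<in> ?J" for j
    proof -
      have "coeffwise \<omega> (Lmat s j k * ?Y i j) = fsc (sg ((?p j + ?p k) * (?p i + ?p j))) * (coeffwise \<omega> (?Y i j) * coeffwise \<omega> (Lmat s j k))"
        by (rule coeffwise_mult[OF Lmat_graded Yinv_graded]) (use ik that x in auto)
      also have "\<dots> = fsc (sg ((?p i + ?p j) * (?p j + ?p k)) * ?tw j k) * (coeffwise \<omega> (?Y i j) * ?T' j k)"
        unfolding omega_Lmat[OF J[OF that] J[OF ik(2)]] by (simp only: ord.sc_gather5 mult.commute[of "?p j + ?p k"])
      also have "\<dots> = fsc (?tw i k) * (?W i j * ?T' j k)"
        unfolding sgE(2) by (simp only: ord.sc_mult mult.assoc)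
      finally show ?thesis .
    qed
    then have "of_bool (i = k) = fsc (?tw i k) * (\<Sum>j\<in>?J. ?W i j * ?T' j k)"
      using arg_cong[OF Y(2)[OF ik], of "coeffwise \<omega>"] by (simp add: coeffwise_sum coeffwise_of_bool sum_distrib_left)
    then show "(\<Sum>j\<in>?J. ?W i j * ?T' j k) = of_bool (i = k)" by (rule fb)
  qed
  moreover have diff: "{1..LENGTH('m) + LENGTH('n)} - ?J = {1..x - 1}" using x by auto
  have "minv ?J ?T' (schur {1..x - 1} (Lt s) (Tinv s 1 (x - 1)))"
    unfolding diff[symmetric]
  proof (rule minv_block)
    show "minv {1..LENGTH('m) + LENGTH('n)} (Lt s) ?T'" by (rule Tinv(1)) auto
    show "minv ({1..LENGTH('m) + LENGTH('n)} - ?J) (Lt s) (Tinv s 1 (x - 1) :: nat \<Rightarrow> nat \<Rightarrow> ('m, 'n) uq fps)"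
      unfolding diff by (rule Tinv(1)) (use x in auto)
  qed (use x in auto)
  ultimately have "?W x x = schur {1..x - 1} (Lt s) (Tinv s 1 (x - 1)) x x"
    by (rule minv_unique[rotated]) (use x in auto)
  then show ?thesis by (simp add: ord.dsch_def ord.sc_1)
qed

lemma omega_Yinv_shift:
  assumes x: "x \<in> {1..LENGTH('m) + LENGTH('n)}"
  shows "coeffwise \<omega> (shift (- a) (Yinv s x (LENGTH('m) + LENGTH('n)) x x)) = ord.dsch 1 (x - 1) (- a) x"
proof -
  have "coeffwise \<omega> (shift (- a) (Yinv s x (LENGTH('m) + LENGTH('n)) x x)) = shift (- a) (coeffwise \<omega> (Yinv s x (LENGTH('m) + LENGTH('n)) x x))"
    by (rule coeffwise_shift[OF Yinv_graded]) (use x in auto)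
  then show ?thesis by (simp add: omega_Yinv[OF x] shift_dsch)
qed

text \<open>Found as the inverse of the image in \<open>omega_Yinv_shift\<close>, since \<omega>
  reverses products of even series without signs.\<close>

lemma omega_op_dsch:
  assumes x: "x \<in> {1..LENGTH('m) + LENGTH('n)}"
  shows "coeffwise \<omega> (unop (op.dsch (Suc x) (LENGTH('m) + LENGTH('n)) a x)) = shift (- a) (Tinv s 1 x x x)"
proof (rule left_right_inverse_eq_ring)
  show "coeffwise \<omega> (unop (op.dsch (Suc x) (LENGTH('m) + LENGTH('n)) a x)) * ord.dsch 1 (x - 1) (- a) x = 1"
    unfolding omega_Yinv_shift[OF x, symmetric] coeffwise_mult_even[OF Yinv_diag_graded[OF x] op_dsch_graded[OF x], symmetric]
    by (simp add: op_dsch_inverse[OF x] coeffwise_1)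
  show "ord.dsch 1 (x - 1) (- a) x * shift (- a) (Tinv s 1 x x x) = 1"
    using ord.dsch_up(2)[of 1 x "- a"] x by simp
qed

lemma omega_op_dn:
  assumes x: "x \<in> {1..LENGTH('m) + LENGTH('n)}"
  shows "coeffwise \<omega> (unop (op.dn x (LENGTH('m) + LENGTH('n)) a)) = ord.up_inv 1 x (- a)"
    "coeffwise \<omega> (unop (op.dn_inv x (LENGTH('m) + LENGTH('n)) a)) = ord.up 1 x (- a)"
  by (simp_all add: op.dn_def op.dn_inv_def ord.up_def ord.up_inv_def omega_op_dsch[OF x] omega_Yinv_shift[OF x])

text \<open>The result is the inverse of the Berezinian. It is written as a product of opposite
  quasideterminants because \<open>\<phi>\<close> is easily applied to these.\<close>

lemma omega_ber:
  "coeffwise \<omega> (ord.ber 1 (LENGTH('m) + LENGTH('n)) e) =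
    prod_list (rev (map (\<lambda>x. unop (op.dn_inv x (LENGTH('m) + LENGTH('n)) (2 * int (parity LENGTH('m) x) - (e + 2 * hh LENGTH('m) 1 (x - 1))))) [1..<Suc (LENGTH('m) + LENGTH('n))]))"
proof -
  let ?a = "\<lambda>x. 2 * int (parity LENGTH('m) x) - (e + 2 * hh LENGTH('m) 1 (x - 1))"
  let ?d = "\<lambda>x. unop (op.dn x (LENGTH('m) + LENGTH('n)) (?a x))" and ?g = "\<lambda>x. unop (op.dn_inv x (LENGTH('m) + LENGTH('n)) (?a x))"
  have b: "ord.ber 1 (LENGTH('m) + LENGTH('n)) e = prod_list (map ?d [1..<Suc (LENGTH('m) + LENGTH('n))])"
    using ber_eq_ob[of 1 "LENGTH('m) + LENGTH('n)" e] ob_eq_prod[of 1 e] by simp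
  have "coeffwise \<omega> (ord.ber 1 (LENGTH('m) + LENGTH('n)) e) = prod_list (rev (map (coeffwise \<omega> \<circ> ?d) [1..<Suc (LENGTH('m) + LENGTH('n))]))"
    unfolding b map_map[symmetric] by (rule coeffwise_prod_list[where s = s]) (auto simp: op_dn_graded simp del: upt_Suc)
  also have "map (coeffwise \<omega> \<circ> ?d) [1..<Suc (LENGTH('m) + LENGTH('n))] = map (\<lambda>t. ord.up_inv 1 t (e + 2 * hh LENGTH('m) 1 (t - 1) - 2 * int (parity LENGTH('m) t))) [1..<Suc (LENGTH('m) + LENGTH('n))]"
    by (rule map_cong[OF refl]) (simp add: omega_op_dn del: upt_Suc)
  also have "prod_list (rev \<dots>) = ord.ber_inv 1 (LENGTH('m) + LENGTH('n)) e"
    unfolding ord.ber_inv_def ..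
  also have "\<dots> = prod_list (rev (map ?g [1..<Suc (LENGTH('m) + LENGTH('n))]))"
  proof (rule left_right_inverse_eq_ring)
    show "ord.ber_inv 1 (LENGTH('m) + LENGTH('n)) e * ord.ber 1 (LENGTH('m) + LENGTH('n)) e = 1" by (rule ord.ber_inv) auto
    show "ord.ber 1 (LENGTH('m) + LENGTH('n)) e * prod_list (rev (map ?g [1..<Suc (LENGTH('m) + LENGTH('n))])) = 1"
      unfolding b using ord.prod_list_inverse[of "[1..<Suc (LENGTH('m) + LENGTH('n))]" ?d ?g] op_dn_inverse by (simp del: upt_Suc)
  qed
  finally show ?thesis .
qed

end

section \<open>The homomorphism shifting the indices\<close>

lemma minv_reindex:
  assumes "inj_on h K" "minv (h ` K) A B"
  shows "minv K (\<lambda>i j. A (h i) (h j)) (\<lambda>i j. B (h i) (h j))"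
  using assms unfolding minv_def by (simp add: sum.reindex inj_on_eq_iff)

locale uq_phi = A: uq_affine s mt nt + B: uq_affine s kmt nt
  for s and mt :: "'m::len0 itself" and kmt :: "'km::len0 itself" and nt :: "'n::len0 itself" +
  fixes k :: nat and \<phi> :: "('m, 'n) uq \<Rightarrow> ('km, 'n) uq"
  assumes km: "LENGTH('km) = k + LENGTH('m)" and is_phi: "is_phi s k \<phi>"
begin

lemma phi_add: "x \<in> uq_sub s \<Longrightarrow> y \<in> uq_sub s \<Longrightarrow> \<phi> (x + y) = \<phi> x + \<phi> y"
  and phi_mult: "x \<in> uq_sub s \<Longrightarrow> y \<in> uq_sub s \<Longrightarrow> \<phi> (x * y) = \<phi> x * \<phi> y"
  and phi_const: "\<phi> (uconst c) = uconst c"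
  using is_phi by (simp_all add: is_phi_def algebra_hom_on_def)

lemma phi_0: "\<phi> 0 = 0" and phi_1: "\<phi> 1 = 1"
  using phi_const[of 0] phi_const[of 1] by (simp_all add: uq.sc_1)

lemma phi_sum: "(\<And>i. i \<in> I \<Longrightarrow> f i \<in> uq_sub s \<inter> uq_homogeneous e) \<Longrightarrow> \<phi> (\<Sum>i\<in>I. f i) = (\<Sum>i\<in>I. \<phi> (f i))"
proof (induction I rule: infinite_finite_induct)
  case (insert i I)
  have "(\<Sum>i\<in>I. f i) \<in> uq_sub s \<inter> uq_homogeneous e" by (rule uqg.H_sum) (use insert.prems in auto)
  then show ?case using insert phi_add[of "f i" "\<Sum>i\<in>I. f i"] by auto
qed (simp_all add: phi_0)

lemma phi_fps_1: "coeffwise \<phi> 1 = 1"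
  by (rule fps_ext) (simp add: phi_0 phi_1)

lemma phi_fps_of_bool: "coeffwise \<phi> (of_bool b) = of_bool b"
  by (cases b) (simp_all add: phi_fps_1, simp add: fps_eq_iff phi_0)

lemma phi_fps_mult:
  assumes F: "F \<in> graded_series s d" and G: "G \<in> graded_series s e"
  shows "coeffwise \<phi> (F * G) = coeffwise \<phi> F * coeffwise \<phi> G"
proof (rule fps_ext)
  fix n
  have FG: "fps_nth F i \<in> uq_sub s \<inter> uq_homogeneous d" "fps_nth G i \<in> uq_sub s \<inter> uq_homogeneous e" for i
    using F G unfolding graded_series_def by blast+
  have "\<phi> (\<Sum>i = 0..n. fps_nth F i * fps_nth G (n - i)) = (\<Sum>i = 0..n. \<phi> (fps_nth F i * fps_nth G (n - i)))"
    by (rule phi_sum[where e = "d + e"]) (rule uqg.H_mult[OF FG])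
  then show "fps_nth (coeffwise \<phi> (F * G)) n = fps_nth (coeffwise \<phi> F * coeffwise \<phi> G) n"
    unfolding coeffwise_nth fps_mult_nth using FG phi_mult by simp
qed

lemma phi_fps_sum:
  assumes "\<And>i. i \<in> I \<Longrightarrow> f i \<in> graded_series s e"
  shows "coeffwise \<phi> (\<Sum>i\<in>I. f i) = (\<Sum>i\<in>I. coeffwise \<phi> (f i))"
proof (rule fps_ext)
  fix n
  show "fps_nth (coeffwise \<phi> (\<Sum>i\<in>I. f i)) n = fps_nth (\<Sum>i\<in>I. coeffwise \<phi> (f i)) n"
    unfolding coeffwise_nth fps_sum_nth
    by (rule phi_sum) (use assms in \<open>unfold graded_series_def, blast\<close>)
qed

lemma phi_fps_prod_list:
  assumes "\<And>F. F \<in> set Fs \<Longrightarrow> F \<in> graded_series s 0"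
  shows "coeffwise \<phi> (prod_list Fs) = prod_list (map (coeffwise \<phi>) Fs)"
  using assms
proof (induction Fs)
  case (Cons F Fs)
  then show ?case
    using phi_fps_mult[of F 0 "prod_list Fs" 0] prod_list_graded[of Fs s] by simp
qed (simp add: phi_fps_1)

lemma phi_shift:
  assumes "F \<in> graded_series s e"
  shows "coeffwise \<phi> (uqs.shift t a F) = uqs.shift t a (coeffwise \<phi> F)"
proof (rule fps_ext)
  fix n
  have "fps_nth F n \<in> uq_sub s" using assms unfolding graded_series_def by blast
  then show "fps_nth (coeffwise \<phi> (uqs.shift t a F)) n = fps_nth (uqs.shift t a (coeffwise \<phi> F)) n"
    by (simp add: phi_mult uq_sub.const phi_const)
qed

lemma phi_Lmat:
  "i \<in> {1..LENGTH('m) + LENGTH('n)} \<Longrightarrow> j \<in> {1..LENGTH('m) + LENGTH('n)} \<Longrightarrow> coeffwise \<phi> (Lmat s i j) = Lmat s (k + i) (k + j)"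
  using is_phi by (simp add: is_phi_def)

text \<open>The image satisfies the inverse equations of the larger matrix on {k+i..k+M+N}, again an
  interval up to the last index, and inverses are unique. All products and sums to which \<phi> is
  applied lie in \<open>uq_sub\<close>.\<close>

lemma phi_Yinv:
  assumes i: "1 \<le> i" and xy: "x \<in> {i..LENGTH('m) + LENGTH('n)}" "y \<in> {i..LENGTH('m) + LENGTH('n)}"
  shows "coeffwise \<phi> (Yinv s i (LENGTH('m) + LENGTH('n)) x y) = Yinv s (k + i) (LENGTH('km) + LENGTH('n)) (k + x) (k + y)"
proof -
  let ?N = "LENGTH('m) + LENGTH('n)"
  let ?Y = "Yinv s i ?N :: nat \<Rightarrow> nat \<Rightarrow> ('m, 'n) uq fps"
  let ?L = "\<lambda>x y. Lmat s (k + x) (k + y) :: ('km, 'n) uq fps"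
  have 1: "minv {i..?N} (\<lambda>x y. Op (?L x y)) (\<lambda>x y. Op (coeffwise \<phi> (?Y x y)))"
    unfolding minv_opp
  proof (intro ballI conjI)
    fix u v assume uv: "u \<in> {i..?N}" "v \<in> {i..?N}"
    let ?p = "parity LENGTH('m)"
    have Y: "(\<Sum>j\<in>{i..?N}. ?Y j v * Lmat s u j) = of_bool (u = v)" "(\<Sum>j\<in>{i..?N}. Lmat s j v * ?Y u j) = of_bool (u = v)"
      using Yinv(1)[of i ?N s, where 'm = 'm and 'n = 'n] i uv unfolding minv_opp by auto
    have t: "coeffwise \<phi> (?Y j v * Lmat s u j) = coeffwise \<phi> (?Y j v) * ?L u j"
      "coeffwise \<phi> (Lmat s j v * ?Y u j) = ?L j v * coeffwise \<phi> (?Y u j)" if "j \<in> {i..?N}" for j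
      using phi_fps_mult[OF A.Yinv_graded[OF i that uv(2)] Lmat_graded[of s u j]]
        phi_fps_mult[OF Lmat_graded[of s j v] A.Yinv_graded[OF i uv(1) that]] phi_Lmat that uv i by simp_all
    have g: "?Y j v * Lmat s u j \<in> graded_series s (?p u + ?p v)" "Lmat s j v * ?Y u j \<in> graded_series s (?p u + ?p v)"
      if "j \<in> {i..?N}" for j
      by (rule gs.H_mult'[OF A.Yinv_graded[OF i that uv(2)] Lmat_graded[of s u j]], presburger,
        rule gs.H_mult'[OF Lmat_graded[of s j v] A.Yinv_graded[OF i uv(1) that]], presburger)
    show "(\<Sum>j\<in>{i..?N}. coeffwise \<phi> (?Y j v) * ?L u j) = of_bool (u = v)"
      unfolding phi_fps_of_bool[symmetric] Y(1)[symmetric] by (subst phi_fps_sum[OF g(1)]) (simp_all add: t)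
    show "(\<Sum>j\<in>{i..?N}. ?L j v * coeffwise \<phi> (?Y u j)) = of_bool (u = v)"
      unfolding phi_fps_of_bool[symmetric] Y(2)[symmetric] by (subst phi_fps_sum[OF g(2)]) (simp_all add: t)
  qed
  have im: "(+) k ` {i..?N} = {k + i..LENGTH('km) + LENGTH('n)}" by (simp add: km add.assoc)
  have 2: "minv {i..?N} (\<lambda>x y. Op (?L x y)) (\<lambda>x y. Op (Yinv s (k + i) (LENGTH('km) + LENGTH('n)) (k + x) (k + y)))"
    by (rule minv_reindex[where h = "(+) k" and A = "\<lambda>x y. Op (Lmat s x y)"])
      (simp, unfold im, rule Yinv(1), use i in auto)
  show ?thesis
    using minv_unique[OF _ 1 2 xy] by simp
qed

lemma parity_shift: "1 \<le> x \<Longrightarrow> parity LENGTH('km) (k + x) = parity LENGTH('m) x"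
  by (simp add: km parity_def)

lemma phi_op_dsch:
  assumes x: "x \<in> {1..LENGTH('m) + LENGTH('n)}"
  shows "coeffwise \<phi> (unop (A.op.dsch (Suc x) (LENGTH('m) + LENGTH('n)) a x)) =
    unop (B.op.dsch (Suc (k + x)) (LENGTH('km) + LENGTH('n)) a (k + x))"
    and "coeffwise \<phi> (A.shift (- a) (Yinv s x (LENGTH('m) + LENGTH('n)) x x)) =
      B.shift (- a) (Yinv s (k + x) (LENGTH('km) + LENGTH('n)) (k + x) (k + x))"
proof -
  let ?N = "LENGTH('m) + LENGTH('n)" and ?N' = "LENGTH('km) + LENGTH('n)"
  show Y: "coeffwise \<phi> (A.shift (- a) (Yinv s x ?N x x)) = B.shift (- a) (Yinv s (k + x) ?N' (k + x) (k + x))"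
    using phi_shift[OF A.Yinv_graded[of x x x]] phi_Yinv[of x x x] x by simp
  show "coeffwise \<phi> (unop (A.op.dsch (Suc x) ?N a x)) = unop (B.op.dsch (Suc (k + x)) ?N' a (k + x))"
  proof (rule left_right_inverse_eq_ring)
    show "coeffwise \<phi> (unop (A.op.dsch (Suc x) ?N a x)) * B.shift (- a) (Yinv s (k + x) ?N' (k + x) (k + x)) = 1"
      unfolding Y[symmetric] phi_fps_mult[OF A.op_dsch_graded[OF x] A.Yinv_diag_graded[OF x], symmetric]
      by (simp add: A.op_dsch_inverse[OF x] phi_fps_1)
    show "B.shift (- a) (Yinv s (k + x) ?N' (k + x) (k + x)) * unop (B.op.dsch (Suc (k + x)) ?N' a (k + x)) = 1"
      by (rule B.op_dsch_inverse) (use x km in auto)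
  qed
qed

lemma phi_op_dn_inv:
  assumes "x \<in> {1..LENGTH('m) + LENGTH('n)}"
  shows "coeffwise \<phi> (unop (A.op.dn_inv x (LENGTH('m) + LENGTH('n)) a)) =
    unop (B.op.dn_inv (k + x) (LENGTH('km) + LENGTH('n)) a)"
  using phi_op_dsch[OF assms] assms by (simp add: A.op.dn_inv_def B.op.dn_inv_def parity_shift)

lemma hh_shift: "hh LENGTH('km) 1 (k + x) = int k + hh LENGTH('m) 1 x"
proof (induction x)
  case 0
  have "hh LENGTH('km) 1 k = (\<Sum>t = 1..k. 1)"
    unfolding hh_def by (rule sum.cong) (auto simp: gr_def parity_def km)
  then show ?case by simp
next
  case (Suc x)
  then show ?case
    using hh_snoc[of 1 "k + Suc x" "LENGTH('km)"] hh_snoc[of 1 "Suc x" "LENGTH('m)"] by (simp add: gr_def parity_shift[of "Suc x", simplified])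
qed

text \<open>The first k indices are even and raise the exponents of all later factors by 2k.
  Starting at z q^(-2k) compensates for this, so the later factors stand at the arguments of the
  smaller Berezinian at z.\<close>

lemma ber_shift:
  "B.ord.ber 1 (LENGTH('km) + LENGTH('n)) (- 2 * int k) = B.ord.ber 1 k (- 2 * int k) *
    prod_list (map (\<lambda>x. B.ord.up 1 (k + x) (2 * hh LENGTH('m) 1 (x - 1) - 2 * int (parity LENGTH('m) x))) [1..<Suc (LENGTH('m) + LENGTH('n))])"
proof -
  let ?N = "LENGTH('m) + LENGTH('n)"
  let ?u = "\<lambda>t. B.ord.up 1 t (- 2 * int k + 2 * hh LENGTH('km) 1 (t - 1) - 2 * int (parity LENGTH('km) t))"
  have "[1..<Suc (LENGTH('km) + LENGTH('n))] = [1..<Suc k] @ [Suc k..<Suc (LENGTH('km) + LENGTH('n))]"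
    using upt_add_eq_append[of 1 "Suc k" ?N] by (simp add: km add.assoc)
  also have "[Suc k..<Suc (LENGTH('km) + LENGTH('n))] = map (\<lambda>t. k + t) [1..<Suc ?N]"
    by (intro nth_equalityI) (auto simp: km simp del: upt_Suc)
  finally have "B.ord.ber 1 (LENGTH('km) + LENGTH('n)) (- 2 * int k) = B.ord.ber 1 k (- 2 * int k) *
    prod_list (map (?u \<circ> (\<lambda>t. k + t)) [1..<Suc ?N])"
    by (simp only: B.ord.ber_def map_append prod_list.append map_map)
  also have "map (?u \<circ> (\<lambda>t. k + t)) [1..<Suc ?N] =
    map (\<lambda>x. B.ord.up 1 (k + x) (2 * hh LENGTH('m) 1 (x - 1) - 2 * int (parity LENGTH('m) x))) [1..<Suc ?N]"
  proof (rule map_cong[OF refl])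
    fix x assume "x \<in> set [1..<Suc ?N]"
    then have x: "1 \<le> x" by (simp del: upt_Suc)
    show "(?u \<circ> (\<lambda>t. k + t)) x = B.ord.up 1 (k + x) (2 * hh LENGTH('m) 1 (x - 1) - 2 * int (parity LENGTH('m) x))"
      unfolding o_apply by (rule arg_cong[of _ _ "B.ord.up 1 (k + x)"]) (use hh_shift[of "x - 1"] x in \<open>simp add: parity_shift\<close>)
  qed
  finally show ?thesis .
qed

lemma psi_ber:
  fixes \<omega> \<omega>'
  assumes "is_omega \<omega>" "is_omega \<omega>'"
  shows "B.ord.ber 1 k (- 2 * int k) * coeffwise (\<omega>' \<circ> \<phi> \<circ> \<omega>) (A.ord.ber 1 (LENGTH('m) + LENGTH('n)) 0) =
    B.ord.ber 1 (LENGTH('km) + LENGTH('n)) (- 2 * int k)"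
proof -
  let ?N = "LENGTH('m) + LENGTH('n)" and ?N' = "LENGTH('km) + LENGTH('n)"
  interpret O: uq_omega s mt nt \<omega>
    by unfold_locales (use assms in \<open>simp_all add: is_omega_def\<close>)
  interpret O': uq_omega s kmt nt \<omega>'
    by unfold_locales (use assms in \<open>simp_all add: is_omega_def\<close>)
  let ?a = "\<lambda>x. 2 * int (parity LENGTH('m) x) - (0 + 2 * hh LENGTH('m) 1 (x - 1))"
  let ?g = "\<lambda>x. unop (A.op.dn_inv x ?N (?a x))" and ?h = "\<lambda>x. unop (B.op.dn_inv (k + x) ?N' (?a x))"
  have x: "x \<in> {1..?N}" "k + x \<in> {1..?N'}" if "x \<in> set [1..<Suc ?N]" for x
    using that by (auto simp: km simp del: upt_Suc)
  have "coeffwise (\<omega>' \<circ> \<phi> \<circ> \<omega>) (A.ord.ber 1 ?N 0) = coeffwise \<omega>' (coeffwise \<phi> (coeffwise \<omega> (A.ord.ber 1 ?N 0)))"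
    by (simp add: coeffwise_def)
  also have "coeffwise \<omega> (A.ord.ber 1 ?N 0) = prod_list (map ?g (rev [1..<Suc ?N]))"
    using O.omega_ber[of 0] by (simp only: rev_map)
  also have "coeffwise \<phi> \<dots> = prod_list (map (coeffwise \<phi>) (map ?g (rev [1..<Suc ?N])))"
    by (rule phi_fps_prod_list) (auto simp: A.op_dn_graded simp del: upt_Suc)
  also have "map (coeffwise \<phi>) (map ?g (rev [1..<Suc ?N])) = map ?h (rev [1..<Suc ?N])"
    unfolding map_map by (rule map_cong[OF refl]) (use phi_op_dn_inv x in \<open>simp del: upt_Suc\<close>)
  also have "coeffwise \<omega>' (prod_list \<dots>) = prod_list (rev (map (coeffwise \<omega>') (map ?h (rev [1..<Suc ?N]))))"
    by (rule O'.coeffwise_prod_list[where s = s]) (use x B.op_dn_graded in \<open>auto simp del: upt_Suc\<close>)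
  \<comment> \<open>The reversals of order caused by \<omega> and by \<omega>' cancel, and \<omega>'
    turns the inverse factors back into factors of b.\<close>
  also have "rev (map (coeffwise \<omega>') (map ?h (rev [1..<Suc ?N]))) = map (coeffwise \<omega>' \<circ> ?h) [1..<Suc ?N]"
    by (simp only: map_map rev_map rev_rev_ident)
  also have "\<dots> = map (\<lambda>x. B.ord.up 1 (k + x) (2 * hh LENGTH('m) 1 (x - 1) - 2 * int (parity LENGTH('m) x))) [1..<Suc ?N]"
    by (rule map_cong[OF refl]) (use O'.omega_op_dn(2) x in \<open>simp del: upt_Suc\<close>)
  finally show ?thesis
    unfolding ber_shift by (simp only:)
qed

end

lemma ring_inv_eq:
  assumes "a * b = 1" "b * a = 1"
  shows "ring_inv a = b"
  unfolding ring_inv_def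
  by (rule the_equality) (use assms left_right_inverse_eq_ring in metis)+

theorem theorem4p8:
  fixes s :: pm and k :: nat
    and \<omega> :: "('m::len0, 'n::len0) uq \<Rightarrow> ('m, 'n) uq"
    and \<omega>' :: "('km::len0, 'n) uq \<Rightarrow> ('km, 'n) uq"
    and \<phi> \<psi> :: "('m, 'n) uq \<Rightarrow> ('km, 'n) uq"
  assumes "LENGTH('m) \<noteq> LENGTH('n)"
    and "LENGTH('km) = k + LENGTH('m)"
    and "LENGTH('km) \<noteq> LENGTH('n)"
    and "is_omega \<omega>"
    and "is_omega \<omega>'"
    and "is_phi s k \<phi>"
    and "\<psi> = \<omega>' \<circ> \<phi> \<circ> \<omega>"
  shows "coeffwise \<psi> (berezinian s LENGTH('m) LENGTH('n) (Lmat s)) =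
    ring_inv (qdet s k (\<lambda>i j. qshift s (-2 * int k) (Lmat s i j))) *
    berezinian s LENGTH('km) LENGTH('n) (\<lambda>i j. qshift s (-2 * int k) (Lmat s i j))"
proof -
  interpret uq_phi s "TYPE('m)" "TYPE('km)" "TYPE('n)" k \<phi>
    by unfold_locales (use assms in simp_all)
  have "berezinian s LENGTH('m) LENGTH('n) (Lmat s :: ('m, 'n) uq smat) = A.ord.ber 1 (LENGTH('m) + LENGTH('n)) 0"
    using A.berezinian_eq_ber[of 0] by (simp add: qshift_eq)
  moreover have "ring_inv (B.ord.ber 1 k (- 2 * int k)) * B.ord.ber 1 k (- 2 * int k) = 1"
    using B.ord.ber_inv[of 1 k "- 2 * int k"] assms(2) ring_inv_eq by fastforce
  ultimately show ?thesis
    unfolding B.berezinian_eq_ber B.qdet_eq_ber[OF le_add1[of k "LENGTH('m)", folded assms(2)]]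
      psi_ber[OF assms(4,5), symmetric] assms(7)
    by (simp add: mult.assoc[symmetric])
qed

end
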